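(* Let $D\subset\mathbb{R}^d$ be a Lipschitz domain. Let $a,b\in\mathcal{A}_1$, $f\in L_\infty(D)$, and let $u_a,u_b$ be the corresponding weak solutions with right side $f$. Let $\beta\ge 0$ and suppose that $(D,f,a)$ satisfies the positivity condition $\mathbf{PC}(\beta)$ with constant $c>0$, that is, $$a(x)|\nabla u_a(x)|^2+f(x)u_a(x)\ge c\,\mathrm{dist}(x,\partial D)^\beta\quad\text{for a.e. }x\in D.$$ Then $$\|a-b\|_{L_2(D)}\le C\sqrt{1+C_0}\,\|u_a-u_b\|_{H^1_0(D)}^{\frac{1}{2(\beta+1)}},$$ where $C_0:=C_1\|f\|_{L_\infty(D)}\bigl(1+\max\{\|\nabla a\|_{L_2(D)},\|\nabla b\|_{L_2(D)}\}\bigr)$, $C_1$ is a constant depending only on $D,d,\lambda,\Lambda$, and $C$ is a constant depending only on $D,d,\lambda,\Lambda$ and $c$.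
   Context: $D\subset\mathbb{R}^d$, $d\ge 2$, is a bounded domain (open, connected). $\lambda,\Lambda$ are fixed positive constants and $\mathcal{A}:=\{a\in L_\infty(D):\lambda\le a\le\Lambda\}$. For $s>0$, $\mathcal{A}_s:=\{a\in\mathcal{A}:\|a\|_{H^s(D)}\le M\}$, where $M>0$ is arbitrary but fixed. $H^1_0(D)$ is equipped with the norm $\|v\|_{H^1_0(D)}=\|\nabla v\|_{L_2(D)}$. For $a\in\mathcal{A}$, $u_a\in H^1_0(D)$ is the unique weak solution of $-\mathrm{div}(a\nabla u_a)=f$ on $D$, $u_a=0$ on $\partial D$, i.e. $\int_D a\nabla u_a\cdot\nabla v=\int_D fv$ for all $v\in H^1_0(D)$. *)

theory Defs
  imports "HOL-Analysis.Analysis" "HOL-Probability.Essential_Supremum"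
begin

text \<open>
  Elements of \<open>L\<^sub>2(D)\<close>, \<open>L\<^sub>\<infinity>(D)\<close> and the Sobolev spaces are represented by total functions on the
  ambient Euclidean space, of which only the restriction to \<open>D\<close> modulo null sets matters.
\<close>

section \<open>Domains\<close>

definition bounded_domain :: "'a::euclidean_space set \<Rightarrow> bool" where
  "bounded_domain D \<longleftrightarrow> open D \<and> connected D \<and> bounded D \<and> D \<noteq> {}"

text \<open>
  Near each boundary point, \<open>D\<close> is the region strictly above the graph of a Lipschitz function in a
  rotated coordinate system: \<open>e\<close> is the vertical unit vector, and \<open>x - (x \<bullet> e) *\<^sub>R e\<close> is the
  orthogonal projection of \<open>x\<close> to the hyperplane of the remaining coordinates.
\<close>

definition lipschitz_domain :: "'a::euclidean_space set \<Rightarrow> bool" where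
  "lipschitz_domain D \<longleftrightarrow>
     bounded_domain D \<and>
     (\<forall>p\<in>frontier D. \<exists>r>0. \<exists>e. norm e = 1 \<and>
        (\<exists>\<gamma> L. lipschitz_on L {y. y \<bullet> e = 0} \<gamma> \<and>
           D \<inter> ball p r = {x \<in> ball p r. x \<bullet> e > (\<gamma> (x - (x \<bullet> e) *\<^sub>R e) :: real)}))"

section \<open>Lebesgue spaces\<close>

definition L2 :: "'a::euclidean_space set \<Rightarrow> ('a \<Rightarrow> 'b::euclidean_space) set" where
  "L2 D = {f \<in> borel_measurable (lebesgue_on D). integrable (lebesgue_on D) (\<lambda>x. (norm (f x))\<^sup>2)}"

definition L2_norm :: "'a::euclidean_space set \<Rightarrow> ('a \<Rightarrow> 'b::euclidean_space) \<Rightarrow> real" where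
  "L2_norm D f = sqrt (LINT x|lebesgue_on D. (norm (f x))\<^sup>2)"

definition Linf :: "'a::euclidean_space set \<Rightarrow> ('a \<Rightarrow> real) set" where
  "Linf D = {f \<in> borel_measurable (lebesgue_on D). esssup (lebesgue_on D) (\<lambda>x. ereal \<bar>f x\<bar>) < \<infinity>}"

definition Linf_norm :: "'a::euclidean_space set \<Rightarrow> ('a \<Rightarrow> real) \<Rightarrow> real" where
  "Linf_norm D f = real_of_ereal (esssup (lebesgue_on D) (\<lambda>x. ereal \<bar>f x\<bar>))"

definition locally_integrable :: "'a::euclidean_space set \<Rightarrow> ('a \<Rightarrow> 'b::euclidean_space) \<Rightarrow> bool" where
  "locally_integrable D f \<longleftrightarrow> (\<forall>K. compact K \<and> K \<subseteq> D \<longrightarrow> integrable (lebesgue_on K) f)"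

section \<open>Sobolev spaces\<close>

primrec Ck :: "nat \<Rightarrow> ('a::euclidean_space \<Rightarrow> real) \<Rightarrow> bool" where
  "Ck 0 \<phi> \<longleftrightarrow> continuous_on UNIV \<phi>"
| "Ck (Suc k) \<phi> \<longleftrightarrow>
     \<phi> differentiable_on UNIV \<and> (\<forall>i\<in>Basis. Ck k (\<lambda>x. frechet_derivative \<phi> (at x) i))"

text \<open>\<open>C\<^sub>c\<^sup>\<infinity>(D)\<close>, each element being extended by zero to the whole space.\<close>

definition test_functions :: "'a::euclidean_space set \<Rightarrow> ('a \<Rightarrow> real) set" where
  "test_functions D =
     {\<phi>. (\<forall>k. Ck k \<phi>) \<and> compact (closure {x. \<phi> x \<noteq> 0}) \<and> closure {x. \<phi> x \<noteq> 0} \<subseteq> D}"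

definition has_weak_gradient ::
    "'a::euclidean_space set \<Rightarrow> ('a \<Rightarrow> real) \<Rightarrow> ('a \<Rightarrow> 'a) \<Rightarrow> bool" where
  "has_weak_gradient D u g \<longleftrightarrow>
     locally_integrable D u \<and> locally_integrable D g \<and>
     (\<forall>\<phi>\<in>test_functions D. \<forall>i\<in>Basis.
        (LINT x|lebesgue_on D. u x * frechet_derivative \<phi> (at x) i)
          = - (LINT x|lebesgue_on D. (g x \<bullet> i) * \<phi> x))"

text \<open>The weak gradient is unique almost everywhere in \<open>D\<close>, so the choice is harmless.\<close>

definition weak_grad :: "'a::euclidean_space set \<Rightarrow> ('a \<Rightarrow> real) \<Rightarrow> 'a \<Rightarrow> 'a" where
  "weak_grad D u = (SOME g. has_weak_gradient D u g)"

definition H1 :: "'a::euclidean_space set \<Rightarrow> ('a \<Rightarrow> real) set" where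
  "H1 D = {u \<in> L2 D. \<exists>g\<in>L2 D. has_weak_gradient D u g}"

definition H1_norm :: "'a::euclidean_space set \<Rightarrow> ('a \<Rightarrow> real) \<Rightarrow> real" where
  "H1_norm D u = sqrt ((L2_norm D u)\<^sup>2 + (L2_norm D (weak_grad D u))\<^sup>2)"

text \<open>The closure of \<open>C\<^sub>c\<^sup>\<infinity>(D)\<close> in \<open>H\<^sup>1(D)\<close>.\<close>

definition H10 :: "'a::euclidean_space set \<Rightarrow> ('a \<Rightarrow> real) set" where
  "H10 D = {u \<in> H1 D. \<forall>\<epsilon>>0. \<exists>\<phi>\<in>test_functions D. H1_norm D (\<lambda>x. u x - \<phi> x) < \<epsilon>}"

definition H10_norm :: "'a::euclidean_space set \<Rightarrow> ('a \<Rightarrow> real) \<Rightarrow> real" where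
  "H10_norm D v = L2_norm D (weak_grad D v)"

section \<open>Diffusion coefficients and weak solutions\<close>

definition coeffs :: "'a::euclidean_space set \<Rightarrow> real \<Rightarrow> real \<Rightarrow> ('a \<Rightarrow> real) set" where
  "coeffs D lam Lam = {a \<in> Linf D. AE x in lebesgue_on D. lam \<le> a x \<and> a x \<le> Lam}"

text \<open>The class \<open>\<A>\<^sub>s\<close> for \<open>s = 1\<close>, with the bound \<open>M\<close> explicit.\<close>

definition coeffs_H1 ::
    "'a::euclidean_space set \<Rightarrow> real \<Rightarrow> real \<Rightarrow> real \<Rightarrow> ('a \<Rightarrow> real) set" where
  "coeffs_H1 D lam Lam M = {a \<in> coeffs D lam Lam. a \<in> H1 D \<and> H1_norm D a \<le> M}"

definition weak_solution ::
    "'a::euclidean_space set \<Rightarrow> ('a \<Rightarrow> real) \<Rightarrow> ('a \<Rightarrow> real) \<Rightarrow> ('a \<Rightarrow> real) \<Rightarrow> bool" where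
  "weak_solution D a f u \<longleftrightarrow>
     u \<in> H10 D \<and>
     (\<forall>v\<in>H10 D. (LINT x|lebesgue_on D. a x * (weak_grad D u x \<bullet> weak_grad D v x))
                 = (LINT x|lebesgue_on D. f x * v x))"

text \<open>\<open>PC(\<beta>)\<close> for \<open>(D, f, a)\<close> with constant \<open>c\<close>; it is imposed on every representative \<open>u\<close> of the
  (almost everywhere unique) weak solution \<open>u\<^sub>a\<close>.\<close>

definition positivity_condition ::
    "'a::euclidean_space set \<Rightarrow> ('a \<Rightarrow> real) \<Rightarrow> ('a \<Rightarrow> real) \<Rightarrow> real \<Rightarrow> real \<Rightarrow> bool" where
  "positivity_condition D f a \<beta> c \<longleftrightarrow>
     (\<forall>u. weak_solution D a f u \<longrightarrow>
       (AE x in lebesgue_on D.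
          a x * (norm (weak_grad D u x))\<^sup>2 + f x * u x \<ge> c * infdist x (frontier D) powr \<beta>))"

end

theory Submission
  imports Defs
begin

text \<open>
  Put \<open>w = (a - b) / a\<close>. Testing the equations of \<open>u\<^sub>a\<close> and \<open>u\<^sub>b\<close> with \<open>w u\<^sub>a\<close> and the equation of \<open>u\<^sub>a\<close>
  with \<open>w\<^sup>2 u\<^sub>a\<close> gives \<open>\<integral> w\<^sup>2 (a |\<nabla>u\<^sub>a|\<^sup>2 + f u\<^sub>a) = 2 \<integral> b \<nabla>(u\<^sub>b - u\<^sub>a) \<cdot> \<nabla>(w u\<^sub>a)\<close>. The right side is
  at most a multiple of \<open>\<parallel>u\<^sub>a - u\<^sub>b\<parallel>\<close>, once \<open>u\<^sub>a\<close> is bounded by a multiple of \<open>\<parallel>f\<parallel>\<^sub>\<infinity>\<close> (Stampacchia's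
  truncation method, with an elementary Nash inequality in place of Sobolev's). By \<open>PC(\<beta>)\<close> the left
  side controls \<open>(a - b)\<^sup>2\<close> at distance at least \<open>\<rho>\<close> from the boundary, with a factor \<open>\<rho>\<^sup>-\<^sup>\<beta>\<close>; the
  remaining boundary layer has measure \<open>O(\<rho>)\<close>, since \<open>D\<close> is a Lipschitz domain. Choosing \<open>\<rho>\<close>
  optimally gives the exponent.
\<close>

section \<open>Smooth functions\<close>

text \<open>Twice the test with \<open>w u_a\<close> minus the test with \<open>w^2 u_a\<close> is
  the combination in which the gradient of \<open>w\<close> cancels, and a w = a - b turns the
  weight into the difference of the coefficients. The price is that both products must lie in H^1_0.
  The coefficients are bounded but their gradients are merely in L2, so u_a times the gradient of
  \<open>w\<close> is kept in L2 by the boundedness of u_a; this is the purpose of the maximum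
  principle, whose bound is linear in the sup norm of f and so produces the factor of f in C_0.
  Since H^1_0 is a closure, chain and product rules are proved for test functions and then passed to
  the limit, with function and gradient converging together in L2. The gradient of b / a is a local
  matter: on the support of a test function, a is replaced by mollifications that keep the lower
  bound lam. The Nash inequality fits Stampacchia's scheme because it needs only a translation
  estimate and Fubini, holds in every dimension and compares level sets with balls.\<close>

definition smooth :: "('a::euclidean_space \<Rightarrow> real) \<Rightarrow> bool" where
  "smooth f \<longleftrightarrow> (\<forall>k. Ck k f)"

definition partial :: "'a::euclidean_space \<Rightarrow> ('a \<Rightarrow> real) \<Rightarrow> 'a \<Rightarrow> real" where
  "partial i f x = frechet_derivative f (at x) i"

lemma Ck_Suc_iff: "Ck (Suc k) f \<longleftrightarrow> (\<forall>x. f differentiable (at x)) \<and> (\<forall>i\<in>Basis. Ck k (partial i f))"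
  by (simp add: differentiable_on_def partial_def [abs_def])

declare Ck.simps(2) [simp del]

lemma Ck_SucD: "Ck (Suc k) f \<Longrightarrow> Ck k f"
proof (induction k arbitrary: f)
  case 0
  then show ?case
    by (simp add: Ck.simps differentiable_imp_continuous_on)
next
  case (Suc k)
  then show ?case
    using Ck_Suc_iff by blast
qed

lemma Ck_imp_continuous: "Ck k f \<Longrightarrow> continuous_on UNIV f"
  by (cases k) (auto simp: Ck.simps intro: differentiable_imp_continuous_on)

lemma partial_eq: "(f has_derivative f') (at x) \<Longrightarrow> partial i f x = f' i"
  by (metis partial_def frechet_derivative_at)

lemma has_derivative_frechet:
  "f differentiable (at x) \<Longrightarrow> (f has_derivative frechet_derivative f (at x)) (at x)"
  by (simp add: frechet_derivative_works)

lemma partial_const [simp]: "partial i (\<lambda>_. c) x = 0"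
  by (simp add: partial_def)

lemma Ck_const: "Ck k (\<lambda>_. c)"
proof (induction k arbitrary: c)
  case (Suc k)
  have "partial i (\<lambda>_::'a. c) = (\<lambda>_. 0)" for i by auto
  with Suc show ?case unfolding Ck_Suc_iff by simp
qed simp

lemma partial_add:
  "f differentiable (at x) \<Longrightarrow> g differentiable (at x) \<Longrightarrow>
   partial i (\<lambda>x. f x + g x) x = partial i f x + partial i g x"
  by (subst partial_eq[OF has_derivative_add[OF has_derivative_frechet has_derivative_frechet]])
     (auto simp: partial_def)

lemma partial_mult:
  "f differentiable (at x) \<Longrightarrow> g differentiable (at x) \<Longrightarrow>
   partial i (\<lambda>x. f x * g x) x = f x * partial i g x + partial i f x * g x"
  by (subst partial_eq[OF has_derivative_mult[OF has_derivative_frechet has_derivative_frechet]])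
     (auto simp: partial_def)

lemma Ck_add: "Ck k f \<Longrightarrow> Ck k g \<Longrightarrow> Ck k (\<lambda>x. f x + g x)"
proof (induction k arbitrary: f g)
  case (Suc k)
  have "partial i (\<lambda>x. f x + g x) = (\<lambda>x. partial i f x + partial i g x)" for i
    using Suc.prems by (auto simp: Ck_Suc_iff partial_add)
  with Suc show ?case unfolding Ck_Suc_iff by auto
qed (auto intro: continuous_intros)

lemma Ck_mult: "Ck k f \<Longrightarrow> Ck k g \<Longrightarrow> Ck k (\<lambda>x. f x * g x)"
proof (induction k arbitrary: f g)
  case (Suc k)
  have "partial i (\<lambda>x. f x * g x) = (\<lambda>x. f x * partial i g x + partial i f x * g x)" for i
    using Suc.prems by (auto simp: Ck_Suc_iff partial_mult)
  moreover have "Ck k f" "Ck k g" using Suc.prems by (auto dest: Ck_SucD)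
  ultimately show ?case
    using Suc unfolding Ck_Suc_iff by (auto intro!: Ck_add differentiable_mult)
qed (auto intro: continuous_intros)

lemma Ck_uminus: "Ck k f \<Longrightarrow> Ck k (\<lambda>x. - f x)"
  using Ck_mult[OF Ck_const[of k "-1"]] by fastforce

lemma Ck_diff: "Ck k f \<Longrightarrow> Ck k g \<Longrightarrow> Ck k (\<lambda>x. f x - g x)"
  using Ck_add[OF _ Ck_uminus, of k f g] by simp

lemma partial_chain:
  assumes "f differentiable (at x)" "(G has_real_derivative G') (at (f x))"
  shows "partial i (\<lambda>x. G (f x)) x = G' * partial i f x"
  by (subst partial_eq[OF has_derivative_compose[OF has_derivative_frechet[OF assms(1)]
        assms(2)[unfolded has_field_derivative_def]]]) (auto simp: partial_def)

lemma differentiable_chain: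
  assumes "f differentiable (at x)" "(G has_real_derivative G') (at (f x))"
  shows "(\<lambda>x. G (f x)) differentiable (at x)"
  using has_derivative_compose[OF has_derivative_frechet[OF assms(1)]
        assms(2)[unfolded has_field_derivative_def]] unfolding differentiable_def by blast

text \<open>The derivative of 1/f is -(1/f)^2 times that of f and contains 1/f again, but only to
  one order less, which the induction hypothesis supplies.\<close>

lemma Ck_inverse:
  assumes "Ck k f" "\<And>x. f x \<noteq> 0"
  shows "Ck k (\<lambda>x. inverse (f x))"
  using assms(1)
proof (induction k)
  case 0
  then show ?case using assms by (auto intro!: continuous_intros)
next
  case (Suc k)
  have d: "(inverse has_real_derivative - (inverse (f x) * inverse (f x))) (at (f x))" for x
    using DERIV_inverse[OF assms(2)[of x]] by (simp add: power2_eq_square numeral_2_eq_2)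
  have f: "f differentiable (at x)" for x using Suc.prems by (auto simp: Ck_Suc_iff)
  have "partial i (\<lambda>x. inverse (f x)) = (\<lambda>x. - (inverse (f x) * inverse (f x) * partial i f x))" for i
    using partial_chain[OF f d] by auto
  moreover have "Ck k (\<lambda>x. inverse (f x))" using Suc Ck_SucD by blast
  moreover have "\<forall>i\<in>Basis. Ck k (partial i f)" using Suc.prems by (auto simp: Ck_Suc_iff)
  ultimately show ?case
    unfolding Ck_Suc_iff using differentiable_chain[OF f d] by (auto intro!: Ck_mult Ck_uminus)
qed

text \<open>Sine and cosine differentiate into each other up to sign, so one induction carries
  both.\<close>

lemma Ck_sin_cos: "Ck k f \<Longrightarrow> Ck k (\<lambda>x. sin (f x)) \<and> Ck k (\<lambda>x. cos (f x))"
proof (induction k)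
  case 0
  then show ?case by (auto intro!: continuous_intros)
next
  case (Suc k)
  have f: "f differentiable (at x)" for x using Suc.prems by (auto simp: Ck_Suc_iff)
  have s: "partial i (\<lambda>x. sin (f x)) = (\<lambda>x. cos (f x) * partial i f x)"
    and c: "partial i (\<lambda>x. cos (f x)) = (\<lambda>x. - (sin (f x) * partial i f x))" for i
    using partial_chain[OF f DERIV_sin] partial_chain[OF f DERIV_cos] by auto
  have "Ck k (\<lambda>x. sin (f x))" "Ck k (\<lambda>x. cos (f x))" using Suc Ck_SucD by blast+
  moreover have "\<forall>i\<in>Basis. Ck k (partial i f)" using Suc.prems by (auto simp: Ck_Suc_iff)
  ultimately show ?case
    unfolding Ck_Suc_iff using differentiable_chain[OF f DERIV_sin] differentiable_chain[OF f DERIV_cos]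
    by (auto intro!: Ck_mult Ck_uminus simp: s c)
qed

text \<open>A family of flat functions closed under differentiation up to linear combinations.\<close>

definition flat :: "nat \<Rightarrow> real \<Rightarrow> real" where
  "flat n t = (if t > 0 then exp (- inverse t) * inverse t ^ n else 0)"

text \<open>This is the difference quotient of \<open>flat n\<close> at 0, the one point where the
  formula for the derivative cannot be computed. From the right, s = 1/t turns it into s^(n+1) / exp
  s as s tends to infinity.\<close>

lemma flat_tendsto: "((\<lambda>t. flat n t / t) \<longlongrightarrow> 0) (at 0)"
proof -
  have "((\<lambda>t::real. exp (- inverse t) * inverse t ^ Suc n) \<longlongrightarrow> 0) (at_right 0)"
  proof -
    have "((\<lambda>x::real. x ^ Suc n / exp x) \<longlongrightarrow> 0) at_top"
      by (rule tendsto_power_div_exp_0)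
    then have "((\<lambda>t::real. inverse t ^ Suc n / exp (inverse t)) \<longlongrightarrow> 0) (at_right 0)"
      by (rule filterlim_compose[OF _ filterlim_inverse_at_top_right])
    then show ?thesis by (simp add: exp_minus field_simps)
  qed
  moreover have "\<forall>\<^sub>F t in at_right 0. flat n t / t = exp (- inverse t) * inverse t ^ Suc n"
    by (auto simp: flat_def eventually_at_filter field_simps)
  ultimately have r: "((\<lambda>t. flat n t / t) \<longlongrightarrow> 0) (at_right 0)"
    by (subst tendsto_cong)
  have "\<forall>\<^sub>F t in at_left 0. flat n t / t = 0"
    by (auto simp: flat_def eventually_at_filter)
  then have l: "((\<lambda>t. flat n t / t) \<longlongrightarrow> 0) (at_left 0)"
    by (subst tendsto_cong) auto
  show ?thesis using l r by (simp add: filterlim_split_at)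
qed

text \<open>For t > 0 the exponential contributes the factor t^(-2) and the power contributes -n
  t^(-1), which raise the index by 2 and by 1.\<close>

lemma flat_derivative:
  "(flat n has_real_derivative flat (n + 2) t - real n * flat (n + 1) t) (at t)"
proof (cases "t = 0")
  case True
  then show ?thesis
    using flat_tendsto[of n] by (simp add: DERIV_def flat_def)
next
  case nz: False
  show ?thesis
  proof (cases "t > 0")
    case True
    have "((\<lambda>t. exp (- inverse t) * inverse t ^ n) has_real_derivative
        flat (n + 2) t - real n * flat (n + 1) t) (at t)"
      using True
      by (auto intro!: derivative_eq_intros simp: flat_def)
         (cases n; simp add: field_simps power2_eq_square)
    moreover have "\<forall>\<^sub>F s in nhds t. s > 0" using True eventually_nhds_in_open[of "{0<..}" t] by auto
    then have "\<forall>\<^sub>F s in nhds t. flat n s = exp (- inverse s) * inverse s ^ n"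
      by eventually_elim (auto simp: flat_def)
    ultimately show ?thesis by (simp add: DERIV_cong_ev)
  next
    case False
    then have "\<forall>\<^sub>F s in nhds t. s < 0" using nz eventually_nhds_in_open[of "{..<0}" t] by auto
    then have "\<forall>\<^sub>F s in nhds t. flat n s = 0"
      by eventually_elim (auto simp: flat_def)
    then have "(flat n has_real_derivative 0) (at t) = ((\<lambda>_. 0) has_real_derivative 0) (at t)"
      by (intro DERIV_cong_ev) auto
    then show ?thesis using False by (simp add: flat_def)
  qed
qed

text \<open>The index n varies in the induction on k, because one derivative of
  \<open>flat n\<close> produces \<open>flat (n + 1)\<close> and
  \<open>flat (n + 2)\<close>.\<close>

lemma Ck_flat:
  assumes "\<And>k. Ck k f"
  shows "Ck k (\<lambda>x. flat n (f x))"
proof (induction k arbitrary: n)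
  case 0
  have "isCont (flat n) t" for t using flat_derivative DERIV_isCont by blast
  then have "continuous_on UNIV (flat n)" by (simp add: continuous_at_imp_continuous_on)
  moreover have "continuous_on UNIV f" using assms Ck_imp_continuous by blast
  ultimately show ?case by (auto intro: continuous_on_compose2)
next
  case (Suc k)
  have f: "f differentiable (at x)" for x using assms[of "Suc 0"] by (auto simp: Ck_Suc_iff)
  have p: "partial i (\<lambda>x. flat n (f x)) =
    (\<lambda>x. (flat (n + 2) (f x) - real n * flat (n + 1) (f x)) * partial i f x)" for i
    using partial_chain[OF f flat_derivative] by auto
  have "\<forall>i\<in>Basis. Ck k (partial i f)" using assms[of "Suc k"] by (auto simp: Ck_Suc_iff)
  then show ?case
    unfolding Ck_Suc_iff p using Suc differentiable_chain[OF f flat_derivative]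
    by (auto intro!: Ck_mult Ck_diff Ck_const)
qed

lemma Ck_inner: "Ck k (\<lambda>x. x \<bullet> v)"
proof (cases k)
  case (Suc m)
  have "((\<lambda>x. x \<bullet> v) has_derivative (\<lambda>x. x \<bullet> v)) (at x)" for x
    by (auto intro!: derivative_eq_intros)
  then have "partial i (\<lambda>x. x \<bullet> v) = (\<lambda>_. i \<bullet> v)" "(\<lambda>x. x \<bullet> v) differentiable (at x)" for i x
    by (auto intro!: ext partial_eq intro: differentiableI)
  then show ?thesis unfolding Suc Ck_Suc_iff by (simp add: Ck_const)
qed (auto intro: continuous_intros)

lemma Ck_power2_norm: "Ck k (\<lambda>x::'a::euclidean_space. (norm x)\<^sup>2)"
proof (cases k)
  case (Suc m)
  have "((\<lambda>x::'a. (norm x)\<^sup>2) has_derivative (\<lambda>h. 2 * (x \<bullet> h))) (at x)" for x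
    unfolding power2_norm_eq_inner by (auto intro!: derivative_eq_intros simp: inner_commute)
  then have "partial i (\<lambda>x::'a. (norm x)\<^sup>2) = (\<lambda>x. 2 * (x \<bullet> i))"
    "(\<lambda>x::'a. (norm x)\<^sup>2) differentiable (at x)" for i x
    by (auto intro!: ext partial_eq intro: differentiableI)
  then show ?thesis unfolding Suc Ck_Suc_iff by (simp add: Ck_const Ck_inner Ck_mult)
qed (auto intro: continuous_intros)

lemma smooth_add: "smooth f \<Longrightarrow> smooth g \<Longrightarrow> smooth (\<lambda>x. f x + g x)"
  and smooth_mult: "smooth f \<Longrightarrow> smooth g \<Longrightarrow> smooth (\<lambda>x. f x * g x)"
  and smooth_const: "smooth (\<lambda>_. c)"
  and smooth_inverse: "smooth f \<Longrightarrow> (\<And>x. f x \<noteq> 0) \<Longrightarrow> smooth (\<lambda>x. inverse (f x))"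
  and smooth_sin: "smooth f \<Longrightarrow> smooth (\<lambda>x. sin (f x))"
  and smooth_flat: "smooth f \<Longrightarrow> smooth (\<lambda>x. flat n (f x))"
  and smooth_power2_norm: "smooth (\<lambda>x. (norm x)\<^sup>2)"
  by (simp_all add: smooth_def Ck_add Ck_mult Ck_const Ck_inverse Ck_sin_cos Ck_flat Ck_power2_norm)

lemma smooth_diff: "smooth f \<Longrightarrow> smooth g \<Longrightarrow> smooth (\<lambda>x. f x - g x)"
  by (simp add: smooth_def Ck_diff)

lemma smooth_differentiable: "smooth f \<Longrightarrow> f differentiable (at x)"
  unfolding smooth_def using Ck_Suc_iff by blast

lemma smooth_partial: "smooth f \<Longrightarrow> i \<in> Basis \<Longrightarrow> smooth (partial i f)"
  unfolding smooth_def using Ck_Suc_iff by blast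

lemma smooth_continuous: "smooth f \<Longrightarrow> continuous_on S f"
  unfolding smooth_def using Ck_imp_continuous continuous_on_subset by blast

subsection \<open>Test functions\<close>

text \<open>Trades the closure of the support for any compact set outside of which the function
  vanishes. Such a set survives differences, products and derivatives without computing a
  closure.\<close>

lemma test_functions_iff:
  "\<phi> \<in> test_functions D \<longleftrightarrow> smooth \<phi> \<and> (\<exists>K. compact K \<and> K \<subseteq> D \<and> (\<forall>x. x \<notin> K \<longrightarrow> \<phi> x = 0))"
    (is "?L = ?R")
proof
  assume ?L
  then have "smooth \<phi>" "compact (closure {x. \<phi> x \<noteq> 0})" "closure {x. \<phi> x \<noteq> 0} \<subseteq> D"
    by (auto simp: test_functions_def smooth_def)
  moreover have "\<forall>x. x \<notin> closure {x. \<phi> x \<noteq> 0} \<longrightarrow> \<phi> x = 0" using closure_subset[of "{x. \<phi> x \<noteq> 0}"] by auto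
  ultimately show ?R by blast
next
  assume ?R
  then obtain K where K: "smooth \<phi>" "compact K" "K \<subseteq> D" "\<forall>x. x \<notin> K \<longrightarrow> \<phi> x = 0" by blast
  have "closure {x. \<phi> x \<noteq> 0} \<subseteq> K"
    using K by (intro closure_minimal) (auto intro: compact_imp_closed)
  moreover have "closure {x. \<phi> x \<noteq> 0} = K \<inter> closure {x. \<phi> x \<noteq> 0}" using calculation by blast
  then have "compact (closure {x. \<phi> x \<noteq> 0})"
    using compact_Int_closed[OF K(2) closed_closure[of "{x. \<phi> x \<noteq> 0}"]] by simp
  ultimately show ?L using K by (auto simp: test_functions_def smooth_def)
qed

lemma test_functionsI:
  "smooth \<phi> \<Longrightarrow> compact K \<Longrightarrow> K \<subseteq> D \<Longrightarrow> (\<And>x. x \<notin> K \<Longrightarrow> \<phi> x = 0) \<Longrightarrow> \<phi> \<in> test_functions D"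
  unfolding test_functions_iff by blast

lemma test_functions_smooth: "\<phi> \<in> test_functions D \<Longrightarrow> smooth \<phi>"
  by (simp add: test_functions_iff)

lemma test_functions_diff:
  assumes "\<phi> \<in> test_functions D" "\<psi> \<in> test_functions D"
  shows "(\<lambda>x. \<phi> x - \<psi> x) \<in> test_functions D"
proof -
  obtain K L where "compact K" "K \<subseteq> D" "\<forall>x. x \<notin> K \<longrightarrow> \<phi> x = 0" "compact L" "L \<subseteq> D" "\<forall>x. x \<notin> L \<longrightarrow> \<psi> x = 0"
    using assms unfolding test_functions_iff by metis
  then show ?thesis
    using assms by (intro test_functionsI[of _ "K \<union> L"] smooth_diff) (auto dest: test_functions_smooth)
qed

lemma test_functions_mult:
  assumes "\<phi> \<in> test_functions D" "smooth \<psi>"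
  shows "(\<lambda>x. \<phi> x * \<psi> x) \<in> test_functions D"
proof -
  obtain K where "compact K" "K \<subseteq> D" "\<forall>x. x \<notin> K \<longrightarrow> \<phi> x = 0"
    using assms unfolding test_functions_iff by metis
  then show ?thesis
    using assms by (intro test_functionsI[of _ K] smooth_mult) (auto dest: test_functions_smooth)
qed

lemma partial_eq_0:
  assumes "closed K" "\<And>x. x \<notin> K \<Longrightarrow> f x = 0" "x \<notin> K"
  shows "partial i f x = 0"
proof -
  have "((\<lambda>_. 0::real) has_derivative (\<lambda>_. 0)) (at x)" by simp
  then have "(f has_derivative (\<lambda>_. 0)) (at x)"
    by (rule has_derivative_transform_within_open[of _ _ _ _ "-K"]) (use assms in auto)
  then show ?thesis by (rule partial_eq)
qed

lemma test_functions_partial: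
  assumes "\<phi> \<in> test_functions D" "i \<in> Basis"
  shows "partial i \<phi> \<in> test_functions D"
proof -
  obtain K where K: "compact K" "K \<subseteq> D" "\<forall>x. x \<notin> K \<longrightarrow> \<phi> x = 0"
    using assms unfolding test_functions_iff by metis
  then show ?thesis
    using assms partial_eq_0[of K \<phi>]
    by (intro test_functionsI[of _ K] smooth_partial) (auto dest: test_functions_smooth compact_imp_closed)
qed

text \<open>The bump is exp(-1/(\<epsilon>^2 - |x|^2)) in the ball of radius \<epsilon>; the squared
  norm keeps it smooth at the centre. It is positive on the open ball, so its integral is nonzero
  and can be divided out.\<close>

lemma mollifier_exists:
  assumes "\<epsilon> > 0"
  obtains \<eta> :: "'a::euclidean_space \<Rightarrow> real"
  where "smooth \<eta>" "\<And>x. \<eta> x \<ge> 0" "\<And>x. norm x \<ge> \<epsilon> \<Longrightarrow> \<eta> x = 0" "integrable lborel \<eta>" "(LINT x|lborel. \<eta> x) = 1"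
proof -
  define \<xi> where "\<xi> x = flat 0 (\<epsilon>\<^sup>2 - (norm x)\<^sup>2)" for x :: 'a
  have sm: "smooth \<xi>"
    unfolding \<xi>_def by (intro smooth_flat smooth_diff smooth_const smooth_power2_norm)
  have nn: "\<xi> x \<ge> 0" for x by (simp add: \<xi>_def flat_def)
  have supp: "\<xi> x = 0" if "norm x \<ge> \<epsilon>" for x
  proof -
    have "\<not> 0 < \<epsilon>\<^sup>2 - (norm x)\<^sup>2"
      using power_mono[OF that less_imp_le[OF assms], of 2] by linarith
    then show ?thesis unfolding \<xi>_def flat_def by (rule if_not_P)
  qed
  have pos: "norm x < \<epsilon> \<Longrightarrow> \<xi> x > 0" for x
    using assms power_strict_mono[of "norm x" \<epsilon> 2] by (auto simp: \<xi>_def flat_def)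
  have "integrable lborel (\<lambda>x. indicator (cball 0 \<epsilon>) x *\<^sub>R \<xi> x)"
    using borel_integrable_compact[OF compact_cball smooth_continuous[OF sm]]
    by simp
  also have "(\<lambda>x. indicator (cball 0 \<epsilon>) x *\<^sub>R \<xi> x) = \<xi>"
    using supp by (intro ext) (metis indicator_simps linear mem_cball_0 mult_cancel_right1 mult_eq_0_iff real_scaleR_def)
  finally have int: "integrable lborel \<xi>" .
  have "(LINT x|lborel. \<xi> x) \<noteq> 0"
  proof
    assume "(LINT x|lborel. \<xi> x) = 0"
    then have "AE x in lborel. \<xi> x = 0"
      using integral_nonneg_eq_0_iff_AE[OF int] nn by auto
    then have "AE x in lborel. x \<notin> ball (0::'a) \<epsilon>"
      by eventually_elim (use pos in force)
    then have "ball (0::'a) \<epsilon> \<in> null_sets lborel"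
      using AE_iff_null_sets[of "ball (0::'a) \<epsilon>" lborel] by simp
    then have "measure lebesgue (ball (0::'a) \<epsilon>) = 0"
      by (simp add: null_sets_def measure_def)
    then show False using content_ball_pos[OF assms, of "0::'a"] by simp
  qed
  moreover have "(LINT x|lborel. \<xi> x) \<ge> 0" using nn by simp
  ultimately have Z: "(LINT x|lborel. \<xi> x) > 0" by simp
  define \<eta> where "\<eta> x = \<xi> x * inverse (LINT x|lborel. \<xi> x)" for x
  show thesis
  proof (rule that[of \<eta>])
    show "smooth \<eta>" unfolding \<eta>_def by (intro smooth_mult sm smooth_const)
    show "(LINT x|lborel. \<eta> x) = 1" unfolding \<eta>_def using Z by simp
    show "integrable lborel \<eta>" unfolding \<eta>_def using int by simp
  qed (use nn supp Z in \<open>auto simp: \<eta>_def\<close>)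
qed

section \<open>Square-integrable functions\<close>

lemma L2_measurable: "f \<in> L2 D \<Longrightarrow> f \<in> borel_measurable (lebesgue_on D)"
  and L2_integrable: "f \<in> L2 D \<Longrightarrow> integrable (lebesgue_on D) (\<lambda>x. (norm (f x))\<^sup>2)"
  by (auto simp: L2_def)

lemma L2_norm_nonneg [simp]: "L2_norm D f \<ge> 0"
  by (simp add: L2_norm_def)

lemma L2_norm_sq: "(L2_norm D f)\<^sup>2 = (LINT x|lebesgue_on D. (norm (f x))\<^sup>2)"
  by (simp add: L2_norm_def)

lemma L2_norm_mult_integrable:
  assumes "f \<in> L2 D" "g \<in> L2 D"
  shows "integrable (lebesgue_on D) (\<lambda>x. norm (f x) * norm (g x))"
proof (rule Bochner_Integration.integrable_bound)
  show "integrable (lebesgue_on D) (\<lambda>x. (norm (f x))\<^sup>2 + (norm (g x))\<^sup>2)"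
    using assms by (auto dest: L2_integrable)
  show "(\<lambda>x. norm (f x) * norm (g x)) \<in> borel_measurable (lebesgue_on D)"
    using assms[THEN L2_measurable] by measurable
  have "a * b \<le> a\<^sup>2 + b\<^sup>2" if "a \<ge> 0" "b \<ge> 0" for a b :: real
    using that sum_squares_bound[of a b] mult_nonneg_nonneg[OF that] by linarith
  then show "AE x in lebesgue_on D. norm (norm (f x) * norm (g x)) \<le> norm ((norm (f x))\<^sup>2 + (norm (g x))\<^sup>2)"
    by (auto simp: abs_mult)
qed

lemma L2_bounded_by_mult:
  fixes h :: "'a::euclidean_space \<Rightarrow> 'c::euclidean_space"
  assumes "f \<in> L2 D" "g \<in> L2 D" "h \<in> borel_measurable (lebesgue_on D)"
    "AE x in lebesgue_on D. norm (h x) \<le> norm (f x) * norm (g x)"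
  shows "integrable (lebesgue_on D) h"
  using assms by (intro Bochner_Integration.integrable_bound[OF L2_norm_mult_integrable[OF assms(1,2)]]) auto

lemma L2_inner_integrable:
  assumes "f \<in> L2 D" "g \<in> L2 D"
  shows "integrable (lebesgue_on D) (\<lambda>x. f x \<bullet> g x)"
  using assms[THEN L2_measurable] Cauchy_Schwarz_ineq2 by (intro L2_bounded_by_mult[OF assms]) auto

lemma L2_mult_integrable:
  fixes f g :: "'a::euclidean_space \<Rightarrow> real"
  shows "f \<in> L2 D \<Longrightarrow> g \<in> L2 D \<Longrightarrow> integrable (lebesgue_on D) (\<lambda>x. f x * g x)"
  using L2_inner_integrable[of f D g] by simp

lemma L2_norm_Cauchy_Schwarz:
  assumes "f \<in> L2 D" "g \<in> L2 D"
  shows "(LINT x|lebesgue_on D. norm (f x) * norm (g x)) \<le> L2_norm D f * L2_norm D g"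
proof -
  let ?A = "LINT x|lebesgue_on D. norm (f x) * norm (g x)"
  have "(\<integral>\<^sup>+x. ennreal (norm (f x)) * ennreal (norm (g x)) \<partial>lebesgue_on D)\<^sup>2
    \<le> (\<integral>\<^sup>+x. ennreal (norm (f x)) ^ 2 \<partial>lebesgue_on D) * (\<integral>\<^sup>+x. ennreal (norm (g x)) ^ 2 \<partial>lebesgue_on D)"
    using assms[THEN L2_measurable] by (intro Cauchy_Schwarz_nn_integral) auto
  also have "(\<integral>\<^sup>+x. ennreal (norm (f x)) * ennreal (norm (g x)) \<partial>lebesgue_on D) = ennreal ?A"
    using nn_integral_eq_integral[OF L2_norm_mult_integrable[OF assms]] by (simp add: ennreal_mult)
  also have "(\<integral>\<^sup>+x. ennreal (norm (f x)) ^ 2 \<partial>lebesgue_on D) = ennreal ((L2_norm D f)\<^sup>2)"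
    using nn_integral_eq_integral[OF L2_integrable[OF assms(1)]] by (simp add: L2_norm_sq ennreal_power)
  also have "(\<integral>\<^sup>+x. ennreal (norm (g x)) ^ 2 \<partial>lebesgue_on D) = ennreal ((L2_norm D g)\<^sup>2)"
    using nn_integral_eq_integral[OF L2_integrable[OF assms(2)]] by (simp add: L2_norm_sq ennreal_power)
  finally have "?A\<^sup>2 \<le> (L2_norm D f * L2_norm D g)\<^sup>2"
    by (simp add: ennreal_power ennreal_mult[symmetric] power_mult_distrib)
  then show ?thesis by (rule power2_le_imp_le) simp
qed

lemma L2_norm_bound_mult:
  fixes h :: "'a::euclidean_space \<Rightarrow> 'c::euclidean_space"
  assumes "f \<in> L2 D" "g \<in> L2 D" "h \<in> borel_measurable (lebesgue_on D)"
    "AE x in lebesgue_on D. norm (h x) \<le> norm (f x) * norm (g x)"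
  shows "norm (LINT x|lebesgue_on D. h x) \<le> L2_norm D f * L2_norm D g"
proof -
  have "norm (LINT x|lebesgue_on D. h x) \<le> (LINT x|lebesgue_on D. norm (h x))"
    by (rule integral_norm_bound)
  also have "\<dots> \<le> (LINT x|lebesgue_on D. norm (f x) * norm (g x))"
    using L2_bounded_by_mult[OF assms] L2_norm_mult_integrable[OF assms(1,2)] assms(4)
    by (intro integral_mono_AE) auto
  finally have "norm (LINT x|lebesgue_on D. h x) \<le> (LINT x|lebesgue_on D. norm (f x) * norm (g x))" .
  then show ?thesis using L2_norm_Cauchy_Schwarz[OF assms(1,2)] by linarith
qed

lemma L2_inner_le:
  assumes "f \<in> L2 D" "g \<in> L2 D"
  shows "\<bar>LINT x|lebesgue_on D. f x \<bullet> g x\<bar> \<le> L2_norm D f * L2_norm D g"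
  using L2_norm_bound_mult[OF assms, of "\<lambda>x. f x \<bullet> g x"] assms[THEN L2_measurable] Cauchy_Schwarz_ineq2
  by fastforce

lemma L2_bound:
  fixes f :: "'a::euclidean_space \<Rightarrow> 'b::euclidean_space" and g :: "'a \<Rightarrow> 'c::euclidean_space"
  assumes "g \<in> L2 D" "f \<in> borel_measurable (lebesgue_on D)" "AE x in lebesgue_on D. norm (f x) \<le> norm (g x)"
  shows "f \<in> L2 D" "L2_norm D f \<le> L2_norm D g"
proof -
  have *: "AE x in lebesgue_on D. (norm (f x))\<^sup>2 \<le> (norm (g x))\<^sup>2"
    using assms(3) by eventually_elim (simp add: power_mono)
  have "integrable (lebesgue_on D) (\<lambda>x. (norm (f x))\<^sup>2)"
    using assms * by (intro Bochner_Integration.integrable_bound[OF L2_integrable[OF assms(1)]]) auto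
  then show "f \<in> L2 D" using assms by (simp add: L2_def)
  then show "L2_norm D f \<le> L2_norm D g"
    unfolding L2_norm_def using * assms
    by (intro real_sqrt_le_mono integral_mono_AE) (auto dest: L2_integrable)
qed

lemma L2_scaleR:
  fixes f :: "'a::euclidean_space \<Rightarrow> 'b::euclidean_space"
  assumes "f \<in> L2 D"
  shows "(\<lambda>x. c *\<^sub>R f x) \<in> L2 D" "L2_norm D (\<lambda>x. c *\<^sub>R f x) = \<bar>c\<bar> * L2_norm D f"
  using assms by (auto simp: L2_def L2_norm_def power_mult_distrib real_sqrt_mult)

lemma L2_uminus: "f \<in> L2 D \<Longrightarrow> (\<lambda>x. - f x) \<in> L2 D" "L2_norm D (\<lambda>x. - f x) = L2_norm D f"
  by (auto simp: L2_def L2_norm_def)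

lemma L2_norm_minus_commute: "L2_norm D (\<lambda>x. f x - g x) = L2_norm D (\<lambda>x. g x - f x)"
  by (simp add: L2_norm_def norm_minus_commute)

lemma L2_add:
  fixes f g :: "'a::euclidean_space \<Rightarrow> 'b::euclidean_space"
  assumes "f \<in> L2 D" "g \<in> L2 D"
  shows "(\<lambda>x. f x + g x) \<in> L2 D" "L2_norm D (\<lambda>x. f x + g x) \<le> L2_norm D f + L2_norm D g"
proof -
  note m = assms[THEN L2_measurable] and i = assms[THEN L2_integrable]
  note ii = L2_norm_mult_integrable[OF assms]
  have b: "(norm (f x + g x))\<^sup>2 \<le> (norm (f x))\<^sup>2 + (norm (g x))\<^sup>2 + 2 * (norm (f x) * norm (g x))" for x
    using power_mono[OF norm_triangle_ineq[of "f x" "g x"], of 2] by (simp add: power2_sum mult.assoc)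
  have int: "integrable (lebesgue_on D) (\<lambda>x. (norm (f x))\<^sup>2 + (norm (g x))\<^sup>2 + 2 * (norm (f x) * norm (g x)))"
    using i ii by auto
  have int2: "integrable (lebesgue_on D) (\<lambda>x. (norm (f x + g x))\<^sup>2)"
  proof (rule Bochner_Integration.integrable_bound[OF int])
    show "AE x in lebesgue_on D. norm ((norm (f x + g x))\<^sup>2)
      \<le> norm ((norm (f x))\<^sup>2 + (norm (g x))\<^sup>2 + 2 * (norm (f x) * norm (g x)))"
      using b by (intro AE_I2) (smt (verit) real_norm_def zero_le_power2)
  qed (use m in measurable)
  then show "(\<lambda>x. f x + g x) \<in> L2 D" using m by (simp add: L2_def)
  have "(L2_norm D (\<lambda>x. f x + g x))\<^sup>2 \<le> (LINT x|lebesgue_on D. (norm (f x))\<^sup>2 + (norm (g x))\<^sup>2 + 2 * (norm (f x) * norm (g x)))"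
    unfolding L2_norm_sq using int int2 b by (intro integral_mono) auto
  also have "\<dots> = (L2_norm D f)\<^sup>2 + (L2_norm D g)\<^sup>2 + 2 * (LINT x|lebesgue_on D. norm (f x) * norm (g x))"
    unfolding L2_norm_sq using i ii by simp
  also have "\<dots> \<le> (L2_norm D f)\<^sup>2 + (L2_norm D g)\<^sup>2 + 2 * (L2_norm D f * L2_norm D g)"
    using L2_norm_Cauchy_Schwarz[OF assms] by simp
  also have "\<dots> = (L2_norm D f + L2_norm D g)\<^sup>2" by (simp add: power2_sum)
  finally show "L2_norm D (\<lambda>x. f x + g x) \<le> L2_norm D f + L2_norm D g"
    by (rule power2_le_imp_le) simp
qed

lemma L2_diff:
  fixes f g :: "'a::euclidean_space \<Rightarrow> 'b::euclidean_space"
  assumes "f \<in> L2 D" "g \<in> L2 D"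
  shows "(\<lambda>x. f x - g x) \<in> L2 D" "L2_norm D (\<lambda>x. f x - g x) \<le> L2_norm D f + L2_norm D g"
  using L2_add[OF assms(1) L2_uminus(1)[OF assms(2)]] by (simp_all add: L2_uminus)

lemma L2_norm_triangle:
  fixes f g h :: "'a::euclidean_space \<Rightarrow> 'b::euclidean_space"
  assumes "f \<in> L2 D" "g \<in> L2 D" "h \<in> L2 D"
  shows "L2_norm D (\<lambda>x. f x - h x) \<le> L2_norm D (\<lambda>x. f x - g x) + L2_norm D (\<lambda>x. g x - h x)"
  using L2_add(2)[OF L2_diff(1)[OF assms(1,2)] L2_diff(1)[OF assms(2,3)]] by simp

lemma L2_norm_le_add_diff:
  fixes f g :: "'a::euclidean_space \<Rightarrow> 'b::euclidean_space"
  assumes "f \<in> L2 D" "g \<in> L2 D"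
  shows "\<bar>L2_norm D f - L2_norm D g\<bar> \<le> L2_norm D (\<lambda>x. f x - g x)"
  using L2_add(2)[OF L2_diff(1)[OF assms] assms(2)] L2_add(2)[OF L2_diff(1)[OF assms(2,1)] assms(1)]
  by (simp add: L2_norm_minus_commute[of D f g])

lemma L2_norm_cong_AE:
  assumes "AE x in lebesgue_on D. f x = g x" "f \<in> borel_measurable (lebesgue_on D)" "g \<in> borel_measurable (lebesgue_on D)"
  shows "L2_norm D f = L2_norm D g"
  unfolding L2_norm_def using assms by (intro arg_cong[of _ _ sqrt] integral_cong_AE) auto

lemma L2_AE_cong:
  fixes f g :: "'a::euclidean_space \<Rightarrow> 'b::euclidean_space"
  assumes "AE x in lebesgue_on D. f x = g x" "f \<in> L2 D" "g \<in> borel_measurable (lebesgue_on D)"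
  shows "g \<in> L2 D" "L2_norm D f = L2_norm D g"
proof -
  show "g \<in> L2 D" using assms by (intro L2_bound(1)[OF assms(2)]) auto
  show "L2_norm D f = L2_norm D g" using assms by (intro L2_norm_cong_AE) (auto dest: L2_measurable)
qed

lemma L2_component:
  assumes "f \<in> L2 D" "norm i \<le> 1"
  shows "(\<lambda>x. f x \<bullet> i) \<in> L2 D" "L2_norm D (\<lambda>x. f x \<bullet> i) \<le> L2_norm D f"
proof -
  have "\<bar>f x \<bullet> i\<bar> \<le> norm (f x)" for x
    using Cauchy_Schwarz_ineq2[of "f x" i] mult_left_mono[OF assms(2), of "norm (f x)"] by simp
  then have "AE x in lebesgue_on D. norm (f x \<bullet> i) \<le> norm (f x)" by simp
  moreover have "(\<lambda>x. f x \<bullet> i) \<in> borel_measurable (lebesgue_on D)"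
    using L2_measurable[OF assms(1)] by measurable
  ultimately show "(\<lambda>x. f x \<bullet> i) \<in> L2 D" "L2_norm D (\<lambda>x. f x \<bullet> i) \<le> L2_norm D f"
    using L2_bound[OF assms(1)] by blast+
qed

subsection \<open>Convergence\<close>

lemma L2_dominated_convergence:
  fixes f :: "nat \<Rightarrow> 'a::euclidean_space \<Rightarrow> 'b::euclidean_space" and w :: "'a \<Rightarrow> 'c::euclidean_space"
  assumes "w \<in> L2 D" "\<And>n. f n \<in> borel_measurable (lebesgue_on D)"
    "\<And>n. AE x in lebesgue_on D. norm (f n x) \<le> norm (w x)" "AE x in lebesgue_on D. (\<lambda>n. f n x) \<longlonglongrightarrow> 0"
  shows "(\<lambda>n. L2_norm D (f n)) \<longlonglongrightarrow> 0"
proof -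
  have "(\<lambda>n. LINT x|lebesgue_on D. (norm (f n x))\<^sup>2) \<longlonglongrightarrow> (LINT x|lebesgue_on D. 0)"
  proof (rule integral_dominated_convergence[OF _ _ L2_integrable[OF assms(1)]])
    show "AE x in lebesgue_on D. (\<lambda>n. (norm (f n x))\<^sup>2) \<longlonglongrightarrow> 0"
      using assms(4) by eventually_elim (simp add: tendsto_norm_zero tendsto_null_power)
    show "AE x in lebesgue_on D. norm ((norm (f n x))\<^sup>2) \<le> (norm (w x))\<^sup>2" for n
      using assms(3)[of n] by eventually_elim (simp add: power_mono)
  qed (use assms in measurable)
  then have "(\<lambda>n. sqrt (LINT x|lebesgue_on D. (norm (f n x))\<^sup>2)) \<longlonglongrightarrow> sqrt 0"
    by (intro tendsto_real_sqrt) simp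
  then show ?thesis by (simp add: L2_norm_def)
qed

text \<open>Convergence in L2 is convergence of |f n - g|^2 to 0 in L1, and L1 convergence yields an
  almost everywhere convergent subsequence.\<close>

lemma L2_AE_subseq:
  fixes f :: "nat \<Rightarrow> 'a::euclidean_space \<Rightarrow> 'b::euclidean_space"
  assumes "\<And>n. f n \<in> L2 D" "g \<in> L2 D" "(\<lambda>n. L2_norm D (\<lambda>x. f n x - g x)) \<longlonglongrightarrow> 0"
  obtains r where "strict_mono r" "AE x in lebesgue_on D. (\<lambda>n. f (r n) x) \<longlonglongrightarrow> g x"
proof -
  have "(\<lambda>n. LINT x|lebesgue_on D. norm ((norm (f n x - g x))\<^sup>2)) \<longlonglongrightarrow> 0"
    using tendsto_null_power[OF assms(3), of 2] by (simp add: L2_norm_sq)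
  moreover have "integrable (lebesgue_on D) (\<lambda>x. (norm (f n x - g x))\<^sup>2)" for n
    using L2_integrable[OF L2_diff(1)[OF assms(1,2)]] .
  ultimately obtain r where r: "strict_mono (r :: nat \<Rightarrow> nat)"
    "AE x in lebesgue_on D. (\<lambda>n. (norm (f (r n) x - g x))\<^sup>2) \<longlonglongrightarrow> 0"
    using tendsto_L1_AE_subseq[of "lebesgue_on D" "\<lambda>n x. (norm (f n x - g x))\<^sup>2"] by blast
  have "AE x in lebesgue_on D. (\<lambda>n. f (r n) x) \<longlonglongrightarrow> g x"
    using r(2)
  proof eventually_elim
    case (elim x)
    have "(\<lambda>n. sqrt ((norm (f (r n) x - g x))\<^sup>2)) \<longlonglongrightarrow> sqrt 0"
      using elim by (rule tendsto_real_sqrt)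
    then show ?case using LIM_zero_iff[of "\<lambda>n. f (r n) x"] by (simp add: tendsto_norm_zero_iff)
  qed
  with r show thesis using that by blast
qed

lemma L2_inner_tendsto:
  fixes f :: "nat \<Rightarrow> 'a::euclidean_space \<Rightarrow> 'b::euclidean_space"
  assumes "\<And>n. f n \<in> L2 D" "f' \<in> L2 D" "(\<lambda>n. L2_norm D (\<lambda>x. f n x - f' x)) \<longlonglongrightarrow> 0" "g \<in> L2 D"
  shows "(\<lambda>n. LINT x|lebesgue_on D. f n x \<bullet> g x) \<longlonglongrightarrow> (LINT x|lebesgue_on D. f' x \<bullet> g x)"
proof -
  have "(LINT x|lebesgue_on D. f n x \<bullet> g x) - (LINT x|lebesgue_on D. f' x \<bullet> g x)
     = (LINT x|lebesgue_on D. (f n x - f' x) \<bullet> g x)" for n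
    using assms by (subst Bochner_Integration.integral_diff[symmetric]) (auto intro: L2_inner_integrable simp: inner_diff_left)
  then have *: "norm ((LINT x|lebesgue_on D. f n x \<bullet> g x) - (LINT x|lebesgue_on D. f' x \<bullet> g x))
     \<le> L2_norm D (\<lambda>x. f n x - f' x) * L2_norm D g" for n
    using L2_inner_le[OF L2_diff(1)[OF assms(1,2)] assms(4)] by simp
  have "(\<lambda>n. (LINT x|lebesgue_on D. f n x \<bullet> g x) - (LINT x|lebesgue_on D. f' x \<bullet> g x)) \<longlonglongrightarrow> 0"
  proof (rule Lim_null_comparison)
    show "(\<lambda>n. L2_norm D (\<lambda>x. f n x - f' x) * L2_norm D g) \<longlonglongrightarrow> 0"
      by (rule tendsto_mult_left_zero[OF assms(3)])
  qed (rule always_eventually, rule allI, rule * )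
  then show ?thesis by (rule LIM_zero_cancel)
qed

lemma L2_norm_tendsto:
  fixes f :: "nat \<Rightarrow> 'a::euclidean_space \<Rightarrow> 'b::euclidean_space"
  assumes "\<And>n. f n \<in> L2 D" "g \<in> L2 D" "(\<lambda>n. L2_norm D (\<lambda>x. f n x - g x)) \<longlonglongrightarrow> 0"
  shows "(\<lambda>n. L2_norm D (f n)) \<longlonglongrightarrow> L2_norm D g"
proof -
  have "(\<lambda>n. L2_norm D (f n) - L2_norm D g) \<longlonglongrightarrow> 0"
    by (rule Lim_null_comparison[OF _ assms(3)]) (simp add: L2_norm_le_add_diff[OF assms(1,2)])
  then show ?thesis by (rule LIM_zero_cancel)
qed

lemma L2_tendsto_add:
  fixes f g :: "nat \<Rightarrow> 'a::euclidean_space \<Rightarrow> 'b::euclidean_space"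
  assumes "\<And>n. f n \<in> L2 D" "\<And>n. g n \<in> L2 D" "(\<lambda>n. L2_norm D (f n)) \<longlonglongrightarrow> 0" "(\<lambda>n. L2_norm D (g n)) \<longlonglongrightarrow> 0"
  shows "(\<lambda>n. L2_norm D (\<lambda>x. f n x + g n x)) \<longlonglongrightarrow> 0"
proof (rule Lim_null_comparison)
  show "(\<lambda>n. L2_norm D (f n) + L2_norm D (g n)) \<longlonglongrightarrow> 0" using tendsto_add[OF assms(3,4)] by simp
  show "\<forall>\<^sub>F n in sequentially. norm (L2_norm D (\<lambda>x. f n x + g n x)) \<le> L2_norm D (f n) + L2_norm D (g n)"
    using L2_add(2)[OF assms(1,2)] by simp
qed

lemma L2_tendsto_bound:
  fixes f :: "nat \<Rightarrow> 'a::euclidean_space \<Rightarrow> 'b::euclidean_space" and g :: "nat \<Rightarrow> 'a \<Rightarrow> 'c::euclidean_space"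
  assumes "\<And>n. g n \<in> L2 D" "(\<lambda>n. L2_norm D (g n)) \<longlonglongrightarrow> 0" "\<And>n. f n \<in> borel_measurable (lebesgue_on D)"
    "\<And>n. AE x in lebesgue_on D. norm (f n x) \<le> c * norm (g n x)" "c \<ge> 0"
  shows "(\<lambda>n. L2_norm D (f n)) \<longlonglongrightarrow> 0"
proof (rule Lim_null_comparison)
  show "(\<lambda>n. c * L2_norm D (g n)) \<longlonglongrightarrow> 0" using tendsto_mult_right_zero[OF assms(2)] .
  have "L2_norm D (f n) \<le> L2_norm D (\<lambda>x. c *\<^sub>R g n x)" for n
    using assms by (intro L2_bound(2) L2_scaleR) auto
  then show "\<forall>\<^sub>F n in sequentially. norm (L2_norm D (f n)) \<le> c * L2_norm D (g n)"
    using L2_scaleR(2)[OF assms(1), of c] assms(5) by simp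
qed

lemma L2_norm_bounded_lmeasurable:
  fixes f :: "'a::euclidean_space \<Rightarrow> 'b::euclidean_space"
  assumes "D \<in> lmeasurable" "f \<in> borel_measurable (lebesgue_on D)" "AE x in lebesgue_on D. norm (f x) \<le> B" "B \<ge> 0"
  shows "f \<in> L2 D" "L2_norm D f \<le> B * sqrt (measure lebesgue D)"
proof -
  have c: "(\<lambda>_. B) \<in> L2 D"
    using finite_measure.integrable_const[OF finite_measure_lebesgue_on[OF assms(1)]] by (simp add: L2_def)
  have "L2_norm D (\<lambda>_::'a. B) = B * sqrt (measure lebesgue D)"
    using assms(1,4) by (simp add: L2_norm_def real_sqrt_mult measure_restrict_space fmeasurableD mult.commute)
  then show "f \<in> L2 D" "L2_norm D f \<le> B * sqrt (measure lebesgue D)"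
    using L2_bound[OF c assms(2)] assms(3,4) by auto
qed

section \<open>Translations and convolutions\<close>

text \<open>The condition on c treats translations (c = 1) and the reflections x -> a - x (c = -1)
  at once.\<close>

lemma distr_lborel_affine:
  fixes a :: "'a::euclidean_space"
  assumes "\<bar>c\<bar> = 1"
  shows "distr lborel borel (\<lambda>x. a + c *\<^sub>R x) = lborel"
proof -
  have "c \<noteq> 0" using assms by auto
  from lborel_affine[OF this, of a] show ?thesis using assms by (simp add: density_1)
qed

lemma lborel_integrable_affine:
  fixes f :: "'a::euclidean_space \<Rightarrow> real"
  assumes "f \<in> borel_measurable borel" "\<bar>c\<bar> = 1"
  shows "integrable lborel (\<lambda>x. f (a + c *\<^sub>R x)) \<longleftrightarrow> integrable lborel f"
    and "(LINT x|lborel. f (a + c *\<^sub>R x)) = (LINT x|lborel. f x)"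
proof -
  have m: "(\<lambda>x. a + c *\<^sub>R x) \<in> measurable lborel borel" by measurable
  show "integrable lborel (\<lambda>x. f (a + c *\<^sub>R x)) \<longleftrightarrow> integrable lborel f"
    using integrable_distr_eq[OF m assms(1)] distr_lborel_affine[OF assms(2), of a] by simp
  show "(LINT x|lborel. f (a + c *\<^sub>R x)) = (LINT x|lborel. f x)"
    using integral_distr[OF m assms(1)] distr_lborel_affine[OF assms(2), of a] by simp
qed

lemmas lborel_integrable_translation = lborel_integrable_affine(1)[where c = 1, simplified]
  and lborel_integral_translation = lborel_integrable_affine(2)[where c = 1, simplified]
  and lborel_integrable_reflect = lborel_integrable_affine(1)[where c = "-1", simplified]
  and lborel_integral_reflect = lborel_integrable_affine(2)[where c = "-1", simplified]

text \<open>Borel instead of Lebesgue measurability, so that v may be composed with (x, h) -> h + x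
  and Fubini applied to the result.\<close>

definition sq_int :: "('a::euclidean_space \<Rightarrow> real) \<Rightarrow> bool" where
  "sq_int v \<longleftrightarrow> v \<in> borel_measurable borel \<and> integrable lborel (\<lambda>x. (v x)\<^sup>2)"

lemma sq_intD: "sq_int v \<Longrightarrow> v \<in> borel_measurable borel" "sq_int v \<Longrightarrow> integrable lborel (\<lambda>x. (v x)\<^sup>2)"
  by (auto simp: sq_int_def)

lemma sq_int_bound:
  assumes "sq_int w" "v \<in> borel_measurable borel" "\<And>x. \<bar>v x\<bar> \<le> \<bar>w x\<bar>"
  shows "sq_int v"
  unfolding sq_int_def
proof (intro conjI Bochner_Integration.integrable_bound[OF sq_intD(2)[OF assms(1)]])
  show "AE x in lborel. norm ((v x)\<^sup>2) \<le> norm ((w x)\<^sup>2)"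
    using assms(3) by (auto simp: abs_le_square_iff)
qed (use assms in measurable)

lemma sq_int_add:
  assumes "sq_int v" "sq_int w"
  shows "sq_int (\<lambda>x. v x + w x)"
  unfolding sq_int_def
proof (intro conjI Bochner_Integration.integrable_bound[where g="\<lambda>x. (v x + w x)\<^sup>2"])
  have "(v x + w x)\<^sup>2 \<le> 2 * (v x)\<^sup>2 + 2 * (w x)\<^sup>2" for x
    using zero_le_power2[of "v x - w x"] by (simp add: power2_sum power2_diff)
  then show "AE x in lborel. norm ((v x + w x)\<^sup>2) \<le> norm (2 * (v x)\<^sup>2 + 2 * (w x)\<^sup>2)"
    by (intro AE_I2) (simp add: abs_of_nonneg)
  show "integrable lborel (\<lambda>x. 2 * (v x)\<^sup>2 + 2 * (w x)\<^sup>2)" using assms by (auto simp: sq_int_def)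
qed (use sq_intD(1)[OF assms(1)] sq_intD(1)[OF assms(2)] in measurable)

lemma sq_int_cmult: "sq_int v \<Longrightarrow> sq_int (\<lambda>x. c * v x)"
  unfolding sq_int_def power_mult_distrib by auto

lemma sq_int_diff: "sq_int v \<Longrightarrow> sq_int w \<Longrightarrow> sq_int (\<lambda>x. v x - w x)"
  using sq_int_add[OF _ sq_int_cmult[of w "-1"], of v] by simp

lemma sq_int_translation: "sq_int v \<Longrightarrow> sq_int (\<lambda>x. v (h + x))"
  unfolding sq_int_def using lborel_integrable_translation[of "\<lambda>x. (v x)\<^sup>2" h] by auto

lemma sq_int_mult_integrable:
  assumes "sq_int v" "sq_int w"
  shows "integrable lborel (\<lambda>x. v x * w x)"
proof (rule Bochner_Integration.integrable_bound[where f="\<lambda>x. (v x)\<^sup>2 + (w x)\<^sup>2"])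
  have "\<bar>v x * w x\<bar> \<le> (v x)\<^sup>2 + (w x)\<^sup>2" for x
  proof -
    have "2 * (\<bar>v x\<bar> * \<bar>w x\<bar>) \<le> (v x)\<^sup>2 + (w x)\<^sup>2"
      using sum_squares_bound[of "\<bar>v x\<bar>" "\<bar>w x\<bar>"] by (simp add: mult.assoc)
    moreover have "0 \<le> \<bar>v x\<bar> * \<bar>w x\<bar>" by simp
    ultimately show ?thesis unfolding abs_mult by linarith
  qed
  then show "AE x in lborel. norm (v x * w x) \<le> norm ((v x)\<^sup>2 + (w x)\<^sup>2)"
    by (intro AE_I2) (simp add: abs_of_nonneg)
  show "integrable lborel (\<lambda>x. (v x)\<^sup>2 + (w x)\<^sup>2)"
    using sq_intD(2)[OF assms(1)] sq_intD(2)[OF assms(2)] by (rule Bochner_Integration.integrable_add)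
  show "(\<lambda>x. v x * w x) \<in> borel_measurable lborel"
    using sq_intD(1)[OF assms(1)] sq_intD(1)[OF assms(2)] by measurable
qed

section \<open>Continuity of translations in L2\<close>

definition trans_cont :: "('a::euclidean_space \<Rightarrow> real) \<Rightarrow> bool" where
  "trans_cont v \<longleftrightarrow> sq_int v \<and> ((\<lambda>h. LINT x|lborel. (v (h + x) - v x)\<^sup>2) \<longlongrightarrow> 0) (at 0)"

lemma trans_contI_seq:
  assumes "sq_int v" "\<And>h. h \<longlonglongrightarrow> 0 \<Longrightarrow> (\<lambda>n::nat. LINT x|lborel. (v (h n + x) - v x)\<^sup>2) \<longlonglongrightarrow> 0"
  shows "trans_cont v"
  using assms unfolding trans_cont_def tendsto_at_iff_sequentially comp_def by blast

text \<open>Squared norms are kept throughout, so the triangle inequality for three summands costs a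
  factor 3. For two summands the third is taken to be 0.\<close>

lemma integral_sq_triangle:
  assumes "sq_int u" "sq_int v" "sq_int w"
  shows "(LINT x|lborel. (u x + v x + w x)\<^sup>2)
    \<le> 3 * (LINT x|lborel. (u x)\<^sup>2) + 3 * (LINT x|lborel. (v x)\<^sup>2) + 3 * (LINT x|lborel. (w x)\<^sup>2)"
proof -
  have "(a + b + c)\<^sup>2 \<le> 3 * a\<^sup>2 + 3 * b\<^sup>2 + 3 * c\<^sup>2" for a b c :: real
    using zero_le_power2[of "a - b"] zero_le_power2[of "a - c"] zero_le_power2[of "b - c"]
    by (simp add: power2_eq_square algebra_simps)
  then have "(LINT x|lborel. (u x + v x + w x)\<^sup>2) \<le> (LINT x|lborel. 3 * (u x)\<^sup>2 + 3 * (v x)\<^sup>2 + 3 * (w x)\<^sup>2)"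
    using assms sq_int_add[OF sq_int_add[OF assms(1,2)] assms(3)]
    by (intro integral_mono) (auto simp: sq_int_def)
  then show ?thesis using assms by (simp add: sq_int_def)
qed

lemma trans_cont_limit:
  assumes "sq_int v" "\<And>e. e > 0 \<Longrightarrow> \<exists>w. trans_cont w \<and> (LINT x|lborel. (v x - w x)\<^sup>2) < e"
  shows "trans_cont v"
  unfolding trans_cont_def
proof (intro conjI tendstoI)
  fix e :: real assume "e > 0"
  \<comment> \<open>Three summands, each with a factor 3, leave a ninth of e for each integral. The
    first and the last integral agree by translation invariance.\<close>
  then obtain w where w: "trans_cont w" "(LINT x|lborel. (v x - w x)\<^sup>2) < e / 9" using assms(2)[of "e/9"] by auto
  have sw: "sq_int w" using w by (simp add: trans_cont_def)
  have "\<forall>\<^sub>F h in at 0. dist (LINT x|lborel. (w (h + x) - w x)\<^sup>2) 0 < e / 9"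
    using w(1) \<open>e > 0\<close> unfolding trans_cont_def by (intro tendstoD) auto
  then show "\<forall>\<^sub>F h in at 0. dist (LINT x|lborel. (v (h + x) - v x)\<^sup>2) 0 < e"
  proof eventually_elim
    case (elim h)
    have d: "sq_int (\<lambda>x. v x - w x)" "sq_int (\<lambda>x. w x - v x)" using sq_int_diff assms(1) sw by auto
    have "(LINT x|lborel. (v (h + x) - v x)\<^sup>2)
      = (LINT x|lborel. ((v (h + x) - w (h + x)) + (w (h + x) - w x) + (w x - v x))\<^sup>2)" by simp
    also have "\<dots> \<le> 3 * (LINT x|lborel. (v (h + x) - w (h + x))\<^sup>2) + 3 * (LINT x|lborel. (w (h + x) - w x)\<^sup>2)
       + 3 * (LINT x|lborel. (w x - v x)\<^sup>2)"
      using sq_int_translation[OF d(1), of h] d(2) sq_int_diff[OF sq_int_translation[OF sw] sw]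
      by (intro integral_sq_triangle)
    also have "(LINT x|lborel. (v (h + x) - w (h + x))\<^sup>2) = (LINT x|lborel. (v x - w x)\<^sup>2)"
      using lborel_integral_translation[of "\<lambda>x. (v x - w x)\<^sup>2" h] sq_intD(1)[OF d(1)] by simp
    also have "(LINT x|lborel. (w x - v x)\<^sup>2) = (LINT x|lborel. (v x - w x)\<^sup>2)"
      by (simp add: power2_commute)
    finally show ?case using w(2) elim by simp
  qed
qed (rule assms)

lemma trans_cont_add:
  assumes "trans_cont v" "trans_cont w"
  shows "trans_cont (\<lambda>x. v x + w x)"
proof -
  have s: "sq_int v" "sq_int w" using assms by (auto simp: trans_cont_def)
  have t: "((\<lambda>h. 3 * (LINT x|lborel. (v (h + x) - v x)\<^sup>2) + 3 * (LINT x|lborel. (w (h + x) - w x)\<^sup>2)) \<longlongrightarrow> 3 * 0 + 3 * 0) (at 0)"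
    using assms by (intro tendsto_intros) (auto simp: trans_cont_def)
  have "(LINT x|lborel. (v (h + x) + w (h + x) - (v x + w x))\<^sup>2)
     \<le> 3 * (LINT x|lborel. (v (h + x) - v x)\<^sup>2) + 3 * (LINT x|lborel. (w (h + x) - w x)\<^sup>2)" for h
    using integral_sq_triangle[OF sq_int_diff[OF sq_int_translation[OF s(1)] s(1)]
       sq_int_diff[OF sq_int_translation[OF s(2)] s(2)] sq_int_cmult[OF s(1), of 0], of h h]
    by (simp add: algebra_simps)
  then have "((\<lambda>h. LINT x|lborel. (v (h + x) + w (h + x) - (v x + w x))\<^sup>2) \<longlongrightarrow> 0) (at 0)"
    by (intro tendsto_sandwich[OF _ _ tendsto_const t[simplified]] always_eventually allI) auto
  then show ?thesis using s by (auto simp: trans_cont_def intro: sq_int_add)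
qed

lemma trans_cont_cmult:
  assumes "trans_cont v"
  shows "trans_cont (\<lambda>x. c * v x)"
proof -
  have "(LINT x|lborel. (c * v (h + x) - c * v x)\<^sup>2) = c\<^sup>2 * (LINT x|lborel. (v (h + x) - v x)\<^sup>2)" for h
    by (simp add: right_diff_distrib[symmetric] power_mult_distrib)
  moreover have "((\<lambda>h. c\<^sup>2 * (LINT x|lborel. (v (h + x) - v x)\<^sup>2)) \<longlongrightarrow> c\<^sup>2 * 0) (at 0)"
    using assms by (intro tendsto_intros) (auto simp: trans_cont_def)
  ultimately show ?thesis using assms by (auto simp: trans_cont_def intro: sq_int_cmult)
qed

lemma sq_int_indicator:
  assumes "A \<in> sets borel" "emeasure lborel A < \<infinity>"
  shows "sq_int (indicator A)"
proof -
  have "(\<lambda>x. (indicator A x :: real)\<^sup>2) = indicator A" by (auto simp: indicator_def)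
  then show ?thesis using assms by (auto simp: sq_int_def)
qed

text \<open>For x in U, openness puts h n + x into U eventually. Nothing is known pointwise outside
  U, but expanding the square reduces everything to the overlap of U with its translate, and the
  overlap only involves points of U.\<close>

lemma trans_cont_open:
  assumes "open U" "emeasure lborel U < \<infinity>"
  shows "trans_cont (indicator U)"
proof (rule trans_contI_seq)
  show s: "sq_int (indicator U :: 'a \<Rightarrow> real)" using assms by (intro sq_int_indicator) auto
  fix h :: "nat \<Rightarrow> 'a" assume h: "h \<longlonglongrightarrow> 0"
  let ?I = "indicator U :: 'a \<Rightarrow> real"
  have [measurable]: "?I \<in> borel_measurable borel" using assms by auto
  have iU: "integrable lborel ?I" using assms by auto
  have *: "(LINT x|lborel. (?I (h n + x) - ?I x)\<^sup>2) = 2 * (LINT x|lborel. ?I x) - 2 * (LINT x|lborel. ?I (h n + x) * ?I x)" for n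
  proof -
    have i: "integrable lborel (\<lambda>x. ?I (h n + x) * ?I x)"
      by (rule sq_int_mult_integrable[OF sq_int_translation[OF s] s])
    have "(LINT x|lborel. (?I (h n + x) - ?I x)\<^sup>2) = (LINT x|lborel. ?I (h n + x) + ?I x - 2 * (?I (h n + x) * ?I x))"
      by (rule Bochner_Integration.integral_cong) (auto simp: indicator_def)
    also have "\<dots> = (LINT x|lborel. ?I (h n + x)) + (LINT x|lborel. ?I x) - 2 * (LINT x|lborel. ?I (h n + x) * ?I x)"
      using iU i lborel_integrable_translation[of ?I "h n"] by simp
    also have "(LINT x|lborel. ?I (h n + x)) = (LINT x|lborel. ?I x)"
      by (rule lborel_integral_translation) simp
    finally show ?thesis by simp
  qed
  have "(\<lambda>n. LINT x|lborel. ?I (h n + x) * ?I x) \<longlonglongrightarrow> (LINT x|lborel. ?I x)"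
  proof (rule integral_dominated_convergence[OF _ _ iU])
    show "AE x in lborel. (\<lambda>n. ?I (h n + x) * ?I x) \<longlonglongrightarrow> ?I x"
    proof (rule AE_I2)
      fix x
      show "(\<lambda>n. ?I (h n + x) * ?I x) \<longlonglongrightarrow> ?I x"
      proof (cases "x \<in> U")
        case True
        have "(\<lambda>n. h n + x) \<longlonglongrightarrow> 0 + x" using h by (intro tendsto_intros)
        then have "\<forall>\<^sub>F n in sequentially. h n + x \<in> U" using True assms(1) by (intro topological_tendstoD) auto
        then have "\<forall>\<^sub>F n in sequentially. ?I (h n + x) * ?I x = ?I x" by eventually_elim (use True in simp)
        then show ?thesis by (rule tendsto_eventually)
      qed simp
    qed
    show "AE x in lborel. norm (?I (h n + x) * ?I x) \<le> ?I x" for n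
      by (auto simp: indicator_def)
  qed (measurable)
  then have "(\<lambda>n. 2 * (LINT x|lborel. ?I x) - 2 * (LINT x|lborel. ?I (h n + x) * ?I x))
     \<longlonglongrightarrow> 2 * (LINT x|lborel. ?I x) - 2 * (LINT x|lborel. ?I x)" by (intro tendsto_intros)
  then show "(\<lambda>n. LINT x|lborel. (?I (h n + x) - ?I x)\<^sup>2) \<longlonglongrightarrow> 0" unfolding * by simp
qed

text \<open>Outer regularity encloses A in an open set with small excess measure, and that measure
  is the squared L2 distance of the two indicators.\<close>

lemma trans_cont_indicator:
  assumes "A \<in> sets borel" "emeasure lborel A < \<infinity>"
  shows "trans_cont (indicator A)"
proof (rule trans_cont_limit)
  show "sq_int (indicator A :: 'a \<Rightarrow> real)" using assms by (rule sq_int_indicator)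
  fix e :: real assume "e > 0"
  then obtain U where U: "open U" "A \<subseteq> U" "emeasure lborel (U - A) < e" using outer_regular_lborel[OF assms(1)] by blast
  have "emeasure lborel U \<le> emeasure lborel A + emeasure lborel (U - A)"
    using assms(1) U emeasure_subadditive[of A lborel "U - A"] by (simp add: Un_absorb1)
  then have fU: "emeasure lborel U < \<infinity>" using assms(2) U(3)
    by (metis ennreal_add_eq_top ennreal_less_top infinity_ennreal_def not_top_less order_le_less_trans order_less_trans top.not_eq_extremum)
  have "(\<lambda>x. (indicator A x - indicator U x :: real)\<^sup>2) = indicator (U - A)"
    using U(2) by (intro ext) (auto split: split_indicator)
  then have "(LINT x|lborel. (indicator A x - indicator U x :: real)\<^sup>2) = measure lborel (U - A)"
    by simp
  also have "\<dots> < e" using U(3) \<open>e > 0\<close> by (metis emeasure_eq_ennreal_measure ennreal_less_iff less_top measure_nonneg order_less_trans ennreal_less_top)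
  finally show "\<exists>w. trans_cont w \<and> (LINT x|lborel. (indicator A x - w x)\<^sup>2) < e"
    using trans_cont_open[OF U(1) fU] by blast
qed

text \<open>Simple functions bounded by 2|v| converge to v pointwise, hence in L2 by dominated
  convergence; each is a finite combination of indicators of its level sets.\<close>

lemma trans_cont_sq_int:
  assumes "sq_int v"
  shows "trans_cont v"
proof (rule trans_cont_limit[OF assms])
  fix e :: real assume "e > 0"
  have vm: "v \<in> borel_measurable lborel" using assms by (simp add: sq_int_def)
  obtain F where F: "\<And>i. simple_function lborel (F i)" "\<And>x. (\<lambda>i. F i x) \<longlonglongrightarrow> v x"
    "\<And>i x. \<bar>F i x\<bar> \<le> 2 * \<bar>v x\<bar>"
    using borel_measurable_implies_sequence_metric[OF vm, of 0] by (auto simp: dist_real_def)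
  have Fm: "F i \<in> borel_measurable borel" for i using borel_measurable_simple_function[OF F(1)] by simp
  have sF: "sq_int (F i)" for i
    using F(3) by (intro sq_int_bound[OF sq_int_cmult[OF assms, of 2] Fm]) (auto simp: abs_mult)
  have "trans_cont (F i)" for i
  proof -
    \<comment> \<open>The value 0 is left out because its level set may have infinite measure. For y
      nonzero, Chebyshev's inequality bounds the measure by the integral of (F i)^2 over
      y^2.\<close>
    let ?R = "range (F i) - {0}"
    have fin: "finite ?R" using F(1)[of i] by (simp add: simple_function_def)
    have lv: "F i -` {y} \<in> sets borel" for y using measurable_sets[OF Fm, of "{y}"] by simp
    have "emeasure lborel (F i -` {y}) < \<infinity>" if "y \<noteq> 0" for y
    proof -
      have "integrable lborel (\<lambda>x. indicator (F i -` {y}) x *\<^sub>R (1::real))"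
      proof (rule Bochner_Integration.integrable_bound[where f="\<lambda>x. (1 / y\<^sup>2) * (F i x)\<^sup>2"])
        show "integrable lborel (\<lambda>x. (1 / y\<^sup>2) * (F i x)\<^sup>2)" using sF[of i] unfolding sq_int_def by (intro integrable_mult_right) auto
        show "(\<lambda>x. indicator (F i -` {y}) x *\<^sub>R (1::real)) \<in> borel_measurable lborel"
          using borel_measurable_indicator[of "F i -` {y}" lborel] lv by simp
        show "AE x in lborel. norm (indicator (F i -` {y}) x *\<^sub>R (1::real)) \<le> norm (1 / y\<^sup>2 * (F i x)\<^sup>2)"
          using that by (intro AE_I2) (auto split: split_indicator)
      qed
      then have "integrable lborel (indicator (F i -` {y}) :: 'a \<Rightarrow> real)" by simp
      then show ?thesis by (simp add: integrable_indicator_iff lv)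
    qed
    then have *: "trans_cont (indicator (F i -` {y}))" if "y \<noteq> 0" for y
      using that lv by (intro trans_cont_indicator) auto
    have "trans_cont (\<lambda>x. \<Sum>y\<in>S. y * indicator (F i -` {y}) x)" if "finite S" "0 \<notin> S" for S
      using that
    proof (induction S)
      case empty
      show ?case using trans_cont_cmult[OF *[of 1], of 0] by simp
    next
      case (insert y S)
      have "trans_cont (\<lambda>x. \<Sum>y\<in>S. y * indicator (F i -` {y}) x)" "y \<noteq> 0"
        using insert.IH insert.prems by blast+
      then have "trans_cont (\<lambda>x. y * indicator (F i -` {y}) x + (\<Sum>y\<in>S. y * indicator (F i -` {y}) x))"
        by (intro trans_cont_add trans_cont_cmult * )
      then show ?case by (simp only: sum.insert[OF insert.hyps])
    qed
    from this[OF fin] have "trans_cont (\<lambda>x. \<Sum>y\<in>?R. y * indicator (F i -` {y}) x)" by blast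
    moreover have "(\<Sum>y\<in>?R. y * indicator (F i -` {y}) x) = F i x" for x
    proof -
      have "(\<Sum>y\<in>?R. y * indicator (F i -` {y}) x) = (\<Sum>y\<in>?R. if F i x = y then y else 0)"
        by (rule sum.cong) (auto simp: indicator_def)
      also have "\<dots> = F i x" using fin by (subst sum.delta') auto
      finally show ?thesis .
    qed
    ultimately show ?thesis by (simp only:)
  qed
  moreover have "(\<lambda>i. LINT x|lborel. (v x - F i x)\<^sup>2) \<longlonglongrightarrow> (LINT x|(lborel :: 'a measure). 0)"
  proof (rule integral_dominated_convergence[where w="\<lambda>x. 9 * (v x)\<^sup>2"])
    show "AE x in lborel. (\<lambda>i. (v x - F i x)\<^sup>2) \<longlonglongrightarrow> 0"
    proof (rule AE_I2)
      fix x
      have "(\<lambda>i. v x - F i x) \<longlonglongrightarrow> v x - v x" using F(2) by (intro tendsto_diff tendsto_const)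
      then show "(\<lambda>i. (v x - F i x)\<^sup>2) \<longlonglongrightarrow> 0" by (intro tendsto_null_power) auto
    qed
    have "(v x - F i x)\<^sup>2 \<le> 9 * (v x)\<^sup>2" for i x
    proof -
      have "\<bar>v x - F i x\<bar> \<le> \<bar>3 * v x\<bar>" using F(3)[of i x] by linarith
      then show ?thesis by (simp add: abs_le_square_iff power_mult_distrib)
    qed
    then show "AE x in lborel. norm ((v x - F i x)\<^sup>2) \<le> 9 * (v x)\<^sup>2" for i by simp
    show "integrable lborel (\<lambda>x. 9 * (v x)\<^sup>2)" using assms by (simp add: sq_int_def)
  qed (use vm Fm in measurable)
  then have "\<forall>\<^sub>F i in sequentially. (LINT x|lborel. (v x - F i x)\<^sup>2) < e"
    using \<open>e > 0\<close> by (intro order_tendstoD) auto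
  then obtain i where "(LINT x|lborel. (v x - F i x)\<^sup>2) < e" by (auto simp: eventually_sequentially)
  ultimately show "\<exists>w. trans_cont w \<and> (LINT x|lborel. (v x - w x)\<^sup>2) < e" by blast
qed

section \<open>Convolution with smooth kernels\<close>

definition kernel :: "real \<Rightarrow> ('a::euclidean_space \<Rightarrow> real) \<Rightarrow> bool" where
  "kernel \<epsilon> \<eta> \<longleftrightarrow> smooth \<eta> \<and> (\<forall>x. x \<notin> cball 0 \<epsilon> \<longrightarrow> \<eta> x = 0)"

definition mollifier :: "real \<Rightarrow> ('a::euclidean_space \<Rightarrow> real) \<Rightarrow> bool" where
  "mollifier \<epsilon> \<eta> \<longleftrightarrow> kernel \<epsilon> \<eta> \<and> (\<forall>x. \<eta> x \<ge> 0) \<and> integrable lborel \<eta> \<and> (LINT x|lborel. \<eta> x) = 1"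

definition conv :: "('a::euclidean_space \<Rightarrow> real) \<Rightarrow> ('a \<Rightarrow> real) \<Rightarrow> 'a \<Rightarrow> real" where
  "conv \<eta> v x = (LINT y|lborel. \<eta> (x - y) * v y)"

lemma mollifier_ex: "\<epsilon> > 0 \<Longrightarrow> \<exists>\<eta> :: 'a::euclidean_space \<Rightarrow> real. mollifier \<epsilon> \<eta>"
  by (erule mollifier_exists) (auto simp: mollifier_def kernel_def not_le)

text \<open>Kernels carry no condition on sign or mass exactly for this closure property: the
  derivatives of a mollifier have integral 0. It drives the induction that makes convolutions
  smooth.\<close>

lemma kernel_partial: "kernel \<epsilon> \<eta> \<Longrightarrow> i \<in> Basis \<Longrightarrow> kernel \<epsilon> (partial i \<eta>)"
  unfolding kernel_def by (metis closed_cball partial_eq_0 smooth_partial)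

lemma kernel_bounded:
  assumes "kernel \<epsilon> \<eta>"
  obtains B where "B \<ge> 0" "\<And>x. \<bar>\<eta> x\<bar> \<le> B"
proof -
  have "compact (\<eta> ` cball 0 \<epsilon>)"
    using assms by (intro compact_continuous_image smooth_continuous) (auto simp: kernel_def)
  then have "bounded (\<eta> ` cball 0 \<epsilon>)" by (rule compact_imp_bounded)
  then obtain B where B: "B > 0" "\<And>y. y \<in> \<eta> ` cball 0 \<epsilon> \<Longrightarrow> norm y \<le> B"
    using bounded_pos by metis
  have "\<bar>\<eta> x\<bar> \<le> B" for x
    using B(1) B(2)[of "\<eta> x"] assms unfolding kernel_def by (cases "x \<in> cball 0 \<epsilon>") auto
  with B(1) show thesis using that[of B] by simp
qed

lemma kernel_borel: "kernel \<epsilon> \<eta> \<Longrightarrow> \<eta> \<in> borel_measurable borel"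
  unfolding kernel_def by (intro borel_measurable_continuous_onI smooth_continuous) auto

lemma frechet_derivative_partial:
  assumes "f differentiable (at x)"
  shows "frechet_derivative f (at x) k = (\<Sum>i\<in>Basis. (k \<bullet> i) * partial i f x)"
proof -
  have l: "linear (frechet_derivative f (at x))" using assms by (rule linear_frechet_derivative)
  have "frechet_derivative f (at x) k = frechet_derivative f (at x) (\<Sum>i\<in>Basis. (k \<bullet> i) *\<^sub>R i)"
    by (simp add: euclidean_representation)
  also have "\<dots> = (\<Sum>i\<in>Basis. (k \<bullet> i) *\<^sub>R frechet_derivative f (at x) i)"
    by (simp add: linear_sum[OF l] linear_cmul[OF l])
  finally show ?thesis by (simp add: partial_def)
qed

lemma partial_mean_value:
  assumes "\<And>x. f differentiable (at x)"
  obtains t where "0 < t" "t < 1" "f (x + k) - f x = (\<Sum>i\<in>Basis. (k \<bullet> i) * partial i f (x + t *\<^sub>R k))"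
proof -
  have "((\<lambda>t. f (x + t *\<^sub>R k)) has_real_derivative frechet_derivative f (at (x + t *\<^sub>R k)) k) (at t)" for t
  proof -
    have 1: "((\<lambda>t. x + t *\<^sub>R k) has_derivative (\<lambda>s. s *\<^sub>R k)) (at t)"
      by (auto intro!: derivative_eq_intros)
    have "((\<lambda>t. f (x + t *\<^sub>R k)) has_derivative (\<lambda>s. frechet_derivative f (at (x + t *\<^sub>R k)) (s *\<^sub>R k))) (at t)"
      by (rule has_derivative_compose[OF 1 has_derivative_frechet[OF assms]])
    also have "(\<lambda>s. frechet_derivative f (at (x + t *\<^sub>R k)) (s *\<^sub>R k)) = (*) (frechet_derivative f (at (x + t *\<^sub>R k)) k)"
      using linear_cmul[OF linear_frechet_derivative[OF assms]] by (auto simp: mult.commute)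
    finally show ?thesis by (simp add: has_field_derivative_def)
  qed
  then obtain t where "0 < t" "t < 1"
    "f (x + 1 *\<^sub>R k) - f (x + 0 *\<^sub>R k) = (1 - 0) * frechet_derivative f (at (x + t *\<^sub>R k)) k"
    using MVT2[of 0 1 "\<lambda>t. f (x + t *\<^sub>R k)" "\<lambda>t. frechet_derivative f (at (x + t *\<^sub>R k)) k"] by auto
  then show thesis using that frechet_derivative_partial[OF assms] by simp
qed

lemma sum_Basis_mult_bound:
  fixes k :: "'a::euclidean_space"
  assumes "\<And>i. i \<in> Basis \<Longrightarrow> \<bar>a i\<bar> \<le> b i"
  shows "\<bar>\<Sum>i\<in>Basis. (k \<bullet> i) * a i\<bar> \<le> norm k * (\<Sum>i\<in>Basis. b i)"
proof -
  have "\<bar>\<Sum>i\<in>Basis. (k \<bullet> i) * a i\<bar> \<le> (\<Sum>i\<in>Basis. \<bar>(k \<bullet> i) * a i\<bar>)" by (rule sum_abs)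
  also have "\<dots> \<le> (\<Sum>i\<in>Basis. norm k * b i)"
    unfolding abs_mult using assms by (intro sum_mono mult_mono Basis_le_norm) auto
  finally show ?thesis by (simp add: sum_distrib_left)
qed

lemma kernel_Lipschitz:
  assumes "kernel \<epsilon> \<eta>"
  obtains L where "L \<ge> 0" "\<And>x k. \<bar>\<eta> (x + k) - \<eta> x\<bar> \<le> L * norm k"
proof -
  have "\<exists>B. \<forall>x. \<bar>partial i \<eta> x\<bar> \<le> B" if "i \<in> Basis" for i
    using kernel_bounded[OF kernel_partial[OF assms that]] by metis
  then obtain B where B: "\<And>i x. i \<in> Basis \<Longrightarrow> \<bar>partial i \<eta> x\<bar> \<le> B i" by metis
  have d: "\<eta> differentiable (at x)" for x using assms by (auto simp: kernel_def smooth_differentiable)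
  have "\<bar>\<eta> (x + k) - \<eta> x\<bar> \<le> (\<Sum>i\<in>Basis. B i) * norm k" for x k
  proof -
    obtain t where "\<eta> (x + k) - \<eta> x = (\<Sum>i\<in>Basis. (k \<bullet> i) * partial i \<eta> (x + t *\<^sub>R k))"
      using partial_mean_value[OF d] by metis
    then show ?thesis using sum_Basis_mult_bound[of "\<lambda>i. partial i \<eta> (x + t *\<^sub>R k)" B k] B
      by (simp add: mult.commute)
  qed
  moreover have "0 \<le> (\<Sum>i\<in>Basis. B i)" using B by (intro sum_nonneg) (meson abs_ge_zero order_trans)
  ultimately show thesis using that by blast
qed

text \<open>The remainder of the first order Taylor expansion, with a constant independent of x
  because the partial derivatives are Lipschitz. This uniformity allows differentiation under the
  integral for a merely integrable v.\<close>

lemma kernel_quadratic: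
  assumes "kernel \<epsilon> \<eta>"
  obtains L where "L \<ge> 0"
    "\<And>x k. \<bar>\<eta> (x + k) - \<eta> x - (\<Sum>i\<in>Basis. (k \<bullet> i) * partial i \<eta> x)\<bar> \<le> L * (norm k)\<^sup>2"
proof -
  have "\<exists>L. L \<ge> 0 \<and> (\<forall>x k. \<bar>partial i \<eta> (x + k) - partial i \<eta> x\<bar> \<le> L * norm k)" if "i \<in> Basis" for i
    using kernel_Lipschitz[OF kernel_partial[OF assms that]] by metis
  then obtain L where L: "\<And>i. i \<in> Basis \<Longrightarrow> L i \<ge> 0"
    "\<And>i x k. i \<in> Basis \<Longrightarrow> \<bar>partial i \<eta> (x + k) - partial i \<eta> x\<bar> \<le> L i * norm k" by metis
  have d: "\<eta> differentiable (at x)" for x using assms by (auto simp: kernel_def smooth_differentiable)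
  have "\<bar>\<eta> (x + k) - \<eta> x - (\<Sum>i\<in>Basis. (k \<bullet> i) * partial i \<eta> x)\<bar> \<le> (\<Sum>i\<in>Basis. L i) * (norm k)\<^sup>2" for x k
  proof -
    obtain t where t: "0 < t" "t < 1" "\<eta> (x + k) - \<eta> x = (\<Sum>i\<in>Basis. (k \<bullet> i) * partial i \<eta> (x + t *\<^sub>R k))"
      using partial_mean_value[OF d] by metis
    have "\<bar>partial i \<eta> (x + t *\<^sub>R k) - partial i \<eta> x\<bar> \<le> L i * norm k" if "i \<in> Basis" for i
    proof -
      \<comment> \<open>The intermediate point x + t k is no further from x than x + k, so the
        Lipschitz bound may be taken at |k|.\<close>
      have "t * norm k \<le> norm k" using t(1,2) mult_right_mono[of t 1 "norm k"] by simp
      then have "L i * norm (t *\<^sub>R k) \<le> L i * norm k" using t(1) L(1)[OF that] by (intro mult_left_mono) auto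
      then show ?thesis using L(2)[OF that, of x "t *\<^sub>R k"] by linarith
    qed
    then have "\<bar>\<Sum>i\<in>Basis. (k \<bullet> i) * (partial i \<eta> (x + t *\<^sub>R k) - partial i \<eta> x)\<bar> \<le> norm k * (\<Sum>i\<in>Basis. L i * norm k)"
      by (rule sum_Basis_mult_bound)
    then show ?thesis
      unfolding t(3) by (simp add: right_diff_distrib sum_subtractf sum_distrib_right[symmetric] power2_eq_square mult_ac)
  qed
  moreover have "0 \<le> (\<Sum>i\<in>Basis. L i)" using L by (intro sum_nonneg) auto
  ultimately show thesis using that by blast
qed

lemma conv_integrable:
  assumes "kernel \<epsilon> \<eta>" "integrable lborel v"
  shows "integrable lborel (\<lambda>y. \<eta> (x - y) * v y)"
proof -
  obtain B where B: "B \<ge> 0" "\<And>x. \<bar>\<eta> x\<bar> \<le> B" using kernel_bounded[OF assms(1)] by metis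
  note [measurable] = kernel_borel[OF assms(1)] borel_measurable_integrable[OF assms(2)]
  show ?thesis
  proof (rule Bochner_Integration.integrable_bound[where f="\<lambda>y. B * v y"])
    show "AE y in lborel. norm (\<eta> (x - y) * v y) \<le> norm (B * v y)"
      using B by (auto simp: abs_mult intro!: mult_right_mono)
    show "(\<lambda>y. \<eta> (x - y) * v y) \<in> borel_measurable lborel" by measurable
  qed (use assms in auto)
qed

text \<open>The Taylor remainder of the convolution is the integral of the Taylor remainder of the
  kernel against v, hence at most L |k|^2 times the L1 norm of v.\<close>

lemma conv_has_derivative:
  assumes k: "kernel \<epsilon> \<eta>" and v: "integrable lborel v"
  shows "(conv \<eta> v has_derivative (\<lambda>k. \<Sum>i\<in>Basis. (k \<bullet> i) * conv (partial i \<eta>) v x)) (at x)"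
proof -
  obtain L where L: "L \<ge> 0"
    "\<And>x k. \<bar>\<eta> (x + k) - \<eta> x - (\<Sum>i\<in>Basis. (k \<bullet> i) * partial i \<eta> x)\<bar> \<le> L * (norm k)\<^sup>2"
    using kernel_quadratic[OF k] by metis
  define N where "N = (LINT y|lborel. \<bar>v y\<bar>)"
  have N: "N \<ge> 0" unfolding N_def by simp
  have est: "\<bar>conv \<eta> v (x + k) - conv \<eta> v x - (\<Sum>i\<in>Basis. (k \<bullet> i) * conv (partial i \<eta>) v x)\<bar>
      \<le> L * N * (norm k)\<^sup>2" for k
  proof -
    define R where "R y = \<eta> (x + k - y) - \<eta> (x - y) - (\<Sum>i\<in>Basis. (k \<bullet> i) * partial i \<eta> (x - y))" for y
    note int = conv_integrable[OF k v] conv_integrable[OF kernel_partial[OF k] v]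
    have eq: "R y * v y = \<eta> (x + k - y) * v y - \<eta> (x - y) * v y - (\<Sum>i\<in>Basis. (k \<bullet> i) * (partial i \<eta> (x - y) * v y))" for y
      unfolding R_def by (simp add: left_diff_distrib sum_distrib_right mult.assoc)
    have i1: "integrable lborel (\<lambda>y. \<eta> (x + k - y) * v y - \<eta> (x - y) * v y)"
      using int(1) by (intro Bochner_Integration.integrable_diff)
    have i2: "integrable lborel (\<lambda>y. \<Sum>i\<in>Basis. (k \<bullet> i) * (partial i \<eta> (x - y) * v y))"
      using int(2) by (intro Bochner_Integration.integrable_sum integrable_mult_right)
    have iR: "integrable lborel (\<lambda>y. R y * v y)"
      unfolding eq by (rule Bochner_Integration.integrable_diff[OF i1 i2])
    have "(LINT y|lborel. R y * v y) = (LINT y|lborel. \<eta> (x + k - y) * v y - \<eta> (x - y) * v y)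
        - (LINT y|lborel. (\<Sum>i\<in>Basis. (k \<bullet> i) * (partial i \<eta> (x - y) * v y)))"
      unfolding eq by (rule Bochner_Integration.integral_diff[OF i1 i2])
    also have "(LINT y|lborel. \<eta> (x + k - y) * v y - \<eta> (x - y) * v y) = conv \<eta> v (x + k) - conv \<eta> v x"
      unfolding conv_def by (rule Bochner_Integration.integral_diff[OF int(1) int(1)])
    also have "(LINT y|lborel. (\<Sum>i\<in>Basis. (k \<bullet> i) * (partial i \<eta> (x - y) * v y))) = (\<Sum>i\<in>Basis. (k \<bullet> i) * conv (partial i \<eta>) v x)"
      unfolding conv_def using int(2) by (subst Bochner_Integration.integral_sum) auto
    finally have eqR: "conv \<eta> v (x + k) - conv \<eta> v x - (\<Sum>i\<in>Basis. (k \<bullet> i) * conv (partial i \<eta>) v x) = (LINT y|lborel. R y * v y)"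
      by simp
    have "\<bar>LINT y|lborel. R y * v y\<bar> \<le> (LINT y|lborel. \<bar>R y * v y\<bar>)" using integral_norm_bound[of lborel "\<lambda>y. R y * v y"] by simp
    also have "\<dots> \<le> (LINT y|lborel. L * (norm k)\<^sup>2 * \<bar>v y\<bar>)"
    proof (rule integral_mono)
      fix y
      have "\<bar>R y\<bar> \<le> L * (norm k)\<^sup>2" using L(2)[of "x - y" k] by (simp add: R_def algebra_simps)
      then show "\<bar>R y * v y\<bar> \<le> L * (norm k)\<^sup>2 * \<bar>v y\<bar>"
        unfolding abs_mult by (intro mult_right_mono) auto
    qed (use iR v in auto)
    also have "\<dots> = L * N * (norm k)\<^sup>2" by (simp add: N_def)
    finally show ?thesis unfolding eqR .
  qed
  show ?thesis
    unfolding has_derivative_at_alt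
  proof (intro conjI allI impI)
    show "bounded_linear (\<lambda>k. \<Sum>i\<in>Basis. (k \<bullet> i) * conv (partial i \<eta>) v x)"
      by (intro bounded_linear_sum bounded_linear_mult_left bounded_linear_compose[OF bounded_linear_mult_left] bounded_linear_inner_left)
    fix e :: real assume "e > 0"
    show "\<exists>d>0. \<forall>y. norm (y - x) < d \<longrightarrow>
        norm (conv \<eta> v y - conv \<eta> v x - (\<Sum>i\<in>Basis. ((y - x) \<bullet> i) * conv (partial i \<eta>) v x)) \<le> e * norm (y - x)"
    proof (intro exI conjI allI impI)
      \<comment> \<open>The summand 1 keeps the denominator positive when L or N vanishes.\<close>
      show "e / (L * N + 1) > 0" using \<open>e > 0\<close> L(1) N by (simp add: add_nonneg_pos)
      fix y assume y: "norm (y - x) < e / (L * N + 1)"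
      have "L * N * norm (y - x) \<le> (L * N + 1) * norm (y - x)" by (intro mult_right_mono) auto
      also have "\<dots> \<le> e"
      proof -
        have "0 < L * N + 1" using L(1) N by (simp add: add_nonneg_pos)
        then have "norm (y - x) * (L * N + 1) < e" using y by (simp only: pos_less_divide_eq)
        then show ?thesis by (simp only: mult.commute less_imp_le)
      qed
      finally have "L * N * (norm (y - x))\<^sup>2 \<le> e * norm (y - x)"
        using mult_right_mono[of "L * N * norm (y - x)" e "norm (y - x)"] by (simp add: power2_eq_square mult.assoc)
      then show "norm (conv \<eta> v y - conv \<eta> v x - (\<Sum>i\<in>Basis. ((y - x) \<bullet> i) * conv (partial i \<eta>) v x)) \<le> e * norm (y - x)"
        using est[of "y - x"] by simp
    qed
  qed
qed

lemma conv_partial: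
  assumes "kernel \<epsilon> \<eta>" "integrable lborel v" "i \<in> Basis"
  shows "partial i (conv \<eta> v) = conv (partial i \<eta>) v"
proof
  fix x
  have "partial i (conv \<eta> v) x = (\<Sum>j\<in>Basis. (i \<bullet> j) * conv (partial j \<eta>) v x)"
    by (rule partial_eq[OF conv_has_derivative[OF assms(1,2)]])
  also have "\<dots> = (\<Sum>j\<in>Basis. if j = i then conv (partial j \<eta>) v x else 0)"
    using assms(3) by (intro sum.cong) (auto simp: inner_Basis)
  also have "\<dots> = conv (partial i \<eta>) v x" using assms(3) by simp
  finally show "partial i (conv \<eta> v) x = conv (partial i \<eta>) v x" .
qed

text \<open>Every derivative falls on the kernel and v is never differentiated; the induction
  therefore ranges over all kernels of the given radius.\<close>

lemma conv_smooth:
  assumes "kernel \<epsilon> \<eta>" "integrable lborel v"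
  shows "smooth (conv \<eta> v)"
proof -
  have "Ck k (conv \<eta> v)" if "kernel \<epsilon> \<eta>" for k \<eta>
    using that
  proof (induction k arbitrary: \<eta>)
    case 0
    have "continuous (at x) (conv \<eta> v)" for x
      using conv_has_derivative[OF 0 assms(2)] has_derivative_continuous by blast
    then show ?case by (simp add: continuous_at_imp_continuous_on)
  next
    case (Suc k)
    show ?case
      unfolding Ck_Suc_iff
      using Suc conv_has_derivative[OF Suc.prems assms(2)] kernel_partial[OF Suc.prems]
      by (auto simp: conv_partial[OF Suc.prems assms(2)] intro: differentiableI)
  qed
  then show ?thesis using assms by (simp add: smooth_def)
qed

lemma conv_eq_0:
  assumes "kernel \<epsilon> \<eta>" "\<And>y. y \<in> cball x \<epsilon> \<Longrightarrow> v y = 0"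
  shows "conv \<eta> v x = 0"
proof -
  have "\<eta> (x - y) * v y = 0" for y
    using assms unfolding kernel_def by (cases "y \<in> cball x \<epsilon>") (auto simp: dist_norm)
  then show ?thesis by (simp only: conv_def Bochner_Integration.integral_zero)
qed

lemma conv_translate:
  assumes "\<eta> \<in> borel_measurable borel" "v \<in> borel_measurable borel"
  shows "conv \<eta> v x = (LINT h|lborel. \<eta> (- h) * v (x + h))"
  unfolding conv_def using assms lborel_integral_translation[of "\<lambda>y. \<eta> (x - y) * v y" x] by simp

lemma mollifier_reflect:
  assumes "mollifier \<epsilon> \<eta>"
  shows "integrable lborel (\<lambda>h. \<eta> (a - h))" "(LINT h|lborel. \<eta> (a - h)) = 1"
  using assms kernel_borel lborel_integrable_reflect[of \<eta> a] lborel_integral_reflect[of \<eta> a]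
  by (auto simp: mollifier_def)

lemma conv_bounds:
  assumes "mollifier \<epsilon> \<eta>" "integrable lborel v"
  shows "(\<And>y. 0 \<le> v y) \<Longrightarrow> 0 \<le> conv \<eta> v x" "(\<And>y. \<bar>v y\<bar> \<le> B) \<Longrightarrow> \<bar>conv \<eta> v x\<bar> \<le> B"
proof -
  have k: "kernel \<epsilon> \<eta>" and nn: "\<And>x. \<eta> x \<ge> 0" using assms by (auto simp: mollifier_def)
  show "0 \<le> conv \<eta> v x" if "\<And>y. 0 \<le> v y"
    unfolding conv_def using that nn by (intro Bochner_Integration.integral_nonneg) auto
  assume B: "\<And>y. \<bar>v y\<bar> \<le> B"
  have "\<bar>conv \<eta> v x\<bar> \<le> (LINT y|lborel. \<bar>\<eta> (x - y) * v y\<bar>)"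
    unfolding conv_def using integral_norm_bound[of lborel "\<lambda>y. \<eta> (x - y) * v y"] by simp
  also have "\<dots> \<le> (LINT y|lborel. \<eta> (x - y) * B)"
  proof (rule integral_mono)
    show "\<bar>\<eta> (x - y) * v y\<bar> \<le> \<eta> (x - y) * B" for y
      using B nn by (auto simp: abs_mult intro: mult_left_mono)
  qed (use conv_integrable[OF k assms(2)] mollifier_reflect(1)[OF assms(1)] in auto)
  also have "\<dots> = B" using mollifier_reflect[OF assms(1)] by simp
  finally show "\<bar>conv \<eta> v x\<bar> \<le> B" .
qed

text \<open>The difference conv \<eta> v - v is an average of the differences v(h + x) - v(x) with
  weights \<eta>(-h). The square of an average is at most the average of the squares, and Fubini
  reduces the rest to single translations with |h| at most \<epsilon>.\<close>

lemma conv_L2_estimate: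
  assumes m: "mollifier \<epsilon> \<eta>" and v: "sq_int v" "integrable lborel v"
    and e: "\<And>h. norm h \<le> \<epsilon> \<Longrightarrow> (LINT x|lborel. (v (h + x) - v x)\<^sup>2) \<le> e" "e \<ge> 0"
  shows "sq_int (conv \<eta> v)" "(LINT x|lborel. (conv \<eta> v x - v x)\<^sup>2) \<le> e"
proof -
  have k: "kernel \<epsilon> \<eta>" and nn: "\<And>x. \<eta> x \<ge> 0" using m by (auto simp: mollifier_def)
  note [measurable] = kernel_borel[OF k] sq_intD(1)[OF v(1)]
  have cm [measurable]: "conv \<eta> v \<in> borel_measurable borel"
    by (intro borel_measurable_continuous_onI smooth_continuous conv_smooth[OF k v(2)])
  have pt: "ennreal ((conv \<eta> v x - v x)\<^sup>2) \<le> (\<integral>\<^sup>+h. ennreal (\<eta> (- h) * (v (h + x) - v x)\<^sup>2) \<partial>lborel)" for x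
  proof -
    have 1: "integrable lborel (\<lambda>h. \<eta> (- h) * v (x + h))"
      using lborel_integrable_translation[of "\<lambda>y. \<eta> (x - y) * v y" x] conv_integrable[OF k v(2), of x] by simp
    have 2: "integrable lborel (\<lambda>h. \<eta> (- h))" "(LINT h|lborel. \<eta> (- h)) = 1"
      using mollifier_reflect[OF m, of 0] by auto
    have 3: "integrable lborel (\<lambda>h. \<eta> (- h) * (v (h + x) - v x))"
      using Bochner_Integration.integrable_diff[OF 1 integrable_mult_left[OF 2(1), of "v x"]] by (simp add: right_diff_distrib add.commute)
    have "conv \<eta> v x - v x = (LINT h|lborel. \<eta> (- h) * (v (h + x) - v x))"
      using Bochner_Integration.integral_diff[OF 1 integrable_mult_left[OF 2(1), of "v x"]] 2
      by (simp add: conv_translate right_diff_distrib add.commute)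
    then have "ennreal \<bar>conv \<eta> v x - v x\<bar> \<le> (\<integral>\<^sup>+h. norm (\<eta> (- h) * (v (h + x) - v x)) \<partial>lborel)"
      using integral_norm_bound_ennreal[OF 3] by simp
    \<comment> \<open>Splitting the weight into two square roots lets the Cauchy-Schwarz inequality
      act as Jensen's: the first factor integrates to the total mass 1.\<close>
    also have "\<dots> = (\<integral>\<^sup>+h. ennreal (sqrt (\<eta> (- h))) * ennreal (sqrt (\<eta> (- h)) * \<bar>v (h + x) - v x\<bar>) \<partial>lborel)"
      using nn by (intro nn_integral_cong) (simp add: ennreal_mult[symmetric] abs_mult mult.assoc[symmetric])
    finally have "ennreal \<bar>conv \<eta> v x - v x\<bar> ^ 2 \<le>
       (\<integral>\<^sup>+h. ennreal (sqrt (\<eta> (- h))) * ennreal (sqrt (\<eta> (- h)) * \<bar>v (h + x) - v x\<bar>) \<partial>lborel)\<^sup>2"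
      by (rule power_mono) simp
    also have "\<dots> \<le> (\<integral>\<^sup>+h. ennreal (sqrt (\<eta> (- h))) ^ 2 \<partial>lborel) * (\<integral>\<^sup>+h. ennreal (sqrt (\<eta> (- h)) * \<bar>v (h + x) - v x\<bar>) ^ 2 \<partial>lborel)"
      by (rule Cauchy_Schwarz_nn_integral) measurable
    also have "(\<integral>\<^sup>+h. ennreal (sqrt (\<eta> (- h))) ^ 2 \<partial>lborel) = 1"
      using nn_integral_eq_integral[OF 2(1)] nn 2(2) by (simp add: ennreal_power)
    also have "(\<integral>\<^sup>+h. ennreal (sqrt (\<eta> (- h)) * \<bar>v (h + x) - v x\<bar>) ^ 2 \<partial>lborel) = (\<integral>\<^sup>+h. ennreal (\<eta> (- h) * (v (h + x) - v x)\<^sup>2) \<partial>lborel)"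
      using nn by (intro nn_integral_cong) (simp add: ennreal_power power_mult_distrib)
    finally show ?thesis by (simp add: ennreal_power)
  qed
  have "(\<integral>\<^sup>+x. ennreal ((conv \<eta> v x - v x)\<^sup>2) \<partial>lborel)
     \<le> (\<integral>\<^sup>+x. (\<integral>\<^sup>+h. ennreal (\<eta> (- h) * (v (h + x) - v x)\<^sup>2) \<partial>lborel) \<partial>lborel)"
    by (intro nn_integral_mono pt)
  also have "\<dots> = (\<integral>\<^sup>+h. (\<integral>\<^sup>+x. ennreal (\<eta> (- h) * (v (h + x) - v x)\<^sup>2) \<partial>lborel) \<partial>lborel)"
    by (rule lborel_pair.Fubini') measurable
  also have "\<dots> \<le> (\<integral>\<^sup>+h. ennreal (\<eta> (- h)) * ennreal e \<partial>lborel)"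
  proof (rule nn_integral_mono)
    fix h
    have "(\<integral>\<^sup>+x. ennreal (\<eta> (- h) * (v (h + x) - v x)\<^sup>2) \<partial>lborel) = ennreal (\<eta> (- h)) * (\<integral>\<^sup>+x. ennreal ((v (h + x) - v x)\<^sup>2) \<partial>lborel)"
      using nn by (simp add: ennreal_mult nn_integral_cmult)
    also have "(\<integral>\<^sup>+x. ennreal ((v (h + x) - v x)\<^sup>2) \<partial>lborel) = ennreal (LINT x|lborel. (v (h + x) - v x)\<^sup>2)"
      using sq_intD(2)[OF sq_int_diff[OF sq_int_translation[OF v(1)] v(1)]] by (intro nn_integral_eq_integral) auto
    also have "ennreal (\<eta> (- h)) * \<dots> \<le> ennreal (\<eta> (- h)) * ennreal e"
    proof (cases "norm h \<le> \<epsilon>")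
      case True
      then show ?thesis using e by (intro mult_left_mono ennreal_leI) auto
    next
      case False
      then have "\<eta> (- h) = 0" using k by (auto simp: kernel_def)
      then show ?thesis by simp
    qed
    finally show "(\<integral>\<^sup>+x. ennreal (\<eta> (- h) * (v (h + x) - v x)\<^sup>2) \<partial>lborel) \<le> ennreal (\<eta> (- h)) * ennreal e" .
  qed
  also have "\<dots> = ennreal e"
    using nn_integral_eq_integral[OF mollifier_reflect(1)[OF m, of 0]] nn mollifier_reflect(2)[OF m, of 0]
    by (simp add: nn_integral_multc)
  finally have le: "(\<integral>\<^sup>+x. ennreal ((conv \<eta> v x - v x)\<^sup>2) \<partial>lborel) \<le> ennreal e" .
  have int: "integrable lborel (\<lambda>x. (conv \<eta> v x - v x)\<^sup>2)"
  proof (rule integrableI_bounded)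
    show "(\<integral>\<^sup>+ x. ennreal (norm ((conv \<eta> v x - v x)\<^sup>2)) \<partial>lborel) < \<infinity>"
      using le by (simp add: order_le_less_trans)
  qed measurable
  then have "sq_int (\<lambda>x. conv \<eta> v x - v x)" by (simp add: sq_int_def)
  from sq_int_add[OF this v(1)] show "sq_int (conv \<eta> v)" by simp
  show "(LINT x|lborel. (conv \<eta> v x - v x)\<^sup>2) \<le> e"
    using le nn_integral_eq_integral[OF int] e(2) by simp
qed

text \<open>The threshold \<delta> comes from the translations of v alone, so it serves all
  mollifiers of smaller radius.\<close>

lemma mollification:
  assumes "sq_int v" "integrable lborel v" "e > 0"
  obtains \<delta> where "\<delta> > 0" "\<And>\<epsilon> \<eta>. mollifier \<epsilon> \<eta> \<Longrightarrow> \<epsilon> < \<delta> \<Longrightarrow> sq_int (conv \<eta> v) \<and> (LINT x|lborel. (conv \<eta> v x - v x)\<^sup>2) \<le> e"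
proof -
  have "\<forall>\<^sub>F h in at 0. dist (LINT x|lborel. (v (h + x) - v x)\<^sup>2) 0 < e"
    using trans_cont_sq_int[OF assms(1)] assms(3) unfolding trans_cont_def by (intro tendstoD) auto
  then obtain \<delta> where \<delta>: "\<delta> > 0" "\<And>h. h \<noteq> 0 \<Longrightarrow> norm h < \<delta> \<Longrightarrow> (LINT x|lborel. (v (h + x) - v x)\<^sup>2) < e"
    unfolding eventually_at by (auto simp: dist_real_def)
  have "(LINT x|lborel. (v (h + x) - v x)\<^sup>2) \<le> e" if "norm h < \<delta>" for h
    using \<delta>(2)[of h] that assms(3) by (cases "h = 0") auto
  then show thesis
    using that[OF \<delta>(1)] conv_L2_estimate[OF _ assms(1,2), of _ _ e] assms(3)
    by (meson less_imp_le order_le_less_trans)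
qed

section \<open>Lebesgue measure on an open set\<close>

lemma borel_restrict_lebesgue: "h \<in> borel_measurable borel \<Longrightarrow> h \<in> borel_measurable (lebesgue_on D)"
  by (simp add: measurable_completion measurable_restrict_space1)

lemma lborel_lebesgue_on:
  fixes h :: "'a::euclidean_space \<Rightarrow> 'b::euclidean_space"
  assumes "h \<in> borel_measurable borel" "D \<in> sets lebesgue" "\<And>x. x \<notin> D \<Longrightarrow> h x = 0"
  shows "integrable (lebesgue_on D) h \<longleftrightarrow> integrable lborel h"
    and "(LINT x|lebesgue_on D. h x) = (LINT x|lborel. h x)"
proof -
  have h: "(\<lambda>x. if x \<in> D then h x else 0) = h" using assms(3) by auto
  show "integrable (lebesgue_on D) h \<longleftrightarrow> integrable lborel h"
    using Lebesgue_Measure.integrable_restrict_UNIV[OF assms(2), of h] integrable_completion[of h lborel] assms(1) unfolding h by simp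
  show "(LINT x|lebesgue_on D. h x) = (LINT x|lborel. h x)"
    using Lebesgue_Measure.integral_restrict_UNIV[OF assms(2), of h] integral_completion[of h lborel] assms(1) unfolding h by simp
qed

lemma AE_lebesgue_on:
  assumes "D \<in> sets lebesgue"
  shows "(AE x in lebesgue_on D. P x) \<longleftrightarrow> (AE x in lebesgue. x \<in> D \<longrightarrow> P x)"
  using assms by (subst AE_restrict_space_iff) auto

lemma AE_lebesgue_on_D: "AE x in lebesgue_on D. x \<in> D"
  by (intro AE_I2) (simp add: space_restrict_space)

lemma integrable_lebesgue_on_subset:
  fixes f :: "'a::euclidean_space \<Rightarrow> 'b::euclidean_space"
  assumes "integrable (lebesgue_on D) f" "K \<subseteq> D" "D \<in> sets lebesgue" "K \<in> sets lebesgue"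
  shows "integrable (lebesgue_on K) f"
proof -
  have "set_integrable lebesgue D f"
    unfolding set_integrable_def using integrable_restrict_space[of D lebesgue f] assms(1,3) by simp
  then have "set_integrable lebesgue K f" by (rule set_integrable_subset[OF _ assms(4,2)])
  then show ?thesis
    unfolding set_integrable_def using integrable_restrict_space[of K lebesgue f] assms(4) by simp
qed

text \<open>Passes from functions that matter only on D up to null sets to Borel functions on the
  whole space, where translations and convolutions are defined.\<close>

lemma borel_representative:
  fixes f :: "'a::euclidean_space \<Rightarrow> real"
  assumes "D \<in> sets borel" "f \<in> borel_measurable (lebesgue_on D)"
  obtains v where "v \<in> borel_measurable borel" "\<And>x. x \<notin> D \<Longrightarrow> v x = 0" "AE x in lebesgue_on D. v x = f x"
proof -
  have D: "D \<in> sets lebesgue" using assms(1) by simp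
  have "(\<lambda>x. if x \<in> D then f x else 0) \<in> borel_measurable lebesgue"
    using assms(2) by (intro borel_measurable_if_I D)
  then obtain v where v: "v \<in> borel_measurable borel" "AE x in lborel. (if x \<in> D then f x else 0) = v x"
    using completion_ex_borel_measurable_real[of "\<lambda>x. if x \<in> D then f x else 0" lborel] by auto
  show thesis
  proof (rule that[of "\<lambda>x. indicator D x * v x"])
    show "(\<lambda>x. indicator D x * v x) \<in> borel_measurable borel" using v(1) assms(1) by measurable
    have "AE x in lebesgue. (if x \<in> D then f x else 0) = v x" using v(2) by (rule AE_completion)
    then show "AE x in lebesgue_on D. indicator D x * v x = f x"
      unfolding AE_lebesgue_on[OF D] by eventually_elim (auto split: if_splits)
  qed auto
qed

lemma sq_int_L2:
  assumes "sq_int w" "D \<in> sets borel"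
  shows "w \<in> L2 D" "L2_norm D w \<le> sqrt (LINT x|lborel. (w x)\<^sup>2)"
proof -
  let ?h = "\<lambda>x. indicator D x * (w x)\<^sup>2"
  have D: "D \<in> sets lebesgue" using assms(2) by simp
  note [measurable] = sq_intD(1)[OF assms(1)] assms(2)
  have m: "?h \<in> borel_measurable borel" by measurable
  have ih: "integrable lborel ?h"
    using integrable_mult_indicator[of D lborel "\<lambda>x. (w x)\<^sup>2"] assms by (simp add: sq_int_def)
  have "integrable (lebesgue_on D) ?h"
    using ih by (subst lborel_lebesgue_on(1)[OF m D]) auto
  then have i: "integrable (lebesgue_on D) (\<lambda>x. (w x)\<^sup>2)"
    by (rule Bochner_Integration.integrable_cong[THEN iffD1, rotated -1]) auto
  then show "w \<in> L2 D" using borel_restrict_lebesgue[OF sq_intD(1)[OF assms(1)]] by (simp add: L2_def)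
  have "(LINT x|lebesgue_on D. (w x)\<^sup>2) = (LINT x|lebesgue_on D. ?h x)"
    by (rule Bochner_Integration.integral_cong) auto
  also have "\<dots> = (LINT x|lborel. ?h x)" by (rule lborel_lebesgue_on(2)[OF m D]) auto
  also have "\<dots> \<le> (LINT x|lborel. (w x)\<^sup>2)"
    using ih sq_intD(2)[OF assms(1)] by (intro integral_mono) (auto split: split_indicator)
  finally show "L2_norm D w \<le> sqrt (LINT x|lborel. (w x)\<^sup>2)" by (simp add: L2_norm_def)
qed

lemma L2_representative:
  fixes f :: "'a::euclidean_space \<Rightarrow> real"
  assumes "D \<in> sets borel" "f \<in> L2 D"
  obtains v where "sq_int v" "\<And>x. x \<notin> D \<Longrightarrow> v x = 0" "AE x in lebesgue_on D. v x = f x"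
proof -
  obtain v where v: "v \<in> borel_measurable borel" "\<And>x. x \<notin> D \<Longrightarrow> v x = 0" "AE x in lebesgue_on D. v x = f x"
    using borel_representative[OF assms(1) L2_measurable[OF assms(2)]] by metis
  have "integrable (lebesgue_on D) (\<lambda>x. (f x)\<^sup>2)" using L2_integrable[OF assms(2)] by simp
  then have "integrable (lebesgue_on D) (\<lambda>x. (v x)\<^sup>2)"
    using v(3) L2_measurable[OF assms(2)] borel_restrict_lebesgue[OF v(1)]
    by (subst integrable_cong_AE[of _ _ "\<lambda>x. (f x)\<^sup>2"]) auto
  then have "integrable lborel (\<lambda>x. (v x)\<^sup>2)"
    using v assms(1) by (subst (asm) lborel_lebesgue_on(1)) auto
  then show thesis using that[of v] v by (simp add: sq_int_def)
qed

lemma sq_int_integrable: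
  assumes "sq_int v" "\<And>x. x \<notin> D \<Longrightarrow> v x = 0" "D \<in> sets borel" "bounded D"
  shows "integrable lborel v"
proof -
  have "emeasure lborel D < \<infinity>" using assms(4) by (rule emeasure_bounded_finite)
  then have "integrable lborel (\<lambda>x. v x * indicator D x)"
    using assms by (intro sq_int_mult_integrable sq_int_indicator) auto
  moreover have "(\<lambda>x. v x * indicator D x) = v" using assms(2) by (auto split: split_indicator)
  ultimately show ?thesis by (simp only:)
qed

text \<open>A single sequence of kernels is fixed because a function and the components of its
  gradient have to be smoothed by the same kernel.\<close>

definition mol :: "nat \<Rightarrow> 'a::euclidean_space \<Rightarrow> real" where
  "mol n = (SOME \<eta>. mollifier (inverse (real (Suc n))) \<eta>)"

lemma mol: "mollifier (inverse (real (Suc n))) (mol n :: 'a::euclidean_space \<Rightarrow> real)"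
proof -
  have "\<exists>\<eta> :: 'a \<Rightarrow> real. mollifier (inverse (real (Suc n))) \<eta>" by (rule mollifier_ex) simp
  then show ?thesis unfolding mol_def by (rule someI_ex)
qed

lemma mol_kernel: "kernel (inverse (real (Suc n))) (mol n)"
  using mol by (auto simp: mollifier_def)

lemma conv_mol_sq_int:
  assumes "sq_int v" "integrable lborel v"
  shows "sq_int (conv (mol n) v)"
proof (rule conv_L2_estimate[OF mol assms])
  fix h :: 'a
  \<comment> \<open>Only finiteness is wanted here, so a crude bound uniform in h is enough: 3 + 3
    with a zero third summand.\<close>
  show "(LINT x|lborel. (v (h + x) - v x)\<^sup>2) \<le> 6 * (LINT x|lborel. (v x)\<^sup>2)"
    using integral_sq_triangle[OF sq_int_translation[OF assms(1), of h] sq_int_cmult[OF assms(1), of "-1"] sq_int_cmult[OF assms(1), of 0]]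
      lborel_integral_translation[of "\<lambda>x. (v x)\<^sup>2" h] sq_intD[OF assms(1)] by simp
qed simp

lemma real_null_comparison:
  fixes f g :: "nat \<Rightarrow> real"
  assumes "g \<longlonglongrightarrow> 0" "\<And>n. \<bar>f n\<bar> \<le> g n"
  shows "f \<longlonglongrightarrow> 0"
  by (rule Lim_null_comparison[OF _ assms(1)]) (simp add: assms(2))

lemma conv_mol_tendsto:
  assumes "sq_int v" "integrable lborel v" "D \<in> sets borel"
  shows "(\<lambda>n. L2_norm D (\<lambda>x. conv (mol n) v x - v x)) \<longlonglongrightarrow> 0"
proof -
  have l: "(\<lambda>n. LINT x|lborel. (conv (mol n) v x - v x)\<^sup>2) \<longlonglongrightarrow> 0"
  proof (rule LIMSEQ_I)
    fix e :: real assume "e > 0"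
    then obtain \<delta> where \<delta>: "\<delta> > 0" "\<And>\<epsilon> \<eta>. mollifier \<epsilon> \<eta> \<Longrightarrow> \<epsilon> < \<delta> \<Longrightarrow> (LINT x|lborel. (conv \<eta> v x - v x)\<^sup>2) \<le> e / 2"
      using mollification[OF assms(1,2), of "e/2"] by (metis half_gt_zero)
    obtain N where N: "inverse (real (Suc N)) < \<delta>" using reals_Archimedean[OF \<delta>(1)] by auto
    have "(LINT x|lborel. (conv (mol n) v x - v x)\<^sup>2) \<le> e / 2" if "n \<ge> N" for n
    proof (rule \<delta>(2)[OF mol])
      have "inverse (real (Suc n)) \<le> inverse (real (Suc N))" using that by (intro le_imp_inverse_le) auto
      then show "inverse (real (Suc n)) < \<delta>" using N by linarith
    qed
    then have "\<forall>n\<ge>N. norm ((LINT x|lborel. (conv (mol n) v x - v x)\<^sup>2) - 0) < e"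
      using \<open>e > 0\<close> by fastforce
    then show "\<exists>N. \<forall>n\<ge>N. norm ((LINT x|lborel. (conv (mol n) v x - v x)\<^sup>2) - 0) < e" by blast
  qed
  have "(\<lambda>n. sqrt (LINT x|lborel. (conv (mol n) v x - v x)\<^sup>2)) \<longlonglongrightarrow> 0"
    using tendsto_real_sqrt[OF l] by simp
  moreover have "\<bar>L2_norm D (\<lambda>x. conv (mol n) v x - v x)\<bar> \<le> sqrt (LINT x|lborel. (conv (mol n) v x - v x)\<^sup>2)" for n
    using sq_int_L2(2)[OF sq_int_diff[OF conv_mol_sq_int[OF assms(1,2)] assms(1)] assms(3)] by simp
  ultimately show ?thesis by (rule real_null_comparison)
qed

section \<open>Weak gradients\<close>

definition grad :: "('a::euclidean_space \<Rightarrow> real) \<Rightarrow> 'a \<Rightarrow> 'a" where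
  "grad f x = (\<Sum>i\<in>Basis. partial i f x *\<^sub>R i)"

lemma grad_inner [simp]: "i \<in> Basis \<Longrightarrow> grad f x \<bullet> i = partial i f x"
  by (simp add: grad_def inner_sum_left inner_Basis if_distrib cong: if_cong)

lemma has_weak_gradient_iff:
  "has_weak_gradient D u g \<longleftrightarrow> locally_integrable D u \<and> locally_integrable D g \<and>
     (\<forall>\<phi>\<in>test_functions D. \<forall>i\<in>Basis.
        (LINT x|lebesgue_on D. u x * partial i \<phi> x) = - (LINT x|lebesgue_on D. (g x \<bullet> i) * \<phi> x))"
  by (simp add: has_weak_gradient_def partial_def)

section \<open>Convolution of compactly supported functions inside an open set\<close>

lemma compact_neighbourhood:
  fixes K :: "'a::euclidean_space set"
  assumes "compact K" "open D" "K \<subseteq> D"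
  obtains e K' where "e > 0" "compact K'" "K' \<subseteq> D" "K \<subseteq> K'" "\<And>x. x \<notin> K' \<Longrightarrow> cball x e \<inter> K = {}" "\<And>x. cball x e \<inter> K \<noteq> {} \<Longrightarrow> cball x e \<subseteq> D"
proof (cases "K = {}")
  case True
  then show ?thesis using that[of 1 "{}"] by auto
next
  case False
  obtain e where e: "e > 0" "{x. infdist x K \<le> e} \<subseteq> D"
    using compact_in_open_separated[OF False assms(1,2,3)] by metis
  \<comment> \<open>Half the separation distance: if a ball of radius e/2 meets K, each of its
    points is within e of K and hence in D.\<close>
  show ?thesis
  proof (rule that[of "e/2" "{x. infdist x K \<le> e}"])
    show "compact {x. infdist x K \<le> e}" using False assms(1) e(1) by (rule compact_infdist_le)
    show "K \<subseteq> {x. infdist x K \<le> e}" using e(1) by auto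
    show "cball x (e/2) \<inter> K = {}" if "x \<notin> {x. infdist x K \<le> e}" for x
    proof -
      have "infdist x K \<le> dist x y" if "y \<in> K" for y using that by (rule infdist_le)
      then show ?thesis using that e(1) by fastforce
    qed
    show "cball x (e/2) \<subseteq> D" if "cball x (e/2) \<inter> K \<noteq> {}" for x
    proof
      fix z assume z: "z \<in> cball x (e/2)"
      obtain y where y: "y \<in> K" "dist x y \<le> e/2" using \<open>cball x (e/2) \<inter> K \<noteq> {}\<close> by auto
      have "infdist z K \<le> dist z y" using y(1) by (rule infdist_le)
      also have "\<dots> \<le> dist x z + dist x y" by (metis dist_commute dist_triangle)
      also have "\<dots> \<le> e" using z y(2) by simp
      finally show "z \<in> D" using e(2) by auto
    qed
  qed (use e in auto)
qed

lemma conv_test_function: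
  assumes "compact K" "open D" "K \<subseteq> D" "\<And>x. x \<notin> K \<Longrightarrow> v x = 0" "integrable lborel v"
  obtains N K' where "compact K'" "K' \<subseteq> D" "\<And>n. n \<ge> N \<Longrightarrow> conv (mol n) v \<in> test_functions D"
    "\<And>n x. n \<ge> N \<Longrightarrow> x \<notin> K' \<Longrightarrow> conv (mol n) v x = 0"
proof -
  obtain e K' where K': "e > 0" "compact K'" "K' \<subseteq> D" "\<And>x. x \<notin> K' \<Longrightarrow> cball x e \<inter> K = {}"
    using compact_neighbourhood[OF assms(1-3)] by metis
  obtain N where N: "inverse (real (Suc N)) < e" using reals_Archimedean[OF K'(1)] by auto
  have z: "conv (mol n) v x = 0" if "n \<ge> N" "x \<notin> K'" for n x
  proof (rule conv_eq_0[OF mol_kernel])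
    fix y assume y: "y \<in> cball x (inverse (real (Suc n)))"
    have "inverse (real (Suc n)) \<le> inverse (real (Suc N))" using that by (intro le_imp_inverse_le) auto
    then have "y \<in> cball x e" using y N unfolding mem_cball by linarith
    then show "v y = 0" using K'(4)[OF that(2)] assms(4) by blast
  qed
  show thesis
  proof (rule that[OF K'(2,3) _ z])
    show "conv (mol n) v \<in> test_functions D" if "n \<ge> N" for n
      using K'(2,3) z[OF that] by (intro test_functionsI[of _ K'] conv_smooth[OF mol_kernel assms(5)])
  qed auto
qed

section \<open>The fundamental lemma and uniqueness of weak gradients\<close>

lemma compact_exhaustion:
  fixes D :: "'a::euclidean_space set"
  assumes "open D"
  obtains C :: "nat \<Rightarrow> 'a set" where "\<And>n. compact (C n)" "\<And>n. C n \<subseteq> D" "mono C" "\<Union>(range C) = D"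
proof (rule open_Union_compact_subsets[OF assms])
  fix C :: "nat \<Rightarrow> 'a set"
  assume C: "\<And>n. compact (C n)" "\<And>n. C n \<subseteq> D" "\<And>n. C n \<subseteq> interior (C (Suc n))" "\<Union>(range C) = D"
  have "C n \<subseteq> C (Suc n)" for n using C(3)[of n] interior_subset by (rule order_trans)
  then have "C m \<subseteq> C n" if "m \<le> n" for m n using that by (rule lift_Suc_mono_le)
  then have "mono C" by (rule monoI)
  then show thesis by (rule that[OF C(1,2) _ C(4)])
qed

text \<open>On a compact K the ideal test function is the sign of g cut off to K. Its mollifications
  are test functions bounded by 1, so dominated convergence along an almost everywhere convergent
  subsequence gives the integral of |g| over K as a limit of zeros. Exhausting D by countably many
  compact sets finishes the proof.\<close>

lemma fundamental_lemma:
  fixes g :: "'a::euclidean_space \<Rightarrow> real"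
  assumes "open D" "locally_integrable D g"
    and z: "\<And>\<phi>. \<phi> \<in> test_functions D \<Longrightarrow> (LINT x|lebesgue_on D. g x * \<phi> x) = 0"
  shows "AE x in lebesgue_on D. g x = 0"
proof -
  have D: "D \<in> sets lebesgue" using assms(1) by simp
  have main: "AE x in lebesgue. x \<in> K \<longrightarrow> g x = 0" if K: "compact K" "K \<subseteq> D" for K
  proof -
    have Kb: "K \<in> sets borel" "K \<in> sets lebesgue" using K(1) by (auto simp: borel_compact)
    have gK: "integrable (lebesgue_on K) g" using assms(2) K by (simp add: locally_integrable_def)
    obtain g0 where g0: "g0 \<in> borel_measurable borel" "\<And>x. x \<notin> K \<Longrightarrow> g0 x = 0" "AE x in lebesgue_on K. g0 x = g x"
      using borel_representative[OF Kb(1) borel_measurable_integrable[OF gK]] by metis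
    \<comment> \<open>The sign is taken of the Borel representative, which makes h Borel and zero
      outside K at every point.\<close>
    define h where "h x = sgn (g0 x)" for x
    have hm: "h \<in> borel_measurable borel" unfolding h_def using g0(1) by measurable
    have hK: "h x = 0" if "x \<notin> K" for x using g0(2)[OF that] by (simp add: h_def)
    have h1: "\<bar>h x\<bar> \<le> 1" for x by (simp add: h_def sgn_real_def)
    have sh: "sq_int h"
      using emeasure_compact_finite[OF K(1)] Kb hK h1
      by (intro sq_int_bound[OF sq_int_indicator[OF Kb(1)] hm]) (auto split: split_indicator)
    have ih: "integrable lborel h" by (rule sq_int_integrable[OF sh hK Kb(1) compact_imp_bounded[OF K(1)]])
    obtain N K' where N: "compact K'" "K' \<subseteq> D" "\<And>n. n \<ge> N \<Longrightarrow> conv (mol n) h \<in> test_functions D"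
      "\<And>n x. n \<ge> N \<Longrightarrow> x \<notin> K' \<Longrightarrow> conv (mol n) h x = 0"
      using conv_test_function[OF K(1) assms(1) K(2) hK ih] by metis
    have bD: "D \<in> sets borel" using assms(1) by simp
    define f where "f n = conv (mol (n + N)) h" for n
    have fL: "f n \<in> L2 D" for n unfolding f_def by (intro sq_int_L2 conv_mol_sq_int sh ih bD)
    have fh: "(\<lambda>n. L2_norm D (\<lambda>x. f n x - h x)) \<longlonglongrightarrow> 0"
      unfolding f_def using LIMSEQ_ignore_initial_segment[OF conv_mol_tendsto[OF sh ih bD]] .
    obtain r where r: "strict_mono r" "AE x in lebesgue_on D. (\<lambda>n. f (r n) x) \<longlonglongrightarrow> h x"
      by (rule L2_AE_subseq[OF fL sq_int_L2(1)[OF sh bD] fh])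
    have K'l: "K' \<in> sets lebesgue" using N(1) by (simp add: borel_compact)
    have gK': "integrable (lebesgue_on K') g" using assms(2) N by (simp add: locally_integrable_def)
    have K'gm: "(\<lambda>x. if x \<in> K' then g x else 0) \<in> borel_measurable lebesgue"
      using gK' by (intro borel_measurable_if_I K'l) auto
    then have K'gD: "(\<lambda>x. if x \<in> K' then g x else 0) \<in> borel_measurable (lebesgue_on D)"
      by (rule measurable_restrict_space1)
    have w: "integrable (lebesgue_on D) (\<lambda>x. if x \<in> K' then g x else 0)"
    proof -
      have "integrable lebesgue (\<lambda>x. if x \<in> K' then g x else 0)" using gK' Lebesgue_Measure.integrable_restrict_UNIV[OF K'l, of g] by simp
      then have "integrable (lebesgue_on UNIV) (\<lambda>x. if x \<in> K' then g x else 0)" by (simp add: lebesgue_on_UNIV_eq)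
      then show ?thesis by (rule integrable_lebesgue_on_subset) (auto simp: D)
    qed
    have lim: "(\<lambda>n. LINT x|lebesgue_on D. (if x \<in> K' then g x else 0) * f (r n) x) \<longlonglongrightarrow>
        (LINT x|lebesgue_on D. (if x \<in> K' then g x else 0) * h x)"
    proof (rule integral_dominated_convergence[OF _ _ integrable_norm[OF w]])
      show "AE x in lebesgue_on D. (\<lambda>n. (if x \<in> K' then g x else 0) * f (r n) x) \<longlonglongrightarrow> (if x \<in> K' then g x else 0) * h x"
        using r(2) by eventually_elim (intro tendsto_intros)
      have "\<bar>f n x\<bar> \<le> 1" for n x unfolding f_def by (rule conv_bounds(2)[OF mol ih h1])
      then show "AE x in lebesgue_on D. norm ((if x \<in> K' then g x else 0) * f (r n) x) \<le> norm (if x \<in> K' then g x else 0)" for n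
        by (intro AE_I2) (simp add: abs_mult mult_left_le)
    qed (intro borel_measurable_times K'gD borel_restrict_lebesgue hm L2_measurable[OF fL])+
    have z0: "(LINT x|lebesgue_on D. (if x \<in> K' then g x else 0) * f n x) = 0" for n
    proof -
      have "(LINT x|lebesgue_on D. (if x \<in> K' then g x else 0) * f n x) = (LINT x|lebesgue_on D. g x * f n x)"
        unfolding f_def using N(4) by (intro Bochner_Integration.integral_cong) auto
      then show ?thesis using z N(3) by (simp add: f_def)
    qed
    have int0: "(LINT x|lebesgue_on D. (if x \<in> K' then g x else 0) * h x) = 0"
      by (rule LIMSEQ_unique[OF lim]) (simp only: z0 tendsto_const)
    \<comment> \<open>The set K' only contains the supports of the smoothed functions. That it
      contains almost every point with g0 nonzero follows from convergence: outside K' the limit h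
      would be 0.\<close>
    have KK': "x \<in> K'" if "g0 x \<noteq> 0" "(\<lambda>n. f (r n) x) \<longlonglongrightarrow> h x" for x
    proof (rule ccontr)
      assume "x \<notin> K'"
      then have "f (r n) x = 0" for n unfolding f_def by (intro N) auto
      then have "h x = 0" using that(2) by (simp add: LIMSEQ_const_iff)
      then show False using that(1) by (simp add: h_def sgn_real_def split: if_splits)
    qed
    have ae0: "AE x in lebesgue_on D. x \<in> K \<longrightarrow> g0 x = g x"
      using g0(3) unfolding AE_lebesgue_on[OF D] AE_lebesgue_on[OF Kb(2)] by eventually_elim auto
    have ae1: "AE x in lebesgue_on D. (if x \<in> K' then g x else 0) * h x = \<bar>g0 x\<bar>"
      using ae0 r(2)
    proof eventually_elim
      case (elim x)
      show ?case
      proof (cases "g0 x = 0")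
        case False
        then have "x \<in> K" "x \<in> K'" using g0(2) KK' elim by auto
        then show ?thesis using elim by (simp add: h_def mult_sgn_abs sgn_mult_abs abs_sgn)
      qed (simp add: h_def)
    qed
    have g0D: "g0 \<in> borel_measurable (lebesgue_on D)" by (rule borel_restrict_lebesgue[OF g0(1)])
    have "integrable (lebesgue_on K) g0"
      using gK g0 by (subst integrable_cong_AE[of _ _ g]) (auto intro: borel_restrict_lebesgue)
    then have "integrable lborel g0" using g0 Kb by (subst (asm) lborel_lebesgue_on(1)) auto
    then have "integrable (lebesgue_on D) g0" using g0 K(2) D by (subst lborel_lebesgue_on(1)) auto
    moreover have "(LINT x|lebesgue_on D. \<bar>g0 x\<bar>) = 0"
    proof -
      have "(LINT x|lebesgue_on D. (if x \<in> K' then g x else 0) * h x) = (LINT x|lebesgue_on D. \<bar>g0 x\<bar>)"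
        by (intro integral_cong_AE[OF _ _ ae1] borel_measurable_times borel_measurable_abs K'gD g0D borel_restrict_lebesgue[OF hm])
      then show ?thesis using int0 by (simp only:)
    qed
    ultimately have "AE x in lebesgue_on D. \<bar>g0 x\<bar> = 0"
      by (subst integral_nonneg_eq_0_iff_AE[symmetric]) auto
    then show ?thesis using ae0 unfolding AE_lebesgue_on[OF D]
      by eventually_elim (use K(2) in auto)
  qed
  obtain C :: "nat \<Rightarrow> 'a set" where C: "\<And>n. compact (C n)" "\<And>n. C n \<subseteq> D" "mono C" "\<Union>(range C) = D"
    using compact_exhaustion[OF assms(1)] by blast
  have "AE x in lebesgue. \<forall>n. x \<in> C n \<longrightarrow> g x = 0"
    unfolding AE_all_countable using main C by blast
  then show ?thesis unfolding AE_lebesgue_on[OF D] by eventually_elim (use C(4) in auto)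
qed

lemma locally_integrable_mult:
  assumes "locally_integrable D g" "compact K" "K \<subseteq> D" "D \<in> sets lebesgue" "continuous_on UNIV \<phi>" "\<And>x. x \<notin> K \<Longrightarrow> \<phi> x = 0"
  shows "integrable (lebesgue_on D) (\<lambda>x. g x * (\<phi> x :: real))"
proof -
  have Kl: "K \<in> sets lebesgue" using assms(2) by (simp add: borel_compact)
  have gK: "integrable (lebesgue_on K) g" using assms by (simp add: locally_integrable_def)
  have "compact (\<phi> ` K)" using assms(2,5) by (intro compact_continuous_image) (auto intro: continuous_on_subset)
  then have "bounded (\<phi> ` K)" by (rule compact_imp_bounded)
  then obtain B where B: "\<And>x. x \<in> K \<Longrightarrow> \<bar>\<phi> x\<bar> \<le> B"
    by (auto simp: bounded_iff)
  have \<phi>m: "\<phi> \<in> borel_measurable (lebesgue_on K)"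
    using assms(5) by (intro borel_restrict_lebesgue borel_measurable_continuous_onI)
  have "integrable (lebesgue_on K) (\<lambda>x. g x * \<phi> x)"
  proof (rule Bochner_Integration.integrable_bound[where f="\<lambda>x. B * g x"])
    show "AE x in lebesgue_on K. norm (g x * \<phi> x) \<le> norm (B * g x)"
      using AE_lebesgue_on_D[of K]
    proof eventually_elim
      case (elim x)
      have "\<bar>g x\<bar> * \<bar>\<phi> x\<bar> \<le> \<bar>g x\<bar> * \<bar>B\<bar>" using B[OF elim] by (intro mult_left_mono) auto
      then show ?case by (simp add: abs_mult mult.commute)
    qed
    show "(\<lambda>x. g x * \<phi> x) \<in> borel_measurable (lebesgue_on K)"
      using borel_measurable_integrable[OF gK] \<phi>m by measurable
  qed (use gK in auto)
  then have "integrable lebesgue (\<lambda>x. if x \<in> K then g x * \<phi> x else 0)"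
    using Lebesgue_Measure.integrable_restrict_UNIV[OF Kl, of "\<lambda>x. g x * \<phi> x"] by simp
  also have "(\<lambda>x. if x \<in> K then g x * \<phi> x else 0) = (\<lambda>x. if x \<in> D then g x * \<phi> x else 0)"
    using assms(3,6) by (intro ext) auto
  finally show ?thesis
    using Lebesgue_Measure.integrable_restrict_UNIV[OF assms(4), of "\<lambda>x. g x * \<phi> x"] by simp
qed

lemma locally_integrable_component:
  "locally_integrable D g \<Longrightarrow> locally_integrable D (\<lambda>x. g x \<bullet> i)"
  by (simp add: locally_integrable_def)

lemma locally_integrable_diff:
  "locally_integrable D f \<Longrightarrow> locally_integrable D g \<Longrightarrow> locally_integrable D (\<lambda>x. f x - g x)"
  by (simp add: locally_integrable_def)

lemma test_function_integrable:
  assumes "locally_integrable D g" "open D" "\<phi> \<in> test_functions D"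
  shows "integrable (lebesgue_on D) (\<lambda>x. g x * (\<phi> x :: real))"
proof -
  obtain K where K: "compact K" "K \<subseteq> D" "\<And>x. x \<notin> K \<Longrightarrow> \<phi> x = 0" using assms(3) by (auto simp: test_functions_iff)
  have "D \<in> sets lebesgue" using assms(2) by simp
  then show ?thesis
    by (intro locally_integrable_mult[OF assms(1) K(1,2) _ smooth_continuous[OF test_functions_smooth[OF assms(3)]] K(3)])
qed

lemma weak_gradient_unique:
  fixes D :: "'a::euclidean_space set"
  assumes "open D" "has_weak_gradient D u g" "has_weak_gradient D u' g'" "AE x in lebesgue_on D. u x = u' x"
    and "u \<in> borel_measurable (lebesgue_on D)" "u' \<in> borel_measurable (lebesgue_on D)"
  shows "AE x in lebesgue_on D. g x = g' x"
proof -
  have c: "AE x in lebesgue_on D. g x \<bullet> i - g' x \<bullet> i = 0" if i: "i \<in> Basis" for i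
  proof (rule fundamental_lemma[OF assms(1)])
    have l: "locally_integrable D (\<lambda>x. g x \<bullet> i)" "locally_integrable D (\<lambda>x. g' x \<bullet> i)"
      using assms(2,3) by (auto simp: has_weak_gradient_def intro: locally_integrable_component)
    then show "locally_integrable D (\<lambda>x. g x \<bullet> i - g' x \<bullet> i)" by (rule locally_integrable_diff)
    fix \<phi> assume \<phi>: "\<phi> \<in> test_functions D"
    have "(LINT x|lebesgue_on D. (g x \<bullet> i - g' x \<bullet> i) * \<phi> x) =
      (LINT x|lebesgue_on D. (g x \<bullet> i) * \<phi> x) - (LINT x|lebesgue_on D. (g' x \<bullet> i) * \<phi> x)"
      unfolding left_diff_distrib
      by (intro Bochner_Integration.integral_diff test_function_integrable assms(1) \<phi> l)
    also have "\<dots> = (LINT x|lebesgue_on D. u' x * partial i \<phi> x) - (LINT x|lebesgue_on D. u x * partial i \<phi> x)"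
      using assms(2,3) \<phi> i unfolding has_weak_gradient_iff by simp
    also have "(LINT x|lebesgue_on D. u x * partial i \<phi> x) = (LINT x|lebesgue_on D. u' x * partial i \<phi> x)"
    proof (rule integral_cong_AE)
      have "partial i \<phi> \<in> borel_measurable (lebesgue_on D)"
        using \<phi> i by (intro borel_restrict_lebesgue borel_measurable_continuous_onI smooth_continuous smooth_partial test_functions_smooth)
      then show "(\<lambda>x. u x * partial i \<phi> x) \<in> borel_measurable (lebesgue_on D)" "(\<lambda>x. u' x * partial i \<phi> x) \<in> borel_measurable (lebesgue_on D)"
        using assms(5,6) by (auto intro: borel_measurable_times)
      show "AE x in lebesgue_on D. u x * partial i \<phi> x = u' x * partial i \<phi> x"
        using assms(4) by eventually_elim simp
    qed
    finally show "(LINT x|lebesgue_on D. (g x \<bullet> i - g' x \<bullet> i) * \<phi> x) = 0" by simp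
  qed
  have "AE x in lebesgue_on D. \<forall>i\<in>Basis. g x \<bullet> i - g' x \<bullet> i = 0"
    by (rule AE_finite_allI[OF finite_Basis c])
  then show ?thesis by eventually_elim (rule euclidean_eqI, simp)
qed

text \<open>Local integrability gives measurability on compact pieces only; the function cut off to
  an increasing exhaustion converges pointwise to its restriction to D.\<close>

lemma locally_integrable_measurable:
  fixes f :: "'a::euclidean_space \<Rightarrow> 'b::euclidean_space"
  assumes "open D" "locally_integrable D f"
  shows "f \<in> borel_measurable (lebesgue_on D)"
proof -
  have D: "D \<in> sets lebesgue" using assms(1) by simp
  obtain C :: "nat \<Rightarrow> 'a set" where C: "\<And>n. compact (C n)" "\<And>n. C n \<subseteq> D" and mono: "mono C"
    and C4: "\<Union>(range C) = D"
    using compact_exhaustion[OF assms(1)] by blast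
  have "(\<lambda>x. if x \<in> D then f x else 0) \<in> borel_measurable lebesgue"
  proof (rule borel_measurable_LIMSEQ_metric)
    show "(\<lambda>x. if x \<in> C n then f x else 0) \<in> borel_measurable lebesgue" for n
      using assms(2) C(1,2) by (intro borel_measurable_if_I borel_measurable_integrable)
        (auto simp: locally_integrable_def borel_compact)
    fix x
    show "(\<lambda>n. if x \<in> C n then f x else 0) \<longlonglongrightarrow> (if x \<in> D then f x else 0)"
    proof (cases "x \<in> D")
      case True
      then obtain m where "x \<in> C m" using C4 by auto
      then have "\<forall>\<^sub>F n in sequentially. x \<in> C n" using monoD[OF mono] unfolding eventually_sequentially by blast
      then have "\<forall>\<^sub>F n in sequentially. (if x \<in> C n then f x else 0) = f x" by eventually_elim simp
      then show ?thesis using True by (simp add: tendsto_eventually)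
    next
      case False
      then have "x \<notin> C n" for n using C(2) by blast
      then show ?thesis using False by simp
    qed
  qed
  then show ?thesis by (rule borel_measurable_if_D)
qed

text \<open>By translation invariance each difference quotient in direction i has integral 0, and
  the quotients converge boundedly with a common compact support. This yields integration by parts
  without iterated integrals.\<close>

lemma C1_integral_partial:
  fixes f :: "'a::euclidean_space \<Rightarrow> real"
  assumes d: "\<And>x. f differentiable (at x)" and c: "\<And>i. i \<in> Basis \<Longrightarrow> continuous_on UNIV (partial i f)"
    and K: "compact K" "\<And>x. x \<notin> K \<Longrightarrow> f x = 0" and i: "i \<in> Basis"
  shows "(LINT x|lborel. partial i f x) = 0"
proof -
  have fc: "continuous_on UNIV f" using d by (simp add: continuous_at_imp_continuous_on differentiable_imp_continuous_within)
  have Kc: "closed K" using K(1) by (rule compact_imp_closed)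
  have pK: "partial i f x = 0" if "x \<notin> K" for x using partial_eq_0[OF Kc K(2) that] .
  have ext: "integrable lborel g" if "continuous_on UNIV g" "\<And>x. x \<notin> K \<Longrightarrow> g x = (0::real)" for g
  proof -
    have "integrable lborel (\<lambda>x. indicator K x *\<^sub>R g x)"
      using that(1) by (intro borel_integrable_compact K(1)) (auto intro: continuous_on_subset)
    moreover have "(\<lambda>x. indicator K x *\<^sub>R g x) = g" using that(2) by (auto split: split_indicator)
    ultimately show ?thesis by (simp only:)
  qed
  have fi: "integrable lborel f" by (rule ext[OF fc K(2)])
  have fb: "f \<in> borel_measurable borel" by (rule borel_measurable_continuous_onI[OF fc])
  have "compact (partial i f ` K)" using K(1) c[OF i] by (intro compact_continuous_image) (auto intro: continuous_on_subset)
  then obtain B where "B > 0" and B0: "\<And>y. y \<in> partial i f ` K \<Longrightarrow> norm y \<le> B"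
    using compact_imp_bounded bounded_pos by metis
  have B: "\<bar>partial i f x\<bar> \<le> B" for x using B0[of "partial i f x"] \<open>B > 0\<close> pK[of x] by (cases "x \<in> K") auto
  obtain R where R: "\<And>x. x \<in> K \<Longrightarrow> norm x \<le> R" using compact_imp_bounded[OF K(1)] by (auto simp: bounded_iff)
  define h where "h n = inverse (real (Suc n))" for n
  have h: "h n > 0" "h n \<le> 1" for n by (auto simp: h_def field_simps)
  have mv: "\<exists>t. 0 < t \<and> t < 1 \<and> f (x + s *\<^sub>R i) - f x = s * partial i f (x + (t * s) *\<^sub>R i)" for x s
  proof -
    obtain t where t: "0 < t" "t < 1" "f (x + s *\<^sub>R i) - f x = (\<Sum>j\<in>Basis. (s *\<^sub>R i \<bullet> j) * partial j f (x + t *\<^sub>R s *\<^sub>R i))"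
      by (rule partial_mean_value[OF d])
    have "(\<Sum>j\<in>Basis. (s *\<^sub>R i \<bullet> j) * partial j f (x + t *\<^sub>R s *\<^sub>R i)) = (\<Sum>j\<in>Basis. if j = i then s * partial j f (x + t *\<^sub>R s *\<^sub>R i) else 0)"
      using i by (intro sum.cong) (auto simp: inner_Basis)
    then show ?thesis using t i by auto
  qed
  have "(\<lambda>n. LINT x|lborel. (f (h n *\<^sub>R i + x) - f x) / h n) \<longlonglongrightarrow> (LINT x|lborel. partial i f x)"
  \<comment> \<open>The step h n is at most 1, so all quotients vanish outside the ball of radius R
    + 1.\<close>
  proof (rule integral_dominated_convergence[where w="\<lambda>x. B * indicator (cball 0 (R + 1)) x"])
    show "AE x in lborel. (\<lambda>n. (f (h n *\<^sub>R i + x) - f x) / h n) \<longlonglongrightarrow> partial i f x"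
    proof (rule AE_I2)
      fix x
      have 1: "((\<lambda>s. x + s *\<^sub>R i) has_derivative (\<lambda>s. s *\<^sub>R i)) (at 0)" by (auto intro!: derivative_eq_intros)
      have "((\<lambda>s. f (x + s *\<^sub>R i)) has_derivative (\<lambda>s. frechet_derivative f (at (x + 0 *\<^sub>R i)) (s *\<^sub>R i))) (at 0)"
        by (rule has_derivative_compose[OF 1 has_derivative_frechet[OF d]])
      also have "(\<lambda>s. frechet_derivative f (at (x + 0 *\<^sub>R i)) (s *\<^sub>R i)) = (*) (partial i f x)"
        using linear_cmul[OF linear_frechet_derivative[OF d]] by (auto simp: mult.commute partial_def)
      finally have "DERIV (\<lambda>s. f (x + s *\<^sub>R i)) 0 :> partial i f x" by (simp add: has_field_derivative_def)
      then have "((\<lambda>s. (f (x + s *\<^sub>R i) - f x) / s) \<longlongrightarrow> partial i f x) (at 0)" by (simp add: DERIV_def)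
      moreover have "filterlim h (at 0) sequentially"
      proof -
        have "h \<longlonglongrightarrow> 0" unfolding h_def [abs_def] by (rule LIMSEQ_inverse_real_of_nat)
        moreover have "h n \<noteq> 0" for n using h(1)[of n] by simp
        ultimately show ?thesis unfolding filterlim_at by simp
      qed
      ultimately have "(\<lambda>n. (f (x + h n *\<^sub>R i) - f x) / h n) \<longlonglongrightarrow> partial i f x" by (rule filterlim_compose)
      then show "(\<lambda>n. (f (h n *\<^sub>R i + x) - f x) / h n) \<longlonglongrightarrow> partial i f x" by (simp add: add.commute)
    qed
    fix n
    have "\<bar>(f (h n *\<^sub>R i + x) - f x) / h n\<bar> \<le> B * indicator (cball 0 (R + 1)) x" for x
    proof (cases "norm x \<le> R + 1")
      case True
      obtain t where "f (x + h n *\<^sub>R i) - f x = h n * partial i f (x + (t * h n) *\<^sub>R i)" using mv by blast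
      then show ?thesis using B True h(1)[of n] by (simp add: add.commute)
    next
      case False
      have "norm (h n *\<^sub>R i) \<le> 1" using h[of n] i by simp
      then have "norm (h n *\<^sub>R i + x) > R" using False norm_diff_ineq[of x "h n *\<^sub>R i"] by (simp add: add.commute)
      then have "h n *\<^sub>R i + x \<notin> K" "x \<notin> K" using R[of "h n *\<^sub>R i + x"] R[of x] False by auto
      then show ?thesis using K(2) False by simp
    qed
    then show "AE x in lborel. norm ((f (h n *\<^sub>R i + x) - f x) / h n) \<le> B * indicator (cball 0 (R + 1)) x" by simp
    show "(\<lambda>x. (f (h n *\<^sub>R i + x) - f x) / h n) \<in> borel_measurable lborel" using fb by measurable
  next
    show "integrable lborel (\<lambda>x. B * indicator (cball 0 (R + 1)) x)"
      using emeasure_lborel_cball_finite by (intro integrable_mult_right) (simp add: integrable_indicator_iff)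
    show "partial i f \<in> borel_measurable lborel" using borel_measurable_continuous_onI[OF c[OF i]] by simp
  qed
  moreover have "(LINT x|lborel. (f (h n *\<^sub>R i + x) - f x) / h n) = 0" for n
  proof -
    have "integrable lborel (\<lambda>x. f (h n *\<^sub>R i + x))" using lborel_integrable_translation[OF fb] fi by blast
    then have "(LINT x|lborel. f (h n *\<^sub>R i + x) - f x) = (LINT x|lborel. f (h n *\<^sub>R i + x)) - (LINT x|lborel. f x)"
      using fi by (rule Bochner_Integration.integral_diff)
    then show ?thesis using lborel_integral_translation[OF fb] by simp
  qed
  ultimately have "(\<lambda>n. 0) \<longlonglongrightarrow> (LINT x|lborel. partial i f x)" by (simp only:)
  then show ?thesis by (simp add: LIMSEQ_const_iff)
qed

lemma continuous_compact_support_L2: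
  fixes f :: "'a::euclidean_space \<Rightarrow> 'b::euclidean_space"
  assumes "continuous_on UNIV f" "compact K" "\<And>x. x \<notin> K \<Longrightarrow> f x = 0" "D \<in> lmeasurable"
  shows "f \<in> L2 D" "f \<in> borel_measurable borel" "\<exists>B. \<forall>x. norm (f x) \<le> B"
proof -
  show m: "f \<in> borel_measurable borel" using assms(1) by (rule borel_measurable_continuous_onI)
  have "compact (f ` K)" using assms(1,2) by (intro compact_continuous_image) (auto intro: continuous_on_subset)
  then obtain B where B: "B > 0" "\<And>y. y \<in> f ` K \<Longrightarrow> norm y \<le> B" using compact_imp_bounded bounded_pos by metis
  have b: "norm (f x) \<le> B" for x using B assms(3)[of x] by (cases "x \<in> K") auto
  then show "\<exists>B. \<forall>x. norm (f x) \<le> B" by blast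
  show "f \<in> L2 D" using b B(1) by (intro L2_norm_bounded_lmeasurable(1)[OF assms(4) borel_restrict_lebesgue[OF m]]) auto
qed

lemma L2_locally_integrable:
  fixes f :: "'a::euclidean_space \<Rightarrow> 'b::euclidean_space"
  assumes "f \<in> L2 D" "D \<in> lmeasurable"
  shows "locally_integrable D f" "integrable (lebesgue_on D) f"
proof -
  have "(\<lambda>_. 1 :: real) \<in> L2 D" using assms(2) by (intro L2_norm_bounded_lmeasurable(1)[of _ _ 1]) auto
  from L2_bounded_by_mult[OF assms(1) this L2_measurable[OF assms(1)]]
  show i: "integrable (lebesgue_on D) f" by simp
  show "locally_integrable D f"
    unfolding locally_integrable_def using assms(2)
    by (auto intro!: integrable_lebesgue_on_subset[OF i] simp: fmeasurableD borel_compact)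
qed

lemma norm_sq_components: "(norm (x :: 'a::euclidean_space))\<^sup>2 = (\<Sum>i\<in>Basis. (x \<bullet> i)\<^sup>2)"
  unfolding power2_norm_eq_inner by (subst euclidean_inner) (simp add: power2_eq_square)

lemma L2_components:
  fixes f :: "'a::euclidean_space \<Rightarrow> 'b::euclidean_space"
  assumes "\<And>i. i \<in> Basis \<Longrightarrow> (\<lambda>x. f x \<bullet> i) \<in> L2 D"
  shows "f \<in> L2 D" "L2_norm D f = sqrt (\<Sum>i\<in>Basis. (L2_norm D (\<lambda>x. f x \<bullet> i))\<^sup>2)"
proof -
  have m: "f \<in> borel_measurable (lebesgue_on D)"
    using assms L2_measurable by (subst borel_measurable_euclidean_space) blast
  have i: "integrable (lebesgue_on D) (\<lambda>x. (f x \<bullet> i)\<^sup>2)" if "i \<in> Basis" for i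
    using L2_integrable[OF assms[OF that]] by simp
  then have "integrable (lebesgue_on D) (\<lambda>x. (norm (f x))\<^sup>2)"
    unfolding norm_sq_components by (rule Bochner_Integration.integrable_sum)
  with m show "f \<in> L2 D" by (simp add: L2_def)
  have "(LINT x|lebesgue_on D. (norm (f x))\<^sup>2) = (\<Sum>i\<in>Basis. LINT x|lebesgue_on D. (f x \<bullet> i)\<^sup>2)"
    unfolding norm_sq_components by (rule Bochner_Integration.integral_sum[OF i])
  then show "L2_norm D f = sqrt (\<Sum>i\<in>Basis. (L2_norm D (\<lambda>x. f x \<bullet> i))\<^sup>2)"
    by (simp add: L2_norm_sq) (simp add: L2_norm_def)
qed

lemma L2_components_tendsto:
  fixes f :: "nat \<Rightarrow> 'a::euclidean_space \<Rightarrow> 'b::euclidean_space"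
  assumes "\<And>n i. i \<in> Basis \<Longrightarrow> (\<lambda>x. f n x \<bullet> i) \<in> L2 D"
    "\<And>i. i \<in> Basis \<Longrightarrow> (\<lambda>n. L2_norm D (\<lambda>x. f n x \<bullet> i)) \<longlonglongrightarrow> 0"
  shows "(\<lambda>n. L2_norm D (f n)) \<longlonglongrightarrow> 0"
proof -
  have "(\<lambda>n. sqrt (\<Sum>i\<in>Basis. (L2_norm D (\<lambda>x. f n x \<bullet> i))\<^sup>2)) \<longlonglongrightarrow> sqrt (\<Sum>i\<in>(Basis::'b set). 0\<^sup>2)"
    by (intro tendsto_intros assms(2))
  then show ?thesis using L2_components(2)[OF assms(1)] by simp
qed

lemma L2_dominated:
  fixes f :: "nat \<Rightarrow> 'a::euclidean_space \<Rightarrow> 'b::euclidean_space" and w :: "'a \<Rightarrow> 'c::euclidean_space"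
  assumes "w \<in> L2 D" "\<And>n. f n \<in> borel_measurable (lebesgue_on D)"
    "\<And>n. AE x in lebesgue_on D. norm (f n x) \<le> c * norm (w x)" "AE x in lebesgue_on D. (\<lambda>n. f n x) \<longlonglongrightarrow> 0"
  shows "(\<lambda>n. L2_norm D (f n)) \<longlonglongrightarrow> 0"
proof (rule L2_dominated_convergence[OF L2_scaleR(1)[OF assms(1), of c] assms(2) _ assms(4)])
  show "AE x in lebesgue_on D. norm (f n x) \<le> norm (c *\<^sub>R w x)" for n
    using assms(3)[of n]
  proof eventually_elim
    case (elim x)
    have "c * norm (w x) \<le> \<bar>c\<bar> * norm (w x)" by (intro mult_right_mono) auto
    then show ?case using elim by simp
  qed
qed

text \<open>Provides the test functions y -> \<eta>(x - y); the sign of their derivative later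
  cancels the sign in the definition of the weak gradient.\<close>

lemma smooth_reflect:
  assumes "smooth f"
  shows "smooth (\<lambda>y. f (x - y))" "partial i (\<lambda>y. f (x - y)) y = - partial i f (x - y)"
proof -
  have d: "((\<lambda>y. f (x - y)) has_derivative (\<lambda>k. frechet_derivative f (at (x - y)) (- k))) (at y)"
    if "smooth f" for f y
  proof -
    have "((\<lambda>y. x - y) has_derivative (\<lambda>k. - k)) (at y)" by (auto intro!: derivative_eq_intros)
    from has_derivative_compose[OF this has_derivative_frechet[OF smooth_differentiable[OF that]]]
    show ?thesis .
  qed
  have p: "partial i (\<lambda>y. f (x - y)) y = - partial i f (x - y)" if "smooth f" for f i y
    unfolding partial_eq[OF d[OF that]] using linear_neg[OF linear_frechet_derivative[OF smooth_differentiable[OF that]]]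
    by (simp add: partial_def)
  have "Ck k (\<lambda>y. f (x - y))" if "smooth f" for k f
    using that
  proof (induction k arbitrary: f)
    case 0
    have "continuous_on UNIV (\<lambda>y. f (x - y))"
      by (rule continuous_on_compose2[OF smooth_continuous[OF 0, of UNIV]]) (auto intro: continuous_intros)
    then show ?case by simp
  next
    case (Suc k)
    have "partial i (\<lambda>y. f (x - y)) = (\<lambda>y. - partial i f (x - y))" for i using p[OF Suc.prems] by blast
    moreover have "(\<lambda>y. f (x - y)) differentiable (at y)" for y using d[OF Suc.prems] by (blast intro: differentiableI)
    ultimately show ?case unfolding Ck_Suc_iff using Suc.IH smooth_partial[OF Suc.prems] by (auto intro!: Ck_uminus)
  qed
  then show "smooth (\<lambda>y. f (x - y))" using assms by (simp add: smooth_def)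
  show "partial i (\<lambda>y. f (x - y)) y = - partial i f (x - y)" by (rule p[OF assms])
qed

text \<open>When the ball of radius \<epsilon> about x lies in D, y -> \<eta>(x - y) is a test
  function. The identity for the weak gradient then moves the derivative from the kernel to
  u.\<close>

lemma conv_weak_partial:
  fixes D :: "'a::euclidean_space set"
  assumes k: "kernel \<epsilon> \<eta>" and D: "open D" "cball x \<epsilon> \<subseteq> D" and u: "has_weak_gradient D u g" and i: "i \<in> Basis"
    and v: "v \<in> borel_measurable borel" "\<And>y. y \<notin> D \<Longrightarrow> v y = 0" "AE y in lebesgue_on D. v y = u y"
    and w: "w \<in> borel_measurable borel" "\<And>y. y \<notin> D \<Longrightarrow> w y = 0" "AE y in lebesgue_on D. w y = g y \<bullet> i"
  shows "conv (partial i \<eta>) v x = conv \<eta> w x"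
proof -
  have s: "smooth \<eta>" using k by (simp add: kernel_def)
  have Dl: "D \<in> sets lebesgue" using D by simp
  note [measurable] = kernel_borel[OF k] kernel_borel[OF kernel_partial[OF k i]] v(1) w(1)
  have um: "u \<in> borel_measurable (lebesgue_on D)" "g \<in> borel_measurable (lebesgue_on D)"
    using u D(1) by (auto simp: has_weak_gradient_def intro: locally_integrable_measurable)
  have \<phi>: "(\<lambda>y. \<eta> (x - y)) \<in> test_functions D"
    by (rule test_functionsI[OF smooth_reflect(1)[OF s] compact_cball D(2)])
       (use k in \<open>auto simp: kernel_def dist_norm\<close>)
  have m1: "(\<lambda>y. \<eta> (x - y)) \<in> borel_measurable (lebesgue_on D)" "(\<lambda>y. partial i \<eta> (x - y)) \<in> borel_measurable (lebesgue_on D)"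
    by (intro borel_restrict_lebesgue; measurable)+
  have m2: "v \<in> borel_measurable (lebesgue_on D)" "w \<in> borel_measurable (lebesgue_on D)"
    by (intro borel_restrict_lebesgue v w)+
  have "conv (partial i \<eta>) v x = (LINT y|lebesgue_on D. partial i \<eta> (x - y) * v y)"
    unfolding conv_def by (rule lborel_lebesgue_on(2)[OF _ Dl, symmetric]) (use v(2) in auto)
  also have "\<dots> = - (LINT y|lebesgue_on D. u y * partial i (\<lambda>y. \<eta> (x - y)) y)"
    unfolding smooth_reflect(2)[OF s] using m1 m2 um v(3)
    by (subst Bochner_Integration.integral_minus[symmetric], intro integral_cong_AE) auto
  also have "\<dots> = (LINT y|lebesgue_on D. (g y \<bullet> i) * \<eta> (x - y))"
    using u \<phi> i unfolding has_weak_gradient_iff by auto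
  also have "\<dots> = (LINT y|lebesgue_on D. \<eta> (x - y) * w y)"
    using m1 m2 um w(3) by (intro integral_cong_AE) auto
  also have "\<dots> = conv \<eta> w x"
    unfolding conv_def by (rule lborel_lebesgue_on(2)[OF _ Dl]) (use w(2) in auto)
  finally show ?thesis .
qed

section \<open>The space \<open>H\<^sub>0\<^sup>1\<close>\<close>

text \<open>The closure in L2 x L2 of the graph of the gradient on test functions. Carrying the
  gradient as an explicit second component keeps the choice behind \<open>weak_grad\<close> out of
  all calculations; \<open>H10_gradientD\<close> and \<open>H10I\<close> relate this to
  \<open>H10\<close>.\<close>

definition H10_gradient :: "'a::euclidean_space set \<Rightarrow> ('a \<Rightarrow> real) \<Rightarrow> ('a \<Rightarrow> 'a) \<Rightarrow> bool" where
  "H10_gradient D u g \<longleftrightarrow> u \<in> L2 D \<and> g \<in> L2 D \<and>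
     (\<forall>\<epsilon>>0. \<exists>\<phi>\<in>test_functions D. L2_norm D (\<lambda>x. u x - \<phi> x) < \<epsilon> \<and> L2_norm D (\<lambda>x. g x - grad \<phi> x) < \<epsilon>)"

lemma H10_gradient_L2: "H10_gradient D u g \<Longrightarrow> u \<in> L2 D" "H10_gradient D u g \<Longrightarrow> g \<in> L2 D"
  by (auto simp: H10_gradient_def)

lemma H10_gradient_approx:
  assumes "H10_gradient D u g" "\<epsilon> > 0"
  obtains \<phi> where "\<phi> \<in> test_functions D" "L2_norm D (\<lambda>x. u x - \<phi> x) < \<epsilon>" "L2_norm D (\<lambda>x. g x - grad \<phi> x) < \<epsilon>"
  using assms unfolding H10_gradient_def by blast

section \<open>Density arguments on a bounded open set\<close>

locale bounded_open =
  fixes D :: "'a::euclidean_space set"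
  assumes open_D: "open D" and bounded_D: "bounded D"
begin

lemma lmeas: "D \<in> lmeasurable" and lsets: "D \<in> sets lebesgue" and bsets: "D \<in> sets borel"
  using lmeasurable_open[OF bounded_D open_D] open_D by auto

lemma C1_support_L2:
  assumes d: "\<And>x. f differentiable (at x)" and c: "\<And>i. i \<in> Basis \<Longrightarrow> continuous_on UNIV (partial i f)"
    and K: "compact K" "\<And>x. x \<notin> K \<Longrightarrow> f x = 0"
  shows "f \<in> L2 D" "grad f \<in> L2 D" "continuous_on UNIV f" "continuous_on UNIV (grad f)"
proof -
  show fc: "continuous_on UNIV f" using d by (simp add: continuous_at_imp_continuous_on differentiable_imp_continuous_within)
  show "f \<in> L2 D" by (rule continuous_compact_support_L2(1)[OF fc K lmeas])
  show gc: "continuous_on UNIV (grad f)" unfolding grad_def [abs_def] using c by (intro continuous_intros)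
  have "grad f x = 0" if "x \<notin> K" for x
    unfolding grad_def using partial_eq_0[OF compact_imp_closed[OF K(1)] K(2) that] by simp
  then show "grad f \<in> L2 D" by (rule continuous_compact_support_L2(1)[OF gc K(1) _ lmeas])
qed

text \<open>The product of f with a test function is C^1 with compact support, so its partial
  derivative integrates to 0; the product rule splits that integral into the two sides of the
  identity.\<close>

lemma C1_weak_gradient:
  assumes d: "\<And>x. f differentiable (at x)" and c: "\<And>i. i \<in> Basis \<Longrightarrow> continuous_on UNIV (partial i f)"
    and K: "compact K" "\<And>x. x \<notin> K \<Longrightarrow> f x = 0"
  shows "has_weak_gradient D f (grad f)"
  unfolding has_weak_gradient_iff
proof (intro conjI ballI)
  note L2 = C1_support_L2[OF d c K]
  show li: "locally_integrable D f" "locally_integrable D (grad f)"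
    using L2 L2_locally_integrable lmeas by blast+
  fix \<psi> and i :: 'a assume \<psi>: "\<psi> \<in> test_functions D" and i: "i \<in> Basis"
  obtain S where S: "compact S" "S \<subseteq> D" "\<And>x. x \<notin> S \<Longrightarrow> \<psi> x = 0" using \<psi> by (auto simp: test_functions_iff)
  have sm: "smooth \<psi>" using \<psi> by (rule test_functions_smooth)
  have \<psi>d: "\<psi> differentiable (at x)" for x using sm by (rule smooth_differentiable)
  have pp: "partial j (\<lambda>x. f x * \<psi> x) = (\<lambda>x. f x * partial j \<psi> x + partial j f x * \<psi> x)" for j
    using partial_mult[OF d \<psi>d] by blast
  have pc: "continuous_on UNIV (partial j (\<lambda>x. f x * \<psi> x))" if "j \<in> Basis" for j
    unfolding pp using c[OF that] L2(3) smooth_continuous[OF sm] smooth_continuous[OF smooth_partial[OF sm that]]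
    by (intro continuous_intros)
  have z: "(LINT x|lborel. f x * partial i \<psi> x + partial i f x * \<psi> x) = 0"
    using C1_integral_partial[of "\<lambda>x. f x * \<psi> x" S i] pc[unfolded pp] S i differentiable_mult[OF d \<psi>d] unfolding pp by simp
  have i1: "integrable (lebesgue_on D) (\<lambda>x. f x * partial i \<psi> x)"
    by (rule test_function_integrable[OF li(1) open_D test_functions_partial[OF \<psi> i]])
  have i2: "integrable (lebesgue_on D) (\<lambda>x. partial i f x * \<psi> x)"
    using test_function_integrable[OF locally_integrable_component[OF li(2), of i] open_D \<psi>] i by simp
  have m: "(\<lambda>x. f x * partial i \<psi> x + partial i f x * \<psi> x) \<in> borel_measurable borel"
    using pc[OF i] unfolding pp by (rule borel_measurable_continuous_onI)
  have "(LINT x|lebesgue_on D. f x * partial i \<psi> x + partial i f x * \<psi> x) = (LINT x|lborel. f x * partial i \<psi> x + partial i f x * \<psi> x)"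
  proof (rule lborel_lebesgue_on(2)[OF m lsets])
    fix x assume "x \<notin> D"
    then have "x \<notin> S" using S(2) by blast
    then show "f x * partial i \<psi> x + partial i f x * \<psi> x = 0"
      using S(3) partial_eq_0[OF compact_imp_closed[OF S(1)] S(3)] by simp
  qed
  then have "(LINT x|lebesgue_on D. f x * partial i \<psi> x) + (LINT x|lebesgue_on D. partial i f x * \<psi> x) = 0"
    using z Bochner_Integration.integral_add[OF i1 i2] by simp
  then show "(LINT x|lebesgue_on D. f x * partial i \<psi> x) = - (LINT x|lebesgue_on D. (grad f x \<bullet> i) * \<psi> x)"
    using i by simp
qed

lemma test_function_C1:
  assumes "\<phi> \<in> test_functions D"
  shows "\<phi> \<in> L2 D" "grad \<phi> \<in> L2 D" "i \<in> Basis \<Longrightarrow> partial i \<phi> \<in> L2 D" "has_weak_gradient D \<phi> (grad \<phi>)"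
    "\<phi> \<in> borel_measurable borel" "grad \<phi> \<in> borel_measurable borel" "\<exists>B. \<forall>x. \<bar>\<phi> x\<bar> \<le> B"
proof -
  obtain K where K: "compact K" "K \<subseteq> D" "\<And>x. x \<notin> K \<Longrightarrow> \<phi> x = 0" using assms by (auto simp: test_functions_iff)
  have sm: "smooth \<phi>" using assms by (rule test_functions_smooth)
  note dc = smooth_differentiable[OF sm] smooth_continuous[OF smooth_partial[OF sm]]
  note L2 = C1_support_L2[OF dc K(1,3)]
  show "\<phi> \<in> L2 D" "grad \<phi> \<in> L2 D" using L2 by auto
  show "partial i \<phi> \<in> L2 D" if "i \<in> Basis" using L2_component(1)[OF L2(2), of i] that by simp
  show "has_weak_gradient D \<phi> (grad \<phi>)" by (rule C1_weak_gradient[OF dc K(1,3)])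
  show "\<phi> \<in> borel_measurable borel" "grad \<phi> \<in> borel_measurable borel"
    using L2(3,4) by (auto intro: borel_measurable_continuous_onI)
  show "\<exists>B. \<forall>x. \<bar>\<phi> x\<bar> \<le> B" using continuous_compact_support_L2(3)[OF L2(3) K(1,3) lmeas] by simp
qed

lemma weak_gradient_limit:
  assumes "\<And>n. has_weak_gradient D (u n) (g n)" "\<And>n. u n \<in> L2 D" "\<And>n. g n \<in> L2 D" "v \<in> L2 D" "h \<in> L2 D"
    "(\<lambda>n. L2_norm D (\<lambda>x. u n x - v x)) \<longlonglongrightarrow> 0" "(\<lambda>n. L2_norm D (\<lambda>x. g n x - h x)) \<longlonglongrightarrow> 0"
  shows "has_weak_gradient D v h"
  unfolding has_weak_gradient_iff
proof (intro conjI ballI)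
  show "locally_integrable D v" "locally_integrable D h" using assms L2_locally_integrable lmeas by blast+
  fix \<phi> and i :: 'a assume \<phi>: "\<phi> \<in> test_functions D" and i: "i \<in> Basis"
  note t = test_function_C1[OF \<phi>]
  have l1: "(\<lambda>n. LINT x|lebesgue_on D. u n x \<bullet> partial i \<phi> x) \<longlonglongrightarrow> (LINT x|lebesgue_on D. v x \<bullet> partial i \<phi> x)"
    by (rule L2_inner_tendsto[OF assms(2,4,6) t(3)[OF i]])
  have l2: "(\<lambda>n. LINT x|lebesgue_on D. g n x \<bullet> (\<phi> x *\<^sub>R i)) \<longlonglongrightarrow> (LINT x|lebesgue_on D. h x \<bullet> (\<phi> x *\<^sub>R i))"
  proof (rule L2_inner_tendsto[OF assms(3,5,7)])
    show "(\<lambda>x. \<phi> x *\<^sub>R i) \<in> L2 D"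
      using t(1) i L2_measurable[OF t(1)] by (intro L2_bound(1)[OF t(1)]) auto
  qed
  have e: "(LINT x|lebesgue_on D. u n x \<bullet> partial i \<phi> x) = - (LINT x|lebesgue_on D. g n x \<bullet> (\<phi> x *\<^sub>R i))" for n
    using assms(1)[of n] \<phi> i unfolding has_weak_gradient_iff by (simp add: mult.commute)
  have "(LINT x|lebesgue_on D. v x \<bullet> partial i \<phi> x) = - (LINT x|lebesgue_on D. h x \<bullet> (\<phi> x *\<^sub>R i))"
    by (rule LIMSEQ_unique[OF l1]) (unfold e, rule tendsto_minus[OF l2])
  then show "(LINT x|lebesgue_on D. v x * partial i \<phi> x) = - (LINT x|lebesgue_on D. (h x \<bullet> i) * \<phi> x)"
    by (simp add: mult.commute)
qed

lemma H10_gradient_seq: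
  assumes "H10_gradient D u g"
  obtains \<phi> where "\<forall>n. \<phi> n \<in> test_functions D" "(\<lambda>n. L2_norm D (\<lambda>x. \<phi> n x - u x)) \<longlonglongrightarrow> 0"
    "(\<lambda>n. L2_norm D (\<lambda>x. grad (\<phi> n) x - g x)) \<longlonglongrightarrow> 0"
proof -
  have "\<forall>n. \<exists>\<phi>\<in>test_functions D. L2_norm D (\<lambda>x. u x - \<phi> x) < inverse (real (Suc n)) \<and> L2_norm D (\<lambda>x. g x - grad \<phi> x) < inverse (real (Suc n))"
    using assms unfolding H10_gradient_def by simp
  then obtain \<phi> where \<phi>: "\<forall>n. \<phi> n \<in> test_functions D" "\<And>n. L2_norm D (\<lambda>x. u x - \<phi> n x) < inverse (real (Suc n))"
    "\<And>n. L2_norm D (\<lambda>x. g x - grad (\<phi> n) x) < inverse (real (Suc n))" by metis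
  show thesis
  proof (rule that[OF \<phi>(1)])
    show "(\<lambda>n. L2_norm D (\<lambda>x. \<phi> n x - u x)) \<longlonglongrightarrow> 0"
      using \<phi>(2) by (intro real_null_comparison[OF LIMSEQ_inverse_real_of_nat]) (simp add: L2_norm_minus_commute[of D "\<phi> _"] less_imp_le)
    show "(\<lambda>n. L2_norm D (\<lambda>x. grad (\<phi> n) x - g x)) \<longlonglongrightarrow> 0"
      using \<phi>(3) by (intro real_null_comparison[OF LIMSEQ_inverse_real_of_nat]) (simp add: L2_norm_minus_commute[of D "grad (\<phi> _)"] less_imp_le)
  qed
qed

lemma H10_gradient_test: "\<phi> \<in> test_functions D \<Longrightarrow> H10_gradient D \<phi> (grad \<phi>)"
  unfolding H10_gradient_def using test_function_C1 by (auto simp: L2_norm_def intro!: bexI[of _ \<phi>])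

text \<open>The set of pairs is closed. This is how the rules proved for test functions below reach
  all of H^1_0.\<close>

lemma H10_gradient_limit:
  assumes "\<And>n. H10_gradient D (u n) (g n)" "v \<in> L2 D" "h \<in> L2 D"
    "(\<lambda>n. L2_norm D (\<lambda>x. u n x - v x)) \<longlonglongrightarrow> 0" "(\<lambda>n. L2_norm D (\<lambda>x. g n x - h x)) \<longlonglongrightarrow> 0"
  shows "H10_gradient D v h"
  unfolding H10_gradient_def
proof (intro conjI allI impI assms(2,3))
  fix \<epsilon> :: real assume "\<epsilon> > 0"
  have "\<forall>\<^sub>F n in sequentially. L2_norm D (\<lambda>x. u n x - v x) < \<epsilon> / 2 \<and> L2_norm D (\<lambda>x. g n x - h x) < \<epsilon> / 2"
    using \<open>\<epsilon> > 0\<close> by (intro eventually_conj order_tendstoD(2)[OF assms(4)] order_tendstoD(2)[OF assms(5)]) auto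
  then obtain n where n: "L2_norm D (\<lambda>x. u n x - v x) < \<epsilon> / 2" "L2_norm D (\<lambda>x. g n x - h x) < \<epsilon> / 2"
    by (auto simp: eventually_sequentially)
  obtain \<phi> where \<phi>: "\<phi> \<in> test_functions D" "L2_norm D (\<lambda>x. u n x - \<phi> x) < \<epsilon> / 2" "L2_norm D (\<lambda>x. g n x - grad \<phi> x) < \<epsilon> / 2"
    using \<open>\<epsilon> > 0\<close> by (rule H10_gradient_approx[OF assms(1)[of n] half_gt_zero])
  note l = H10_gradient_L2[OF assms(1)[of n]] and t = test_function_C1[OF \<phi>(1)]
  have "L2_norm D (\<lambda>x. v x - \<phi> x) < \<epsilon>" "L2_norm D (\<lambda>x. h x - grad \<phi> x) < \<epsilon>"
    using L2_norm_triangle[OF assms(2) l(1) t(1)] L2_norm_triangle[OF assms(3) l(2) t(2)] n \<phi>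
      L2_norm_minus_commute[of D v "u n"] L2_norm_minus_commute[of D h "g n"] by linarith+
  then show "\<exists>\<phi>\<in>test_functions D. L2_norm D (\<lambda>x. v x - \<phi> x) < \<epsilon> \<and> L2_norm D (\<lambda>x. h x - grad \<phi> x) < \<epsilon>"
    using \<phi>(1) by blast
qed

lemma H10_gradient_weak:
  assumes "H10_gradient D u g"
  shows "has_weak_gradient D u g"
proof -
  obtain \<phi> where \<phi>: "\<forall>n. \<phi> n \<in> test_functions D" "(\<lambda>n. L2_norm D (\<lambda>x. \<phi> n x - u x)) \<longlonglongrightarrow> 0"
    "(\<lambda>n. L2_norm D (\<lambda>x. grad (\<phi> n) x - g x)) \<longlonglongrightarrow> 0"
    by (rule H10_gradient_seq[OF assms])
  note t = test_function_C1[OF spec[OF \<phi>(1)]]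
  show ?thesis
    by (rule weak_gradient_limit[OF t(4) t(1) t(2) H10_gradient_L2[OF assms] \<phi>(2,3)])
qed

lemma weak_grad_eq:
  assumes "has_weak_gradient D u g" "g \<in> L2 D"
  shows "has_weak_gradient D u (weak_grad D u)" "AE x in lebesgue_on D. weak_grad D u x = g x" "weak_grad D u \<in> L2 D"
proof -
  show w: "has_weak_gradient D u (weak_grad D u)" unfolding weak_grad_def using someI[of "has_weak_gradient D u", OF assms(1)] .
  have m: "u \<in> borel_measurable (lebesgue_on D)" "weak_grad D u \<in> borel_measurable (lebesgue_on D)"
    using w locally_integrable_measurable[OF open_D] by (auto simp: has_weak_gradient_def)
  show ae: "AE x in lebesgue_on D. weak_grad D u x = g x"
    by (rule weak_gradient_unique[OF open_D w assms(1) _ m(1) m(1)]) simp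
  show "weak_grad D u \<in> L2 D"
    by (rule L2_AE_cong(1)[OF _ assms(2) m(2)]) (use ae in eventually_elim, simp)
qed

lemma H1_weak_grad:
  assumes "u \<in> H1 D"
  shows "u \<in> L2 D" "has_weak_gradient D u (weak_grad D u)" "weak_grad D u \<in> L2 D"
  using assms weak_grad_eq unfolding H1_def by blast+

lemma has_weak_gradient_diff:
  assumes "has_weak_gradient D u g" "has_weak_gradient D v h"
  shows "has_weak_gradient D (\<lambda>x. u x - v x) (\<lambda>x. g x - h x)"
  unfolding has_weak_gradient_iff
proof (intro conjI ballI)
  have l: "locally_integrable D u" "locally_integrable D v" "locally_integrable D g" "locally_integrable D h"
    using assms by (auto simp: has_weak_gradient_def)
  then show "locally_integrable D (\<lambda>x. u x - v x)" "locally_integrable D (\<lambda>x. g x - h x)" by (auto intro: locally_integrable_diff)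
  fix \<phi> and i :: 'a assume \<phi>: "\<phi> \<in> test_functions D" and i: "i \<in> Basis"
  note p = test_functions_partial[OF \<phi> i]
  have "(LINT x|lebesgue_on D. (u x - v x) * partial i \<phi> x) = (LINT x|lebesgue_on D. u x * partial i \<phi> x) - (LINT x|lebesgue_on D. v x * partial i \<phi> x)"
    unfolding left_diff_distrib by (intro Bochner_Integration.integral_diff test_function_integrable open_D p l)
  moreover have "(LINT x|lebesgue_on D. ((g x - h x) \<bullet> i) * \<phi> x) = (LINT x|lebesgue_on D. (g x \<bullet> i) * \<phi> x) - (LINT x|lebesgue_on D. (h x \<bullet> i) * \<phi> x)"
    unfolding inner_diff_left left_diff_distrib
    by (intro Bochner_Integration.integral_diff test_function_integrable open_D \<phi> locally_integrable_component l)
  ultimately show "(LINT x|lebesgue_on D. (u x - v x) * partial i \<phi> x) = - (LINT x|lebesgue_on D. ((g x - h x) \<bullet> i) * \<phi> x)"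
    using assms \<phi> i unfolding has_weak_gradient_iff by simp
qed

text \<open>Being a choice, \<open>weak_grad\<close> is additive only almost everywhere. This
  bridges the H^1 norm of a difference, as it occurs in \<open>H10\<close>, and the difference of
  explicit gradients.\<close>

lemma weak_grad_norm_diff_test:
  assumes "has_weak_gradient D u g" "g \<in> L2 D" "\<phi> \<in> test_functions D"
  shows "L2_norm D (weak_grad D (\<lambda>x. u x - \<phi> x)) = L2_norm D (\<lambda>x. g x - grad \<phi> x)"
proof -
  note t = test_function_C1[OF assms(3)]
  have w: "has_weak_gradient D (\<lambda>x. u x - \<phi> x) (\<lambda>x. g x - grad \<phi> x)" "(\<lambda>x. g x - grad \<phi> x) \<in> L2 D"
    using has_weak_gradient_diff[OF assms(1) t(4)] L2_diff(1)[OF assms(2) t(2)] by auto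
  show ?thesis
    using weak_grad_eq[OF w] w(2) by (intro L2_norm_cong_AE) (auto dest: L2_measurable)
qed

lemma H10_gradientD:
  assumes "u \<in> H10 D"
  shows "H10_gradient D u (weak_grad D u)"
  unfolding H10_gradient_def
proof (intro conjI allI impI)
  have "u \<in> H1 D" using assms by (simp add: H10_def)
  note h = H1_weak_grad[OF this]
  show "u \<in> L2 D" "weak_grad D u \<in> L2 D" using h by auto
  fix \<epsilon> :: real assume "\<epsilon> > 0"
  then obtain \<phi> where \<phi>: "\<phi> \<in> test_functions D" "H1_norm D (\<lambda>x. u x - \<phi> x) < \<epsilon>"
    using assms by (auto simp: H10_def)
  have "L2_norm D (\<lambda>x. u x - \<phi> x) \<le> H1_norm D (\<lambda>x. u x - \<phi> x)"
    "L2_norm D (weak_grad D (\<lambda>x. u x - \<phi> x)) \<le> H1_norm D (\<lambda>x. u x - \<phi> x)"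
    unfolding H1_norm_def by (auto intro: real_le_rsqrt)
  then show "\<exists>\<phi>\<in>test_functions D. L2_norm D (\<lambda>x. u x - \<phi> x) < \<epsilon> \<and> L2_norm D (\<lambda>x. weak_grad D u x - grad \<phi> x) < \<epsilon>"
    using \<phi> weak_grad_norm_diff_test[OF h(2,3) \<phi>(1)] by (intro bexI[of _ \<phi>]) auto
qed

lemma H10I:
  assumes "H10_gradient D u g"
  shows "u \<in> H10 D" "AE x in lebesgue_on D. weak_grad D u x = g x"
proof -
  note w = H10_gradient_weak[OF assms] and l = H10_gradient_L2[OF assms]
  show "AE x in lebesgue_on D. weak_grad D u x = g x" by (rule weak_grad_eq(2)[OF w l(2)])
  show "u \<in> H10 D"
    unfolding H10_def
  proof (intro CollectI conjI allI impI)
    show "u \<in> H1 D" using w l by (auto simp: H1_def)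
    fix \<epsilon> :: real assume "\<epsilon> > 0"
    then obtain \<phi> where \<phi>: "\<phi> \<in> test_functions D" "L2_norm D (\<lambda>x. u x - \<phi> x) < \<epsilon> / 2" "L2_norm D (\<lambda>x. g x - grad \<phi> x) < \<epsilon> / 2"
      by (rule H10_gradient_approx[OF assms half_gt_zero])
    have "H1_norm D (\<lambda>x. u x - \<phi> x) \<le> L2_norm D (\<lambda>x. u x - \<phi> x) + L2_norm D (\<lambda>x. g x - grad \<phi> x)"
      unfolding H1_norm_def weak_grad_norm_diff_test[OF w l(2) \<phi>(1)] by (intro sqrt_sum_squares_le_sum) auto
    then show "\<exists>\<phi>\<in>test_functions D. H1_norm D (\<lambda>x. u x - \<phi> x) < \<epsilon>" using \<phi> by (intro bexI[of _ \<phi>]) auto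
  qed
qed


lemma H10_gradient_diff:
  assumes "H10_gradient D u g" "H10_gradient D v h"
  shows "H10_gradient D (\<lambda>x. u x - v x) (\<lambda>x. g x - h x)"
  unfolding H10_gradient_def
proof (intro conjI allI impI)
  note l = H10_gradient_L2[OF assms(1)] H10_gradient_L2[OF assms(2)]
  show "(\<lambda>x. u x - v x) \<in> L2 D" "(\<lambda>x. g x - h x) \<in> L2 D" using l by (auto intro: L2_diff)
  fix \<epsilon> :: real assume "\<epsilon> > 0"
  obtain \<phi> where \<phi>: "\<phi> \<in> test_functions D" "L2_norm D (\<lambda>x. u x - \<phi> x) < \<epsilon> / 2" "L2_norm D (\<lambda>x. g x - grad \<phi> x) < \<epsilon> / 2"
    using \<open>\<epsilon> > 0\<close> by (rule H10_gradient_approx[OF assms(1) half_gt_zero])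
  obtain \<psi> where \<psi>: "\<psi> \<in> test_functions D" "L2_norm D (\<lambda>x. v x - \<psi> x) < \<epsilon> / 2" "L2_norm D (\<lambda>x. h x - grad \<psi> x) < \<epsilon> / 2"
    using \<open>\<epsilon> > 0\<close> by (rule H10_gradient_approx[OF assms(2) half_gt_zero])
  note t = test_function_C1[OF \<phi>(1)] and s = test_function_C1[OF \<psi>(1)]
  have d: "\<phi> differentiable (at x)" "\<psi> differentiable (at x)" for x
    using \<phi>(1) \<psi>(1) by (auto intro: smooth_differentiable test_functions_smooth)
  have "partial i (\<lambda>x. \<phi> x - \<psi> x) x = partial i \<phi> x - partial i \<psi> x" for i x
    by (subst partial_eq[OF has_derivative_diff[OF has_derivative_frechet[OF d(1)] has_derivative_frechet[OF d(2)]]])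
       (simp add: partial_def)
  then have gr: "grad (\<lambda>x. \<phi> x - \<psi> x) x = grad \<phi> x - grad \<psi> x" for x
    by (simp add: grad_def scaleR_diff_left sum_subtractf)
  have "L2_norm D (\<lambda>x. (u x - v x) - (\<phi> x - \<psi> x)) \<le> L2_norm D (\<lambda>x. u x - \<phi> x) + L2_norm D (\<lambda>x. v x - \<psi> x)"
    using L2_diff(2)[OF L2_diff(1)[OF l(1) t(1)] L2_diff(1)[OF l(3) s(1)]] by (simp add: algebra_simps)
  moreover have "L2_norm D (\<lambda>x. (g x - h x) - (grad \<phi> x - grad \<psi> x)) \<le> L2_norm D (\<lambda>x. g x - grad \<phi> x) + L2_norm D (\<lambda>x. h x - grad \<psi> x)"
    using L2_diff(2)[OF L2_diff(1)[OF l(2) t(2)] L2_diff(1)[OF l(4) s(2)]] by (simp add: algebra_simps)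
  ultimately show "\<exists>\<phi>\<in>test_functions D. L2_norm D (\<lambda>x. (u x - v x) - \<phi> x) < \<epsilon> \<and> L2_norm D (\<lambda>x. (g x - h x) - grad \<phi> x) < \<epsilon>"
    using \<phi> \<psi> by (intro bexI[of _ "\<lambda>x. \<phi> x - \<psi> x"] test_functions_diff) (auto simp: gr)
qed

lemma zero_test_function: "(\<lambda>_. 0) \<in> test_functions D"
  by (rule test_functionsI[of _ "{}"]) (auto intro: smooth_const)

lemma H10_gradient_uminus:
  assumes "H10_gradient D u g"
  shows "H10_gradient D (\<lambda>x. - u x) (\<lambda>x. - g x)"
proof -
  have "grad (\<lambda>_::'a. 0) = (\<lambda>_. 0)" by (auto simp: grad_def)
  then show ?thesis using H10_gradient_diff[OF H10_gradient_test[OF zero_test_function] assms] by simp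
qed

text \<open>Mollifying v gives test functions. Their classical partial derivatives are the mollified
  components of g as soon as the radius is small against the distance from K to the complement of D,
  so function and gradient converge together.\<close>

lemma H10_gradient_compact_support:
  assumes wg: "has_weak_gradient D v g" and L2: "v \<in> L2 D" "g \<in> L2 D"
    and K: "compact K" "K \<subseteq> D" "\<And>x. x \<notin> K \<Longrightarrow> v x = 0" "\<And>x. x \<notin> K \<Longrightarrow> g x = 0"
  shows "H10_gradient D v g"
proof -
  have Kb: "K \<in> sets borel" using K(1) by (rule borel_compact)
  have rep: "\<exists>w. sq_int w \<and> integrable lborel w \<and> (\<forall>x. x \<notin> K \<longrightarrow> w x = 0) \<and> (AE x in lebesgue_on D. w x = f x)"
    if f: "f \<in> L2 D" "\<And>x. x \<notin> K \<Longrightarrow> f x = 0" for f :: "'a \<Rightarrow> real"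
  proof -
    obtain w0 where w0: "sq_int w0" "\<And>x. x \<notin> D \<Longrightarrow> w0 x = 0" "AE x in lebesgue_on D. w0 x = f x"
      by (rule L2_representative[OF bsets f(1)]) blast
    let ?w = "\<lambda>x. indicator K x * w0 x"
    have s: "sq_int ?w"
      using sq_intD(1)[OF w0(1)] Kb by (intro sq_int_bound[OF w0(1)]) (auto split: split_indicator)
    have "integrable lborel ?w" by (rule sq_int_integrable[OF s _ Kb compact_imp_bounded[OF K(1)]]) simp
    moreover have "AE x in lebesgue_on D. ?w x = f x"
      using w0(3) by eventually_elim (use f(2) in \<open>auto split: split_indicator\<close>)
    ultimately show ?thesis using s by (intro exI[of _ ?w]) auto
  qed
  obtain V where V: "sq_int V" "integrable lborel V" "\<And>x. x \<notin> K \<Longrightarrow> V x = 0" "AE x in lebesgue_on D. V x = v x"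
    using rep[OF L2(1) K(3)] by blast
  have "\<exists>w. sq_int w \<and> integrable lborel w \<and> (\<forall>x. x \<notin> K \<longrightarrow> w x = 0) \<and> (AE x in lebesgue_on D. w x = g x \<bullet> i)"
    if "i \<in> Basis" for i
    using that K(4) by (intro rep L2_component(1)[OF L2(2)]) auto
  then obtain W where W: "\<And>i. i \<in> Basis \<Longrightarrow> sq_int (W i)" "\<And>i. i \<in> Basis \<Longrightarrow> integrable lborel (W i)"
    "\<And>i x. i \<in> Basis \<Longrightarrow> x \<notin> K \<Longrightarrow> W i x = 0" "\<And>i. i \<in> Basis \<Longrightarrow> AE x in lebesgue_on D. W i x = g x \<bullet> i" by metis
  obtain N1 where N1: "\<And>n. n \<ge> N1 \<Longrightarrow> conv (mol n) V \<in> test_functions D"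
    using conv_test_function[OF K(1) open_D K(2) V(3,2)] by metis
  obtain e where e: "e > 0" "\<And>x. cball x e \<inter> K \<noteq> {} \<Longrightarrow> cball x e \<subseteq> D"
    by (rule compact_neighbourhood[OF K(1) open_D K(2)]) blast
  obtain N2 where N2: "inverse (real (Suc N2)) < e" using reals_Archimedean[OF e(1)] by auto
  have P: "partial i (conv (mol n) V) x = conv (mol n) (W i) x" if n: "n \<ge> N2" and i: "i \<in> Basis" for n i x
  proof -
    let ?r = "inverse (real (Suc n))"
    have "?r \<le> inverse (real (Suc N2))" using n by (intro le_imp_inverse_le) auto
    then have r: "cball x ?r \<subseteq> cball x e" using N2 by (intro subset_cball) linarith
    have "conv (partial i (mol n)) V x = conv (mol n) (W i) x"
    \<comment> \<open>Either the ball misses K and both convolutions vanish at x, or it lies inside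
      D and the weak derivative may be moved.\<close>
    proof (cases "cball x e \<inter> K = {}")
      case True
      then have o: "y \<notin> K" if "y \<in> cball x ?r" for y using r that by blast
      show ?thesis
        using conv_eq_0[OF kernel_partial[OF mol_kernel i], where x = x and v = V] conv_eq_0[OF mol_kernel, where x = x and v = "W i"] o V(3) W(3)[OF i] by simp
    next
      case False
      then have cD: "cball x ?r \<subseteq> D" using e(2) r by blast
      have oD: "y \<notin> K" if "y \<notin> D" for y using K(2) that by blast
      show ?thesis
        by (rule conv_weak_partial[OF mol_kernel open_D cD wg i sq_intD(1)[OF V(1)] V(3)[OF oD] V(4) sq_intD(1)[OF W(1)[OF i]] W(3)[OF i oD] W(4)[OF i]])
    qed
    then show ?thesis by (simp add: conv_partial[OF mol_kernel V(2) i])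
  qed
  define N where "N = max N1 N2"
  define f where "f n = conv (mol (n + N)) V" for n
  have ft: "f n \<in> test_functions D" for n unfolding f_def N_def by (rule N1) simp
  show ?thesis
  proof (rule H10_gradient_limit[OF H10_gradient_test[OF ft] L2])
    have VL: "V \<in> L2 D" by (rule sq_int_L2(1)[OF V(1) bsets])
    have "(\<lambda>n. L2_norm D (\<lambda>x. f n x - V x)) \<longlonglongrightarrow> 0"
      unfolding f_def by (rule LIMSEQ_ignore_initial_segment[OF conv_mol_tendsto[OF V(1,2) bsets]])
    moreover have "L2_norm D (\<lambda>x. f n x - V x) = L2_norm D (\<lambda>x. f n x - v x)" for n
    proof (rule L2_norm_cong_AE)
      show "AE x in lebesgue_on D. f n x - V x = f n x - v x" using V(4) by eventually_elim simp
    qed (use L2_measurable[OF VL] L2_measurable[OF L2(1)] L2_measurable[OF test_function_C1(1)[OF ft]] in measurable)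
    ultimately show "(\<lambda>n. L2_norm D (\<lambda>x. f n x - v x)) \<longlonglongrightarrow> 0" by (simp only:)
    show "(\<lambda>n. L2_norm D (\<lambda>x. grad (f n) x - g x)) \<longlonglongrightarrow> 0"
    proof (rule L2_components_tendsto)
      fix i :: 'a assume i: "i \<in> Basis"
      show "(\<lambda>x. (grad (f n) x - g x) \<bullet> i) \<in> L2 D" for n
        using i by (intro L2_component(1)[OF L2_diff(1)[OF test_function_C1(2)[OF ft] L2(2)]]) simp
      have WL: "W i \<in> L2 D" by (rule sq_int_L2(1)[OF W(1)[OF i] bsets])
      have "(\<lambda>n. L2_norm D (\<lambda>x. conv (mol (n + N)) (W i) x - W i x)) \<longlonglongrightarrow> 0"
        by (rule LIMSEQ_ignore_initial_segment[OF conv_mol_tendsto[OF W(1,2)[OF i] bsets]])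
      moreover have "L2_norm D (\<lambda>x. conv (mol (n + N)) (W i) x - W i x) = L2_norm D (\<lambda>x. (grad (f n) x - g x) \<bullet> i)" for n
      proof (rule L2_norm_cong_AE)
        have "n + N \<ge> N2" by (simp add: N_def)
        show "AE x in lebesgue_on D. conv (mol (n + N)) (W i) x - W i x = (grad (f n) x - g x) \<bullet> i"
          using W(4)[OF i] by eventually_elim (simp add: inner_diff_left i f_def P[OF \<open>n + N \<ge> N2\<close> i])
        have "conv (mol (n + N)) (W i) \<in> L2 D" by (intro sq_int_L2(1)[OF conv_mol_sq_int] W i bsets)
        then show "(\<lambda>x. conv (mol (n + N)) (W i) x - W i x) \<in> borel_measurable (lebesgue_on D)"
          using WL by (intro borel_measurable_diff L2_measurable)
        show "(\<lambda>x. (grad (f n) x - g x) \<bullet> i) \<in> borel_measurable (lebesgue_on D)"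
          using L2_measurable[OF test_function_C1(2)[OF ft]] L2_measurable[OF L2(2)] by measurable
      qed
      ultimately show "(\<lambda>n. L2_norm D (\<lambda>x. (grad (f n) x - g x) \<bullet> i)) \<longlonglongrightarrow> 0" by (simp only:)
    qed
  qed
qed

lemma grad_zero_outside:
  "compact K \<Longrightarrow> (\<And>x. x \<notin> K \<Longrightarrow> f x = 0) \<Longrightarrow> x \<notin> K \<Longrightarrow> grad f x = 0"
  by (simp add: grad_def partial_eq_0[OF compact_imp_closed])

lemma H10_gradient_AE_seq:
  assumes "H10_gradient D u g"
  obtains \<phi> where "\<And>n. \<phi> n \<in> test_functions D" "(\<lambda>n. L2_norm D (\<lambda>x. \<phi> n x - u x)) \<longlonglongrightarrow> 0"
    "(\<lambda>n. L2_norm D (\<lambda>x. grad (\<phi> n) x - g x)) \<longlonglongrightarrow> 0" "AE x in lebesgue_on D. (\<lambda>n. \<phi> n x) \<longlonglongrightarrow> u x"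
proof -
  obtain \<phi> where \<phi>: "\<forall>n. \<phi> n \<in> test_functions D" "(\<lambda>n. L2_norm D (\<lambda>x. \<phi> n x - u x)) \<longlonglongrightarrow> 0"
    "(\<lambda>n. L2_norm D (\<lambda>x. grad (\<phi> n) x - g x)) \<longlonglongrightarrow> 0"
    by (rule H10_gradient_seq[OF assms])
  note t = test_function_C1[OF spec[OF \<phi>(1)]]
  obtain r where r: "strict_mono r" "AE x in lebesgue_on D. (\<lambda>n. \<phi> (r n) x) \<longlonglongrightarrow> u x"
    by (rule L2_AE_subseq[OF t(1) H10_gradient_L2(1)[OF assms] \<phi>(2)])
  show thesis
  proof (rule that[of "\<lambda>n. \<phi> (r n)"])
    show "(\<lambda>n. L2_norm D (\<lambda>x. \<phi> (r n) x - u x)) \<longlonglongrightarrow> 0"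
      using LIMSEQ_subseq_LIMSEQ[OF \<phi>(2) r(1)] by (simp add: comp_def)
    show "(\<lambda>n. L2_norm D (\<lambda>x. grad (\<phi> (r n)) x - g x)) \<longlonglongrightarrow> 0"
      using LIMSEQ_subseq_LIMSEQ[OF \<phi>(3) r(1)] by (simp add: comp_def)
  qed (use \<phi>(1) r(2) in auto)
qed

subsection \<open>Chain and product rules\<close>

lemma grad_chain:
  assumes "f differentiable (at x)" "(G has_real_derivative G') (at (f x))"
  shows "grad (\<lambda>x. G (f x)) x = G' *\<^sub>R grad f x"
  using partial_chain[OF assms] by (simp add: grad_def scaleR_sum_right)

text \<open>The bound on G' makes G a contraction, which settles the functions in L2. For the
  gradients G' is only continuous, and the almost everywhere convergent subsequence together with
  dominated convergence takes over.\<close>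

lemma H10_gradient_chain:
  assumes u: "H10_gradient D u g"
    and G: "\<And>t. (G has_real_derivative G' t) (at t)" "continuous_on UNIV G'" "\<And>t. \<bar>G' t\<bar> \<le> 1" "G 0 = 0"
  shows "H10_gradient D (\<lambda>x. G (u x)) (\<lambda>x. G' (u x) *\<^sub>R g x)"
proof -
  obtain \<phi> where \<phi>: "\<And>n. \<phi> n \<in> test_functions D" "(\<lambda>n. L2_norm D (\<lambda>x. \<phi> n x - u x)) \<longlonglongrightarrow> 0"
    "(\<lambda>n. L2_norm D (\<lambda>x. grad (\<phi> n) x - g x)) \<longlonglongrightarrow> 0" "AE x in lebesgue_on D. (\<lambda>n. \<phi> n x) \<longlonglongrightarrow> u x"
    using H10_gradient_AE_seq[OF u] by blast
  note t = test_function_C1[OF \<phi>(1)] and l = H10_gradient_L2[OF u]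
  have Gc: "continuous_on UNIV G" using G(1) by (auto intro: DERIV_isCont continuous_at_imp_continuous_on)
  have [measurable]: "G \<in> borel_measurable borel" "G' \<in> borel_measurable borel"
    using Gc G(2) by (auto intro: borel_measurable_continuous_onI)
  note [measurable] = L2_measurable[OF l(1)] L2_measurable[OF l(2)] L2_measurable[OF t(1)] L2_measurable[OF t(2)]
  have Lip: "\<bar>G s - G r\<bar> \<le> \<bar>s - r\<bar>" for s r
  proof (cases "r = s")
    case False
    then obtain z where "\<bar>G s - G r\<bar> = \<bar>s - r\<bar> * \<bar>G' z\<bar>"
    proof (cases "r < s")
      case True
      then show ?thesis using MVT2[of r s G G'] G(1) that by (auto simp: abs_mult)
    next
      case False
      then have "s < r" using \<open>r \<noteq> s\<close> by simp
      then show ?thesis using MVT2[of s r G G'] G(1) that by (metis abs_minus_commute abs_mult)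
    qed
    then show ?thesis using G(3)[of z] mult_left_mono[of "\<bar>G' z\<bar>" 1 "\<bar>s - r\<bar>"] by simp
  qed simp
  have gr: "grad (\<lambda>x. G (\<phi> n x)) x = G' (\<phi> n x) *\<^sub>R grad (\<phi> n) x" for n x
    by (rule grad_chain[OF smooth_differentiable[OF test_functions_smooth[OF \<phi>(1)]] G(1)])
  have H: "H10_gradient D (\<lambda>x. G (\<phi> n x)) (\<lambda>x. G' (\<phi> n x) *\<^sub>R grad (\<phi> n) x)" for n
  proof -
    obtain K where K: "compact K" "K \<subseteq> D" "\<And>x. x \<notin> K \<Longrightarrow> \<phi> n x = 0" using \<phi>(1)[of n] by (auto simp: test_functions_iff)
    have sm: "smooth (\<phi> n)" using \<phi>(1) by (rule test_functions_smooth)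
    have d: "(\<lambda>x. G (\<phi> n x)) differentiable (at x)" for x
      by (rule differentiable_chain[OF smooth_differentiable[OF sm] G(1)])
    have p: "partial i (\<lambda>x. G (\<phi> n x)) = (\<lambda>x. G' (\<phi> n x) * partial i (\<phi> n) x)" for i
      using partial_chain[OF smooth_differentiable[OF sm] G(1)] by blast
    have c: "continuous_on UNIV (partial i (\<lambda>x. G (\<phi> n x)))" if "i \<in> Basis" for i
      unfolding p using smooth_continuous[OF sm] smooth_continuous[OF smooth_partial[OF sm that]]
      by (intro continuous_intros continuous_on_compose2[OF G(2)]) auto
    have z: "G (\<phi> n x) = 0" if "x \<notin> K" for x using K(3)[OF that] G(4) by simp
    \<comment> \<open>G is merely C^1, so G composed with \<phi> n need not be a test function; the
      criterion for compact support applies instead, thanks to G 0 = 0.\<close>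
    have "H10_gradient D (\<lambda>x. G (\<phi> n x)) (grad (\<lambda>x. G (\<phi> n x)))"
      by (rule H10_gradient_compact_support[OF C1_weak_gradient[OF d c K(1) z] C1_support_L2(1,2)[OF d c K(1) z] K(1,2) z
            grad_zero_outside[OF K(1) z]])
    then show ?thesis unfolding gr [abs_def] .
  qed
  have b1: "AE x in lebesgue_on D. norm (G (u x)) \<le> norm (u x)" using Lip[of _ 0] G(4) by simp
  have b2: "AE x in lebesgue_on D. norm (G' (u x) *\<^sub>R g x) \<le> norm (g x)" using G(3) by (simp add: mult_left_le_one_le)
  show ?thesis
  proof (rule H10_gradient_limit[OF H])
    show "(\<lambda>x. G (u x)) \<in> L2 D" by (rule L2_bound(1)[OF l(1) _ b1]) measurable
    show "(\<lambda>x. G' (u x) *\<^sub>R g x) \<in> L2 D" by (rule L2_bound(1)[OF l(2) _ b2]) measurable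
    show "(\<lambda>n. L2_norm D (\<lambda>x. G (\<phi> n x) - G (u x))) \<longlonglongrightarrow> 0"
    proof (rule L2_tendsto_bound[OF L2_diff(1)[OF t(1) l(1)] \<phi>(2)])
      show "AE x in lebesgue_on D. norm (G (\<phi> n x) - G (u x)) \<le> 1 * norm (\<phi> n x - u x)" for n using Lip by simp
      show "(\<lambda>x. G (\<phi> n x) - G (u x)) \<in> borel_measurable (lebesgue_on D)" for n by measurable
    qed simp
    \<comment> \<open>One summand carries the L2 convergence of the gradients with a bounded factor,
      the other the pointwise convergence of the factor against the fixed gradient g.\<close>
    have eq: "(\<lambda>x. G' (\<phi> n x) *\<^sub>R grad (\<phi> n) x - G' (u x) *\<^sub>R g x)
      = (\<lambda>x. G' (\<phi> n x) *\<^sub>R (grad (\<phi> n) x - g x) + (G' (\<phi> n x) - G' (u x)) *\<^sub>R g x)" for n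
      by (simp add: algebra_simps)
    have b3: "AE x in lebesgue_on D. norm (G' (\<phi> n x) *\<^sub>R (grad (\<phi> n) x - g x)) \<le> norm (grad (\<phi> n) x - g x)" for n
      using G(3) by (simp add: mult_left_le_one_le)
    have b4: "AE x in lebesgue_on D. norm ((G' (\<phi> n x) - G' (u x)) *\<^sub>R g x) \<le> 2 * norm (g x)" for n
    proof (rule AE_I2)
      fix x
      have "\<bar>G' (\<phi> n x) - G' (u x)\<bar> \<le> 2" using G(3)[of "\<phi> n x"] G(3)[of "u x"] by linarith
      then show "norm ((G' (\<phi> n x) - G' (u x)) *\<^sub>R g x) \<le> 2 * norm (g x)" by (simp add: mult_right_mono)
    qed
    show "(\<lambda>n. L2_norm D (\<lambda>x. G' (\<phi> n x) *\<^sub>R grad (\<phi> n) x - G' (u x) *\<^sub>R g x)) \<longlonglongrightarrow> 0"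
      unfolding eq
    proof (rule L2_tendsto_add)
      show "(\<lambda>x. G' (\<phi> n x) *\<^sub>R (grad (\<phi> n) x - g x)) \<in> L2 D" for n
        by (rule L2_bound(1)[OF L2_diff(1)[OF t(2) l(2)] _ b3]) measurable
      show "(\<lambda>n. L2_norm D (\<lambda>x. G' (\<phi> n x) *\<^sub>R (grad (\<phi> n) x - g x))) \<longlonglongrightarrow> 0"
        using b3 by (intro L2_tendsto_bound[OF L2_diff(1)[OF t(2) l(2)] \<phi>(3), where c = 1]) (auto, measurable)
      show "(\<lambda>x. (G' (\<phi> n x) - G' (u x)) *\<^sub>R g x) \<in> L2 D" for n
        using b4 by (intro L2_bound(1)[OF L2_scaleR(1)[OF l(2), of 2]]) (auto, measurable)
      show "(\<lambda>n. L2_norm D (\<lambda>x. (G' (\<phi> n x) - G' (u x)) *\<^sub>R g x)) \<longlonglongrightarrow> 0"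
      proof (rule L2_dominated[OF l(2) _ b4])
        show "AE x in lebesgue_on D. (\<lambda>n. (G' (\<phi> n x) - G' (u x)) *\<^sub>R g x) \<longlonglongrightarrow> 0"
          using \<phi>(4)
        proof eventually_elim
          case (elim x)
          have "isCont G' (u x)" using G(2) by (simp add: continuous_on_eq_continuous_at)
          then have "(\<lambda>n. G' (\<phi> n x)) \<longlonglongrightarrow> G' (u x)" using elim by (rule isCont_tendsto_compose)
          then have "(\<lambda>n. (G' (\<phi> n x) - G' (u x)) *\<^sub>R g x) \<longlonglongrightarrow> (G' (u x) - G' (u x)) *\<^sub>R g x" by (intro tendsto_intros)
          then show ?case by simp
        qed
      qed measurable
    qed
  qed
qed

end

section \<open>Scaled sines as smooth bounded truncations\<close>

lemma tendsto_scaled_sin: "(\<lambda>n. real (Suc n) * sin (t / real (Suc n))) \<longlonglongrightarrow> t"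
proof (cases "t = 0")
  case False
  have "((\<lambda>h. (sin (0 + h) - sin 0) / h) \<longlongrightarrow> cos 0) (at (0::real))"
    using DERIV_sin[of "0::real"] unfolding DERIV_def by simp
  then have s: "((\<lambda>h. sin h / h) \<longlongrightarrow> 1) (at (0::real))" by simp
  have "(\<lambda>n. t * inverse (real (Suc n))) \<longlonglongrightarrow> t * 0" by (intro tendsto_intros LIMSEQ_inverse_real_of_nat)
  then have "filterlim (\<lambda>n. t * inverse (real (Suc n))) (at 0) sequentially"
    unfolding filterlim_at using False by simp
  from filterlim_compose[OF s this]
  have "(\<lambda>n. t * (sin (t * inverse (real (Suc n))) / (t * inverse (real (Suc n))))) \<longlonglongrightarrow> t * 1" by (intro tendsto_intros)
  moreover have "t * (sin (t * inverse m) / (t * inverse m)) = m * sin (t / m)" if "m \<noteq> 0" for m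
    using False that by (simp add: divide_simps)
  ultimately show ?thesis by (simp del: of_nat_Suc)
qed simp

lemma tendsto_scaled_cos: "(\<lambda>n. cos (t / real (Suc n))) \<longlonglongrightarrow> 1"
proof -
  have "(\<lambda>n. cos (t * inverse (real (Suc n)))) \<longlonglongrightarrow> cos (t * 0)" by (intro tendsto_intros LIMSEQ_inverse_real_of_nat)
  then show ?thesis by (simp add: divide_inverse)
qed

lemma scaled_sin_bounds:
  fixes M s t :: real
  assumes "M > 0"
  shows "\<bar>M * sin (s / M) - M * sin (t / M)\<bar> \<le> \<bar>s - t\<bar>" "\<bar>M * sin (s / M)\<bar> \<le> \<bar>s\<bar>" "\<bar>M * sin (s / M)\<bar> \<le> M"
proof -
  have L: "\<bar>sin a - sin b\<bar> \<le> \<bar>a - b\<bar>" for a b :: real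
  proof -
    have "sin a - sin b = 2 * sin ((a - b) / 2) * cos ((a + b) / 2)" by (rule sin_diff_sin)
    then have "\<bar>sin a - sin b\<bar> = 2 * (\<bar>sin ((a - b) / 2)\<bar> * \<bar>cos ((a + b) / 2)\<bar>)" by (simp add: abs_mult)
    also have "\<dots> \<le> 2 * (\<bar>(a - b) / 2\<bar> * 1)"
      by (intro mult_left_mono mult_mono abs_sin_x_le_abs_x abs_cos_le_one) auto
    finally show ?thesis by simp
  qed
  have "\<bar>M * sin (s / M) - M * sin (t / M)\<bar> = M * \<bar>sin (s / M) - sin (t / M)\<bar>"
    by (simp only: right_diff_distrib[symmetric] abs_mult abs_of_pos[OF assms])
  also have "\<dots> \<le> M * \<bar>s / M - t / M\<bar>" using assms L by (intro mult_left_mono) auto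
  also have "\<dots> = \<bar>s - t\<bar>" using assms by (simp add: diff_divide_distrib[symmetric])
  finally show *: "\<bar>M * sin (s / M) - M * sin (t / M)\<bar> \<le> \<bar>s - t\<bar>" .
  show "\<bar>M * sin (s / M)\<bar> \<le> M" using assms mult_left_mono[OF abs_sin_le_one, of M "s/M"] by (simp add: abs_mult)
  show "\<bar>M * sin (s / M)\<bar> \<le> \<bar>s\<bar>"
    using assms mult_left_mono[OF abs_sin_x_le_abs_x, of M "s/M"] by (simp add: abs_mult)
qed

context bounded_open begin

text \<open>Testing the weak gradient of w with \<phi> \<psi> in place of \<psi> gives the product
  rule. The product vanishes outside the support of \<phi>, so no boundary behaviour of w
  enters.\<close>

lemma H10_gradient_mult_test:
  assumes w: "has_weak_gradient D w \<omega>" "w \<in> L2 D" "\<omega> \<in> L2 D" and \<phi>: "\<phi> \<in> test_functions D"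
  shows "H10_gradient D (\<lambda>x. w x * \<phi> x) (\<lambda>x. w x *\<^sub>R grad \<phi> x + \<phi> x *\<^sub>R \<omega> x)"
proof -
  obtain K where K: "compact K" "K \<subseteq> D" "\<And>x. x \<notin> K \<Longrightarrow> \<phi> x = 0" using \<phi> by (auto simp: test_functions_iff)
  have sm: "smooth \<phi>" using \<phi> by (rule test_functions_smooth)
  note t = test_function_C1[OF \<phi>]
  note [measurable] = L2_measurable[OF w(2)] L2_measurable[OF w(3)] L2_measurable[OF t(1)] L2_measurable[OF t(2)]
  obtain B where B: "\<And>x. \<bar>\<phi> x\<bar> \<le> B" using t(7) by blast
  have g0: "grad \<phi> x = 0" if "x \<notin> K" for x by (rule grad_zero_outside[OF K(1,3) that])
  have gc: "continuous_on UNIV (grad \<phi>)"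
    unfolding grad_def [abs_def] by (intro continuous_intros smooth_continuous smooth_partial sm)
  obtain B' where B': "\<And>x. norm (grad \<phi> x) \<le> B'" using continuous_compact_support_L2(3)[OF gc K(1) g0 lmeas] by blast
  have B0: "0 \<le> B" "0 \<le> B'" using order_trans[OF abs_ge_zero B] order_trans[OF norm_ge_zero B'] by auto
  have L1: "(\<lambda>x. w x * \<phi> x) \<in> L2 D"
    using B B0 by (intro L2_bound(1)[OF L2_scaleR(1)[OF w(2), of B]]) (auto simp: abs_mult mult.commute intro!: AE_I2 mult_right_mono)
  have L21: "(\<lambda>x. w x *\<^sub>R grad \<phi> x) \<in> L2 D"
  proof (rule L2_bound(1)[OF L2_scaleR(1)[OF w(2), of B']])
    have "\<bar>w x\<bar> * norm (grad \<phi> x) \<le> \<bar>w x\<bar> * B'" for x by (intro mult_left_mono B') auto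
    then show "AE x in lebesgue_on D. norm (w x *\<^sub>R grad \<phi> x) \<le> norm (B' *\<^sub>R w x)"
      using B0 by (intro AE_I2) (simp add: abs_mult mult.commute)
  qed measurable
  have L22: "(\<lambda>x. \<phi> x *\<^sub>R \<omega> x) \<in> L2 D"
    using B B0 by (intro L2_bound(1)[OF L2_scaleR(1)[OF w(3), of B]]) (auto intro!: AE_I2 mult_right_mono)
  have L2: "(\<lambda>x. w x *\<^sub>R grad \<phi> x + \<phi> x *\<^sub>R \<omega> x) \<in> L2 D" by (rule L2_add(1)[OF L21 L22])
  have wl: "locally_integrable D w" "locally_integrable D \<omega>" using w by (auto simp: has_weak_gradient_def)
  have "has_weak_gradient D (\<lambda>x. w x * \<phi> x) (\<lambda>x. w x *\<^sub>R grad \<phi> x + \<phi> x *\<^sub>R \<omega> x)"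
    unfolding has_weak_gradient_iff
  proof (intro conjI ballI)
    show "locally_integrable D (\<lambda>x. w x * \<phi> x)" "locally_integrable D (\<lambda>x. w x *\<^sub>R grad \<phi> x + \<phi> x *\<^sub>R \<omega> x)"
      using L1 L2 L2_locally_integrable lmeas by blast+
    fix \<psi> and i :: 'a assume \<psi>: "\<psi> \<in> test_functions D" and i: "i \<in> Basis"
    have sp: "smooth \<psi>" using \<psi> by (rule test_functions_smooth)
    have pp: "partial i (\<lambda>x. \<phi> x * \<psi> x) = (\<lambda>x. \<phi> x * partial i \<psi> x + partial i \<phi> x * \<psi> x)"
      using partial_mult[OF smooth_differentiable[OF sm] smooth_differentiable[OF sp]] by blast
    have t1: "(\<lambda>x. \<phi> x * \<psi> x) \<in> test_functions D" by (rule test_functions_mult[OF \<phi> sp])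
    have t2: "(\<lambda>x. \<phi> x * partial i \<psi> x) \<in> test_functions D" by (rule test_functions_mult[OF \<phi> smooth_partial[OF sp i]])
    have t3: "(\<lambda>x. partial i \<phi> x * \<psi> x) \<in> test_functions D" by (rule test_functions_mult[OF test_functions_partial[OF \<phi> i] sp])
    note i2 = test_function_integrable[OF wl(1) open_D t2] and i3 = test_function_integrable[OF wl(1) open_D t3]
      and i1 = test_function_integrable[OF locally_integrable_component[OF wl(2), of i] open_D t1]
    have "(LINT x|lebesgue_on D. w x * partial i (\<lambda>x. \<phi> x * \<psi> x) x) = - (LINT x|lebesgue_on D. (\<omega> x \<bullet> i) * (\<phi> x * \<psi> x))"
      using w(1) t1 i unfolding has_weak_gradient_iff by blast
    also have "(LINT x|lebesgue_on D. w x * partial i (\<lambda>x. \<phi> x * \<psi> x) x) =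
      (LINT x|lebesgue_on D. w x * (\<phi> x * partial i \<psi> x)) + (LINT x|lebesgue_on D. w x * (partial i \<phi> x * \<psi> x))"
      unfolding pp distrib_left by (rule Bochner_Integration.integral_add[OF i2 i3])
    finally have e: "(LINT x|lebesgue_on D. w x * (\<phi> x * partial i \<psi> x)) =
       - ((LINT x|lebesgue_on D. w x * (partial i \<phi> x * \<psi> x)) + (LINT x|lebesgue_on D. (\<omega> x \<bullet> i) * (\<phi> x * \<psi> x)))" by simp
    have "(LINT x|lebesgue_on D. ((w x *\<^sub>R grad \<phi> x + \<phi> x *\<^sub>R \<omega> x) \<bullet> i) * \<psi> x)
      = (LINT x|lebesgue_on D. w x * (partial i \<phi> x * \<psi> x) + (\<omega> x \<bullet> i) * (\<phi> x * \<psi> x))"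
      by (intro Bochner_Integration.integral_cong) (auto simp: inner_add_left i algebra_simps)
    also have "\<dots> = (LINT x|lebesgue_on D. w x * (partial i \<phi> x * \<psi> x)) + (LINT x|lebesgue_on D. (\<omega> x \<bullet> i) * (\<phi> x * \<psi> x))"
      by (rule Bochner_Integration.integral_add[OF i3 i1])
    finally show "(LINT x|lebesgue_on D. w x * \<phi> x * partial i \<psi> x) = - (LINT x|lebesgue_on D. ((w x *\<^sub>R grad \<phi> x + \<phi> x *\<^sub>R \<omega> x) \<bullet> i) * \<psi> x)"
      using e by (simp add: mult.assoc)
  qed
  then show ?thesis
    by (rule H10_gradient_compact_support[OF _ L1 L2 K(1,2)]) (simp_all add: K(3) g0)
qed

text \<open>Truncating by \<open>M sin (t / M)\<close> is bounded and maps test functions to test functions.\<close>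

lemma H10_gradient_mult_sin:
  assumes w: "has_weak_gradient D w \<omega>" "w \<in> L2 D" "\<omega> \<in> L2 D" "AE x in lebesgue_on D. \<bar>w x\<bar> \<le> B"
    and u: "H10_gradient D u g" and M: "M > 0" and B: "B \<ge> 0"
  defines "T \<equiv> \<lambda>t. M * sin (t / M)"
  shows "H10_gradient D (\<lambda>x. w x * T (u x)) (\<lambda>x. (w x * cos (u x / M)) *\<^sub>R g x + T (u x) *\<^sub>R \<omega> x)"
proof -
  obtain \<phi> where \<phi>: "\<And>n. \<phi> n \<in> test_functions D" "(\<lambda>n. L2_norm D (\<lambda>x. \<phi> n x - u x)) \<longlonglongrightarrow> 0"
    "(\<lambda>n. L2_norm D (\<lambda>x. grad (\<phi> n) x - g x)) \<longlonglongrightarrow> 0" "AE x in lebesgue_on D. (\<lambda>n. \<phi> n x) \<longlonglongrightarrow> u x"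
    using H10_gradient_AE_seq[OF u] by blast
  note t = test_function_C1[OF \<phi>(1)] and l = H10_gradient_L2[OF u]
  note [measurable] = L2_measurable[OF l(1)] L2_measurable[OF l(2)] L2_measurable[OF t(1)] L2_measurable[OF t(2)]
     L2_measurable[OF w(2)] L2_measurable[OF w(3)]
  have Tm [measurable]: "T \<in> borel_measurable borel" unfolding T_def by measurable
  have Tb: "\<bar>T s - T t\<bar> \<le> \<bar>s - t\<bar>" "\<bar>T s\<bar> \<le> \<bar>s\<bar>" "\<bar>T s\<bar> \<le> M" for s t
    unfolding T_def by (rule scaled_sin_bounds[OF M])+
  have T': "(T has_real_derivative cos (s / M)) (at s)" for s
    unfolding T_def using M by (auto intro!: derivative_eq_intros)
  have tT: "(\<lambda>x. T (\<phi> n x)) \<in> test_functions D" for n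
  proof -
    obtain K where K: "compact K" "K \<subseteq> D" "\<And>x. x \<notin> K \<Longrightarrow> \<phi> n x = 0" using \<phi>(1)[of n] by (auto simp: test_functions_iff)
    have "smooth (\<lambda>x. M * sin (\<phi> n x * inverse M))"
      using test_functions_smooth[OF \<phi>(1)] by (intro smooth_mult smooth_const smooth_sin)
    then show ?thesis using K by (intro test_functionsI[of _ K]) (auto simp: T_def divide_inverse)
  qed
  have gT: "grad (\<lambda>x. T (\<phi> n x)) x = cos (\<phi> n x / M) *\<^sub>R grad (\<phi> n) x" for n x
    by (rule grad_chain[OF smooth_differentiable[OF test_functions_smooth[OF \<phi>(1)]] T'])
  have H: "H10_gradient D (\<lambda>x. w x * T (\<phi> n x)) (\<lambda>x. w x *\<^sub>R (cos (\<phi> n x / M) *\<^sub>R grad (\<phi> n) x) + T (\<phi> n x) *\<^sub>R \<omega> x)" for n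
    using H10_gradient_mult_test[OF w(1-3) tT] unfolding gT .
  have b1: "AE x in lebesgue_on D. norm (w x * T (u x)) \<le> norm (B *\<^sub>R u x)"
    using w(4) by eventually_elim (use Tb(2) B in \<open>auto simp: abs_mult intro!: mult_mono\<close>)
  have b2: "AE x in lebesgue_on D. norm ((w x * cos (u x / M)) *\<^sub>R g x) \<le> norm (B *\<^sub>R g x)"
    using w(4)
  proof eventually_elim
    case (elim x)
    have "\<bar>w x\<bar> * \<bar>cos (u x / M)\<bar> \<le> B * 1" using elim B by (intro mult_mono) auto
    then show ?case using B by (simp add: abs_mult mult_right_mono)
  qed
  have b3: "AE x in lebesgue_on D. norm (T (u x) *\<^sub>R \<omega> x) \<le> norm (M *\<^sub>R \<omega> x)"
    using Tb(3) M by (intro AE_I2) (simp add: mult_right_mono)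
  have L: "(\<lambda>x. w x * T (u x)) \<in> L2 D" by (rule L2_bound(1)[OF L2_scaleR(1)[OF l(1)] _ b1]) measurable
  have L': "(\<lambda>x. (w x * cos (u x / M)) *\<^sub>R g x + T (u x) *\<^sub>R \<omega> x) \<in> L2 D"
    by (rule L2_add(1)[OF L2_bound(1)[OF L2_scaleR(1)[OF l(2)] _ b2] L2_bound(1)[OF L2_scaleR(1)[OF w(3)] _ b3]]) measurable
  show ?thesis
  proof (rule H10_gradient_limit[OF H L L'])
    show "(\<lambda>n. L2_norm D (\<lambda>x. w x * T (\<phi> n x) - w x * T (u x))) \<longlonglongrightarrow> 0"
    proof (rule L2_tendsto_bound[OF L2_diff(1)[OF t(1) l(1)] \<phi>(2) _ _ B])
      show "AE x in lebesgue_on D. norm (w x * T (\<phi> n x) - w x * T (u x)) \<le> B * norm (\<phi> n x - u x)" for n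
        using w(4) by eventually_elim (use Tb(1) B in \<open>auto simp: right_diff_distrib[symmetric] abs_mult intro!: mult_mono\<close>)
    qed measurable
    \<comment> \<open>Three sources of error: the gradients of the approximations, the cosine factor
      in front of g, and the truncated values in front of \<omega>. The first converges in L2, the
      other two by domination; the last has a dominating function because T is bounded by M.\<close>
    have eq: "(\<lambda>x. (w x *\<^sub>R (cos (\<phi> n x / M) *\<^sub>R grad (\<phi> n) x) + T (\<phi> n x) *\<^sub>R \<omega> x) - ((w x * cos (u x / M)) *\<^sub>R g x + T (u x) *\<^sub>R \<omega> x))
      = (\<lambda>x. (w x * cos (\<phi> n x / M)) *\<^sub>R (grad (\<phi> n) x - g x) + ((w x * (cos (\<phi> n x / M) - cos (u x / M))) *\<^sub>R g x + (T (\<phi> n x) - T (u x)) *\<^sub>R \<omega> x))" for n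
      by (simp add: algebra_simps)
    have c1: "AE x in lebesgue_on D. norm ((w x * cos (\<phi> n x / M)) *\<^sub>R (grad (\<phi> n) x - g x)) \<le> B * norm (grad (\<phi> n) x - g x)" for n
      using w(4)
    proof eventually_elim
      case (elim x)
      have "\<bar>w x\<bar> * \<bar>cos (\<phi> n x / M)\<bar> \<le> B * 1" using elim B by (intro mult_mono) auto
      then show ?case using B by (simp add: abs_mult mult_right_mono)
    qed
    have c2: "AE x in lebesgue_on D. norm ((w x * (cos (\<phi> n x / M) - cos (u x / M))) *\<^sub>R g x) \<le> (B * 2) * norm (g x)" for n
      using w(4)
    proof eventually_elim
      case (elim x)
      have "\<bar>cos (\<phi> n x / M) - cos (u x / M)\<bar> \<le> 2"
        using abs_cos_le_one[of "\<phi> n x / M"] abs_cos_le_one[of "u x / M"] by linarith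
      then have "\<bar>w x\<bar> * \<bar>cos (\<phi> n x / M) - cos (u x / M)\<bar> \<le> B * 2" using elim B by (intro mult_mono) auto
      then show ?case unfolding norm_scaleR abs_mult by (intro mult_right_mono) auto
    qed
    have c3: "AE x in lebesgue_on D. norm ((T (\<phi> n x) - T (u x)) *\<^sub>R \<omega> x) \<le> (2 * M) * norm (\<omega> x)" for n
    proof (rule AE_I2)
      fix x
      have "\<bar>T (\<phi> n x) - T (u x)\<bar> \<le> 2 * M" using Tb(3)[of "\<phi> n x"] Tb(3)[of "u x"] by linarith
      then show "norm ((T (\<phi> n x) - T (u x)) *\<^sub>R \<omega> x) \<le> (2 * M) * norm (\<omega> x)" unfolding norm_scaleR by (intro mult_right_mono) auto
    qed
    have sc: "norm (f x) \<le> norm (k *\<^sub>R h x)" if "norm (f x) \<le> k * norm (h x)" for f h :: "'a \<Rightarrow> 'a" and k x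
      using that abs_ge_self[of k] mult_right_mono[of k "\<bar>k\<bar>" "norm (h x)"] by simp
    have l1: "(\<lambda>x. (w x * cos (\<phi> n x / M)) *\<^sub>R (grad (\<phi> n) x - g x)) \<in> L2 D" for n
      by (rule L2_bound(1)[OF L2_scaleR(1)[OF L2_diff(1)[OF t(2) l(2)], of B]])
         (measurable, use c1[of n] in \<open>eventually_elim, intro sc\<close>)
    have l2: "(\<lambda>x. (w x * (cos (\<phi> n x / M) - cos (u x / M))) *\<^sub>R g x) \<in> L2 D" for n
      by (rule L2_bound(1)[OF L2_scaleR(1)[OF l(2), of "B * 2"]])
         (measurable, use c2[of n] in \<open>eventually_elim, intro sc\<close>)
    have l3: "(\<lambda>x. (T (\<phi> n x) - T (u x)) *\<^sub>R \<omega> x) \<in> L2 D" for n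
      by (rule L2_bound(1)[OF L2_scaleR(1)[OF w(3), of "2 * M"]])
         (measurable, use c3[of n] in \<open>eventually_elim, intro sc\<close>)
    have Tc: "isCont T s" for s using T' by (rule DERIV_isCont)
    show "(\<lambda>n. L2_norm D (\<lambda>x. (w x *\<^sub>R (cos (\<phi> n x / M) *\<^sub>R grad (\<phi> n) x) + T (\<phi> n x) *\<^sub>R \<omega> x) - ((w x * cos (u x / M)) *\<^sub>R g x + T (u x) *\<^sub>R \<omega> x))) \<longlonglongrightarrow> 0"
      unfolding eq
    proof (intro L2_tendsto_add L2_add(1) l1 l2 l3)
      show "(\<lambda>n. L2_norm D (\<lambda>x. (w x * cos (\<phi> n x / M)) *\<^sub>R (grad (\<phi> n) x - g x))) \<longlonglongrightarrow> 0"
        by (rule L2_tendsto_bound[OF L2_diff(1)[OF t(2) l(2)] \<phi>(3) _ c1 B]) measurable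
      show "(\<lambda>n. L2_norm D (\<lambda>x. (w x * (cos (\<phi> n x / M) - cos (u x / M))) *\<^sub>R g x)) \<longlonglongrightarrow> 0"
      proof (rule L2_dominated[OF l(2) _ c2])
        show "AE x in lebesgue_on D. (\<lambda>n. (w x * (cos (\<phi> n x / M) - cos (u x / M))) *\<^sub>R g x) \<longlonglongrightarrow> 0"
          using \<phi>(4)
        proof eventually_elim
          case (elim x)
          then have "(\<lambda>n. (w x * (cos (\<phi> n x / M) - cos (u x / M))) *\<^sub>R g x) \<longlonglongrightarrow> (w x * (cos (u x / M) - cos (u x / M))) *\<^sub>R g x"
            using M by (intro tendsto_intros) auto
          then show ?case by simp
        qed
      qed measurable
      show "(\<lambda>n. L2_norm D (\<lambda>x. (T (\<phi> n x) - T (u x)) *\<^sub>R \<omega> x)) \<longlonglongrightarrow> 0"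
      proof (rule L2_dominated[OF w(3) _ c3])
        show "AE x in lebesgue_on D. (\<lambda>n. (T (\<phi> n x) - T (u x)) *\<^sub>R \<omega> x) \<longlonglongrightarrow> 0"
          using \<phi>(4)
        proof eventually_elim
          case (elim x)
          have "(\<lambda>n. T (\<phi> n x)) \<longlonglongrightarrow> T (u x)" by (rule isCont_tendsto_compose[OF Tc elim])
          then have "(\<lambda>n. (T (\<phi> n x) - T (u x)) *\<^sub>R \<omega> x) \<longlonglongrightarrow> (T (u x) - T (u x)) *\<^sub>R \<omega> x" by (intro tendsto_intros)
          then show ?case by simp
        qed
      qed measurable
    qed
  qed
qed

text \<open>Lets the scale M = n + 1 of the sine truncation tend to infinity. The bound A on u now
  dominates the truncated values in front of \<omega> uniformly in n.\<close>

lemma H10_gradient_mult: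
  assumes w: "has_weak_gradient D w \<omega>" "w \<in> L2 D" "\<omega> \<in> L2 D" "AE x in lebesgue_on D. \<bar>w x\<bar> \<le> B"
    and u: "H10_gradient D u g" "AE x in lebesgue_on D. \<bar>u x\<bar> \<le> A" and B: "B \<ge> 0" and A: "A \<ge> 0"
  shows "H10_gradient D (\<lambda>x. w x * u x) (\<lambda>x. w x *\<^sub>R g x + u x *\<^sub>R \<omega> x)"
proof -
  define T where "T n t = real (Suc n) * sin (t / real (Suc n))" for n t
  define c where "c n t = cos (t / real (Suc n))" for n and t :: real
  have H: "H10_gradient D (\<lambda>x. w x * T n (u x)) (\<lambda>x. (w x * c n (u x)) *\<^sub>R g x + T n (u x) *\<^sub>R \<omega> x)" for n
    unfolding T_def c_def by (rule H10_gradient_mult_sin[OF w u(1) _ B]) simp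
  note l = H10_gradient_L2[OF u(1)]
  note [measurable] = L2_measurable[OF l(1)] L2_measurable[OF l(2)] L2_measurable[OF w(2)] L2_measurable[OF w(3)]
  have [measurable]: "T n \<in> borel_measurable borel" "c n \<in> borel_measurable borel" for n unfolding T_def c_def by measurable
  have Tb: "\<bar>T n s\<bar> \<le> \<bar>s\<bar>" for n s unfolding T_def by (rule scaled_sin_bounds(2)) simp
  have cb: "\<bar>c n s\<bar> \<le> 1" for n s unfolding c_def by simp
  have Tl: "(\<lambda>n. T n s) \<longlonglongrightarrow> s" for s unfolding T_def by (rule tendsto_scaled_sin)
  have cl: "(\<lambda>n. c n s) \<longlonglongrightarrow> 1" for s unfolding c_def by (rule tendsto_scaled_cos)
  have b1: "AE x in lebesgue_on D. norm (w x * u x) \<le> norm (B *\<^sub>R u x)"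
    using w(4) by eventually_elim (use B in \<open>auto simp: abs_mult intro!: mult_right_mono\<close>)
  have b2: "AE x in lebesgue_on D. norm (w x *\<^sub>R g x) \<le> norm (B *\<^sub>R g x)"
    using w(4) by eventually_elim (use B in \<open>auto intro!: mult_right_mono\<close>)
  have b3: "AE x in lebesgue_on D. norm (u x *\<^sub>R \<omega> x) \<le> norm (A *\<^sub>R \<omega> x)"
    using u(2) by eventually_elim (use A in \<open>auto intro!: mult_right_mono\<close>)
  have L: "(\<lambda>x. w x * u x) \<in> L2 D" by (rule L2_bound(1)[OF L2_scaleR(1)[OF l(1)] _ b1]) measurable
  have L': "(\<lambda>x. w x *\<^sub>R g x + u x *\<^sub>R \<omega> x) \<in> L2 D"
    by (rule L2_add(1)[OF L2_bound(1)[OF L2_scaleR(1)[OF l(2)] _ b2] L2_bound(1)[OF L2_scaleR(1)[OF w(3)] _ b3]]) measurable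
  have cc: "\<bar>c n s - 1\<bar> \<le> 2" for n s using cb[of n s] by linarith
  have TT: "\<bar>T n s - s\<bar> \<le> 2 * \<bar>s\<bar>" for n s using Tb[of n s] by linarith
  have d1: "AE x in lebesgue_on D. norm (w x * T n (u x) - w x * u x) \<le> (B * 2) * norm (u x)" for n
    using w(4)
  proof eventually_elim
    case (elim x)
    have "\<bar>w x\<bar> * \<bar>T n (u x) - u x\<bar> \<le> B * (2 * \<bar>u x\<bar>)" using elim TT B by (intro mult_mono) auto
    then show ?case unfolding right_diff_distrib[symmetric] real_norm_def abs_mult by (simp only: mult.assoc)
  qed
  have d2: "AE x in lebesgue_on D. norm ((w x * (c n (u x) - 1)) *\<^sub>R g x) \<le> (B * 2) * norm (g x)" for n
    using w(4)
  proof eventually_elim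
    case (elim x)
    have "\<bar>w x\<bar> * \<bar>c n (u x) - 1\<bar> \<le> B * 2" using elim cc B by (intro mult_mono) auto
    then show ?case unfolding norm_scaleR abs_mult by (intro mult_right_mono) auto
  qed
  have d3: "AE x in lebesgue_on D. norm ((T n (u x) - u x) *\<^sub>R \<omega> x) \<le> (2 * A) * norm (\<omega> x)" for n
    using u(2)
  proof eventually_elim
    case (elim x)
    have "\<bar>T n (u x) - u x\<bar> \<le> 2 * A" using elim TT[of n "u x"] by linarith
    then show ?case unfolding norm_scaleR by (intro mult_right_mono) auto
  qed
  have sc: "norm (f x) \<le> norm (k *\<^sub>R h x)" if "norm (f x) \<le> k * norm (h x)" for f h :: "'a \<Rightarrow> 'a" and k x
    using that abs_ge_self[of k] mult_right_mono[of k "\<bar>k\<bar>" "norm (h x)"] by simp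
  have l2: "(\<lambda>x. (w x * (c n (u x) - 1)) *\<^sub>R g x) \<in> L2 D" for n
    by (rule L2_bound(1)[OF L2_scaleR(1)[OF l(2), of "B * 2"]]) (measurable, use d2[of n] in \<open>eventually_elim, intro sc\<close>)
  have l3: "(\<lambda>x. (T n (u x) - u x) *\<^sub>R \<omega> x) \<in> L2 D" for n
    by (rule L2_bound(1)[OF L2_scaleR(1)[OF w(3), of "2 * A"]]) (measurable, use d3[of n] in \<open>eventually_elim, intro sc\<close>)
  show ?thesis
  proof (rule H10_gradient_limit[OF H L L'])
    show "(\<lambda>n. L2_norm D (\<lambda>x. w x * T n (u x) - w x * u x)) \<longlonglongrightarrow> 0"
    proof (rule L2_dominated[OF l(1) _ d1])
      have "(\<lambda>n. w x * T n (u x) - w x * u x) \<longlonglongrightarrow> w x * u x - w x * u x" for x by (intro tendsto_intros Tl)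
      then show "AE x in lebesgue_on D. (\<lambda>n. w x * T n (u x) - w x * u x) \<longlonglongrightarrow> 0" by simp
    qed measurable
    have eq: "(\<lambda>x. ((w x * c n (u x)) *\<^sub>R g x + T n (u x) *\<^sub>R \<omega> x) - (w x *\<^sub>R g x + u x *\<^sub>R \<omega> x))
      = (\<lambda>x. (w x * (c n (u x) - 1)) *\<^sub>R g x + (T n (u x) - u x) *\<^sub>R \<omega> x)" for n
      by (simp add: algebra_simps)
    show "(\<lambda>n. L2_norm D (\<lambda>x. ((w x * c n (u x)) *\<^sub>R g x + T n (u x) *\<^sub>R \<omega> x) - (w x *\<^sub>R g x + u x *\<^sub>R \<omega> x))) \<longlonglongrightarrow> 0"
      unfolding eq
    proof (rule L2_tendsto_add[OF l2 l3])
      show "(\<lambda>n. L2_norm D (\<lambda>x. (w x * (c n (u x) - 1)) *\<^sub>R g x)) \<longlonglongrightarrow> 0"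
      proof (rule L2_dominated[OF l(2) _ d2])
        have "(\<lambda>n. (w x * (c n (u x) - 1)) *\<^sub>R g x) \<longlonglongrightarrow> (w x * (1 - 1)) *\<^sub>R g x" for x by (intro tendsto_intros cl)
        then show "AE x in lebesgue_on D. (\<lambda>n. (w x * (c n (u x) - 1)) *\<^sub>R g x) \<longlonglongrightarrow> 0" by simp
      qed measurable
      show "(\<lambda>n. L2_norm D (\<lambda>x. (T n (u x) - u x) *\<^sub>R \<omega> x)) \<longlonglongrightarrow> 0"
      proof (rule L2_dominated[OF w(3) _ d3])
        have "(\<lambda>n. (T n (u x) - u x) *\<^sub>R \<omega> x) \<longlonglongrightarrow> (u x - u x) *\<^sub>R \<omega> x" for x by (intro tendsto_intros Tl)
        then show "AE x in lebesgue_on D. (\<lambda>n. (T n (u x) - u x) *\<^sub>R \<omega> x) \<longlonglongrightarrow> 0" by simp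
      qed measurable
    qed
  qed
qed


section \<open>Weak gradients of constants and quotients\<close>

lemma const_L2: "(\<lambda>_. c :: real) \<in> L2 D"
  by (rule L2_norm_bounded_lmeasurable(1)[OF lmeas, of _ "\<bar>c\<bar>"]) auto

lemma has_weak_gradient_const: "has_weak_gradient D (\<lambda>_. c) (\<lambda>_. 0)"
  unfolding has_weak_gradient_iff
proof (intro conjI ballI)
  have "(\<lambda>_. 0 :: 'a) \<in> L2 D" by (rule L2_norm_bounded_lmeasurable(1)[OF lmeas, of _ 0]) auto
  then show "locally_integrable D (\<lambda>_. c)" "locally_integrable D (\<lambda>_. 0 :: 'a)"
    using const_L2 L2_locally_integrable lmeas by blast+
  fix \<phi> and i :: 'a assume \<phi>: "\<phi> \<in> test_functions D" and i: "i \<in> Basis"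
  obtain K where K: "compact K" "K \<subseteq> D" "\<And>x. x \<notin> K \<Longrightarrow> \<phi> x = 0" using \<phi> by (auto simp: test_functions_iff)
  have sm: "smooth \<phi>" using \<phi> by (rule test_functions_smooth)
  have "(LINT x|lebesgue_on D. partial i \<phi> x) = (LINT x|lborel. partial i \<phi> x)"
  proof (rule lborel_lebesgue_on(2)[OF _ lsets])
    show "partial i \<phi> \<in> borel_measurable borel"
      by (intro borel_measurable_continuous_onI smooth_continuous smooth_partial sm i)
    show "partial i \<phi> x = 0" if xD: "x \<notin> D" for x
    proof (rule partial_eq_0[OF compact_imp_closed[OF K(1)] K(3)])
      show "x \<notin> K" using xD K(2) by blast
    qed
  qed
  also have "\<dots> = 0"
    by (rule C1_integral_partial[OF smooth_differentiable[OF sm] smooth_continuous[OF smooth_partial[OF sm]] K(1,3) i])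
  finally show "(LINT x|lebesgue_on D. c * partial i \<phi> x) = - (LINT x|lebesgue_on D. (0 \<bullet> i) * \<phi> x)" by simp
qed

text \<open>If a were smooth, \<psi> / a would be a test function for b and the quotient rule would
  follow. So a is replaced by smooth functions \<open>A n\<close>, bounded below by lam, whose
  partial derivatives on the support of \<psi> are mollified components of \<alpha>; then n tends to
  infinity.\<close>

lemma has_weak_gradient_divide:
  assumes a: "has_weak_gradient D a \<alpha>" "a \<in> L2 D" "\<alpha> \<in> L2 D" and b: "has_weak_gradient D b \<beta>" "b \<in> L2 D" "\<beta> \<in> L2 D"
    and bd: "AE x in lebesgue_on D. lam \<le> a x" "lam > 0" "AE x in lebesgue_on D. \<bar>b x\<bar> \<le> B" "B \<ge> 0"
  shows "has_weak_gradient D (\<lambda>x. b x / a x) (\<lambda>x. (1 / a x) *\<^sub>R \<beta> x - (b x / (a x)\<^sup>2) *\<^sub>R \<alpha> x)"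
    "(\<lambda>x. b x / a x) \<in> L2 D" "(\<lambda>x. (1 / a x) *\<^sub>R \<beta> x - (b x / (a x)\<^sup>2) *\<^sub>R \<alpha> x) \<in> L2 D"
    "AE x in lebesgue_on D. norm ((1 / a x) *\<^sub>R \<beta> x - (b x / (a x)\<^sup>2) *\<^sub>R \<alpha> x) \<le> (1 / lam) * norm (\<beta> x) + (B / lam\<^sup>2) * norm (\<alpha> x)"
proof -
  note [measurable] = L2_measurable[OF a(2)] L2_measurable[OF a(3)] L2_measurable[OF b(2)] L2_measurable[OF b(3)]
  have inv: "\<bar>1 / s\<bar> \<le> 1 / lam" "\<bar>1 / s\<^sup>2\<bar> \<le> 1 / lam\<^sup>2" if "lam \<le> s" for s
    using that bd(2) by (auto simp: frac_le power_mono)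
  have n1: "AE x in lebesgue_on D. norm ((1 / a x) *\<^sub>R \<beta> x) \<le> norm ((1 / lam) *\<^sub>R \<beta> x)"
    using bd(1)
  proof eventually_elim
    case (elim x)
    show ?case unfolding norm_scaleR using inv(1)[OF elim] bd(2) by (intro mult_right_mono) auto
  qed
  have n2: "AE x in lebesgue_on D. norm ((b x / (a x)\<^sup>2) *\<^sub>R \<alpha> x) \<le> norm ((B / lam\<^sup>2) *\<^sub>R \<alpha> x)"
    using bd(1,3)
  proof eventually_elim
    case (elim x)
    have "\<bar>b x\<bar> * \<bar>1 / (a x)\<^sup>2\<bar> \<le> B * (1 / lam\<^sup>2)" using elim inv(2) bd(4) by (intro mult_mono) auto
    then have "\<bar>b x / (a x)\<^sup>2\<bar> \<le> \<bar>B / lam\<^sup>2\<bar>" using bd(4) by (simp add: abs_mult)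
    then show ?case unfolding norm_scaleR by (intro mult_right_mono) auto
  qed
  show L2g: "(\<lambda>x. (1 / a x) *\<^sub>R \<beta> x - (b x / (a x)\<^sup>2) *\<^sub>R \<alpha> x) \<in> L2 D"
    by (rule L2_diff(1)[OF L2_bound(1)[OF L2_scaleR(1)[OF b(3)] _ n1] L2_bound(1)[OF L2_scaleR(1)[OF a(3)] _ n2]]) measurable
  show "AE x in lebesgue_on D. norm ((1 / a x) *\<^sub>R \<beta> x - (b x / (a x)\<^sup>2) *\<^sub>R \<alpha> x) \<le> (1 / lam) * norm (\<beta> x) + (B / lam\<^sup>2) * norm (\<alpha> x)"
    using n1 n2
  proof eventually_elim
    case (elim x)
    have "norm ((1 / a x) *\<^sub>R \<beta> x - (b x / (a x)\<^sup>2) *\<^sub>R \<alpha> x) \<le> norm ((1 / lam) *\<^sub>R \<beta> x) + norm ((B / lam\<^sup>2) *\<^sub>R \<alpha> x)"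
      using norm_triangle_ineq4[of "(1 / a x) *\<^sub>R \<beta> x" "(b x / (a x)\<^sup>2) *\<^sub>R \<alpha> x"] elim by linarith
    then show ?case using bd(2,4) by simp
  qed
  show L2q: "(\<lambda>x. b x / a x) \<in> L2 D"
  proof (rule L2_bound(1)[OF L2_scaleR(1)[OF b(2), of "1 / lam"]])
    show "AE x in lebesgue_on D. norm (b x / a x) \<le> norm ((1 / lam) *\<^sub>R b x)"
      using bd(1)
    proof eventually_elim
      case (elim x)
      have "\<bar>b x\<bar> * \<bar>1 / a x\<bar> \<le> \<bar>b x\<bar> * (1 / lam)" using inv(1)[OF elim] by (intro mult_left_mono) auto
      then show ?case using bd(2) by (simp add: abs_mult)
    qed
  qed measurable

  \<comment> \<open>Subtracting lam first means that extending by 0 outside D and mollifying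
    preserves the lower bound after lam is added back.\<close>
  have al: "(\<lambda>x. a x - lam) \<in> L2 D" by (rule L2_diff(1)[OF a(2) const_L2])
  have awg: "has_weak_gradient D (\<lambda>x. a x - lam) \<alpha>" using has_weak_gradient_diff[OF a(1) has_weak_gradient_const[of lam]] by simp
  obtain V0 where V0: "sq_int V0" "\<And>x. x \<notin> D \<Longrightarrow> V0 x = 0" "AE x in lebesgue_on D. V0 x = a x - lam"
    by (rule L2_representative[OF bsets al]) blast
  \<comment> \<open>The representative is nonnegative only almost everywhere; the maximum makes it
    so at every point, as the positivity of the convolution requires.\<close>
  define V where "V x = max 0 (V0 x)" for x
  have V: "sq_int V" "\<And>x. x \<notin> D \<Longrightarrow> V x = 0" "AE x in lebesgue_on D. V x = a x - lam" "\<And>x. 0 \<le> V x"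
  proof -
    show "sq_int V" unfolding V_def using sq_intD(1)[OF V0(1)] by (intro sq_int_bound[OF V0(1)]) auto
    show "AE x in lebesgue_on D. V x = a x - lam" using V0(3) bd(1) by eventually_elim (simp add: V_def)
  qed (auto simp: V_def V0(2))
  have Vi: "integrable lborel V" by (rule sq_int_integrable[OF V(1,2) bsets bounded_D])
  have VL: "V \<in> L2 D" by (rule sq_int_L2(1)[OF V(1) bsets])
  show "has_weak_gradient D (\<lambda>x. b x / a x) (\<lambda>x. (1 / a x) *\<^sub>R \<beta> x - (b x / (a x)\<^sup>2) *\<^sub>R \<alpha> x)"
    unfolding has_weak_gradient_iff
  proof (intro conjI ballI)
    show "locally_integrable D (\<lambda>x. b x / a x)" "locally_integrable D (\<lambda>x. (1 / a x) *\<^sub>R \<beta> x - (b x / (a x)\<^sup>2) *\<^sub>R \<alpha> x)"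
      using L2q L2g L2_locally_integrable lmeas by blast+
    fix \<psi> and i :: 'a assume \<psi>: "\<psi> \<in> test_functions D" and i: "i \<in> Basis"
    have sp: "smooth \<psi>" using \<psi> by (rule test_functions_smooth)
    obtain K where K: "compact K" "K \<subseteq> D" "\<And>x. x \<notin> K \<Longrightarrow> \<psi> x = 0" using \<psi> by (auto simp: test_functions_iff)
    obtain P where P: "\<And>x. \<bar>\<psi> x\<bar> \<le> P" using test_function_C1(7)[OF \<psi>] by blast
    obtain Q where Q: "\<And>x. \<bar>partial i \<psi> x\<bar> \<le> Q" using test_function_C1(7)[OF test_functions_partial[OF \<psi> i]] by blast
    have P0: "P \<ge> 0" "Q \<ge> 0" using order_trans[OF abs_ge_zero P] order_trans[OF abs_ge_zero Q] by auto
    have \<alpha>i: "(\<lambda>x. \<alpha> x \<bullet> i) \<in> L2 D" and \<beta>i: "(\<lambda>x. \<beta> x \<bullet> i) \<in> L2 D" using i by (intro L2_component(1) a b; simp)+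
    obtain W where W: "sq_int W" "\<And>x. x \<notin> D \<Longrightarrow> W x = 0" "AE x in lebesgue_on D. W x = \<alpha> x \<bullet> i"
      by (rule L2_representative[OF bsets \<alpha>i]) blast
    have Wi: "integrable lborel W" by (rule sq_int_integrable[OF W(1,2) bsets bounded_D])
    have WL: "W \<in> L2 D" by (rule sq_int_L2(1)[OF W(1) bsets])
    obtain e where e: "e > 0" "\<And>x. cball x e \<inter> K \<noteq> {} \<Longrightarrow> cball x e \<subseteq> D"
      by (rule compact_neighbourhood[OF K(1) open_D K(2)]) blast
    obtain N where N: "inverse (real (Suc N)) < e" using reals_Archimedean[OF e(1)] by auto
    define f where "f n = conv (mol (n + N)) V" for n
    have fL: "f n \<in> L2 D" for n unfolding f_def by (intro sq_int_L2(1)[OF conv_mol_sq_int] V Vi bsets)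
    have fV: "(\<lambda>n. L2_norm D (\<lambda>x. f n x - V x)) \<longlonglongrightarrow> 0"
      unfolding f_def by (rule LIMSEQ_ignore_initial_segment[OF conv_mol_tendsto[OF V(1) Vi bsets]])
    obtain r where r: "strict_mono r" "AE x in lebesgue_on D. (\<lambda>n. f (r n) x) \<longlonglongrightarrow> V x"
      by (rule L2_AE_subseq[OF fL VL fV])
    define A where "A n x = lam + f (r n) x" for n x
    define w where "w n = conv (mol (r n + N)) W" for n
    have sA: "smooth (A n)" for n
      unfolding A_def [abs_def] f_def by (intro smooth_add smooth_const conv_smooth[OF mol_kernel Vi])
    have Age: "lam \<le> A n x" for n x
      unfolding A_def f_def using conv_bounds(1)[OF mol Vi V(4)] by simp
    have Anz: "A n x \<noteq> 0" for n x using Age[of n x] bd(2) by linarith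
    have Alim: "AE x in lebesgue_on D. (\<lambda>n. A n x) \<longlonglongrightarrow> a x"
      using r(2) V(3)
    proof eventually_elim
      case (elim x)
      have "(\<lambda>n. A n x) \<longlonglongrightarrow> lam + V x" unfolding A_def using elim(1) by (intro tendsto_intros)
      then show ?case using elim(2) by simp
    qed
    have wL: "w n \<in> L2 D" for n unfolding w_def by (intro sq_int_L2(1)[OF conv_mol_sq_int] W Wi bsets)
    have wW: "(\<lambda>n. L2_norm D (\<lambda>x. w n x - W x)) \<longlonglongrightarrow> 0"
      using LIMSEQ_subseq_LIMSEQ[OF LIMSEQ_ignore_initial_segment[OF conv_mol_tendsto[OF W(1) Wi bsets], of N] r(1)]
      by (simp add: w_def comp_def)
    \<comment> \<open>On the support of \<psi> the smoothing ball stays in D, so the derivative can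
      be moved onto a. Elsewhere the factor \<psi> removes the term.\<close>
    have pA: "partial i (A n) x = w n x" if "x \<in> K" for n x
    proof -
      let ?m = "r n + N"
      have "inverse (real (Suc ?m)) \<le> inverse (real (Suc N))" by (intro le_imp_inverse_le) auto
      then have "cball x (inverse (real (Suc ?m))) \<subseteq> cball x e" using N by (intro subset_cball) linarith
      also have "\<dots> \<subseteq> D"
      proof (rule e(2))
        have "x \<in> cball x e \<inter> K" using that e(1) by simp
        then show "cball x e \<inter> K \<noteq> {}" by blast
      qed
      finally have cD: "cball x (inverse (real (Suc ?m))) \<subseteq> D" .
      have "partial i (A n) x = partial i (\<lambda>_. lam) x + partial i (f (r n)) x"
        unfolding A_def [abs_def] f_def
        by (intro partial_add smooth_differentiable smooth_const conv_smooth[OF mol_kernel Vi])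
      also have "\<dots> = conv (partial i (mol ?m)) V x" unfolding f_def by (simp add: conv_partial[OF mol_kernel Vi i])
      also have "\<dots> = w n x"
        unfolding w_def by (rule conv_weak_partial[OF mol_kernel open_D cD awg i sq_intD(1)[OF V(1)] V(2,3) sq_intD(1)[OF W(1)] W(2,3)])
      finally show ?thesis .
    qed
    have tA: "(\<lambda>x. \<psi> x * inverse (A n x)) \<in> test_functions D" for n
      by (rule test_functions_mult[OF \<psi> smooth_inverse[OF sA Anz]])
    have ppA: "partial i (\<lambda>x. \<psi> x * inverse (A n x)) x = partial i \<psi> x / A n x - \<psi> x * w n x / (A n x)\<^sup>2" for n x
    proof -
      have dA: "A n differentiable (at x)" by (rule smooth_differentiable[OF sA])
      have di: "(inverse has_real_derivative - (inverse (A n x) * inverse (A n x))) (at (A n x))"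
        using DERIV_inverse[OF Anz[of n x]] by (simp add: power2_eq_square numeral_2_eq_2)
      have "partial i (\<lambda>x. \<psi> x * inverse (A n x)) x = \<psi> x * (- (inverse (A n x) * inverse (A n x)) * partial i (A n) x) + partial i \<psi> x * inverse (A n x)"
        using partial_mult[OF smooth_differentiable[OF sp] differentiable_chain[OF dA di]] partial_chain[OF dA di] by simp
      also have "\<dots> = partial i \<psi> x / A n x - \<psi> x * w n x / (A n x)\<^sup>2"
        using pA[of x n] K(3)[of x] Anz[of n x] by (cases "x \<in> K") (simp_all add: divide_simps power2_eq_square)
      finally show ?thesis .
    qed
    note [measurable] = L2_measurable[OF fL] L2_measurable[OF wL] L2_measurable[OF WL]
      L2_measurable[OF test_function_C1(1)[OF \<psi>]] L2_measurable[OF test_function_C1(3)[OF \<psi> i]]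
    have [measurable]: "A n \<in> borel_measurable (lebesgue_on D)" for n unfolding A_def [abs_def] by measurable
    \<comment> \<open>\<open>T1 n\<close> - \<open>T2 n\<close> is b times the partial derivative of
      \<psi> / \<open>A n\<close>, and \<open>T3 n\<close> is the integrand on the other side of the
      weak identity. \<open>S1\<close>, \<open>S2\<close>, \<open>S3\<close> are the same
      expressions with a and its gradient.\<close>
    define T1 where "T1 n x = b x * partial i \<psi> x / A n x" for n x
    define T2 where "T2 n x = b x * \<psi> x / (A n x)\<^sup>2 * w n x" for n x
    define T3 where "T3 n x = (\<beta> x \<bullet> i) * \<psi> x / A n x" for n x
    define S1 where "S1 x = b x * partial i \<psi> x / a x" for x
    define S2 where "S2 x = b x * \<psi> x / (a x)\<^sup>2 * (\<alpha> x \<bullet> i)" for x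
    define S3 where "S3 x = (\<beta> x \<bullet> i) * \<psi> x / a x" for x
    have [measurable]: "T1 n \<in> borel_measurable (lebesgue_on D)" "T2 n \<in> borel_measurable (lebesgue_on D)" "T3 n \<in> borel_measurable (lebesgue_on D)"
      "S1 \<in> borel_measurable (lebesgue_on D)" "S2 \<in> borel_measurable (lebesgue_on D)" "S3 \<in> borel_measurable (lebesgue_on D)" for n
      unfolding T1_def [abs_def] T2_def [abs_def] T3_def [abs_def] S1_def [abs_def] S2_def [abs_def] S3_def [abs_def] by measurable
    have q1: "\<bar>z * p / s\<bar> \<le> R / lam * \<bar>z\<bar>" if "\<bar>p\<bar> \<le> R" "lam \<le> s" for z p s R
    proof -
      have "\<bar>z\<bar> * \<bar>p\<bar> * \<bar>1 / s\<bar> \<le> \<bar>z\<bar> * R * (1 / lam)"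
        using that inv(1)[OF that(2)] order_trans[OF abs_ge_zero that(1)] by (intro mult_mono) auto
      then show ?thesis by (simp add: abs_mult mult.commute)
    qed
    have q2: "\<bar>z * p / s\<^sup>2\<bar> \<le> B * P / lam\<^sup>2" if "\<bar>z\<bar> \<le> B" "\<bar>p\<bar> \<le> P" "lam \<le> s" for z p s
    proof -
      have "\<bar>z\<bar> * \<bar>p\<bar> * \<bar>1 / s\<^sup>2\<bar> \<le> B * P * (1 / lam\<^sup>2)"
        using that inv(2)[OF that(3)] bd(4) P0 by (intro mult_mono) auto
      then show ?thesis by (simp add: abs_mult)
    qed
    have T1L: "T1 n \<in> L2 D" for n
      using q1[OF Q Age] by (intro L2_bound(1)[OF L2_scaleR(1)[OF b(2), of "Q / lam"]]) (measurable, use P0 bd(2) in \<open>auto simp: T1_def abs_mult\<close>)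
    have T3L: "T3 n \<in> L2 D" for n
      using q1[OF P Age] by (intro L2_bound(1)[OF L2_scaleR(1)[OF \<beta>i, of "P / lam"]]) (measurable, use P0 bd(2) in \<open>auto simp: T3_def abs_mult\<close>)
    have S1b: "AE x in lebesgue_on D. \<bar>S1 x\<bar> \<le> Q / lam * \<bar>b x\<bar>"
      using bd(1) by eventually_elim (use q1[OF Q] in \<open>simp add: S1_def\<close>)
    have S1L: "S1 \<in> L2 D"
      using S1b by (intro L2_bound(1)[OF L2_scaleR(1)[OF b(2), of "Q / lam"]]) (measurable, use P0 bd(2) in \<open>auto simp: abs_mult\<close>)
    have S3b: "AE x in lebesgue_on D. \<bar>S3 x\<bar> \<le> P / lam * \<bar>\<beta> x \<bullet> i\<bar>"
      using bd(1) by eventually_elim (use q1[OF P] in \<open>simp add: S3_def\<close>)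
    have S3L: "S3 \<in> L2 D"
      using S3b by (intro L2_bound(1)[OF L2_scaleR(1)[OF \<beta>i, of "P / lam"]]) (measurable, use P0 bd(2) in \<open>auto simp: abs_mult\<close>)
    have c2: "AE x in lebesgue_on D. \<bar>b x * \<psi> x / (A n x)\<^sup>2\<bar> \<le> B * P / lam\<^sup>2" for n
      using bd(3) by eventually_elim (intro q2 P Age)
    have c2': "AE x in lebesgue_on D. \<bar>b x * \<psi> x / (a x)\<^sup>2\<bar> \<le> B * P / lam\<^sup>2"
      using bd(3,1) by eventually_elim (intro q2 P)
    have BP: "B * P / lam\<^sup>2 \<ge> 0" using bd(4) P0 by simp
    have T2L: "T2 n \<in> L2 D" for n
    proof (rule L2_bound(1)[OF L2_scaleR(1)[OF wL[of n], of "B * P / lam\<^sup>2"]])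
      show "AE x in lebesgue_on D. norm (T2 n x) \<le> norm ((B * P / lam\<^sup>2) *\<^sub>R w n x)"
        using c2[of n] by eventually_elim (unfold T2_def real_norm_def abs_mult[of _ "w n _"] real_scaleR_def abs_of_nonneg[OF BP], intro mult_right_mono, auto)
    qed measurable
    have S2L: "S2 \<in> L2 D"
    proof (rule L2_bound(1)[OF L2_scaleR(1)[OF \<alpha>i, of "B * P / lam\<^sup>2"]])
      show "AE x in lebesgue_on D. norm (S2 x) \<le> norm ((B * P / lam\<^sup>2) *\<^sub>R (\<alpha> x \<bullet> i))"
        using c2' by eventually_elim (unfold S2_def real_norm_def abs_mult[of _ "\<alpha> _ \<bullet> i"] real_scaleR_def abs_of_nonneg[OF BP], intro mult_right_mono, auto)
    qed measurable
    have anz: "AE x in lebesgue_on D. a x \<noteq> 0" using bd(1) by eventually_elim (use bd(2) in auto)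
    have l1: "(\<lambda>n. L2_norm D (\<lambda>x. T1 n x - S1 x)) \<longlonglongrightarrow> 0"
    proof (rule L2_dominated[OF b(2), where c = "2 * (Q / lam)"])
      show "AE x in lebesgue_on D. norm (T1 n x - S1 x) \<le> 2 * (Q / lam) * norm (b x)" for n
        using S1b
      proof eventually_elim
        case (elim x)
        have "\<bar>T1 n x\<bar> \<le> Q / lam * \<bar>b x\<bar>" unfolding T1_def by (rule q1[OF Q Age])
        then show ?case using elim by simp
      qed
      show "AE x in lebesgue_on D. (\<lambda>n. T1 n x - S1 x) \<longlonglongrightarrow> 0"
        using Alim anz
      proof eventually_elim
        case (elim x)
        then have "(\<lambda>n. T1 n x - S1 x) \<longlonglongrightarrow> b x * partial i \<psi> x / a x - S1 x" unfolding T1_def by (intro tendsto_intros)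
        then show ?case by (simp add: S1_def)
      qed
    qed measurable
    have l3: "(\<lambda>n. L2_norm D (\<lambda>x. T3 n x - S3 x)) \<longlonglongrightarrow> 0"
    proof (rule L2_dominated[OF \<beta>i, where c = "2 * (P / lam)"])
      show "AE x in lebesgue_on D. norm (T3 n x - S3 x) \<le> 2 * (P / lam) * norm (\<beta> x \<bullet> i)" for n
        using S3b
      proof eventually_elim
        case (elim x)
        have "\<bar>T3 n x\<bar> \<le> P / lam * \<bar>\<beta> x \<bullet> i\<bar>" unfolding T3_def by (rule q1[OF P Age])
        then show ?case using elim by simp
      qed
      show "AE x in lebesgue_on D. (\<lambda>n. T3 n x - S3 x) \<longlonglongrightarrow> 0"
        using Alim anz
      proof eventually_elim
        case (elim x)
        then have "(\<lambda>n. T3 n x - S3 x) \<longlonglongrightarrow> (\<beta> x \<bullet> i) * \<psi> x / a x - S3 x" unfolding T3_def by (intro tendsto_intros)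
        then show ?case by (simp add: S3_def)
      qed
    qed measurable
    have l2: "(\<lambda>n. L2_norm D (\<lambda>x. T2 n x - S2 x)) \<longlonglongrightarrow> 0"
    proof -
      \<comment> \<open>The gradients \<open>w n\<close> converge only in L2, with no common
        dominating function, so they are first replaced by their limit \<open>W\<close>; after that
        domination by \<open>W\<close> is available.\<close>
      let ?p = "\<lambda>n x. b x * \<psi> x / (A n x)\<^sup>2 * (w n x - W x)"
      let ?q = "\<lambda>n x. b x * \<psi> x / (A n x)\<^sup>2 * W x - S2 x"
      have cW: "AE x in lebesgue_on D. \<bar>b x * \<psi> x / (A n x)\<^sup>2 * W x\<bar> \<le> B * P / lam\<^sup>2 * \<bar>W x\<bar>" for n
        using c2[of n] by eventually_elim (unfold abs_mult[of _ "W _"], intro mult_right_mono, auto)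
      have qb: "AE x in lebesgue_on D. norm (?q n x) \<le> 2 * (B * P / lam\<^sup>2) * norm (W x)" for n
        using cW[of n] c2' W(3)
      proof eventually_elim
        case (elim x)
        have "\<bar>S2 x\<bar> \<le> B * P / lam\<^sup>2 * \<bar>W x\<bar>"
          unfolding S2_def abs_mult[of _ "\<alpha> _ \<bullet> i"] elim(3) using elim(2) by (intro mult_right_mono) auto
        moreover have "\<bar>p - q\<bar> \<le> Z + Z" if "\<bar>p\<bar> \<le> Z" "\<bar>q\<bar> \<le> Z" for p q Z :: real using that by linarith
        moreover have "2 * (B * P / lam\<^sup>2) * norm (W x) = B * P / lam\<^sup>2 * \<bar>W x\<bar> + B * P / lam\<^sup>2 * \<bar>W x\<bar>" by simp
        ultimately show ?case using elim(1) by (simp only: real_norm_def)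
      qed
      have pb: "AE x in lebesgue_on D. norm (?p n x) \<le> B * P / lam\<^sup>2 * norm (w n x - W x)" for n
        using c2[of n] by eventually_elim (unfold real_norm_def abs_mult[of _ "w _ _ - W _"], intro mult_right_mono, auto)
      have pL: "?p n \<in> L2 D" for n
      proof (rule L2_bound(1)[OF L2_scaleR(1)[OF L2_diff(1)[OF wL[of n] WL], of "B * P / lam\<^sup>2"]])
        show "AE x in lebesgue_on D. norm (?p n x) \<le> norm ((B * P / lam\<^sup>2) *\<^sub>R (w n x - W x))"
          using pb[of n] BP by (simp only: norm_scaleR abs_of_nonneg)
      qed measurable
      have qL: "?q n \<in> L2 D" for n
      proof (rule L2_bound(1)[OF L2_scaleR(1)[OF WL, of "2 * (B * P / lam\<^sup>2)"]])
        show "AE x in lebesgue_on D. norm (?q n x) \<le> norm ((2 * (B * P / lam\<^sup>2)) *\<^sub>R W x)"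
          using qb[of n] BP by (simp only: norm_scaleR abs_of_nonneg mult_nonneg_nonneg zero_le_numeral)
      qed measurable
      have "(\<lambda>n. L2_norm D (\<lambda>x. ?p n x + ?q n x)) \<longlonglongrightarrow> 0"
      proof (rule L2_tendsto_add[OF pL qL])
        show "(\<lambda>n. L2_norm D (?p n)) \<longlonglongrightarrow> 0"
          by (rule L2_tendsto_bound[OF L2_diff(1)[OF wL WL] wW _ pb BP]) measurable
        show "(\<lambda>n. L2_norm D (?q n)) \<longlonglongrightarrow> 0"
        proof (rule L2_dominated[OF WL _ qb])
          show "AE x in lebesgue_on D. (\<lambda>n. ?q n x) \<longlonglongrightarrow> 0"
            using Alim anz W(3)
          proof eventually_elim
            case (elim x)
            then have "(\<lambda>n. ?q n x) \<longlonglongrightarrow> b x * \<psi> x / (a x)\<^sup>2 * W x - S2 x" by (intro tendsto_intros) auto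
            then show ?case by (simp add: S2_def elim(3))
          qed
        qed measurable
      qed
      then show ?thesis by (simp add: T2_def right_diff_distrib)
    qed
    note one = const_L2[of 1]
    have I: "integrable (lebesgue_on D) h" if "h \<in> L2 D" for h :: "'a \<Rightarrow> real" using L2_locally_integrable(2)[OF that lmeas] .
    have lim1: "(\<lambda>n. LINT x|lebesgue_on D. T1 n x) \<longlonglongrightarrow> (LINT x|lebesgue_on D. S1 x)"
      using L2_inner_tendsto[OF T1L S1L l1 one] by simp
    have lim2: "(\<lambda>n. LINT x|lebesgue_on D. T2 n x) \<longlonglongrightarrow> (LINT x|lebesgue_on D. S2 x)"
      using L2_inner_tendsto[OF T2L S2L l2 one] by simp
    have lim3: "(\<lambda>n. LINT x|lebesgue_on D. T3 n x) \<longlonglongrightarrow> (LINT x|lebesgue_on D. S3 x)"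
      using L2_inner_tendsto[OF T3L S3L l3 one] by simp
    have step: "(LINT x|lebesgue_on D. T1 n x) = (LINT x|lebesgue_on D. T2 n x) - (LINT x|lebesgue_on D. T3 n x)" for n
    proof -
      have "(LINT x|lebesgue_on D. b x * partial i (\<lambda>x. \<psi> x * inverse (A n x)) x) = - (LINT x|lebesgue_on D. (\<beta> x \<bullet> i) * (\<psi> x * inverse (A n x)))"
        using b(1) tA i unfolding has_weak_gradient_iff by blast
      also have "(\<lambda>x. b x * partial i (\<lambda>x. \<psi> x * inverse (A n x)) x) = (\<lambda>x. T1 n x - T2 n x)"
        unfolding ppA T1_def T2_def by (intro ext) (simp add: right_diff_distrib)
      also have "(\<lambda>x. (\<beta> x \<bullet> i) * (\<psi> x * inverse (A n x))) = T3 n"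
        unfolding T3_def by (intro ext) (simp add: divide_inverse)
      also have "(LINT x|lebesgue_on D. T1 n x - T2 n x) = (LINT x|lebesgue_on D. T1 n x) - (LINT x|lebesgue_on D. T2 n x)"
        by (rule Bochner_Integration.integral_diff[OF I[OF T1L] I[OF T2L]])
      finally show ?thesis by simp
    qed
    have "(LINT x|lebesgue_on D. S1 x) = (LINT x|lebesgue_on D. S2 x) - (LINT x|lebesgue_on D. S3 x)"
      by (rule LIMSEQ_unique[OF lim1]) (unfold step, rule tendsto_diff[OF lim2 lim3])
    also have "\<dots> = (LINT x|lebesgue_on D. S2 x - S3 x)"
      by (rule Bochner_Integration.integral_diff[OF I[OF S2L] I[OF S3L], symmetric])
    also have "(\<lambda>x. S2 x - S3 x) = (\<lambda>x. - ((((1 / a x) *\<^sub>R \<beta> x - (b x / (a x)\<^sup>2) *\<^sub>R \<alpha> x) \<bullet> i) * \<psi> x))"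
      unfolding S2_def S3_def by (intro ext) (simp add: inner_diff_left algebra_simps)
    finally show "(LINT x|lebesgue_on D. b x / a x * partial i \<psi> x) = - (LINT x|lebesgue_on D. (((1 / a x) *\<^sub>R \<beta> x - (b x / (a x)\<^sup>2) *\<^sub>R \<alpha> x) \<bullet> i) * \<psi> x)"
      by (simp add: S1_def)
  qed
qed

end

section \<open>A Nash inequality\<close>

lemma L2_UNIV_norm_sq:
  assumes "f \<in> borel_measurable borel"
  shows "(L2_norm UNIV f)\<^sup>2 = (LINT x|lborel. (f x :: real)\<^sup>2)"
  unfolding L2_norm_sq using assms by (subst lborel_lebesgue_on(2)) auto

lemma L2_UNIV_norm_translation:
  assumes "f \<in> borel_measurable borel"
  shows "L2_norm UNIV (\<lambda>x. f (h + x) :: real) = L2_norm UNIV f"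
proof -
  have "(L2_norm UNIV (\<lambda>x. f (h + x)))\<^sup>2 = (L2_norm UNIV f)\<^sup>2"
    using assms lborel_integral_translation[of "\<lambda>x. (f x)\<^sup>2" h] by (simp add: L2_UNIV_norm_sq)
  then show ?thesis by simp
qed

context bounded_open begin

context
  fixes \<phi> assumes \<phi>: "\<phi> \<in> test_functions D"
begin

lemma test_sq_int: "sq_int \<phi>" "integrable lborel \<phi>" "sq_int (\<lambda>x. grad \<phi> x \<bullet> h)"
proof -
  obtain K where K: "compact K" "K \<subseteq> D" "\<And>x. x \<notin> K \<Longrightarrow> \<phi> x = 0" using \<phi> by (auto simp: test_functions_iff)
  have sm: "smooth \<phi>" using \<phi> by (rule test_functions_smooth)
  have *: "integrable lborel f" "sq_int f" if "continuous_on UNIV f" "\<And>x. x \<notin> K \<Longrightarrow> f x = 0" for f :: "'a \<Rightarrow> real"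
  proof -
    have fi: "integrable lborel f" if "continuous_on UNIV f" "\<And>x. x \<notin> K \<Longrightarrow> f x = 0" for f :: "'a \<Rightarrow> real"
    proof -
      have "integrable lborel (\<lambda>x. indicator K x *\<^sub>R f x)"
        using that(1) by (intro borel_integrable_compact K(1)) (auto intro: continuous_on_subset)
      moreover have "(\<lambda>x. indicator K x *\<^sub>R f x) = f" using that(2) by (auto split: split_indicator)
      ultimately show ?thesis by (simp only:)
    qed
    show "integrable lborel f" by (rule fi[OF that])
    have "integrable lborel (\<lambda>x. (f x)\<^sup>2)" using that by (intro fi continuous_intros) auto
    then show "sq_int f" using that by (simp add: sq_int_def borel_measurable_continuous_onI)
  qed
  show "integrable lborel \<phi>" by (rule *(1)[OF smooth_continuous[OF sm] K(3)])
  show "sq_int \<phi>" by (rule *(2)[OF smooth_continuous[OF sm] K(3)])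
  have "continuous_on UNIV (\<lambda>x. grad \<phi> x \<bullet> h)"
    unfolding grad_def by (intro continuous_intros smooth_continuous smooth_partial sm)
  then show "sq_int (\<lambda>x. grad \<phi> x \<bullet> h)"
    by (rule *(2)) (simp add: grad_zero_outside[OF K(1,3)])
qed

text \<open>Moving by \<open>h\<close> in \<open>n\<close> steps and letting \<open>n \<longlonglongrightarrow> \<infinity>\<close> avoids integrating along segments.\<close>

lemma translation_subadditive:
  "L2_norm UNIV (\<lambda>x. \<phi> (real n *\<^sub>R h + x) - \<phi> x) \<le> real n * L2_norm UNIV (\<lambda>x. \<phi> (h + x) - \<phi> x)"
proof (induction n)
  case 0
  show ?case by (simp add: L2_norm_def)
next
  case (Suc n)
  have T: "(\<lambda>x. \<phi> (k + x)) \<in> L2 UNIV" for k by (rule sq_int_L2(1)[OF sq_int_translation[OF test_sq_int(1)]]) simp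
  have T0: "\<phi> \<in> L2 UNIV" using T[of 0] by simp
  have [measurable]: "\<phi> \<in> borel_measurable borel" using sq_intD(1)[OF test_sq_int(1)] .
  have "L2_norm UNIV (\<lambda>x. \<phi> (real (Suc n) *\<^sub>R h + x) - \<phi> x)
    \<le> L2_norm UNIV (\<lambda>x. \<phi> (real (Suc n) *\<^sub>R h + x) - \<phi> (h + x)) + L2_norm UNIV (\<lambda>x. \<phi> (h + x) - \<phi> x)"
    by (rule L2_norm_triangle[OF T T T0])
  also have "L2_norm UNIV (\<lambda>x. \<phi> (real (Suc n) *\<^sub>R h + x) - \<phi> (h + x)) = L2_norm UNIV (\<lambda>x. \<phi> (real n *\<^sub>R h + x) - \<phi> x)"
    using L2_UNIV_norm_translation[of "\<lambda>x. \<phi> (real n *\<^sub>R h + x) - \<phi> x" h] by (simp add: algebra_simps)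
  finally show ?case using Suc by (simp add: algebra_simps)
qed

text \<open>With h cut into n + 1 equal pieces, subadditivity bounds the left side by the L2 norm of
  the difference quotient \<open>q n\<close>. The quotients converge to the directional derivative
  in L2, being bounded with support in a fixed ball.\<close>

lemma translation_estimate:
  "L2_norm UNIV (\<lambda>x. \<phi> (h + x) - \<phi> x) \<le> L2_norm UNIV (\<lambda>x. grad \<phi> x \<bullet> h)"
proof -
  obtain K where K: "compact K" "K \<subseteq> D" "\<And>x. x \<notin> K \<Longrightarrow> \<phi> x = 0" using \<phi> by (auto simp: test_functions_iff)
  have sm: "smooth \<phi>" using \<phi> by (rule test_functions_smooth)
  note d = smooth_differentiable[OF sm]
  have [measurable]: "\<phi> \<in> borel_measurable borel" "(\<lambda>x. grad \<phi> x \<bullet> h) \<in> borel_measurable borel"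
    using sq_intD(1)[OF test_sq_int(1)] sq_intD(1)[OF test_sq_int(3)] by auto
  have fr: "frechet_derivative \<phi> (at x) k = grad \<phi> x \<bullet> k" for x k
    using frechet_derivative_partial[OF d] by (simp add: grad_def inner_sum_left inner_commute[of k] mult.commute)
  define e where "e n = inverse (real (Suc n))" for n
  have e: "e n > 0" "e n \<le> 1" for n by (auto simp: e_def field_simps)
  have el: "e \<longlonglongrightarrow> 0" unfolding e_def [abs_def] by (rule LIMSEQ_inverse_real_of_nat)
  define q where "q n x = (\<phi> (e n *\<^sub>R h + x) - \<phi> x) / e n" for n x
  have [measurable]: "q n \<in> borel_measurable borel" for n unfolding q_def [abs_def] by measurable
  obtain B where B: "\<And>x. norm (grad \<phi> x) \<le> B"
  proof -
    have "continuous_on UNIV (grad \<phi>)"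
      unfolding grad_def [abs_def] by (intro continuous_intros smooth_continuous smooth_partial sm)
    moreover have "grad \<phi> x = 0" if "x \<notin> K" for x by (rule grad_zero_outside[OF K(1,3) that])
    ultimately show ?thesis using continuous_compact_support_L2(3)[OF _ K(1) _ lmeas, of "grad \<phi>"] that by blast
  qed
  obtain R where R: "\<And>x. x \<in> K \<Longrightarrow> norm x \<le> R" using compact_imp_bounded[OF K(1)] by (auto simp: bounded_iff)
  \<comment> \<open>Each step \<open>e n\<close> h is no longer than h, so beyond radius R + |h|
    neither x nor the moved point meets the support.\<close>
  let ?w = "\<lambda>x. B * norm h * indicator (cball (0::'a) (R + norm h)) x"
  have B0: "B \<ge> 0" using order_trans[OF norm_ge_zero B] .
  have gb: "\<bar>grad \<phi> x \<bullet> h\<bar> \<le> B * norm h" for x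
    using Cauchy_Schwarz_ineq2[of "grad \<phi> x" h] mult_right_mono[OF B[of x], of "norm h"] by simp
  have qb: "\<bar>q n x\<bar> \<le> ?w x" for n x
  proof (cases "norm x \<le> R + norm h")
    case True
    obtain t where "\<phi> (x + e n *\<^sub>R h) - \<phi> x = (\<Sum>i\<in>Basis. (e n *\<^sub>R h \<bullet> i) * partial i \<phi> (x + t *\<^sub>R e n *\<^sub>R h))"
      by (rule partial_mean_value[OF d])
    also have "\<dots> = e n * (grad \<phi> (x + t *\<^sub>R e n *\<^sub>R h) \<bullet> h)"
      by (simp add: grad_def inner_sum_left inner_commute[of h] sum_distrib_left mult_ac)
    finally have "q n x = grad \<phi> (x + t *\<^sub>R e n *\<^sub>R h) \<bullet> h" using e(1)[of n] by (simp add: q_def add.commute)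
    then show ?thesis using gb True by simp
  next
    case False
    have "norm (e n *\<^sub>R h) \<le> norm h" using e[of n] by (simp add: mult_left_le_one_le)
    then have "norm (e n *\<^sub>R h + x) > R" using False norm_diff_ineq[of x "e n *\<^sub>R h"] by (simp add: add.commute)
    moreover have "norm x > R" using False norm_ge_zero[of h] by linarith
    ultimately have "e n *\<^sub>R h + x \<notin> K" "x \<notin> K" using R by force+
    then show ?thesis using K(3) B0 by (simp add: q_def)
  qed
  have ql: "(\<lambda>n. q n x) \<longlonglongrightarrow> grad \<phi> x \<bullet> h" for x
  proof -
    have 1: "((\<lambda>s. x + s *\<^sub>R h) has_derivative (\<lambda>s. s *\<^sub>R h)) (at 0)" by (auto intro!: derivative_eq_intros)
    have "((\<lambda>s. \<phi> (x + s *\<^sub>R h)) has_derivative (\<lambda>s. frechet_derivative \<phi> (at (x + 0 *\<^sub>R h)) (s *\<^sub>R h))) (at 0)"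
      by (rule has_derivative_compose[OF 1 has_derivative_frechet[OF d]])
    also have "(\<lambda>s. frechet_derivative \<phi> (at (x + 0 *\<^sub>R h)) (s *\<^sub>R h)) = (*) (grad \<phi> x \<bullet> h)"
      by (simp add: fr fun_eq_iff)
    finally have "DERIV (\<lambda>s. \<phi> (x + s *\<^sub>R h)) 0 :> grad \<phi> x \<bullet> h" by (simp add: has_field_derivative_def)
    then have "((\<lambda>s. (\<phi> (x + s *\<^sub>R h) - \<phi> x) / s) \<longlongrightarrow> grad \<phi> x \<bullet> h) (at 0)" by (simp add: DERIV_def)
    moreover have "e n \<noteq> 0" for n using e(1)[of n] by simp
    then have "filterlim e (at 0) sequentially" unfolding filterlim_at using el by simp
    ultimately have "(\<lambda>n. (\<phi> (x + e n *\<^sub>R h) - \<phi> x) / e n) \<longlonglongrightarrow> grad \<phi> x \<bullet> h" by (rule filterlim_compose)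
    then show ?thesis by (simp add: q_def add.commute)
  qed
  have sw: "sq_int ?w" using emeasure_lborel_cball_finite by (intro sq_int_cmult sq_int_indicator) auto
  have wL: "?w \<in> L2 UNIV" by (rule sq_int_L2(1)[OF sw]) simp
  have w0: "?w x \<ge> 0" for x using B0 by simp
  have qw: "\<bar>q n x\<bar> \<le> \<bar>?w x\<bar>" for n x using qb[of n x] w0[of x] by linarith
  have qL: "q n \<in> L2 UNIV" for n by (rule sq_int_L2(1)[OF sq_int_bound[OF sw _ qw]]) simp_all
  have gL: "(\<lambda>x. grad \<phi> x \<bullet> h) \<in> L2 UNIV" by (rule sq_int_L2(1)[OF test_sq_int(3)]) simp
  have gw: "\<bar>grad \<phi> x \<bullet> h\<bar> \<le> ?w x" for x
    by (rule LIMSEQ_le_const2[OF tendsto_rabs[OF ql]]) (use qb in blast)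
  have "(\<lambda>n. L2_norm UNIV (\<lambda>x. q n x - grad \<phi> x \<bullet> h)) \<longlonglongrightarrow> 0"
  proof (rule L2_dominated[OF wL])
    show "(\<lambda>x. q n x - grad \<phi> x \<bullet> h) \<in> borel_measurable (lebesgue_on UNIV)" for n
      by (intro borel_restrict_lebesgue) measurable
    show "AE x in lebesgue_on UNIV. norm (q n x - grad \<phi> x \<bullet> h) \<le> 2 * norm (?w x)" for n
    proof (rule AE_I2)
      fix x show "norm (q n x - grad \<phi> x \<bullet> h) \<le> 2 * norm (?w x)"
        using qb[of n x] gw[of x] w0[of x] unfolding real_norm_def by linarith
    qed
    show "AE x in lebesgue_on UNIV. (\<lambda>n. q n x - grad \<phi> x \<bullet> h) \<longlonglongrightarrow> 0"
      using LIM_zero[OF ql] by simp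
  qed
  then have lim: "(\<lambda>n. L2_norm UNIV (q n)) \<longlonglongrightarrow> L2_norm UNIV (\<lambda>x. grad \<phi> x \<bullet> h)" by (rule L2_norm_tendsto[OF qL gL])
  have "L2_norm UNIV (\<lambda>x. \<phi> (h + x) - \<phi> x) \<le> L2_norm UNIV (q n)" for n
  proof -
    have "L2_norm UNIV (\<lambda>x. \<phi> (real (Suc n) *\<^sub>R (e n *\<^sub>R h) + x) - \<phi> x) \<le> real (Suc n) * L2_norm UNIV (\<lambda>x. \<phi> (e n *\<^sub>R h + x) - \<phi> x)"
      by (rule translation_subadditive)
    moreover have "real (Suc n) *\<^sub>R (e n *\<^sub>R h) = h" by (simp add: e_def del: of_nat_Suc)
    moreover have "q n = (\<lambda>x. real (Suc n) *\<^sub>R (\<phi> (e n *\<^sub>R h + x) - \<phi> x))"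
      by (simp add: q_def[abs_def] e_def field_simps del: of_nat_Suc)
    moreover have "(\<lambda>x. \<phi> (e n *\<^sub>R h + x) - \<phi> x) \<in> L2 UNIV"
      by (rule sq_int_L2(1)[OF sq_int_diff[OF sq_int_translation[OF test_sq_int(1)] test_sq_int(1)]]) simp
    ultimately show ?thesis using L2_scaleR(2)[of "\<lambda>x. \<phi> (e n *\<^sub>R h + x) - \<phi> x" UNIV "real (Suc n)"] by simp
  qed
  then show ?thesis by (intro LIMSEQ_le_const[OF lim]) blast
qed

lemma test_function_norms:
  "L2_norm UNIV \<phi> = L2_norm D \<phi>" "L2_norm UNIV (\<lambda>x. grad \<phi> x \<bullet> h) \<le> L2_norm D (grad \<phi>) * norm h"
  "(LINT x|lborel. \<bar>\<phi> x\<bar>) = (LINT x|lebesgue_on D. \<bar>\<phi> x\<bar>)"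
proof -
  obtain K where K: "compact K" "K \<subseteq> D" "\<And>x. x \<notin> K \<Longrightarrow> \<phi> x = 0" using \<phi> by (auto simp: test_functions_iff)
  have z: "\<phi> x = 0" "grad \<phi> x = 0" if "x \<notin> D" for x
  proof -
    have "x \<notin> K" using K(2) that by blast
    then show "\<phi> x = 0" "grad \<phi> x = 0" using K(3) grad_zero_outside[OF K(1,3)] by auto
  qed
  note [measurable] = sq_intD(1)[OF test_sq_int(1)] sq_intD(1)[OF test_sq_int(3), of h]
  have eq: "(LINT x|lebesgue_on D. f x) = (LINT x|lborel. f x)" if "f \<in> borel_measurable borel" "\<And>x. x \<notin> D \<Longrightarrow> f x = 0" for f :: "'a \<Rightarrow> real"
    by (rule lborel_lebesgue_on(2)[OF that(1) lsets that(2)])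
  show "(LINT x|lborel. \<bar>\<phi> x\<bar>) = (LINT x|lebesgue_on D. \<bar>\<phi> x\<bar>)" using z by (subst eq) auto
  have "(L2_norm UNIV \<phi>)\<^sup>2 = (L2_norm D \<phi>)\<^sup>2" using z by (subst L2_UNIV_norm_sq, simp, subst L2_norm_sq, subst eq) auto
  then show "L2_norm UNIV \<phi> = L2_norm D \<phi>" by simp
  have "(L2_norm UNIV (\<lambda>x. grad \<phi> x \<bullet> h))\<^sup>2 = (L2_norm D (\<lambda>x. grad \<phi> x \<bullet> h))\<^sup>2"
    using z by (subst L2_UNIV_norm_sq, simp, subst L2_norm_sq, subst eq) auto
  then have "L2_norm UNIV (\<lambda>x. grad \<phi> x \<bullet> h) = L2_norm D (\<lambda>x. grad \<phi> x \<bullet> h)" by simp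
  also have "\<dots> \<le> L2_norm D (\<lambda>x. norm h *\<^sub>R grad \<phi> x)"
  proof (rule L2_bound(2)[OF L2_scaleR(1)[OF test_function_C1(2)[OF \<phi>]]])
    show "(\<lambda>x. grad \<phi> x \<bullet> h) \<in> borel_measurable (lebesgue_on D)" by (intro borel_restrict_lebesgue) measurable
    show "AE x in lebesgue_on D. norm (grad \<phi> x \<bullet> h) \<le> norm (norm h *\<^sub>R grad \<phi> x)"
      using Cauchy_Schwarz_ineq2[of "grad \<phi> _" h] by (simp add: mult.commute)
  qed
  also have "\<dots> = L2_norm D (grad \<phi>) * norm h" using L2_scaleR(2)[OF test_function_C1(2)[OF \<phi>], of "norm h"] by simp
  finally show "L2_norm UNIV (\<lambda>x. grad \<phi> x \<bullet> h) \<le> L2_norm D (grad \<phi>) * norm h" .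
qed

text \<open>The autocorrelation of \<phi> at h is at least the bracket for every |h| < r, by the
  translation estimate. Integrating over this ball and enlarging the domain of integration to all h,
  Fubini turns the integral of its absolute version into the square of the L1 norm.\<close>

lemma Nash_test_function:
  assumes "r > 0"
  shows "((L2_norm D \<phi>)\<^sup>2 - r * L2_norm D \<phi> * L2_norm D (grad \<phi>)) * measure lborel (ball (0::'a) r) \<le> (LINT x|lebesgue_on D. \<bar>\<phi> x\<bar>)\<^sup>2"
proof -
  define c where "c = (L2_norm D \<phi>)\<^sup>2 - r * L2_norm D \<phi> * L2_norm D (grad \<phi>)"
  define N where "N = (LINT x|lborel. \<bar>\<phi> x\<bar>)"
  have N0: "N \<ge> 0" unfolding N_def by simp
  have [measurable]: "\<phi> \<in> borel_measurable borel" using sq_intD(1)[OF test_sq_int(1)] .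
  have T0: "\<phi> \<in> L2 UNIV" by (rule sq_int_L2(1)[OF test_sq_int(1)]) simp
  have prod: "integrable lborel (\<lambda>x. \<phi> x * \<phi> (h + x))" for h
    by (rule sq_int_mult_integrable[OF test_sq_int(1) sq_int_translation[OF test_sq_int(1)]])
  have S: "c \<le> (LINT x|lborel. \<phi> x * \<phi> (h + x))" if "norm h < r" for h
  proof -
    have dL: "(\<lambda>x. \<phi> (h + x) - \<phi> x) \<in> L2 UNIV"
      by (rule sq_int_L2(1)[OF sq_int_diff[OF sq_int_translation[OF test_sq_int(1)] test_sq_int(1)]]) simp
    have "(LINT x|lborel. (\<phi> x)\<^sup>2) - (LINT x|lborel. \<phi> x * \<phi> (h + x)) = (LINT x|lborel. (\<phi> x)\<^sup>2 - \<phi> x * \<phi> (h + x))"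
      by (rule Bochner_Integration.integral_diff[OF sq_intD(2)[OF test_sq_int(1)] prod, symmetric])
    also have "\<dots> = - (LINT x|lborel. \<phi> x * (\<phi> (h + x) - \<phi> x))"
      by (subst Bochner_Integration.integral_minus[symmetric], intro Bochner_Integration.integral_cong) (auto simp: power2_eq_square algebra_simps)
    also have "(LINT x|lborel. \<phi> x * (\<phi> (h + x) - \<phi> x)) = (LINT x|lebesgue_on UNIV. \<phi> x \<bullet> (\<phi> (h + x) - \<phi> x))"
      by (subst lborel_lebesgue_on(2)) auto
    also have "- \<dots> \<le> L2_norm UNIV \<phi> * L2_norm UNIV (\<lambda>x. \<phi> (h + x) - \<phi> x)"
      using L2_inner_le[OF T0 dL] by linarith
    also have "\<dots> \<le> L2_norm UNIV \<phi> * (L2_norm D (grad \<phi>) * r)"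
    proof (rule mult_left_mono)
      have "L2_norm D (grad \<phi>) * norm h \<le> L2_norm D (grad \<phi>) * r" using that by (intro mult_left_mono) auto
      then show "L2_norm UNIV (\<lambda>x. \<phi> (h + x) - \<phi> x) \<le> L2_norm D (grad \<phi>) * r"
        using translation_estimate[of h] test_function_norms(2)[of h] by linarith
    qed simp
    finally have "(L2_norm UNIV \<phi>)\<^sup>2 - (LINT x|lborel. \<phi> x * \<phi> (h + x)) \<le> L2_norm UNIV \<phi> * (L2_norm D (grad \<phi>) * r)"
      by (simp add: L2_UNIV_norm_sq)
    then show ?thesis unfolding c_def test_function_norms(1) by (simp add: mult_ac)
  qed
  have abs1: "(\<integral>\<^sup>+x. ennreal \<bar>\<phi> (a + x)\<bar> \<partial>lborel) = ennreal N" for a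
    using nn_integral_eq_integral[of lborel "\<lambda>x. \<bar>\<phi> (a + x)\<bar>"] lborel_integrable_translation[of \<phi> a] test_sq_int(2)
      lborel_integral_translation[of "\<lambda>x. \<bar>\<phi> x\<bar>" a] by (simp add: N_def)
  have "ennreal c * emeasure lborel (ball (0::'a) r) = (\<integral>\<^sup>+h. ennreal c * indicator (ball 0 r) h \<partial>(lborel :: 'a measure))"
    by (simp add: nn_integral_cmult_indicator)
  also have "\<dots> \<le> (\<integral>\<^sup>+h. (\<integral>\<^sup>+x. ennreal \<bar>\<phi> x\<bar> * ennreal \<bar>\<phi> (h + x)\<bar> \<partial>lborel) \<partial>lborel)"
  proof (rule nn_integral_mono)
    fix h :: 'a
    show "ennreal c * indicator (ball 0 r) h \<le> (\<integral>\<^sup>+x. ennreal \<bar>\<phi> x\<bar> * ennreal \<bar>\<phi> (h + x)\<bar> \<partial>lborel)"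
    proof (cases "norm h < r")
      case True
      have "ennreal c \<le> ennreal \<bar>LINT x|lborel. \<phi> x * \<phi> (h + x)\<bar>" using S[OF True] by (intro ennreal_leI) linarith
      also have "\<dots> \<le> (\<integral>\<^sup>+x. norm (\<phi> x * \<phi> (h + x)) \<partial>lborel)" using integral_norm_bound_ennreal[OF prod[of h]] by simp
      finally show ?thesis using True by (simp add: abs_mult ennreal_mult)
    qed simp
  qed
  also have "\<dots> = (\<integral>\<^sup>+x. (\<integral>\<^sup>+h. ennreal \<bar>\<phi> x\<bar> * ennreal \<bar>\<phi> (h + x)\<bar> \<partial>lborel) \<partial>lborel)"
    by (rule lborel_pair.Fubini') measurable
  also have "\<dots> = (\<integral>\<^sup>+x. ennreal \<bar>\<phi> x\<bar> * ennreal N \<partial>lborel)"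
    using abs1 by (intro nn_integral_cong) (simp add: nn_integral_cmult add.commute)
  also have "\<dots> = ennreal N * ennreal N" using abs1[of 0] by (simp add: nn_integral_multc)
  finally have fin: "ennreal c * emeasure lborel (ball (0::'a) r) \<le> ennreal (N * N)" using N0 by (simp add: ennreal_mult)
  have "c * measure lborel (ball (0::'a) r) \<le> N\<^sup>2"
  proof (cases "c \<le> 0")
    case True
    then have "c * measure lborel (ball (0::'a) r) \<le> 0" by (intro mult_nonpos_nonneg) auto
    then show ?thesis using zero_le_power2[of N] by linarith
  next
    case False
    have "emeasure lborel (ball (0::'a) r) = ennreal (measure lborel (ball (0::'a) r))"
      using emeasure_lborel_ball_finite[of "0::'a" r] by (intro emeasure_eq_ennreal_measure) auto
    then have "ennreal (c * measure lborel (ball (0::'a) r)) \<le> ennreal (N * N)" using fin False by (simp add: ennreal_mult)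
    then show ?thesis using N0 by (simp add: power2_eq_square)
  qed
  then show ?thesis unfolding c_def N_def test_function_norms(3) .
qed

end

text \<open>All three norms are continuous along the approximating test functions. For the L1 norm
  this uses that D has finite measure: it is the inner product of |v| with the constant 1.\<close>

lemma Nash_inequality:
  assumes "H10_gradient D v g" "r > 0"
  shows "((L2_norm D v)\<^sup>2 - r * L2_norm D v * L2_norm D g) * measure lborel (ball (0::'a) r) \<le> (LINT x|lebesgue_on D. \<bar>v x\<bar>)\<^sup>2"
proof -
  obtain \<phi> where \<phi>: "\<forall>n. \<phi> n \<in> test_functions D" "(\<lambda>n. L2_norm D (\<lambda>x. \<phi> n x - v x)) \<longlonglongrightarrow> 0"
    "(\<lambda>n. L2_norm D (\<lambda>x. grad (\<phi> n) x - g x)) \<longlonglongrightarrow> 0"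
    by (rule H10_gradient_seq[OF assms(1)])
  note t = test_function_C1[OF spec[OF \<phi>(1)]] and l = H10_gradient_L2[OF assms(1)]
  have n1: "(\<lambda>n. L2_norm D (\<phi> n)) \<longlonglongrightarrow> L2_norm D v" by (rule L2_norm_tendsto[OF t(1) l(1) \<phi>(2)])
  have n2: "(\<lambda>n. L2_norm D (grad (\<phi> n))) \<longlonglongrightarrow> L2_norm D g" by (rule L2_norm_tendsto[OF t(2) l(2) \<phi>(3)])
  have ab: "(\<lambda>x. \<bar>f x\<bar>) \<in> L2 D" if "f \<in> L2 D" for f :: "'a \<Rightarrow> real"
    using that by (intro L2_bound(1)[OF that]) (auto dest: L2_measurable)
  have "(\<lambda>n. L2_norm D (\<lambda>x. \<bar>\<phi> n x\<bar> - \<bar>v x\<bar>)) \<longlonglongrightarrow> 0"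
  proof (rule L2_tendsto_bound[OF L2_diff(1)[OF t(1) l(1)] \<phi>(2), where c = 1])
    show "(\<lambda>x. \<bar>\<phi> n x\<bar> - \<bar>v x\<bar>) \<in> borel_measurable (lebesgue_on D)" for n
      using L2_measurable[OF t(1)] L2_measurable[OF l(1)] by measurable
    show "AE x in lebesgue_on D. norm (\<bar>\<phi> n x\<bar> - \<bar>v x\<bar>) \<le> 1 * norm (\<phi> n x - v x)" for n
      by (intro AE_I2) (simp add: abs_triangle_ineq3)
  qed simp
  from L2_inner_tendsto[OF ab[OF t(1)] ab[OF l(1)] this const_L2[of 1]]
  have n3: "(\<lambda>n. LINT x|lebesgue_on D. \<bar>\<phi> n x\<bar>) \<longlonglongrightarrow> (LINT x|lebesgue_on D. \<bar>v x\<bar>)" by simp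
  show ?thesis
  proof (rule LIMSEQ_le)
    show "(\<lambda>n. ((L2_norm D (\<phi> n))\<^sup>2 - r * L2_norm D (\<phi> n) * L2_norm D (grad (\<phi> n))) * measure lborel (ball (0::'a) r))
      \<longlonglongrightarrow> ((L2_norm D v)\<^sup>2 - r * L2_norm D v * L2_norm D g) * measure lborel (ball (0::'a) r)"
      by (intro tendsto_intros n1 n2)
    show "(\<lambda>n. (LINT x|lebesgue_on D. \<bar>\<phi> n x\<bar>)\<^sup>2) \<longlonglongrightarrow> (LINT x|lebesgue_on D. \<bar>v x\<bar>)\<^sup>2" by (intro tendsto_intros n3)
    show "\<exists>N. \<forall>n\<ge>N. ((L2_norm D (\<phi> n))\<^sup>2 - r * L2_norm D (\<phi> n) * L2_norm D (grad (\<phi> n))) * measure lborel (ball (0::'a) r) \<le> (LINT x|lebesgue_on D. \<bar>\<phi> n x\<bar>)\<^sup>2"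
      using Nash_test_function[OF spec[OF \<phi>(1)] assms(2)] by blast
  qed
qed

text \<open>A function living on S has squared L1 norm at most |S| times its squared L2 norm. If S
  has at most half the measure of the ball, this absorbs half of the square in the Nash inequality
  and leaves a Poincare inequality with constant 2 r.\<close>

lemma Faber_Krahn:
  assumes v: "H10_gradient D v g" and r: "r > 0"
    and S: "S \<in> sets lebesgue" "S \<subseteq> D" "AE x in lebesgue_on D. x \<notin> S \<longrightarrow> v x = 0" "2 * measure lebesgue S \<le> measure lborel (ball (0::'a) r)"
  shows "L2_norm D v \<le> 2 * r * L2_norm D g" "(LINT x|lebesgue_on D. \<bar>v x\<bar>) \<le> sqrt (measure lebesgue S) * L2_norm D v"
proof -
  note l = H10_gradient_L2[OF v]
  let ?I = "indicator S :: 'a \<Rightarrow> real"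
  have Im: "?I \<in> borel_measurable (lebesgue_on D)"
    using borel_measurable_indicator[OF S(1)] by (rule measurable_restrict_space1)
  have IL: "?I \<in> L2 D" by (rule L2_norm_bounded_lmeasurable(1)[OF lmeas Im, of 1]) (auto split: split_indicator)
  have "(LINT x|lebesgue_on D. (norm (?I x))\<^sup>2) = (LINT x|lebesgue_on D. ?I x)"
    by (intro Bochner_Integration.integral_cong) (auto split: split_indicator)
  also have "\<dots> = measure (lebesgue_on D) S"
    using S(1,2) lsets by (simp add: sets_restrict_space_iff Int_absorb2)
  also have "\<dots> = measure lebesgue S" using S(2) lsets by (intro measure_restrict_space) auto
  finally have In: "L2_norm D ?I = sqrt (measure lebesgue S)" by (simp add: L2_norm_def)
  have "(LINT x|lebesgue_on D. \<bar>v x\<bar>) = (LINT x|lebesgue_on D. norm (?I x) * norm (v x))"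
  proof (rule integral_cong_AE)
    show "AE x in lebesgue_on D. \<bar>v x\<bar> = norm (?I x) * norm (v x)"
      using S(3) by eventually_elim (auto split: split_indicator)
  qed (use Im L2_measurable[OF l(1)] in measurable)
  also have "\<dots> \<le> sqrt (measure lebesgue S) * L2_norm D v" using L2_norm_Cauchy_Schwarz[OF IL l(1)] In by simp
  finally show le1: "(LINT x|lebesgue_on D. \<bar>v x\<bar>) \<le> sqrt (measure lebesgue S) * L2_norm D v" .
  define m where "m = measure lborel (ball (0::'a) r)"
  define A where "A = measure lebesgue S"
  define n where "n = L2_norm D v"
  define k where "k = L2_norm D g"
  have m: "m > 0" using content_ball_pos[OF r, of "0::'a"] by (simp add: m_def measure_completion)
  have A: "A \<ge> 0" "2 * A \<le> m" using S(4) by (auto simp: A_def m_def)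
  have nk: "n \<ge> 0" "k \<ge> 0" by (auto simp: n_def k_def)
  have "(LINT x|lebesgue_on D. \<bar>v x\<bar>)\<^sup>2 \<le> (sqrt A * n)\<^sup>2" using le1 by (intro power_mono) (auto simp: A_def n_def)
  then have "(n\<^sup>2 - r * n * k) * m \<le> A * n\<^sup>2"
    using Nash_inequality[OF v r] A(1) by (simp add: m_def n_def k_def power_mult_distrib)
  also have "A * n\<^sup>2 \<le> (m / 2) * n\<^sup>2" using A by (intro mult_right_mono) auto
  finally have "(n\<^sup>2 - r * n * k) * m \<le> (n\<^sup>2 / 2) * m" by (simp add: mult_ac)
  then have "n\<^sup>2 - r * n * k \<le> n\<^sup>2 / 2" using m by (rule mult_right_le_imp_le)
  then have "n * n \<le> n * (2 * r * k)" by (simp add: power2_eq_square algebra_simps)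
  then have "n \<le> 2 * r * k" using nk r by (cases "n = 0") (auto simp: mult_le_cancel_left)
  then show "L2_norm D v \<le> 2 * r * L2_norm D g" by (simp add: n_def k_def)
qed

end

section \<open>The maximum principle\<close>

text \<open>Replaces \<open>max 0 t\<close> in the truncations, because the chain rule above needs a continuous derivative.\<close>

definition ramp :: "real \<Rightarrow> real \<Rightarrow> real" where
  "ramp d t = sqrt ((max 0 t)\<^sup>2 + d\<^sup>2) - d"

lemma ramp_derivative:
  assumes "d > 0"
  shows "(ramp d has_real_derivative max 0 t / sqrt ((max 0 t)\<^sup>2 + d\<^sup>2)) (at t)"
proof -
  have sq: "((\<lambda>t. (max 0 t)\<^sup>2) has_real_derivative 2 * max 0 t) (at t)" for t :: real
  proof (cases "t = 0")
    case True
    have "((\<lambda>h. (max 0 h)\<^sup>2 / h) \<longlongrightarrow> 0) (at (0::real))"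
    proof (rule Lim_null_comparison)
      show "\<forall>\<^sub>F h in at (0::real). norm ((max 0 h)\<^sup>2 / h) \<le> \<bar>h\<bar>"
        by (intro always_eventually allI) (auto simp: max_def power2_eq_square)
      show "((\<lambda>h. \<bar>h\<bar>) \<longlongrightarrow> 0) (at (0::real))" by (rule tendsto_rabs_zero) (rule tendsto_ident_at)
    qed
    then show ?thesis using True by (simp add: DERIV_def)
  next
    case False
    show ?thesis
    proof (cases "t > 0")
      case True
      have "\<forall>\<^sub>F s in nhds t. s \<in> {0<..}" using True by (intro eventually_nhds_in_open) auto
      then have ev: "\<forall>\<^sub>F s in nhds t. (max 0 s)\<^sup>2 = s\<^sup>2" by eventually_elim simp
      have "((\<lambda>s. s\<^sup>2) has_real_derivative 2 * t) (at t)" by (auto intro!: derivative_eq_intros)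
      then show ?thesis using True DERIV_cong_ev[OF refl ev refl] by (simp only: max_absorb2 less_imp_le)
    next
      case 2: False
      have "\<forall>\<^sub>F s in nhds t. s \<in> {..<0}" using False 2 by (intro eventually_nhds_in_open) auto
      then have ev: "\<forall>\<^sub>F s in nhds t. (max 0 s)\<^sup>2 = 0" by eventually_elim simp
      have "((\<lambda>s. 0) has_real_derivative 0) (at t)" by simp
      moreover have "max 0 t = 0" using 2 by simp
      ultimately show ?thesis using DERIV_cong_ev[OF refl ev refl, of 0] by (simp only: mult_zero_right)
    qed
  qed
  have pos: "(max 0 t)\<^sup>2 + d\<^sup>2 > 0" using assms by (simp add: add_nonneg_pos)
  have sq2: "((\<lambda>t. (max 0 t)\<^sup>2 + d\<^sup>2) has_real_derivative 2 * max 0 t + 0) (at t)"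
    by (intro DERIV_add sq DERIV_const)
  have "((\<lambda>t. sqrt ((max 0 t)\<^sup>2 + d\<^sup>2)) has_real_derivative max 0 t / sqrt ((max 0 t)\<^sup>2 + d\<^sup>2)) (at t)"
  proof -
    have "((\<lambda>t. sqrt ((max 0 t)\<^sup>2 + d\<^sup>2)) has_real_derivative
        inverse (sqrt ((max 0 t)\<^sup>2 + d\<^sup>2)) / 2 * (2 * max 0 t + 0)) (at t)"
      by (rule DERIV_chain2[where f = sqrt and g = "\<lambda>t. (max 0 t)\<^sup>2 + d\<^sup>2", OF DERIV_real_sqrt[OF pos] sq2])
    moreover have "inverse s / 2 * (2 * m + 0) = m / s" for s m :: real by (cases "s = 0") (simp_all add: field_simps)
    ultimately show ?thesis by metis
  qed
  from DERIV_diff[OF this DERIV_const[of d]]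
  have "((\<lambda>t. sqrt ((max 0 t)\<^sup>2 + d\<^sup>2) - d) has_real_derivative max 0 t / sqrt ((max 0 t)\<^sup>2 + d\<^sup>2) - 0) (at t)" .
  then show ?thesis unfolding ramp_def [abs_def] by simp
qed

text \<open>At t = d the ramp equals (sqrt 2 - 1) d; the fraction 2/5 is a rational lower bound for
  sqrt 2 - 1, because (7/5)^2 = 49/25 is less than 2.\<close>

lemma ramp_bounds:
  assumes "d > 0"
  shows "0 \<le> ramp d t" "t \<le> 0 \<Longrightarrow> ramp d t = 0" "t \<ge> d \<Longrightarrow> (2/5) * d \<le> ramp d t"
    "0 \<le> max 0 t / sqrt ((max 0 t)\<^sup>2 + d\<^sup>2)" "max 0 t / sqrt ((max 0 t)\<^sup>2 + d\<^sup>2) \<le> 1"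
proof -
  have s: "sqrt ((max 0 t)\<^sup>2 + d\<^sup>2) > 0" using assms by (simp add: add_nonneg_pos)
  show "0 \<le> ramp d t" unfolding ramp_def using real_le_rsqrt[of d "(max 0 t)\<^sup>2 + d\<^sup>2"] by simp
  show "ramp d t = 0" if "t \<le> 0" using that assms by (simp add: ramp_def)
  show "0 \<le> max 0 t / sqrt ((max 0 t)\<^sup>2 + d\<^sup>2)" using s by simp
  have "max 0 t \<le> sqrt ((max 0 t)\<^sup>2 + d\<^sup>2)" by (rule real_le_rsqrt) simp
  then show "max 0 t / sqrt ((max 0 t)\<^sup>2 + d\<^sup>2) \<le> 1" using s by (simp only: pos_divide_le_eq mult_1)
  show "(2/5) * d \<le> ramp d t" if "t \<ge> d"
  proof -
    have "d\<^sup>2 \<le> t\<^sup>2" using that assms by (intro power_mono) auto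
    then have "((7/5) * d)\<^sup>2 \<le> (max 0 t)\<^sup>2 + d\<^sup>2"
    proof -
      have "((7/5) * d)\<^sup>2 = (49/25) * d\<^sup>2" by (simp add: power_mult_distrib power2_eq_square)
      moreover have "max 0 t = t" using that assms by simp
      ultimately show ?thesis using \<open>d\<^sup>2 \<le> t\<^sup>2\<close> zero_le_power2[of d] by (simp only:)
    qed
    then have "(7/5) * d \<le> sqrt ((max 0 t)\<^sup>2 + d\<^sup>2)" by (rule real_le_rsqrt)
    then show ?thesis by (simp add: ramp_def)
  qed
qed

section \<open>Level sets and a priori bounds of weak solutions\<close>

context bounded_open begin

text \<open>The weak formulation for explicit pairs of function and gradient, tested with every such
  pair; it is what the chain and product rules produce directly.\<close>

definition weak_sol :: "('a \<Rightarrow> real) \<Rightarrow> ('a \<Rightarrow> real) \<Rightarrow> ('a \<Rightarrow> real) \<Rightarrow> ('a \<Rightarrow> 'a) \<Rightarrow> bool" where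
  "weak_sol a f u g \<longleftrightarrow> H10_gradient D u g \<and>
     (\<forall>v h. H10_gradient D v h \<longrightarrow> (LINT x|lebesgue_on D. a x * (g x \<bullet> h x)) = (LINT x|lebesgue_on D. f x * v x))"

lemma weak_sol_uminus:
  assumes "weak_sol a f u g"
  shows "weak_sol a (\<lambda>x. - f x) (\<lambda>x. - u x) (\<lambda>x. - g x)"
  using assms unfolding weak_sol_def by (simp add: H10_gradient_uminus)

lemma weak_solutionD:
  assumes "weak_solution D a f u" "a \<in> borel_measurable (lebesgue_on D)"
  shows "weak_sol a f u (weak_grad D u)"
  unfolding weak_sol_def
proof (intro conjI allI impI)
  show "H10_gradient D u (weak_grad D u)" using assms(1) by (intro H10_gradientD) (simp add: weak_solution_def)
  fix v h assume vh: "H10_gradient D v h"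
  note i = H10I[OF vh]
  have g: "weak_grad D u \<in> borel_measurable (lebesgue_on D)"
    using assms(1) H10_gradient_L2(2)[OF H10_gradientD] by (auto simp: weak_solution_def dest: L2_measurable)
  have h: "h \<in> borel_measurable (lebesgue_on D)" "weak_grad D v \<in> borel_measurable (lebesgue_on D)"
    using L2_measurable H10_gradient_L2(2)[OF vh] H10_gradient_L2(2)[OF H10_gradientD[OF i(1)]] by auto
  have "(LINT x|lebesgue_on D. a x * (weak_grad D u x \<bullet> h x)) = (LINT x|lebesgue_on D. a x * (weak_grad D u x \<bullet> weak_grad D v x))"
  proof (rule integral_cong_AE)
    show "AE x in lebesgue_on D. a x * (weak_grad D u x \<bullet> h x) = a x * (weak_grad D u x \<bullet> weak_grad D v x)"
      using i(2) by eventually_elim simp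
  qed (use assms(2) g h in measurable)
  then show "(LINT x|lebesgue_on D. a x * (weak_grad D u x \<bullet> h x)) = (LINT x|lebesgue_on D. f x * v x)"
    using assms(1) i(1) by (simp add: weak_solution_def)
qed

lemma level_set:
  fixes u :: "'a \<Rightarrow> real"
  assumes "u \<in> borel_measurable (lebesgue_on D)"
  shows "{x \<in> D. k < u x} \<in> sets lebesgue" "{x \<in> D. k < u x} \<in> lmeasurable"
proof -
  have "{x \<in> space (lebesgue_on D). k < u x} \<in> sets (lebesgue_on D)"
    using assms by measurable
  then show s: "{x \<in> D. k < u x} \<in> sets lebesgue"
    using lsets by (simp add: sets_restrict_space_iff)
  show "{x \<in> D. k < u x} \<in> lmeasurable" by (rule fmeasurableI2[OF lmeas _ s]) auto
qed

text \<open>Testing with v = G(u), a smoothed positive part of u - k, bounds the energy of v by F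
  times its L1 norm. As v lives on the level set above k, the Poincare inequality with constant 2 r
  closes this into a bound of the L1 norm by the measure of that set; above k + d the function v is
  at least (2/5) d.\<close>

lemma truncation_estimate:
  assumes u: "weak_sol a f u g" and a: "a \<in> borel_measurable (lebesgue_on D)" "AE x in lebesgue_on D. lam \<le> a x \<and> a x \<le> Lam" "lam > 0"
    and f: "f \<in> borel_measurable (lebesgue_on D)" "AE x in lebesgue_on D. \<bar>f x\<bar> \<le> F" "F \<ge> 0"
    and r: "r > 0" and k: "k \<ge> 0" and d: "d > 0"
    and S: "2 * measure lebesgue {x \<in> D. k < u x} \<le> measure lborel (ball (0::'a) r)"
  shows "lam * d * measure lebesgue {x \<in> D. k + d < u x} \<le> 10 * F * r\<^sup>2 * measure lebesgue {x \<in> D. k < u x}"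
proof -
  define G where "G t = ramp d (t - k)" for t
  define G' where "G' t = max 0 (t - k) / sqrt ((max 0 (t - k))\<^sup>2 + d\<^sup>2)" for t
  have Gd: "(G has_real_derivative G' t) (at t)" for t
  proof -
    have "((\<lambda>t. t - k) has_real_derivative 1) (at t)" by (auto intro!: derivative_eq_intros)
    from DERIV_chain2[OF ramp_derivative[OF d] this] show ?thesis unfolding G_def [abs_def] G'_def by simp
  qed
  have pos: "(max 0 (t - k))\<^sup>2 + d\<^sup>2 > 0" for t using d by (simp add: add_nonneg_pos)
  have Gc: "continuous_on UNIV G'"
    unfolding G'_def [abs_def] using pos by (intro continuous_intros) (auto simp: less_imp_neq[THEN not_sym])
  have G': "0 \<le> G' t" "G' t \<le> 1" for t unfolding G'_def by (rule ramp_bounds(4,5)[OF d])+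
  have G'a: "\<bar>G' t\<bar> \<le> 1" for t using G'[of t] by simp
  have G0: "G 0 = 0" unfolding G_def using k by (intro ramp_bounds(2)[OF d]) simp
  have Gnn: "0 \<le> G t" for t unfolding G_def by (rule ramp_bounds(1)[OF d])
  have uH: "H10_gradient D u g" using u by (simp add: weak_sol_def)
  note v = H10_gradient_chain[OF uH Gd Gc G'a G0]
  note ul = H10_gradient_L2[OF uH] and vl = H10_gradient_L2[OF v]
  note [measurable] = L2_measurable[OF ul(1)] L2_measurable[OF ul(2)] a(1) f(1) borel_measurable_continuous_onI[OF Gc]
  let ?S = "{x \<in> D. k < u x}" and ?T = "{x \<in> D. k + d < u x}"
  let ?v = "\<lambda>x. G (u x)" and ?h = "\<lambda>x. G' (u x) *\<^sub>R g x"
  have Sl: "?S \<in> sets lebesgue" "?T \<in> sets lebesgue" "?T \<in> lmeasurable" using level_set[OF L2_measurable[OF ul(1)]] by auto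
  define A where "A = measure lebesgue ?S"
  define n where "n = L2_norm D ?v"
  define m where "m = L2_norm D ?h"
  have nn: "A \<ge> 0" "n \<ge> 0" "m \<ge> 0" by (auto simp: A_def n_def m_def)
  have v0: "AE x in lebesgue_on D. x \<notin> ?S \<longrightarrow> ?v x = 0"
    using AE_lebesgue_on_D[of D] by eventually_elim (auto simp: G_def intro!: ramp_bounds(2)[OF d])
  have Ssub: "?S \<subseteq> D" by auto
  from Faber_Krahn[OF v r Sl(1) Ssub v0 S]
  have FK: "n \<le> 2 * r * m" "(LINT x|lebesgue_on D. \<bar>?v x\<bar>) \<le> sqrt A * n" by (simp_all add: n_def m_def A_def)
  define I where "I = (LINT x|lebesgue_on D. \<bar>?v x\<bar>)"
  have vi: "integrable (lebesgue_on D) ?v" by (rule L2_locally_integrable(2)[OF vl(1) lmeas])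
  have "lam * m\<^sup>2 \<le> F * I"
  proof -
    have i1: "integrable (lebesgue_on D) (\<lambda>x. a x * (g x \<bullet> ?h x))"
    proof (rule L2_bounded_by_mult[OF L2_scaleR(1)[OF ul(2), of Lam] vl(2)])
      show "AE x in lebesgue_on D. norm (a x * (g x \<bullet> ?h x)) \<le> norm (Lam *\<^sub>R g x) * norm (?h x)"
        using a(2)
      proof eventually_elim
        case (elim x)
        have "\<bar>a x\<bar> * \<bar>g x \<bullet> ?h x\<bar> \<le> \<bar>Lam\<bar> * (norm (g x) * norm (?h x))"
          using elim a(3) by (intro mult_mono Cauchy_Schwarz_ineq2) auto
        then show ?case by (simp only: real_norm_def abs_mult norm_scaleR mult.assoc)
      qed
    qed measurable
    have "lam * m\<^sup>2 = (LINT x|lebesgue_on D. lam * (norm (?h x))\<^sup>2)" unfolding m_def L2_norm_sq by simp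
    also have "\<dots> \<le> (LINT x|lebesgue_on D. a x * (g x \<bullet> ?h x))"
    proof (rule integral_mono_AE)
      show "integrable (lebesgue_on D) (\<lambda>x. lam * (norm (?h x))\<^sup>2)" using L2_integrable[OF vl(2)] by simp
      show "AE x in lebesgue_on D. lam * (norm (?h x))\<^sup>2 \<le> a x * (g x \<bullet> ?h x)"
        using a(2)
      proof eventually_elim
        case (elim x)
        \<comment> \<open>The gradient of v is G'(u) g, so its square carries G'(u) twice but the
          equation only once; 0 \<le> G' \<le> 1 makes this harmless.\<close>
        have "(G' (u x))\<^sup>2 \<le> G' (u x)" using G'[of "u x"] by (simp add: power2_eq_square mult_left_le)
        then have "lam * ((G' (u x))\<^sup>2 * (norm (g x))\<^sup>2) \<le> a x * (G' (u x) * (norm (g x))\<^sup>2)"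
          using elim a(3) G'[of "u x"] by (intro mult_mono) auto
        then show ?case by (simp add: power_mult_distrib power2_norm_eq_inner)
      qed
    qed (rule i1)
    also have "\<dots> = (LINT x|lebesgue_on D. f x * ?v x)" using u v unfolding weak_sol_def by blast
    also have "\<dots> \<le> (LINT x|lebesgue_on D. F * \<bar>?v x\<bar>)"
    proof (rule integral_mono_AE)
      have b: "AE x in lebesgue_on D. \<bar>f x * ?v x\<bar> \<le> F * \<bar>?v x\<bar>"
        using f(2) by eventually_elim (simp add: abs_mult mult_right_mono)
      show "integrable (lebesgue_on D) (\<lambda>x. F * \<bar>?v x\<bar>)" using vi by simp
      then show "integrable (lebesgue_on D) (\<lambda>x. f x * ?v x)"
        by (rule Bochner_Integration.integrable_bound)
           (use f(1) L2_measurable[OF vl(1)] in measurable, use b f(3) in \<open>simp add: abs_of_nonneg\<close>)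
      show "AE x in lebesgue_on D. f x * ?v x \<le> F * \<bar>?v x\<bar>" using b by eventually_elim linarith
    qed
    also have "\<dots> = F * I" by (simp add: I_def)
    finally show ?thesis .
  qed
  also have "F * I \<le> F * (sqrt A * (2 * r * m))"
    using FK f(3) nn by (intro mult_left_mono order_trans[OF FK(2)[folded I_def]]) auto
  finally have "m * (lam * m) \<le> m * (2 * F * r * sqrt A)" by (simp add: power2_eq_square mult_ac)
  then have lm: "lam * m \<le> 2 * F * r * sqrt A"
    using nn f(3) r a(3) by (cases "m = 0") (auto simp: mult_le_cancel_left)
  have "I \<le> sqrt A * (2 * r * m)" using FK nn by (intro order_trans[OF FK(2)[folded I_def]] mult_left_mono) auto
  then have "lam * I \<le> (2 * r * sqrt A) * (lam * m)" using mult_left_mono[of I _ lam] a(3) by (simp add: mult_ac)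
  also have "\<dots> \<le> (2 * r * sqrt A) * (2 * F * r * sqrt A)" using lm r nn by (intro mult_left_mono) auto
  also have "\<dots> = 4 * F * r\<^sup>2 * A" using nn(1) by (simp add: power2_eq_square)
  finally have lI: "lam * I \<le> 4 * F * r\<^sup>2 * A" .
  have "(2/5) * d * measure lebesgue ?T \<le> I"
  proof -
    have Tm: "measure (lebesgue_on D) ?T = measure lebesgue ?T" using lsets by (intro measure_restrict_space) auto
    have Ti: "integrable (lebesgue_on D) (indicator ?T :: 'a \<Rightarrow> real)"
      using Sl lsets lmeas by (intro L2_locally_integrable(2)[OF _ lmeas] L2_norm_bounded_lmeasurable(1)[OF lmeas, of _ 1] measurable_restrict_space1 borel_measurable_indicator) (auto split: split_indicator)
    have "(2/5) * d * measure lebesgue ?T = (LINT x|lebesgue_on D. (2/5) * d * indicator ?T x)"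
      using Tm Sl(2) lsets by (simp add: sets_restrict_space_iff Int_absorb2)
    also have "\<dots> \<le> I"
      unfolding I_def
    proof (rule integral_mono)
      show "(2/5) * d * indicator ?T x \<le> \<bar>?v x\<bar>" for x
        using Gnn[of "u x"] ramp_bounds(3)[OF d, of "u x - k"] by (auto simp: G_def split: split_indicator)
    qed (use Ti vi in auto)
    finally show ?thesis .
  qed
  \<comment> \<open>The constant 10 is 4 divided by 2/5.\<close>
  from mult_left_mono[OF this less_imp_le[OF a(3)]] lI
  have "lam * ((2/5) * d * measure lebesgue ?T) \<le> 4 * F * r\<^sup>2 * A" by linarith
  then show ?thesis by (simp add: A_def mult_ac)
qed

text \<open>Iterating the truncation estimate along levels \<open>k\<^sub>n\<close> with \<open>k\<^sub>n\<^sub>+\<^sub>1 - k\<^sub>n \<sim> 4\<^sup>-\<^sup>n\<close> keeps the measure of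
  the level set below that of a ball whose radius is halved in every step.\<close>

lemma maximum_principle:
  assumes R: "R > 0" "2 * measure lebesgue D \<le> measure lborel (ball (0::'a) R)"
    and u: "weak_sol a f u g" and a: "a \<in> borel_measurable (lebesgue_on D)" "AE x in lebesgue_on D. lam \<le> a x \<and> a x \<le> Lam" "lam > 0"
    and f: "f \<in> borel_measurable (lebesgue_on D)" "AE x in lebesgue_on D. \<bar>f x\<bar> \<le> F" "F > 0"
  shows "AE x in lebesgue_on D. u x \<le> 20 * 2 ^ DIM('a) * R\<^sup>2 / lam * F"
proof -
  \<comment> \<open>Chosen so that the first step already shrinks the level set by 2 to the
    dimension, the ratio of the volumes of balls with radii R and R/2.\<close>
  define d0 where "d0 = 10 * 2 ^ DIM('a) * R\<^sup>2 / lam * F"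
  have d0: "d0 > 0" unfolding d0_def using R(1) a(3) f(3) by simp
  define \<delta> where "\<delta> n = d0 / 4 ^ n" for n :: nat
  define \<kappa> where "\<kappa> n = (\<Sum>j<n. \<delta> j)" for n
  define r where "r n = R / 2 ^ n" for n :: nat
  have \<delta>: "\<delta> n > 0" for n using d0 by (simp add: \<delta>_def)
  have \<kappa>0: "\<kappa> n \<ge> 0" for n unfolding \<kappa>_def using \<delta> by (intro sum_nonneg) (simp add: less_imp_le)
  have "\<kappa> n = (4/3) * (d0 - d0 / 4 ^ n)" for n
  proof (induction n)
    case (Suc n)
    define q where "q = d0 / 4 ^ n"
    have 1: "\<kappa> (Suc n) = \<kappa> n + q" by (simp add: \<kappa>_def \<delta>_def q_def)
    have 2: "d0 / 4 ^ Suc n = q / 4" by (simp add: q_def)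
    show ?case unfolding 1 2 Suc[folded q_def] by (simp add: field_simps)
  qed (simp add: \<kappa>_def)
  then have \<kappa>e: "\<kappa> n = (4/3) * d0 - (4/3) * (d0 / 4 ^ n)" for n by (simp only: right_diff_distrib)
  \<comment> \<open>The step widths form a geometric series with sum (4/3) d0. Rounding up to 2 d0
    gives the factor 20 in the statement.\<close>
  have \<kappa>2: "\<kappa> n \<le> 2 * d0" for n
  proof -
    have "0 \<le> (4/3) * (d0 / 4 ^ n)" using d0 by simp
    then show ?thesis using \<kappa>e[of n] d0 by linarith
  qed
  have rpos: "r n > 0" for n using R(1) by (simp add: r_def)
  have ball: "measure lborel (ball (0::'a) (r n)) = measure lborel (ball (0::'a) R) / (2 ^ DIM('a)) ^ n" for n
    using content_ball[of "r n" "0::'a"] content_ball[of R "0::'a"] R(1) rpos[of n]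
    by (simp add: r_def power_divide power_mult[symmetric] mult.commute)
  let ?A = "\<lambda>k. measure lebesgue {x \<in> D. k < u x}"
  have um: "u \<in> borel_measurable (lebesgue_on D)" using u L2_measurable[OF H10_gradient_L2(1)] by (auto simp: weak_sol_def)
  have P: "2 * ?A (\<kappa> n) \<le> measure lborel (ball (0::'a) (r n))" for n
  proof (induction n)
    case 0
    have "?A (\<kappa> 0) \<le> measure lebesgue D" by (intro measure_mono_fmeasurable lmeas level_set(1) um) auto
    then show ?case using R(2) by (simp add: r_def)
  next
    case (Suc n)
    have "lam * \<delta> n * ?A (\<kappa> n + \<delta> n) \<le> 10 * F * (r n)\<^sup>2 * ?A (\<kappa> n)"
      using f(3) by (intro truncation_estimate[OF u a f(1,2) _ rpos \<kappa>0 \<delta> Suc]) simp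
    \<comment> \<open>Both sides scale like 4^(-n): the width by definition, the square of the
      radius by halving. So the gain per step is the same at every level.\<close>
    moreover have "lam * \<delta> n = 2 ^ DIM('a) * (10 * F * (r n)\<^sup>2)"
      using a(3) by (simp add: \<delta>_def d0_def r_def power_divide power_mult[symmetric] mult.commute[of _ 2] power_mult)
    moreover have "0 < 10 * F * (r n)\<^sup>2" using f(3) rpos[of n] by simp
    ultimately have "(10 * F * (r n)\<^sup>2) * (2 ^ DIM('a) * ?A (\<kappa> n + \<delta> n)) \<le> (10 * F * (r n)\<^sup>2) * ?A (\<kappa> n)"
      by (simp add: mult_ac)
    then have "2 ^ DIM('a) * ?A (\<kappa> n + \<delta> n) \<le> ?A (\<kappa> n)" using \<open>0 < 10 * F * (r n)\<^sup>2\<close> by (rule mult_left_le_imp_le)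
    then have "2 ^ DIM('a) * (2 * ?A (\<kappa> (Suc n))) \<le> measure lborel (ball (0::'a) (r n))"
      using Suc by (simp add: \<kappa>_def)
    then show ?case unfolding ball by (simp add: field_simps)
  qed
  have "2 * ?A (2 * d0) \<le> measure lborel (ball (0::'a) R) / (2 ^ DIM('a)) ^ n" for n
  proof -
    have "?A (2 * d0) \<le> ?A (\<kappa> n)"
      using \<kappa>2[of n] by (intro measure_mono_fmeasurable level_set um) auto
    then show ?thesis using P[of n] unfolding ball by linarith
  qed
  moreover have "(\<lambda>n. measure lborel (ball (0::'a) R) / (2 ^ DIM('a)) ^ n) \<longlonglongrightarrow> 0"
    by (intro LIMSEQ_divide_realpow_zero) simp
  ultimately have "2 * ?A (2 * d0) \<le> 0" by (intro LIMSEQ_le_const) auto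
  then have "?A (2 * d0) = 0" using measure_nonneg[of lebesgue] by (metis mult_le_0_iff not_numeral_le_zero order_antisym)
  then have "emeasure lebesgue {x \<in> D. 2 * d0 < u x} = 0"
    using level_set(2)[OF um, of "2 * d0"] by (simp add: emeasure_eq_measure2)
  then have "{x \<in> D. 2 * d0 < u x} \<in> null_sets lebesgue" using level_set(1)[OF um] by auto
  then have "AE x in lebesgue. x \<notin> {x \<in> D. 2 * d0 < u x}" by (rule AE_not_in)
  then have "AE x in lebesgue_on D. u x \<le> 2 * d0"
    unfolding AE_lebesgue_on[OF lsets] by eventually_elim auto
  then show ?thesis by (simp add: d0_def mult.assoc)
qed

text \<open>The two-sided bound comes from applying the maximum principle to u and to -u. The
  gradient bound is the energy identity, the equation tested with u itself, with f u estimated by F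
  times K F.\<close>

lemma weak_sol_bounds:
  assumes R: "R > 0" "2 * measure lebesgue D \<le> measure lborel (ball (0::'a) R)"
    and u: "weak_sol a f u g" and a: "a \<in> borel_measurable (lebesgue_on D)" "AE x in lebesgue_on D. lam \<le> a x \<and> a x \<le> Lam" "lam > 0"
    and f: "f \<in> borel_measurable (lebesgue_on D)" "AE x in lebesgue_on D. \<bar>f x\<bar> \<le> F" "F \<ge> 0"
  defines "K \<equiv> 20 * 2 ^ DIM('a) * R\<^sup>2 / lam"
  shows "AE x in lebesgue_on D. \<bar>u x\<bar> \<le> K * F" "L2_norm D g \<le> sqrt (measure lebesgue D * K / lam) * F"
proof -
  have K: "K > 0" unfolding K_def using R(1) a(3) by simp
  \<comment> \<open>The maximum principle asks for a positive bound on f, as the widths of its steps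
    are proportional to it. Here F may be 0, so it is enlarged slightly and the excess removed in
    the limit.\<close>
  have "AE x in lebesgue_on D. \<bar>u x\<bar> \<le> K * (F + inverse (real (Suc n)))" for n
  proof -
    have F: "0 < F + inverse (real (Suc n))" "AE x in lebesgue_on D. \<bar>f x\<bar> \<le> F + inverse (real (Suc n))"
    proof -
      have i: "0 < inverse (real (Suc n))" by simp
      then show "0 < F + inverse (real (Suc n))" using f(3) by linarith
      show "AE x in lebesgue_on D. \<bar>f x\<bar> \<le> F + inverse (real (Suc n))"
        using f(2) by eventually_elim (use i in linarith)
    qed
    have F': "AE x in lebesgue_on D. \<bar>- f x\<bar> \<le> F + inverse (real (Suc n))" using F(2) by simp
    have m: "(\<lambda>x. - f x) \<in> borel_measurable (lebesgue_on D)" using f(1) by measurable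
    show ?thesis
      using maximum_principle[OF R u a f(1) F(2,1)] maximum_principle[OF R weak_sol_uminus[OF u] a m F' F(1)]
      unfolding K_def by eventually_elim (simp add: abs_le_iff)
  qed
  then have "AE x in lebesgue_on D. \<forall>n. \<bar>u x\<bar> \<le> K * (F + inverse (real (Suc n)))" unfolding AE_all_countable by blast
  then show bd: "AE x in lebesgue_on D. \<bar>u x\<bar> \<le> K * F"
  proof eventually_elim
    case (elim x)
    have "(\<lambda>n. K * (F + inverse (real (Suc n)))) \<longlonglongrightarrow> K * (F + 0)" by (intro tendsto_intros LIMSEQ_inverse_real_of_nat)
    then show ?case using elim by (intro LIMSEQ_le_const[where X = "\<lambda>n. K * (F + inverse (real (Suc n)))"]) auto
  qed
  have uH: "H10_gradient D u g" using u by (simp add: weak_sol_def)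
  note l = H10_gradient_L2[OF uH]
  note [measurable] = L2_measurable[OF l(1)] L2_measurable[OF l(2)] a(1) f(1)
  have ci: "integrable (lebesgue_on D) (\<lambda>x. F * (K * F))" using L2_locally_integrable(2)[OF const_L2 lmeas] .
  have b: "AE x in lebesgue_on D. \<bar>f x * u x\<bar> \<le> F * (K * F)"
    using f(2) bd by eventually_elim (use f(3) in \<open>auto simp: abs_mult intro!: mult_mono\<close>)
  have i1: "integrable (lebesgue_on D) (\<lambda>x. a x * (g x \<bullet> g x))"
  proof (rule L2_bounded_by_mult[OF L2_scaleR(1)[OF l(2), of Lam] l(2)])
    show "AE x in lebesgue_on D. norm (a x * (g x \<bullet> g x)) \<le> norm (Lam *\<^sub>R g x) * norm (g x)"
      using a(2)
    proof eventually_elim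
      case (elim x)
      have "\<bar>a x\<bar> * \<bar>g x \<bullet> g x\<bar> \<le> \<bar>Lam\<bar> * (norm (g x) * norm (g x))"
        using elim a(3) by (intro mult_mono Cauchy_Schwarz_ineq2) auto
      then show ?case by (simp only: real_norm_def abs_mult norm_scaleR mult.assoc)
    qed
  qed measurable
  have "lam * (L2_norm D g)\<^sup>2 = (LINT x|lebesgue_on D. lam * (norm (g x))\<^sup>2)" unfolding L2_norm_sq by simp
  also have "\<dots> \<le> (LINT x|lebesgue_on D. a x * (g x \<bullet> g x))"
  proof (rule integral_mono_AE)
    show "integrable (lebesgue_on D) (\<lambda>x. lam * (norm (g x))\<^sup>2)" using L2_integrable[OF l(2)] by simp
    show "AE x in lebesgue_on D. lam * (norm (g x))\<^sup>2 \<le> a x * (g x \<bullet> g x)"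
      using a(2) by eventually_elim (simp add: power2_norm_eq_inner mult_right_mono)
  qed (rule i1)
  also have "\<dots> = (LINT x|lebesgue_on D. f x * u x)" using u uH unfolding weak_sol_def by blast
  also have "\<dots> \<le> (LINT x|lebesgue_on D. F * (K * F))"
  proof (rule integral_mono_AE[OF _ ci])
    show "integrable (lebesgue_on D) (\<lambda>x. f x * u x)"
      by (rule Bochner_Integration.integrable_bound[OF ci])
         (measurable, use b K f(3) in \<open>auto simp: abs_of_nonneg\<close>)
    show "AE x in lebesgue_on D. f x * u x \<le> F * (K * F)" using b by eventually_elim linarith
  qed
  also have "\<dots> = measure lebesgue D * (F * (K * F))" using lsets by (simp add: measure_restrict_space)
  finally have "(L2_norm D g)\<^sup>2 \<le> (measure lebesgue D * K / lam) * F\<^sup>2" using a(3) by (simp add: field_simps power2_eq_square)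
  then have "L2_norm D g \<le> sqrt ((measure lebesgue D * K / lam) * F\<^sup>2)" by (rule real_le_rsqrt)
  then show "L2_norm D g \<le> sqrt (measure lebesgue D * K / lam) * F" using f(3) by (simp only: real_sqrt_mult real_sqrt_abs abs_of_nonneg)
qed

end

section \<open>The boundary layer of a Lipschitz domain\<close>

text \<open>The strip above the graph is moved up in steps of its own height, so no change of
  coordinates is needed to estimate its measure.\<close>

lemma graph_strip_measure:
  fixes s :: "'a::euclidean_space \<Rightarrow> real"
  assumes e: "norm e = 1" and s: "continuous_on UNIV s" "\<And>x t. s (x + t *\<^sub>R e) = s x + t"
    and r: "r > 0" and h: "h > 0"
  shows "measure lebesgue {x \<in> ball p r. 0 < s x \<and> s x < h} \<le> 2 * measure lebesgue (ball p (2 * r)) / r * h"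
proof -
  define S where "S = {x \<in> ball p r. 0 < s x \<and> s x < h}"
  have "open S"
  proof -
    have "S = ball p r \<inter> (s -` {0<..<h})" by (auto simp: S_def)
    moreover have "open (s -` {0<..<h})" using s(1) by (intro open_vimage) (auto simp: continuous_on_eq_continuous_at)
    ultimately show ?thesis by (simp add: open_Int)
  qed
  then have Sm: "S \<in> lmeasurable" by (intro lmeasurable_open bounded_subset[OF bounded_ball, of S p r]) (auto simp: S_def)
  have mB: "measure lebesgue S \<le> measure lebesgue (ball p (2 * r))"
    using Sm r by (intro measure_mono_fmeasurable) (auto simp: S_def)
  show ?thesis
  proof (cases "h > r")
    case True
    \<comment> \<open>For a strip higher than the ball's radius the measure of the ball is already
      within the claimed bound.\<close>
    have "measure lebesgue (ball p (2 * r)) * r \<le> measure lebesgue (ball p (2 * r)) * (2 * h)" using True r by (intro mult_left_mono) auto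
    then have "measure lebesgue (ball p (2 * r)) \<le> 2 * measure lebesgue (ball p (2 * r)) / r * h" using r by (simp add: field_simps)
    then show ?thesis using mB unfolding S_def by linarith
  next
    case False
    \<comment> \<open>The number of translates: N h \<le> r keeps them all in the ball of radius 2
      r, and N \<ge> 1 gives r / h \<le> 2 N, the origin of the factor 2 in the bound.\<close>
    define N where "N = nat \<lfloor>r / h\<rfloor>"
    have rh: "r / h \<ge> 1" using False h by simp
    then have N1: "real N \<le> r / h" "r / h < real N + 1" unfolding N_def by linarith+
    have "N \<ge> 1" using rh unfolding N_def by linarith
    then have N2: "r / h \<le> 2 * real N" using N1(2) by linarith
    define T where "T j = (+) ((real j * h) *\<^sub>R e) ` S" for j
    \<comment> \<open>Moving by j h along e raises s by the same amount, so the translates occupy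
      disjoint ranges of s.\<close>
    have Ts: "real j * h < s y \<and> s y < (real j + 1) * h" if "y \<in> T j" for y j
      using that s(2)[of _ "real j * h"] by (auto simp: T_def S_def add.commute algebra_simps)
    have dis: "disjoint_family_on T {..<N}"
      unfolding disjoint_family_on_def
    proof (intro ballI impI)
      fix i j :: nat assume "i \<noteq> j"
      have lt: "T i \<inter> T j = {}" if "i < j" for i j
      proof (rule ccontr)
        assume "T i \<inter> T j \<noteq> {}"
        then obtain y where y: "y \<in> T i" "y \<in> T j" by blast
        have "(real i + 1) * h \<le> real j * h" using that h by (intro mult_right_mono) auto
        then show False using Ts[OF y(1)] Ts[OF y(2)] by linarith
      qed
      then show "T i \<inter> T j = {}" using \<open>i \<noteq> j\<close> by (metis inf_commute nat_neq_iff)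
    qed
    have Tm: "T j \<in> lmeasurable" for j unfolding T_def by (rule measurable_translation[OF Sm])
    have "real N * measure lebesgue S = (\<Sum>j<N. measure lebesgue (T j))"
      unfolding T_def by (simp add: measure_translation)
    also have "\<dots> = measure lebesgue (\<Union>j<N. T j)"
    proof (rule measure_finite_Union[symmetric, OF _ _ dis])
      show "T ` {..<N} \<subseteq> sets lebesgue" using fmeasurableD[OF Tm] by blast
      show "emeasure lebesgue (T j) \<noteq> \<infinity>" for j using fmeasurableD2[OF Tm[of j]] by (simp only: infinity_ennreal_def not_False_eq_True)
    qed simp
    also have "\<dots> \<le> measure lebesgue (ball p (2 * r))"
    proof (rule measure_mono_fmeasurable)
      show "(\<Union>j<N. T j) \<subseteq> ball p (2 * r)"
      proof
        fix y assume "y \<in> (\<Union>j<N. T j)"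
        then obtain j x where j: "j < N" "x \<in> S" "y = (real j * h) *\<^sub>R e + x" by (auto simp: T_def)
        have "real j * h \<le> real N * h" using j(1) h by (intro mult_right_mono) auto
        also have "\<dots> \<le> r" using N1(1) h by (simp add: field_simps)
        finally have "norm ((real j * h) *\<^sub>R e) \<le> r" using e h by simp
        moreover have "dist p x < r" using j(2) by (simp add: S_def)
        moreover have "dist p y \<le> dist p x + norm ((real j * h) *\<^sub>R e)"
          unfolding j(3) dist_norm using norm_triangle_ineq4[of "p - x" "(real j * h) *\<^sub>R e"] by (simp add: algebra_simps)
        ultimately show "y \<in> ball p (2 * r)" by simp
      qed
    qed (use Tm in auto)
    finally have "real N * measure lebesgue S \<le> measure lebesgue (ball p (2 * r))" .
    moreover have "(r / h) * measure lebesgue S \<le> 2 * real N * measure lebesgue S" by (intro mult_right_mono N2) auto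
    ultimately have "(r / h) * measure lebesgue S \<le> 2 * measure lebesgue (ball p (2 * r))" by linarith
    then show ?thesis using r h unfolding S_def by (simp add: field_simps)
  qed
qed

text \<open>The height s above the graph is Lipschitz and vanishes at the frontier points of the
  chart. A point within \<rho> of such a frontier point therefore has height less than a multiple of
  \<rho> and lies in a strip. Halving the radius guarantees, for small \<rho>, that the nearest
  frontier point is still in the chart.\<close>

lemma lipschitz_local_layer:
  fixes D :: "'a::euclidean_space set"
  assumes D: "open D" and p: "p \<in> frontier D" and r: "r > 0" and e: "norm e = 1"
    and \<gamma>: "lipschitz_on L {y. y \<bullet> e = 0} \<gamma>"
    and chart: "D \<inter> ball p r = {x \<in> ball p r. x \<bullet> e > (\<gamma> (x - (x \<bullet> e) *\<^sub>R e) :: real)}"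
  obtains C where "C \<ge> 0" "\<And>\<rho>. \<rho> > 0 \<Longrightarrow> measure lebesgue {x \<in> D \<inter> ball p (r / 2). infdist x (frontier D) < \<rho>} \<le> C * \<rho>"
proof -
  define q where "q x = x - (x \<bullet> e) *\<^sub>R e" for x
  \<comment> \<open>The signed height over the graph, with \<open>q\<close> the projection along e.
    The estimate of \<open>q\<close> by the triangle inequality gives it the constant 2, hence the
    constant 1 + 2 L for \<open>s\<close>.\<close>
  define s where "s x = x \<bullet> e - \<gamma> (q x)" for x
  have L: "L \<ge> 0" using \<gamma> by (rule lipschitz_on_nonneg)
  have ee: "e \<bullet> e = 1" using e by (simp add: norm_eq_1)
  have qH: "q x \<bullet> e = 0" for x by (simp add: q_def inner_diff_left ee)
  have \<gamma>L: "\<bar>\<gamma> (q x) - \<gamma> (q y)\<bar> \<le> L * norm (q x - q y)" for x y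
    using lipschitz_onD[OF \<gamma>, of "q x" "q y"] qH by (simp add: dist_norm)
  have qL: "norm (q x - q y) \<le> 2 * norm (x - y)" for x y
  proof -
    have "q x - q y = (x - y) - ((x - y) \<bullet> e) *\<^sub>R e" by (simp add: q_def algebra_simps inner_diff_left)
    then have "norm (q x - q y) \<le> norm (x - y) + \<bar>(x - y) \<bullet> e\<bar>" using norm_triangle_ineq4[of "x - y" "((x - y) \<bullet> e) *\<^sub>R e"] e by simp
    also have "\<bar>(x - y) \<bullet> e\<bar> \<le> norm (x - y)" using Cauchy_Schwarz_ineq2[of "x - y" e] e by simp
    finally show ?thesis by simp
  qed
  have sL: "\<bar>s x - s y\<bar> \<le> (1 + 2 * L) * norm (x - y)" for x y
  proof -
    have "\<bar>s x - s y\<bar> \<le> \<bar>(x - y) \<bullet> e\<bar> + \<bar>\<gamma> (q x) - \<gamma> (q y)\<bar>" unfolding s_def inner_diff_left by linarith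
    also have "\<bar>(x - y) \<bullet> e\<bar> \<le> norm (x - y)" using Cauchy_Schwarz_ineq2[of "x - y" e] e by simp
    also have "\<bar>\<gamma> (q x) - \<gamma> (q y)\<bar> \<le> L * (2 * norm (x - y))"
      by (rule order_trans[OF \<gamma>L]) (intro mult_left_mono qL L)
    finally show ?thesis by (simp add: algebra_simps)
  qed
  have sc: "continuous_on UNIV s"
    unfolding continuous_on_iff
  proof (intro ballI allI impI)
    fix x :: 'a and \<epsilon> :: real assume "\<epsilon> > 0"
    show "\<exists>d>0. \<forall>y\<in>UNIV. dist y x < d \<longrightarrow> dist (s y) (s x) < \<epsilon>"
    proof (intro exI conjI ballI impI)
      show "\<epsilon> / (1 + 2 * L) > 0" using \<open>\<epsilon> > 0\<close> L by simp
      fix y assume "dist y x < \<epsilon> / (1 + 2 * L)"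
      then have "(1 + 2 * L) * norm (y - x) < \<epsilon>" using L by (simp add: dist_norm pos_less_divide_eq mult.commute)
      then show "dist (s y) (s x) < \<epsilon>" using sL[of y x] by (simp add: dist_real_def)
    qed
  qed
  have st: "s (x + t *\<^sub>R e) = s x + t" for x t
  proof -
    have "q (x + t *\<^sub>R e) = q x" by (simp add: q_def inner_add_left ee algebra_simps)
    then show ?thesis by (simp add: s_def inner_add_left ee)
  qed
  have chart': "D \<inter> ball p r = {x \<in> ball p r. 0 < s x}" unfolding chart by (auto simp: s_def q_def)
  \<comment> \<open>A frontier point is not in the open set D, so its height is not positive; a
    negative height would persist on a neighbourhood free of D, contradicting membership in the
    closure.\<close>
  have s0: "s y = 0" if y: "y \<in> frontier D" "y \<in> ball p r" for y
  proof (rule antisym)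
    have "y \<notin> D" using y(1) D by (simp add: frontier_def interior_open)
    then show "s y \<le> 0" using chart' y(2) by fastforce
    show "s y \<ge> 0"
    proof (rule ccontr)
      assume "\<not> s y \<ge> 0"
      let ?U = "ball p r \<inter> s -` {..<0}"
      have "open (s -` {..<0})" using sc by (intro open_vimage) (auto simp: continuous_on_eq_continuous_at)
      then have "open ?U" by auto
      moreover have "y \<in> ?U" using y(2) \<open>\<not> s y \<ge> 0\<close> by simp
      moreover have "y \<in> closure D" using y(1) by (simp add: frontier_def)
      ultimately have "?U \<inter> D \<noteq> {}" using open_Int_closure_eq_empty[of ?U D] by blast
      then obtain z where z: "z \<in> ball p r" "s z < 0" "z \<in> D" by auto
      then have "z \<in> {x \<in> ball p r. 0 < s x}" using chart' by blast
      then show False using z(2) by simp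
    qed
  qed
  \<comment> \<open>The first summand comes from a strip of height (1 + 2 L) \<rho>; the second
    takes care of \<rho> \<ge> r / 2, where the measure of the ball suffices.\<close>
  define C where "C = 2 * measure lebesgue (ball p (2 * r)) / r * (1 + 2 * L) + 2 * measure lebesgue (ball p (2 * r)) / r"
  show thesis
  proof (rule that[of C])
    show "C \<ge> 0" using r L by (simp add: C_def)
    fix \<rho> :: real assume \<rho>: "\<rho> > 0"
    let ?Y = "{x \<in> D \<inter> ball p (r / 2). infdist x (frontier D) < \<rho>}"
    have Yo: "open ?Y"
    proof -
      have "?Y = D \<inter> ball p (r / 2) \<inter> (\<lambda>x. infdist x (frontier D)) -` {..<\<rho>}" by auto
      moreover have "open ((\<lambda>x. infdist x (frontier D)) -` {..<\<rho>})"
        by (intro open_vimage continuous_on_infdist continuous_on_id) auto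
      ultimately show ?thesis using D by (simp add: open_Int)
    qed
    have Y2: "?Y \<subseteq> ball p (2 * r)" using r by auto
    have Ym: "?Y \<in> lmeasurable" by (intro lmeasurable_open Yo bounded_subset[OF bounded_ball Y2])
    show "measure lebesgue ?Y \<le> C * \<rho>"
    proof (cases "\<rho> < r / 2")
      case True
      define h where "h = (1 + 2 * L) * \<rho>"
      have h: "h > 0" using \<rho> L by (simp add: h_def)
      have sub: "?Y \<subseteq> {x \<in> ball p r. 0 < s x \<and> s x < h}"
      proof
        fix x assume x: "x \<in> ?Y"
        then have xb: "dist p x < r / 2" "x \<in> D" by auto
        then have xr: "x \<in> ball p r" using r by simp
        have "frontier D \<noteq> {}" using p by blast
        then obtain y where y: "y \<in> frontier D" "infdist x (frontier D) = dist x y"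
          using infdist_attains_inf[OF frontier_closed] by blast
        have "dist p y \<le> dist p x + dist x y" by (rule dist_triangle)
        then have "y \<in> ball p r" using xb(1) x y(2) True by simp
        then have "s y = 0" by (rule s0[OF y(1)])
        then have "\<bar>s x\<bar> \<le> (1 + 2 * L) * dist x y" using sL[of x y] by (simp add: dist_norm)
        also have "\<dots> < h" unfolding h_def using x y(2) L by (intro mult_strict_left_mono) auto
        finally have "s x < h" by simp
        moreover have "0 < s x" using chart' xb(2) xr by blast
        ultimately show "x \<in> {x \<in> ball p r. 0 < s x \<and> s x < h}" using xr by simp
      qed
      have "measure lebesgue ?Y \<le> measure lebesgue {x \<in> ball p r. 0 < s x \<and> s x < h}"
      proof (rule measure_mono_fmeasurable[OF sub])
        have "{x \<in> ball p r. 0 < s x \<and> s x < h} = ball p r \<inter> s -` {0<..<h}" by auto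
        moreover have "open (s -` {0<..<h})" using sc by (intro open_vimage) (auto simp: continuous_on_eq_continuous_at)
        ultimately have "open {x \<in> ball p r. 0 < s x \<and> s x < h}" by (simp add: open_Int)
        then show "{x \<in> ball p r. 0 < s x \<and> s x < h} \<in> lmeasurable"
          by (intro lmeasurable_open bounded_subset[OF bounded_ball, of _ p r]) auto
      qed (use Ym in auto)
      also have "\<dots> \<le> 2 * measure lebesgue (ball p (2 * r)) / r * h" by (rule graph_strip_measure[OF e sc st r h])
      also have "\<dots> \<le> C * \<rho>" unfolding h_def C_def using \<rho> r by (simp add: algebra_simps)
      finally show ?thesis .
    next
      case False
      have "measure lebesgue ?Y \<le> measure lebesgue (ball p (2 * r))"
        using Ym by (intro measure_mono_fmeasurable Y2) auto
      also have "\<dots> \<le> 2 * measure lebesgue (ball p (2 * r)) / r * \<rho>"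
      proof -
        have "measure lebesgue (ball p (2 * r)) * r \<le> measure lebesgue (ball p (2 * r)) * (2 * \<rho>)" using False by (intro mult_left_mono) auto
        then show ?thesis using r by (simp add: field_simps)
      qed
      also have "\<dots> \<le> C * \<rho>" unfolding C_def distrib_right using \<rho> r L by simp
      finally show ?thesis .
    qed
  qed
qed

text \<open>Finitely many charts cover the compact frontier, and by compactness also all points
  within some \<delta> of it. For \<rho> \<le> \<delta> the local bounds are added up.\<close>

lemma lipschitz_boundary_layer:
  fixes D :: "'a::euclidean_space set"
  assumes "lipschitz_domain D"
  obtains C where "C \<ge> 0" "\<And>\<rho>. \<rho> > 0 \<Longrightarrow> measure lebesgue {x \<in> D. infdist x (frontier D) < \<rho>} \<le> C * \<rho>"
proof -
  have D: "open D" "bounded D" "D \<noteq> {}" using assms by (auto simp: lipschitz_domain_def bounded_domain_def)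
  have Dm: "D \<in> lmeasurable" using D by (intro lmeasurable_open)
  define Q where "Q p r C \<longleftrightarrow> r > 0 \<and> C \<ge> 0 \<and>
    (\<forall>\<rho>>0. measure lebesgue {x \<in> D \<inter> ball p r. infdist x (frontier D) < \<rho>} \<le> C * \<rho>)" for p r C
  have "\<forall>p\<in>frontier D. \<exists>r C. Q p r C"
  proof
    fix p assume p: "p \<in> frontier D"
    obtain r e \<gamma> L where r: "r > 0" "norm e = 1" "lipschitz_on L {y. y \<bullet> e = 0} \<gamma>"
      "D \<inter> ball p r = {x \<in> ball p r. x \<bullet> e > (\<gamma> (x - (x \<bullet> e) *\<^sub>R e) :: real)}"
      using assms p unfolding lipschitz_domain_def by blast
    obtain C where "C \<ge> 0" "\<And>\<rho>. \<rho> > 0 \<Longrightarrow> measure lebesgue {x \<in> D \<inter> ball p (r / 2). infdist x (frontier D) < \<rho>} \<le> C * \<rho>"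
      using lipschitz_local_layer[OF D(1) p r] by blast
    then have "Q p (r / 2) C" using r(1) by (simp add: Q_def)
    then show "\<exists>r C. Q p r C" by blast
  qed
  from bchoice[OF this] obtain r where "\<forall>p\<in>frontier D. \<exists>C. Q p (r p) C" by blast
  from bchoice[OF this] obtain C where "\<forall>p\<in>frontier D. Q p (r p) (C p)" by blast
  then have rC: "\<And>p. p \<in> frontier D \<Longrightarrow> r p > 0" "\<And>p. p \<in> frontier D \<Longrightarrow> C p \<ge> 0"
    "\<And>p \<rho>. p \<in> frontier D \<Longrightarrow> \<rho> > 0 \<Longrightarrow> measure lebesgue {x \<in> D \<inter> ball p (r p). infdist x (frontier D) < \<rho>} \<le> C p * \<rho>"
    by (auto simp: Q_def)
  have Fc: "compact (frontier D)" using D(2) by (rule compact_frontier_bounded)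
  have Fn: "frontier D \<noteq> {}"
  proof
    assume "frontier D = {}"
    then have "D = UNIV" using D(3) frontier_eq_empty by blast
    then show False using D(2) not_bounded_UNIV by blast
  qed
  have "frontier D \<subseteq> (\<Union>p\<in>frontier D. ball p (r p))" using rC(1) by fastforce
  then obtain P where P: "P \<subseteq> frontier D" "finite P" "frontier D \<subseteq> (\<Union>p\<in>P. ball p (r p))"
    using compactE_image[OF Fc, of "frontier D" "\<lambda>p. ball p (r p)"] by auto
  obtain \<delta> where \<delta>: "\<delta> > 0" "{x. infdist x (frontier D) \<le> \<delta>} \<subseteq> (\<Union>p\<in>P. ball p (r p))"
    using compact_in_open_separated[OF Fn Fc _ P(3)] by blast
  define M where "M = (\<Sum>p\<in>P. C p) + measure lebesgue D / \<delta>"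
  have sC: "(\<Sum>p\<in>P. C p) \<ge> 0" using P(1) rC(2) by (intro sum_nonneg) auto
  have lo: "{x \<in> E. infdist x (frontier D) < \<rho>} \<in> lmeasurable" if "open E" "E \<subseteq> D" for E \<rho>
  proof -
    have "open ((\<lambda>x. infdist x (frontier D)) -` {..<\<rho>})"
      by (intro open_vimage continuous_on_infdist continuous_on_id) auto
    moreover have "{x \<in> E. infdist x (frontier D) < \<rho>} = E \<inter> (\<lambda>x. infdist x (frontier D)) -` {..<\<rho>}" by auto
    ultimately have "open {x \<in> E. infdist x (frontier D) < \<rho>}" using that(1) by (simp add: open_Int)
    then show ?thesis using that(2) by (intro lmeasurable_open bounded_subset[OF D(2)]) auto
  qed
  have lp: "{x \<in> D \<inter> ball p (r p). infdist x (frontier D) < \<rho>} \<in> lmeasurable" for p \<rho>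
    by (rule lo) (use D(1) in auto)
  show thesis
  proof (rule that[of M])
    show "M \<ge> 0" using sC \<delta>(1) by (simp add: M_def)
    fix \<rho> :: real assume \<rho>: "\<rho> > 0"
    have e: "M * \<rho> = (\<Sum>p\<in>P. C p) * \<rho> + measure lebesgue D / \<delta> * \<rho>" by (simp add: M_def distrib_right)
    show "measure lebesgue {x \<in> D. infdist x (frontier D) < \<rho>} \<le> M * \<rho>"
    proof (cases "\<rho> \<le> \<delta>")
      case True
      have "measure lebesgue {x \<in> D. infdist x (frontier D) < \<rho>}
        \<le> measure lebesgue (\<Union>p\<in>P. {x \<in> D \<inter> ball p (r p). infdist x (frontier D) < \<rho>})"
      proof (rule measure_mono_fmeasurable)
        show "{x \<in> D. infdist x (frontier D) < \<rho>} \<subseteq> (\<Union>p\<in>P. {x \<in> D \<inter> ball p (r p). infdist x (frontier D) < \<rho>})"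
        proof
          fix x assume x: "x \<in> {x \<in> D. infdist x (frontier D) < \<rho>}"
          then have "x \<in> {x. infdist x (frontier D) \<le> \<delta>}" using True by simp
          then have "x \<in> (\<Union>p\<in>P. ball p (r p))" using \<delta>(2) by (rule rev_subsetD)
          then show "x \<in> (\<Union>p\<in>P. {x \<in> D \<inter> ball p (r p). infdist x (frontier D) < \<rho>})" using x by simp
        qed
        show "(\<Union>p\<in>P. {x \<in> D \<inter> ball p (r p). infdist x (frontier D) < \<rho>}) \<in> lmeasurable"
          by (rule fmeasurable.finite_UN[OF P(2) lp])
        show "{x \<in> D. infdist x (frontier D) < \<rho>} \<in> sets lebesgue" by (rule fmeasurableD[OF lo[OF D(1) order_refl]])
      qed
      also have "\<dots> \<le> (\<Sum>p\<in>P. measure lebesgue {x \<in> D \<inter> ball p (r p). infdist x (frontier D) < \<rho>})"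
        by (rule measure_UNION_le[OF P(2) fmeasurableD[OF lp]])
      also have "\<dots> \<le> (\<Sum>p\<in>P. C p * \<rho>)" using P(1) \<rho> by (intro sum_mono rC(3)) auto
      also have "\<dots> \<le> M * \<rho>" unfolding e using \<delta>(1) \<rho> by (simp add: sum_distrib_right)
      finally show ?thesis .
    next
      case False
      have "measure lebesgue {x \<in> D. infdist x (frontier D) < \<rho>} \<le> measure lebesgue D"
        by (intro measure_mono_fmeasurable fmeasurableD[OF lo[OF D(1) order_refl]] Dm) auto
      also have "\<dots> \<le> measure lebesgue D / \<delta> * \<rho>"
      proof -
        have "measure lebesgue D * 1 \<le> measure lebesgue D * (\<rho> / \<delta>)" using False \<delta>(1) by (intro mult_left_mono) auto
        then show ?thesis by simp
      qed
      also have "\<dots> \<le> M * \<rho>" unfolding e using sC \<rho> by simp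
      finally show ?thesis .
    qed
  qed
qed

section \<open>The stability estimate\<close>

lemma Linf_norm_AE:
  assumes "f \<in> Linf D"
  shows "AE x in lebesgue_on D. \<bar>f x\<bar> \<le> Linf_norm D f"
proof (cases "esssup (lebesgue_on D) (\<lambda>x. ereal \<bar>f x\<bar>) = - \<infinity>")
  \<comment> \<open>If the essential supremum is -\<infinity>, \<open>Linf_norm\<close> takes the
    default value 0. The bound |f| \<le> -\<infinity> is then absurd yet holds almost everywhere, so
    any claim does.\<close>
  case True
  have "AE x in lebesgue_on D. ereal \<bar>f x\<bar> \<le> esssup (lebesgue_on D) (\<lambda>x. ereal \<bar>f x\<bar>)" by (rule esssup_AE)
  then show ?thesis unfolding True by eventually_elim simp
next
  case False
  then have "\<bar>esssup (lebesgue_on D) (\<lambda>x. ereal \<bar>f x\<bar>)\<bar> \<noteq> \<infinity>" using assms by (auto simp: Linf_def)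
  then have e: "ereal (Linf_norm D f) = esssup (lebesgue_on D) (\<lambda>x. ereal \<bar>f x\<bar>)"
    unfolding Linf_norm_def by (rule ereal_real')
  have "AE x in lebesgue_on D. ereal \<bar>f x\<bar> \<le> esssup (lebesgue_on D) (\<lambda>x. ereal \<bar>f x\<bar>)" by (rule esssup_AE)
  then show ?thesis unfolding e[symmetric] by eventually_elim simp
qed

lemma L2_sum_bound:
  fixes h :: "'a::euclidean_space \<Rightarrow> 'b::euclidean_space" and f :: "'a \<Rightarrow> 'c::euclidean_space" and g :: "'a \<Rightarrow> 'd::euclidean_space"
  assumes "f \<in> L2 D" "g \<in> L2 D" "s \<ge> 0" "t \<ge> 0"
    and "AE x in lebesgue_on D. norm (h x) \<le> s * norm (f x) + t * norm (g x)" "h \<in> borel_measurable (lebesgue_on D)"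
  shows "L2_norm D h \<le> s * L2_norm D f + t * L2_norm D g"
proof -
  have n: "(\<lambda>x. norm (f x)) \<in> L2 D" "(\<lambda>x. norm (g x)) \<in> L2 D"
    using assms(1,2) by (auto simp: L2_def)
  have nn: "L2_norm D (\<lambda>x. norm (f x)) = L2_norm D f" "L2_norm D (\<lambda>x. norm (g x)) = L2_norm D g" by (simp_all add: L2_norm_def)
  note sc = L2_scaleR[OF n(1), of s] L2_scaleR[OF n(2), of t]
  have "L2_norm D h \<le> L2_norm D (\<lambda>x. s *\<^sub>R norm (f x) + t *\<^sub>R norm (g x))"
    by (rule L2_bound(2)[OF L2_add(1)[OF sc(1,3)] assms(6)]) (use assms(3-5) in \<open>simp add: abs_of_nonneg\<close>)
  also have "\<dots> \<le> L2_norm D (\<lambda>x. s *\<^sub>R norm (f x)) + L2_norm D (\<lambda>x. t *\<^sub>R norm (g x))" by (rule L2_add(2)[OF sc(1,3)])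
  also have "\<dots> = s * L2_norm D f + t * L2_norm D g" using sc nn assms(3,4) by simp
  finally show ?thesis .
qed

context bounded_open begin

text \<open>With w = 1 - b / a the weak gradient of w is minus that of the quotient. In the bracket,
  the first summand bounds w times the gradient of u and the second u times the gradient of
  w.\<close>

lemma weighted_estimate:
  assumes u: "weak_sol a f u g" and ub: "weak_sol b f ub gb"
    and a: "has_weak_gradient D a \<alpha>" "a \<in> L2 D" "\<alpha> \<in> L2 D" "AE x in lebesgue_on D. lam \<le> a x \<and> a x \<le> Lam"
    and b: "has_weak_gradient D b \<beta>" "b \<in> L2 D" "\<beta> \<in> L2 D" "AE x in lebesgue_on D. lam \<le> b x \<and> b x \<le> Lam"
    and lam: "0 < lam" "lam \<le> Lam"
    and f: "f \<in> borel_measurable (lebesgue_on D)" "AE x in lebesgue_on D. \<bar>f x\<bar> \<le> F" "F \<ge> 0"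
    and U: "AE x in lebesgue_on D. \<bar>u x\<bar> \<le> U" "U \<ge> 0"
  defines "w \<equiv> \<lambda>x. 1 - b x / a x"
  shows "integrable (lebesgue_on D) (\<lambda>x. (w x)\<^sup>2 * (a x * (norm (g x))\<^sup>2 + f x * u x))"
    and "(LINT x|lebesgue_on D. (w x)\<^sup>2 * (a x * (norm (g x))\<^sup>2 + f x * u x))
      \<le> 2 * Lam * L2_norm D (\<lambda>x. g x - gb x) *
        ((1 + Lam / lam) * L2_norm D g + U * (1 / lam + Lam / lam\<^sup>2) * max (L2_norm D \<alpha>) (L2_norm D \<beta>))"
proof -
  have Lam: "Lam > 0" using lam by linarith
  have aL: "AE x in lebesgue_on D. lam \<le> a x" using a(4) by eventually_elim simp
  have bB: "AE x in lebesgue_on D. \<bar>b x\<bar> \<le> Lam" using b(4) by eventually_elim (use lam in auto)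
  note q = has_weak_gradient_divide[OF a(1-3) b(1-3) aL lam(1) bB less_imp_le[OF Lam]]
  define om where "om x = - ((1 / a x) *\<^sub>R \<beta> x - (b x / (a x)\<^sup>2) *\<^sub>R \<alpha> x)" for x
  have wg: "has_weak_gradient D w om"
    using has_weak_gradient_diff[OF has_weak_gradient_const[of 1] q(1)] by (simp add: w_def om_def[abs_def])
  have wL: "w \<in> L2 D" unfolding w_def by (rule L2_diff(1)[OF const_L2 q(2)])
  have oL: "om \<in> L2 D" unfolding om_def [abs_def] by (rule L2_uminus(1)[OF q(3)])
  define W where "W = 1 + Lam / lam"
  have W0: "W \<ge> 0" using lam Lam by (simp add: W_def)
  have wW: "AE x in lebesgue_on D. \<bar>w x\<bar> \<le> W"
    using a(4) b(4)
  proof eventually_elim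
    case (elim x)
    have "b x / a x \<le> Lam / lam" using elim lam by (intro frac_le) auto
    moreover have "0 \<le> b x / a x" using elim lam by simp
    ultimately show ?case unfolding w_def W_def by linarith
  qed
  have uH: "H10_gradient D u g" and ubH: "H10_gradient D ub gb" using u ub by (auto simp: weak_sol_def)
  define v where "v x = w x * u x" for x
  define h where "h x = w x *\<^sub>R g x + u x *\<^sub>R om x" for x
  \<comment> \<open>Here the bound U on u enters: the product of u with the gradient of w must be
    square integrable. The same rule is applied once more to w and v, where v inherits the bound W
    U.\<close>
  have vH: "H10_gradient D v h" unfolding v_def [abs_def] h_def [abs_def] by (rule H10_gradient_mult[OF wg wL oL wW uH U(1) W0 U(2)])
  have vB: "AE x in lebesgue_on D. \<bar>v x\<bar> \<le> W * U"
    using wW U(1) by eventually_elim (use W0 in \<open>auto simp: v_def abs_mult intro!: mult_mono\<close>)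
  define z where "z x = w x * v x" for x
  define k where "k x = w x *\<^sub>R h x + v x *\<^sub>R om x" for x
  have zH: "H10_gradient D z k" unfolding z_def [abs_def] k_def [abs_def]
    using W0 U(2) by (intro H10_gradient_mult[OF wg wL oL wW vH vB]) auto
  note l = H10_gradient_L2[OF uH] and lb = H10_gradient_L2[OF ubH] and lv = H10_gradient_L2[OF vH] and lz = H10_gradient_L2[OF zH]
  note [measurable] = L2_measurable[OF l(1)] L2_measurable[OF l(2)] L2_measurable[OF lb(2)] L2_measurable[OF lv(1)] L2_measurable[OF lv(2)]
    L2_measurable[OF lz(1)] L2_measurable[OF lz(2)] L2_measurable[OF wL] L2_measurable[OF oL] L2_measurable[OF a(2)] L2_measurable[OF b(2)] f(1)
  have mult_L2: "(\<lambda>x. c x *\<^sub>R F x) \<in> L2 D" if "F \<in> L2 D" "c \<in> borel_measurable (lebesgue_on D)" "AE x in lebesgue_on D. \<bar>c x\<bar> \<le> B" "B \<ge> 0"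
    for c :: "'a \<Rightarrow> real" and F :: "'a \<Rightarrow> 'b::euclidean_space" and B
  proof (rule L2_bound(1)[OF L2_scaleR(1)[OF that(1), of B]])
    show "AE x in lebesgue_on D. norm (c x *\<^sub>R F x) \<le> norm (B *\<^sub>R F x)"
      using that(3) by eventually_elim (use that(4) in \<open>simp add: mult_right_mono\<close>)
    show "(\<lambda>x. c x *\<^sub>R F x) \<in> borel_measurable (lebesgue_on D)" using that(2) L2_measurable[OF that(1)] by measurable
  qed
  have aB: "AE x in lebesgue_on D. \<bar>a x\<bar> \<le> Lam" using a(4) by eventually_elim (use lam in auto)
  have agL: "(\<lambda>x. a x *\<^sub>R g x) \<in> L2 D" and bgL: "(\<lambda>x. b x *\<^sub>R g x) \<in> L2 D" and bgbL: "(\<lambda>x. b x *\<^sub>R gb x) \<in> L2 D"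
    by (rule mult_L2[OF _ _ _ less_imp_le[OF Lam]]; (rule l lb aB bB L2_measurable[OF a(2)] L2_measurable[OF b(2)]))+
  have whL: "(\<lambda>x. w x *\<^sub>R h x) \<in> L2 D" by (rule mult_L2[OF lv(2) L2_measurable[OF wL] wW W0])
  have fL: "f \<in> L2 D" by (rule L2_norm_bounded_lmeasurable(1)[OF lmeas f(1) _ f(3)]) (use f(2) in simp)
  have I1: "integrable (lebesgue_on D) (\<lambda>x. (a x *\<^sub>R g x) \<bullet> (w x *\<^sub>R h x))" by (rule L2_inner_integrable[OF agL whL])
  have I2: "integrable (lebesgue_on D) (\<lambda>x. (a x *\<^sub>R g x) \<bullet> k x)" by (rule L2_inner_integrable[OF agL lz(2)])
  have I3: "integrable (lebesgue_on D) (\<lambda>x. f x * z x)" by (rule L2_mult_integrable[OF fL lz(1)])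
  have I4: "integrable (lebesgue_on D) (\<lambda>x. (a x *\<^sub>R g x) \<bullet> h x)" by (rule L2_inner_integrable[OF agL lv(2)])
  have I5: "integrable (lebesgue_on D) (\<lambda>x. (b x *\<^sub>R g x) \<bullet> h x)" by (rule L2_inner_integrable[OF bgL lv(2)])
  have I6: "integrable (lebesgue_on D) (\<lambda>x. (b x *\<^sub>R gb x) \<bullet> h x)" by (rule L2_inner_integrable[OF bgbL lv(2)])
  \<comment> \<open>Here h is the gradient of w u and k that of w^2 u. In 2 w h - k the terms
    containing the gradient of w cancel, leaving w^2 g. After integration the terms with k and z
    also cancel, by the equation of u tested with z.\<close>
  have pw: "(w x)\<^sup>2 * (a x * (norm (g x))\<^sup>2 + f x * u x) = 2 * ((a x *\<^sub>R g x) \<bullet> (w x *\<^sub>R h x)) - (a x *\<^sub>R g x) \<bullet> k x + f x * z x" for x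
    unfolding power2_norm_eq_inner[of "g x"]
    by (simp add: k_def h_def z_def v_def inner_add_right power2_eq_square algebra_simps)
  show "integrable (lebesgue_on D) (\<lambda>x. (w x)\<^sup>2 * (a x * (norm (g x))\<^sup>2 + f x * u x))"
    unfolding pw using I1 I2 I3 by simp
  have "(LINT x|lebesgue_on D. (w x)\<^sup>2 * (a x * (norm (g x))\<^sup>2 + f x * u x))
    = 2 * (LINT x|lebesgue_on D. (a x *\<^sub>R g x) \<bullet> (w x *\<^sub>R h x)) - (LINT x|lebesgue_on D. (a x *\<^sub>R g x) \<bullet> k x) + (LINT x|lebesgue_on D. f x * z x)"
    unfolding pw using I1 I2 I3 by simp
  also have "(LINT x|lebesgue_on D. (a x *\<^sub>R g x) \<bullet> k x) = (LINT x|lebesgue_on D. f x * z x)"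
    using u zH unfolding weak_sol_def by simp
  also have "(LINT x|lebesgue_on D. (a x *\<^sub>R g x) \<bullet> (w x *\<^sub>R h x)) = (LINT x|lebesgue_on D. (a x *\<^sub>R g x) \<bullet> h x - (b x *\<^sub>R g x) \<bullet> h x)"
  proof (rule integral_cong_AE)
    show "AE x in lebesgue_on D. (a x *\<^sub>R g x) \<bullet> (w x *\<^sub>R h x) = (a x *\<^sub>R g x) \<bullet> h x - (b x *\<^sub>R g x) \<bullet> h x"
      using aL
    proof eventually_elim
      case (elim x)
      \<comment> \<open>This is the reason for dividing by a in the weight: it converts a w into the
        difference of the two diffusion operators applied to u.\<close>
      then have "a x * w x = a x - b x" using lam(1) by (simp add: w_def right_diff_distrib)
      moreover have "(a x *\<^sub>R g x) \<bullet> (w x *\<^sub>R h x) = (a x * w x) * (g x \<bullet> h x)" by simp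
      ultimately show ?case by (simp add: left_diff_distrib)
    qed
  qed (use I1 I4 I5 in auto)
  also have "\<dots> = (LINT x|lebesgue_on D. (a x *\<^sub>R g x) \<bullet> h x) - (LINT x|lebesgue_on D. (b x *\<^sub>R g x) \<bullet> h x)"
    by (rule Bochner_Integration.integral_diff[OF I4 I5])
  \<comment> \<open>Both equations have the same right side, so tested with v they agree; only the
    difference of the two gradients, weighted by b, remains.\<close>
  also have "(LINT x|lebesgue_on D. (a x *\<^sub>R g x) \<bullet> h x) = (LINT x|lebesgue_on D. (b x *\<^sub>R gb x) \<bullet> h x)"
    using u ub vH unfolding weak_sol_def by simp
  also have "(LINT x|lebesgue_on D. (b x *\<^sub>R gb x) \<bullet> h x) - (LINT x|lebesgue_on D. (b x *\<^sub>R g x) \<bullet> h x)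
      = (LINT x|lebesgue_on D. (b x *\<^sub>R gb x) \<bullet> h x - (b x *\<^sub>R g x) \<bullet> h x)"
    by (rule Bochner_Integration.integral_diff[OF I6 I5, symmetric])
  finally have eq: "(LINT x|lebesgue_on D. (w x)\<^sup>2 * (a x * (norm (g x))\<^sup>2 + f x * u x))
    = 2 * (LINT x|lebesgue_on D. (b x *\<^sub>R gb x) \<bullet> h x - (b x *\<^sub>R g x) \<bullet> h x)" by simp
  have dL: "(\<lambda>x. g x - gb x) \<in> L2 D" by (rule L2_diff(1)[OF l(2) lb(2)])
  have "norm (LINT x|lebesgue_on D. (b x *\<^sub>R gb x) \<bullet> h x - (b x *\<^sub>R g x) \<bullet> h x) \<le> L2_norm D (\<lambda>x. Lam *\<^sub>R (g x - gb x)) * L2_norm D h"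
  proof (rule L2_norm_bound_mult[OF L2_scaleR(1)[OF dL] lv(2)])
    show "AE x in lebesgue_on D. norm ((b x *\<^sub>R gb x) \<bullet> h x - (b x *\<^sub>R g x) \<bullet> h x) \<le> norm (Lam *\<^sub>R (g x - gb x)) * norm (h x)"
      using bB
    proof eventually_elim
      case (elim x)
      have "(b x *\<^sub>R gb x) \<bullet> h x - (b x *\<^sub>R g x) \<bullet> h x = - (b x * ((g x - gb x) \<bullet> h x))" by (simp add: inner_diff_left algebra_simps)
      then have "norm ((b x *\<^sub>R gb x) \<bullet> h x - (b x *\<^sub>R g x) \<bullet> h x) = \<bar>b x\<bar> * \<bar>(g x - gb x) \<bullet> h x\<bar>" by (simp add: abs_mult)
      also have "\<dots> \<le> Lam * (norm (g x - gb x) * norm (h x))" using elim Lam by (intro mult_mono Cauchy_Schwarz_ineq2) auto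
      finally show ?case using Lam by (simp add: mult.assoc)
    qed
  qed (use I5 I6 in auto)
  then have le1: "(LINT x|lebesgue_on D. (b x *\<^sub>R gb x) \<bullet> h x - (b x *\<^sub>R g x) \<bullet> h x) \<le> Lam * L2_norm D (\<lambda>x. g x - gb x) * L2_norm D h"
    using L2_scaleR(2)[OF dL, of Lam] Lam by simp
  define m where "m = max (L2_norm D \<alpha>) (L2_norm D \<beta>)"
  have "L2_norm D om \<le> (1 / lam) * L2_norm D \<beta> + (Lam / lam\<^sup>2) * L2_norm D \<alpha>"
  proof (rule L2_sum_bound[OF b(3) a(3)])
    show "AE x in lebesgue_on D. norm (om x) \<le> (1 / lam) * norm (\<beta> x) + (Lam / lam\<^sup>2) * norm (\<alpha> x)"
      unfolding om_def norm_minus_cancel by (rule q(4))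
  qed (use lam Lam L2_measurable[OF oL] in auto)
  also have "\<dots> \<le> (1 / lam) * m + (Lam / lam\<^sup>2) * m"
    using lam Lam by (intro add_mono mult_left_mono) (auto simp: m_def)
  finally have om: "L2_norm D om \<le> (1 / lam + Lam / lam\<^sup>2) * m" by (simp add: distrib_right)
  have "L2_norm D h \<le> W * L2_norm D g + U * L2_norm D om"
  proof (rule L2_sum_bound[OF l(2) oL W0 U(2)])
    show "AE x in lebesgue_on D. norm (h x) \<le> W * norm (g x) + U * norm (om x)"
      using wW U(1)
    proof eventually_elim
      case (elim x)
      have "norm (h x) \<le> norm (w x *\<^sub>R g x) + norm (u x *\<^sub>R om x)" unfolding h_def by (rule norm_triangle_ineq)
      also have "\<dots> \<le> W * norm (g x) + U * norm (om x)" unfolding norm_scaleR using elim by (intro add_mono mult_right_mono) auto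
      finally show ?case .
    qed
  qed measurable
  also have "\<dots> \<le> W * L2_norm D g + U * ((1 / lam + Lam / lam\<^sup>2) * m)" using om U(2) by (intro add_left_mono mult_left_mono)
  finally have hb: "L2_norm D h \<le> W * L2_norm D g + U * (1 / lam + Lam / lam\<^sup>2) * m" by (simp add: mult.assoc)
  have "Lam * L2_norm D (\<lambda>x. g x - gb x) * L2_norm D h \<le> Lam * L2_norm D (\<lambda>x. g x - gb x) * (W * L2_norm D g + U * (1 / lam + Lam / lam\<^sup>2) * m)"
    using hb Lam by (intro mult_left_mono) auto
  then show "(LINT x|lebesgue_on D. (w x)\<^sup>2 * (a x * (norm (g x))\<^sup>2 + f x * u x))
      \<le> 2 * Lam * L2_norm D (\<lambda>x. g x - gb x) *
        ((1 + Lam / lam) * L2_norm D g + U * (1 / lam + Lam / lam\<^sup>2) * max (L2_norm D \<alpha>) (L2_norm D \<beta>))"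
    unfolding eq using le1 by (simp add: W_def m_def mult.assoc)
qed

text \<open>At distance at least \<rho> from the frontier, p is at least c \<rho>^\<beta>, and |a -
  b| = a |w| is at most Lam |w|. In the layer the trivial bound |a - b| \<le> Lam is multiplied by
  the measure of the layer.\<close>

lemma layer_splitting:
  assumes ab: "a \<in> L2 D" "b \<in> L2 D" "AE x in lebesgue_on D. lam \<le> a x \<and> a x \<le> Lam" "AE x in lebesgue_on D. lam \<le> b x \<and> b x \<le> Lam" "0 < lam"
    and P: "integrable (lebesgue_on D) (\<lambda>x. (1 - b x / a x)\<^sup>2 * p x)" "AE x in lebesgue_on D. p x \<ge> c * infdist x (frontier D) powr \<beta>" "c > 0" "\<beta> \<ge> 0"
    and \<rho>: "\<rho> > 0" and lay: "measure lebesgue {x \<in> D. infdist x (frontier D) < \<rho>} \<le> C * \<rho>"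
  shows "(L2_norm D (\<lambda>x. a x - b x))\<^sup>2 \<le> Lam\<^sup>2 / c * \<rho> powr (- \<beta>) * (LINT x|lebesgue_on D. (1 - b x / a x)\<^sup>2 * p x) + Lam\<^sup>2 * C * \<rho>"
proof -
  let ?T = "{x \<in> D. infdist x (frontier D) < \<rho>}"
  have To: "open ?T"
  proof -
    have "?T = D \<inter> (\<lambda>x. infdist x (frontier D)) -` {..<\<rho>}" by auto
    moreover have "open ((\<lambda>x. infdist x (frontier D)) -` {..<\<rho>})"
      by (intro open_vimage continuous_on_infdist continuous_on_id) auto
    ultimately show ?thesis using open_D by (simp add: open_Int)
  qed
  then have Tl: "?T \<in> sets lebesgue" by simp
  have Im: "(indicator ?T :: 'a \<Rightarrow> real) \<in> borel_measurable (lebesgue_on D)"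
    using borel_measurable_indicator[OF Tl] by (rule measurable_restrict_space1)
  have Ti: "integrable (lebesgue_on D) (indicator ?T :: 'a \<Rightarrow> real)"
    by (rule L2_locally_integrable(2)[OF L2_norm_bounded_lmeasurable(1)[OF lmeas Im, of 1] lmeas]) (auto split: split_indicator)
  have TI: "(LINT x|lebesgue_on D. indicator ?T x) = measure lebesgue ?T"
  proof -
    have "measure (lebesgue_on D) ?T = measure lebesgue ?T" using lsets by (intro measure_restrict_space) auto
    then show ?thesis using Tl lsets by (simp add: sets_restrict_space_iff Int_absorb2)
  qed
  have abL: "(\<lambda>x. a x - b x) \<in> L2 D" by (rule L2_diff(1)[OF ab(1,2)])
  define \<sigma> where "\<sigma> = Lam\<^sup>2 / c * \<rho> powr (- \<beta>)"
  have pt: "AE x in lebesgue_on D. (norm (a x - b x))\<^sup>2 \<le> \<sigma> * ((1 - b x / a x)\<^sup>2 * p x) + Lam\<^sup>2 * indicator ?T x"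
    using ab(3,4) P(2) AE_lebesgue_on_D[of D]
  proof eventually_elim
    case (elim x)
    define d where "d = infdist x (frontier D)"
    define w where "w = 1 - b x / a x"
    have w: "a x - b x = a x * w" using elim ab(5) by (simp add: w_def right_diff_distrib)
    have ax: "0 < a x" "a x \<le> Lam" using elim ab(5) by auto
    have "(a x)\<^sup>2 \<le> Lam\<^sup>2" using ax by (intro power_mono) auto
    then have abw: "(a x - b x)\<^sup>2 \<le> Lam\<^sup>2 * w\<^sup>2" unfolding w power_mult_distrib by (intro mult_right_mono) auto
    have p0: "p x \<ge> 0" using elim(3) P(3) by (meson mult_nonneg_nonneg less_imp_le powr_ge_zero order_trans)
    have s0: "\<sigma> \<ge> 0" using P(3) by (simp add: \<sigma>_def)
    show ?case
    proof (cases "d < \<rho>")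
      case True
      have "\<bar>a x - b x\<bar> \<le> Lam" using elim ab(5) by auto
      then have "(a x - b x)\<^sup>2 \<le> Lam\<^sup>2" by (metis abs_ge_zero power2_abs power_mono)
      moreover have "indicator ?T x = (1::real)" using True elim by (simp add: d_def)
      moreover have "0 \<le> \<sigma> * (w\<^sup>2 * p x)" using s0 p0 by simp
      ultimately show ?thesis unfolding w_def[symmetric] by simp
    next
      case False
      have "c * \<rho> powr \<beta> \<le> c * d powr \<beta>" using False \<rho> P(3,4) by (intro mult_left_mono powr_mono2) auto
      then have cp: "c * \<rho> powr \<beta> \<le> p x" using elim(3) by (simp add: d_def)
      have "Lam\<^sup>2 * w\<^sup>2 = \<sigma> * (w\<^sup>2 * (c * \<rho> powr \<beta>))"
        using P(3) \<rho> by (simp add: \<sigma>_def powr_minus field_simps)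
      also have "\<dots> \<le> \<sigma> * (w\<^sup>2 * p x)" using cp s0 by (intro mult_left_mono) auto
      finally have "(a x - b x)\<^sup>2 \<le> \<sigma> * (w\<^sup>2 * p x)" using abw by linarith
      moreover have "indicator ?T x = (0::real)" using False by (simp add: d_def)
      ultimately show ?thesis unfolding w_def[symmetric] by simp
    qed
  qed
  have "(L2_norm D (\<lambda>x. a x - b x))\<^sup>2 \<le> (LINT x|lebesgue_on D. \<sigma> * ((1 - b x / a x)\<^sup>2 * p x) + Lam\<^sup>2 * indicator ?T x)"
    unfolding L2_norm_sq by (rule integral_mono_AE[OF L2_integrable[OF abL] _ pt]) (intro Bochner_Integration.integrable_add integrable_mult_right P(1) Ti)
  also have "\<dots> = (LINT x|lebesgue_on D. \<sigma> * ((1 - b x / a x)\<^sup>2 * p x)) + (LINT x|lebesgue_on D. Lam\<^sup>2 * indicator ?T x)"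
    by (intro Bochner_Integration.integral_add integrable_mult_right P(1) Ti)
  also have "(LINT x|lebesgue_on D. \<sigma> * ((1 - b x / a x)\<^sup>2 * p x)) = \<sigma> * (LINT x|lebesgue_on D. (1 - b x / a x)\<^sup>2 * p x)"
    by (rule integral_mult_right_zero)
  also have "(LINT x|lebesgue_on D. Lam\<^sup>2 * indicator ?T x) = Lam\<^sup>2 * measure lebesgue ?T"
    by (subst integral_mult_right_zero) (simp only: TI)
  also have "\<dots> \<le> Lam\<^sup>2 * (C * \<rho>)" by (intro mult_left_mono lay) simp
  finally show ?thesis by (simp add: \<sigma>_def mult.assoc)
qed

end

text \<open>The two contributions balance for \<open>\<rho> = E\<^sup>1\<^sup>/\<^sup>(\<^sup>\<beta>\<^sup>+\<^sup>1\<^sup>)\<close>.\<close>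

lemma optimize_layer:
  fixes E X Q C0 \<beta> :: real
  assumes "E \<ge> 0" "X \<ge> 0" "Q \<ge> 0" "C0 \<ge> 0" "\<beta> \<ge> 0"
    and "\<And>\<rho>. \<rho> > 0 \<Longrightarrow> X\<^sup>2 \<le> Q * (\<rho> powr (- \<beta>) * (C0 * E) + \<rho>)"
  shows "X \<le> sqrt Q * sqrt (1 + C0) * E powr (1 / (2 * (\<beta> + 1)))"
proof (cases "E = 0")
  case True
  \<comment> \<open>For E = 0 the balancing value would be \<rho> = 0, which is not admissible;
    instead \<rho> tends to 0, the choice e / (Q + 1) making the right side at most e.\<close>
  have "X\<^sup>2 \<le> 0"
  proof (rule field_le_epsilon)
    fix e :: real assume "e > 0"
    have "X\<^sup>2 \<le> Q * (e / (Q + 1))" using assms(6)[of "e / (Q + 1)"] True \<open>e > 0\<close> assms(3) by (simp add: add_nonneg_pos)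
    also have "\<dots> \<le> e" using assms(3) \<open>e > 0\<close> by (simp add: field_simps)
    finally show "X\<^sup>2 \<le> 0 + e" by simp
  qed
  then show ?thesis using True by simp
next
  case False
  then have E: "E > 0" using assms(1) by simp
  define \<rho> where "\<rho> = E powr (1 / (\<beta> + 1))"
  have \<rho>: "\<rho> > 0" using E by (simp add: \<rho>_def)
  have b1: "\<beta> + 1 \<noteq> 0" using assms(5) by linarith
  have "\<rho> powr (- \<beta>) * E = E powr (1 / (\<beta> + 1) * (- \<beta>) + 1)"
    unfolding \<rho>_def powr_powr powr_add using E by simp
  \<comment> \<open>The exponent 1 - \<beta>/(\<beta> + 1) equals 1/(\<beta> + 1), so both
    contributions are multiples of \<rho>; the square root at the end halves the exponent.\<close>
  also have "1 / (\<beta> + 1) * (- \<beta>) + 1 = 1 / (\<beta> + 1)" using b1 by (simp add: divide_simps)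
  finally have r: "\<rho> powr (- \<beta>) * E = \<rho>" by (simp add: \<rho>_def)
  have "X\<^sup>2 \<le> Q * (C0 * (\<rho> powr (- \<beta>) * E) + \<rho>)" using assms(6)[OF \<rho>] by (simp add: mult_ac)
  also have "\<dots> = Q * (1 + C0) * \<rho>" unfolding r by (simp add: algebra_simps)
  finally have "X \<le> sqrt (Q * (1 + C0) * \<rho>)" by (rule real_le_rsqrt)
  also have "\<dots> = sqrt Q * sqrt (1 + C0) * sqrt \<rho>" by (simp only: real_sqrt_mult)
  also have "sqrt \<rho> = E powr (1 / (2 * (\<beta> + 1)))"
    unfolding \<rho>_def using E by (simp add: powr_half_sqrt[symmetric] powr_powr mult.commute)
  finally show ?thesis .
qed

theorem theorem3p2:
  fixes D :: "'a::euclidean_space set" and lam Lam :: real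
  assumes "DIM('a) \<ge> 2" and "lipschitz_domain D" and "0 < lam" and "0 < Lam"
  shows "\<exists>C\<^sub>1>0. \<forall>c>0. \<exists>C>0.
           \<forall>M>0. \<forall>\<beta>\<ge>0. \<forall>a\<in>coeffs_H1 D lam Lam M. \<forall>b\<in>coeffs_H1 D lam Lam M. \<forall>f\<in>Linf D.
           \<forall>u\<^sub>a u\<^sub>b. weak_solution D a f u\<^sub>a \<longrightarrow> weak_solution D b f u\<^sub>b \<longrightarrow>
             positivity_condition D f a \<beta> c \<longrightarrow>
             (let C\<^sub>0 = C\<^sub>1 * Linf_norm D f *
                   (1 + max (L2_norm D (weak_grad D a)) (L2_norm D (weak_grad D b)))
              in L2_norm D (\<lambda>x. a x - b x)
                   \<le> C * sqrt (1 + C\<^sub>0) * H10_norm D (\<lambda>x. u\<^sub>a x - u\<^sub>b x) powr (1 / (2 * (\<beta> + 1))))"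
proof -
  have D: "open D" "bounded D" "D \<noteq> {}" using assms(2) by (auto simp: lipschitz_domain_def bounded_domain_def)
  interpret bounded_open D by unfold_locales (use D in auto)
  obtain CL where CL: "CL \<ge> 0" "\<And>\<rho>. \<rho> > 0 \<Longrightarrow> measure lebesgue {x \<in> D. infdist x (frontier D) < \<rho>} \<le> CL * \<rho>"
    by (rule lipschitz_boundary_layer[OF assms(2)]) blast
  define mD where "mD = measure lebesgue D"
  have mD: "mD \<ge> 0" by (simp add: mD_def)
  define o1 where "o1 = measure lborel (ball (0::'a) 1)"
  have o1: "o1 > 0" using content_ball_pos[of 1 "0::'a"] by (simp add: o1_def)
  \<comment> \<open>For R \<ge> 1 the volume o1 R^d is at least o1 R, and o1 R exceeds 2 |D| for
    this choice. So D has at most half the measure of the ball, as the start of the level set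
    iteration requires.\<close>
  define R where "R = 1 + 2 * mD / o1"
  have R1: "R \<ge> 1" using mD o1 by (simp add: R_def)
  have R: "R > 0" "2 * measure lebesgue D \<le> measure lborel (ball (0::'a) R)"
  proof -
    show "R > 0" using R1 by linarith
    have "2 * mD \<le> o1 * R" using o1 mD by (simp add: R_def field_simps)
    also have "\<dots> \<le> o1 * R ^ DIM('a)" using R1 o1 by (intro mult_left_mono self_le_power) auto
    also have "\<dots> = measure lborel (ball (0::'a) R)"
      using content_ball[of 1 "0::'a"] content_ball[of R "0::'a"] R1 by (simp add: o1_def)
    finally show "2 * measure lebesgue D \<le> measure lborel (ball (0::'a) R)" by (simp add: mD_def)
  qed
  define K where "K = 20 * 2 ^ DIM('a) * R\<^sup>2 / lam"
  have K: "K \<ge> 0" using assms(3) by (simp add: K_def)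
  define K2 where "K2 = sqrt (mD * K / lam)"
  have K2: "K2 \<ge> 0" using mD K assms(3) by (simp add: K2_def)
  \<comment> \<open>The two summands are the coefficients of the weighted estimate after inserting
    the a priori bounds K2 F for the gradient and K F for u_a; the final 1 makes the constant
    positive.\<close>
  define C1 where "C1 = (1 + Lam / lam) * K2 + K * (1 / lam + Lam / lam\<^sup>2) + 1"
  have C1: "C1 > 0"
  proof -
    have "0 \<le> (1 + Lam / lam) * K2" "0 \<le> K * (1 / lam + Lam / lam\<^sup>2)" using K K2 assms(3,4) by auto
    then show ?thesis unfolding C1_def by linarith
  qed
  show ?thesis
  proof (rule exI[of _ C1], intro conjI C1 allI impI)
    fix c :: real assume c: "c > 0"
    \<comment> \<open>It majorizes the coefficients of both contributions, 2 Lam^3 / c from the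
      interior and Lam^2 CL from the layer, so that it can be taken out as a common factor. It
      depends neither on \<beta> nor on M.\<close>
    define Q where "Q = 2 * Lam ^ 3 / c + Lam\<^sup>2 * CL + 1"
    have Q1: "0 \<le> 2 * Lam ^ 3 / c" "0 \<le> Lam\<^sup>2 * CL" using c assms(4) CL(1) by auto
    then have Q: "Q > 0" unfolding Q_def by linarith
    show "\<exists>C>0. \<forall>M>0. \<forall>\<beta>\<ge>0. \<forall>a\<in>coeffs_H1 D lam Lam M. \<forall>b\<in>coeffs_H1 D lam Lam M. \<forall>f\<in>Linf D.
           \<forall>u\<^sub>a u\<^sub>b. weak_solution D a f u\<^sub>a \<longrightarrow> weak_solution D b f u\<^sub>b \<longrightarrow>
             positivity_condition D f a \<beta> c \<longrightarrow>
             (let C\<^sub>0 = C1 * Linf_norm D f *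
                   (1 + max (L2_norm D (weak_grad D a)) (L2_norm D (weak_grad D b)))
              in L2_norm D (\<lambda>x. a x - b x)
                   \<le> C * sqrt (1 + C\<^sub>0) * H10_norm D (\<lambda>x. u\<^sub>a x - u\<^sub>b x) powr (1 / (2 * (\<beta> + 1))))"
    proof (intro exI[of _ "sqrt Q"] conjI allI impI ballI)
      show "sqrt Q > 0" using Q by simp
      fix M \<beta> :: real and a b f u\<^sub>a u\<^sub>b :: "'a \<Rightarrow> real"
      assume \<beta>: "\<beta> \<ge> 0" and a: "a \<in> coeffs_H1 D lam Lam M" and b: "b \<in> coeffs_H1 D lam Lam M" and f: "f \<in> Linf D"
        and ua: "weak_solution D a f u\<^sub>a" and ub: "weak_solution D b f u\<^sub>b" and pc: "positivity_condition D f a \<beta> c"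
      define F where "F = Linf_norm D f"
      have a': "AE x in lebesgue_on D. lam \<le> a x \<and> a x \<le> Lam" "a \<in> H1 D"
        and b': "AE x in lebesgue_on D. lam \<le> b x \<and> b x \<le> Lam" "b \<in> H1 D"
        using a b by (auto simp: coeffs_H1_def coeffs_def)
      note ah = H1_weak_grad[OF a'(2)] and bh = H1_weak_grad[OF b'(2)]
      \<comment> \<open>A nonempty open set is not null, so almost everywhere statements on D cannot
        be vacuous. This turns lam \<le> a \<le> Lam into lam \<le> Lam, and |f| \<le> F into F
        \<ge> 0.\<close>
      have Dne: "\<not> (AE x in lebesgue_on D. False)"
      proof
        assume "AE x in lebesgue_on D. False"
        then have "AE x in lebesgue. x \<notin> D" unfolding AE_lebesgue_on[OF lsets] by eventually_elim simp
        then have "D \<in> null_sets lebesgue" using lsets by (simp add: AE_iff_null_sets)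
        then have "negligible D" by (simp add: negligible_iff_null_sets)
        then show False using open_not_negligible[OF D(1,3)] by blast
      qed
      have lL: "lam \<le> Lam"
      proof (rule ccontr)
        assume n: "\<not> lam \<le> Lam"
        have "AE x in lebesgue_on D. False" by (rule AE_mp[OF a'(1)], intro AE_I2) (use n in auto)
        then show False using Dne by blast
      qed
      have fA: "AE x in lebesgue_on D. \<bar>f x\<bar> \<le> F" unfolding F_def by (rule Linf_norm_AE[OF f])
      have F0: "F \<ge> 0"
      proof (rule ccontr)
        assume n: "\<not> F \<ge> 0"
        have "AE x in lebesgue_on D. False" by (rule AE_mp[OF fA], intro AE_I2) (use n in auto)
        then show False using Dne by blast
      qed
      have fm: "f \<in> borel_measurable (lebesgue_on D)" using f by (simp add: Linf_def)
      define g where "g = weak_grad D u\<^sub>a"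
      define gb where "gb = weak_grad D u\<^sub>b"
      have sa: "weak_sol a f u\<^sub>a g" unfolding g_def by (rule weak_solutionD[OF ua L2_measurable[OF ah(1)]])
      have sb: "weak_sol b f u\<^sub>b gb" unfolding gb_def by (rule weak_solutionD[OF ub L2_measurable[OF bh(1)]])
      note bd = weak_sol_bounds[OF R sa L2_measurable[OF ah(1)] a'(1) assms(3) fm fA F0, folded K_def mD_def, folded K2_def]
      define m where "m = max (L2_norm D (weak_grad D a)) (L2_norm D (weak_grad D b))"
      have m0: "m \<ge> 0" by (simp add: m_def le_max_iff_disj)
      define C0 where "C0 = C1 * F * (1 + m)"
      have C0: "C0 \<ge> 0" using C1 F0 m0 by (simp add: C0_def)
      define E where "E = H10_norm D (\<lambda>x. u\<^sub>a x - u\<^sub>b x)"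
      have E0: "E \<ge> 0" by (simp add: E_def H10_norm_def)
      have dH: "H10_gradient D (\<lambda>x. u\<^sub>a x - u\<^sub>b x) (\<lambda>x. g x - gb x)"
        using sa sb by (auto simp: weak_sol_def intro: H10_gradient_diff)
      have EE: "L2_norm D (\<lambda>x. g x - gb x) = E"
        unfolding E_def H10_norm_def
        using H10I(2)[OF dH] H10_gradient_L2(2)[OF dH] H10_gradient_L2(2)[OF H10_gradientD[OF H10I(1)[OF dH]]]
        by (intro L2_norm_cong_AE) (auto dest: L2_measurable)
      define p where "p x = a x * (norm (g x))\<^sup>2 + f x * u\<^sub>a x" for x
      have pP: "AE x in lebesgue_on D. p x \<ge> c * infdist x (frontier D) powr \<beta>"
        using pc ua unfolding positivity_condition_def p_def g_def by blast
      have KF: "K * F \<ge> 0" using K F0 by simp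
      note we = weighted_estimate[OF sa sb ah(2,1,3) a'(1) bh(2,1,3) b'(1) assms(3) lL fm fA F0 bd(1) KF, folded p_def, folded m_def, unfolded EE]
      define I where "I = (LINT x|lebesgue_on D. (1 - b x / a x)\<^sup>2 * p x)"
      have I: "I \<le> 2 * Lam * E * C0"
      proof -
        have "I \<le> 2 * Lam * E * ((1 + Lam / lam) * L2_norm D g + K * F * (1 / lam + Lam / lam\<^sup>2) * m)"
          unfolding I_def by (rule we(2))
        also have "\<dots> \<le> 2 * Lam * E * C0"
        proof (rule mult_left_mono)
          have 1: "(1 + Lam / lam) * L2_norm D g \<le> (1 + Lam / lam) * (K2 * F)"
            using bd(2) assms(3,4) by (intro mult_left_mono) auto
          have 2: "(1 + Lam / lam) * (K2 * F) \<le> (1 + Lam / lam) * K2 * F * (1 + m)"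
          proof -
            have "0 \<le> (1 + Lam / lam) * K2 * F" using assms(3,4) K2 F0 by simp
            from mult_left_mono[OF _ this, of 1 "1 + m"] m0 show ?thesis by (simp add: mult.assoc)
          qed
          have 3: "K * F * (1 / lam + Lam / lam\<^sup>2) * m \<le> K * (1 / lam + Lam / lam\<^sup>2) * F * (1 + m)"
          proof -
            have "0 \<le> K * (1 / lam + Lam / lam\<^sup>2) * F" using assms(3,4) K F0 by simp
            from mult_left_mono[OF _ this, of m "1 + m"] show ?thesis by (simp add: mult_ac)
          qed
          have 4: "0 \<le> F * (1 + m)" using F0 m0 by simp
          have "C0 = (1 + Lam / lam) * K2 * F * (1 + m) + K * (1 / lam + Lam / lam\<^sup>2) * F * (1 + m) + F * (1 + m)"
            unfolding C0_def C1_def by (simp only: distrib_right mult_1)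
          then show "(1 + Lam / lam) * L2_norm D g + K * F * (1 / lam + Lam / lam\<^sup>2) * m \<le> C0"
            using 1 2 3 4 by linarith
          show "0 \<le> 2 * Lam * E" using assms(4) E0 by simp
        qed
        finally show ?thesis .
      qed
      have est: "(L2_norm D (\<lambda>x. a x - b x))\<^sup>2 \<le> Q * (\<rho> powr (- \<beta>) * (C0 * E) + \<rho>)" if \<rho>: "\<rho> > 0" for \<rho>
      proof -
        have "(L2_norm D (\<lambda>x. a x - b x))\<^sup>2 \<le> Lam\<^sup>2 / c * \<rho> powr (- \<beta>) * I + Lam\<^sup>2 * CL * \<rho>"
          unfolding I_def by (rule layer_splitting[OF ah(1) bh(1) a'(1) b'(1) assms(3) we(1) pP c \<beta> \<rho> CL(2)[OF \<rho>]])
        also have "Lam\<^sup>2 / c * \<rho> powr (- \<beta>) * I \<le> Lam\<^sup>2 / c * \<rho> powr (- \<beta>) * (2 * Lam * E * C0)"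
          using I c by (intro mult_left_mono) auto
        also have "\<dots> = (2 * Lam ^ 3 / c) * (\<rho> powr (- \<beta>) * (C0 * E))" by (simp add: power2_eq_square power3_eq_cube)
        also have "\<dots> \<le> Q * (\<rho> powr (- \<beta>) * (C0 * E))"
          using Q1 C0 E0 by (intro mult_right_mono) (auto simp: Q_def)
        also have "Lam\<^sup>2 * CL * \<rho> \<le> Q * \<rho>" using Q1 \<rho> by (intro mult_right_mono) (auto simp: Q_def)
        finally show ?thesis by (simp add: distrib_left)
      qed
      have "L2_norm D (\<lambda>x. a x - b x) \<le> sqrt Q * sqrt (1 + C0) * E powr (1 / (2 * (\<beta> + 1)))"
        using Q by (intro optimize_layer[OF E0 _ _ C0 \<beta> est]) auto
      then show "let C\<^sub>0 = C1 * Linf_norm D f *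
                   (1 + max (L2_norm D (weak_grad D a)) (L2_norm D (weak_grad D b)))
              in L2_norm D (\<lambda>x. a x - b x)
                   \<le> sqrt Q * sqrt (1 + C\<^sub>0) * H10_norm D (\<lambda>x. u\<^sub>a x - u\<^sub>b x) powr (1 / (2 * (\<beta> + 1)))"
        unfolding Let_def C0_def E_def F_def m_def .
    qed
  qed
qed

end
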